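(* Let $G$ be a finite abelian group, $R$ a commutative $k$-algebra, $\pi:T_{par}(G,R)\to T(G,A)$ the semigroup homomorphism $\pi\big(\lfloor S,\alpha_G\rfloor\big)=[T,\beta_G]$, where $(T,\beta_G)$ is the globalization of $(S,\alpha_G)$, and let $\rho=\ker\pi$. Then $$\overline\pi:T_{par}(G,R)/\rho\to T(G,A),\qquad \overline\pi\big(\rho(\lfloor S,\alpha_G\rfloor)\big)=[T,\beta_G],$$ is a group isomorphism.
   Context: $k$ is a commutative ring with identity; all algebras are associative, unital, commutative $k$-algebras. Partial actions. A partial action of a group $G$ on an algebra $S$ is a family $\alpha_G=(S_g,\alpha_g)_{g\in G}$ such that: each $S_g$ is an ideal of $S$ and $\alpha_g:S_{g^{-1}}\to S_g$ is an algebra isomorphism; $S_1=S$ and $\alpha_1=\mathrm{id}_S$; $\alpha_g(S_{g^{-1}}\cap S_h)=S_g\cap S_{gh}$ for all $g,h$; and $\alpha_g(\alpha_h(x))=\alpha_{gh}(x)$ for all $x\in\alpha_{h^{-1}}(S_h\cap S_{g^{-1}})$ and $g,h\in G$. It is unital if $S_g=S1_g$ with $1_g$ an idempotent of $S$ (possibly $0$); it is global if $S_g=S$ for all $g$. For a subgroup $H$, $\alpha_H=(S_h,\alpha_h)_{h\in H}$. Invariants: $S^{\alpha_G}=\{s\in S:\alpha_g(s1_{g^{-1}})=s1_g\ \forall g\in G\}$. Partial Galois extension. For a unital partial action $\alpha_G$ of a finite group $G$ on $S$, $S$ is a partial $\alpha_G$-extension of $R$ if $R\simeq S^{\alpha_G}$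 as $k$-algebras (so $S$ is an $R$-algebra) and there are $m\in\mathbb N$, $x_i,y_i\in S$ with $\sum_{i=1}^m x_i\alpha_g(y_i1_{g^{-1}})=\delta_{1,g}$ for each $g\in G$. It is a partial abelian $\alpha_G$-extension if moreover $G$ is abelian. When $\alpha_G$ is global this is the usual notion of $G$-(Galois) extension, called an abelian extension if $G$ is abelian. Partial $G$-isomorphism. If $S$ and $S'$ are partial $\alpha_G$- and $\alpha'_G$-extensions of $R$, then $(S,\alpha_G)$ and $(S',\alpha'_G)$ are partially $G$-isomorphic if there is an $R$-linear $k$-algebra isomorphism $f:S\to S'$ with $f(S_g)\subseteq S'_g$ and $f\circ\alpha_g=\alpha'_g\circ f$ on $S_{g^{-1}}$ for all $g\in G$. The class of $(S,\alpha_G)$ is denoted $\lfloor S,\alpha_G\rfloor$, and $T_{par}(G,R)$ is the set of the classes $\lfloor S,\alpha_G\rfloor$ where $\alpha_G$ is a unital partial action of $G$ on $S$ and $S$ is a partial abelian $\alpha_G$-extension of $R$. Globalization. A globalization of a unital partial action $\alpha_\Gamma$ of a finite group $\Gamma$ on $S$ is a global action $\beta_\Gamma$ of $\Gamma$ on an algebra $T$ with an injective (not necessarily identity-preserving) algebra homomorphism $S\to T$, regarded as an inclusion, such that $S$ is an ideal of $T$, $S_g=S\cap\beta_g(S)$, $\beta_g(x)=\alpha_g(x)$ for $x\in S_{g^{-1}}$, and $T=\sum_{g\in\Gamma}\beta_g(S)$. It exists and is unique up to isomorphism. Quotient partial action. Let $N=\{h_1=1,h_2,\dots,h_m\}$ be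 a normal subgroup of $\Gamma$. Put $e_1=1_S$, $e_i=(1_T-1_S)(1_T-\beta_{h_2}(1_S))\cdots(1_T-\beta_{h_{i-1}}(1_S))\beta_{h_i}(1_S)$ for $2\le i\le m$, $\psi_N(t)=\sum_i\beta_{h_i}(t)e_i$ for $t\in T$, $e_N=\psi_N(1_S)$. The partial action $\alpha_{\Gamma/N}=(\tilde D_{gN},\alpha_{gN})$ of $\Gamma/N$ on $S^{\alpha_N}$ is given by $\tilde D_{gN}=S^{\alpha_N}\beta_g(e_N)1_S$ and $\alpha_{gN}(x)=\beta_g(\psi_N(x))1_S$ for $x\in\tilde D_{g^{-1}N}$. The operation on $T_{par}(G,R)$. With $\delta G=\{(g,g^{-1}):g\in G\}$ and $(G\times G)/\delta G$ identified with $G$ via $(g,1)\delta G\leftrightarrow g$, let $\alpha_{G\times G}=\alpha_G\otimes\alpha'_G$ be the partial action of $G\times G$ on $S\otimes_RS'$ with ideals $S_g\otimes_RS'_h$ and maps $\alpha_g\otimes\alpha'_h$; then $$\lfloor S,\alpha_G\rfloor\ast_{par}\lfloor S',\alpha'_G\rfloor=\lfloor (S\otimes_RS')^{\alpha_{\delta G}},\alpha_{(G\times G)/\delta G}\rfloor .$$ The algebra $A$. If $(T,\beta_G)$ is the globalization of $(S,\alpha_G)$ with $\lfloor S,\alpha_G\rfloor\in T_{par}(G,R)$, then multiplication by $1_S$ is an algebra isomorphism $T^{\beta_G}\to S^{\alpha_G}\simeq R$. Thus all the algebras $T^{\beta_G}$ are isomorphic; $A$ denotes this common algebra (a copy of $R$),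 and each $T$ is regarded as an $A$-algebra via these isomorphisms. $T$ is then an abelian $G$-extension of $A$. The Harrison group $T(G,A)$. Its elements are the classes $[B,\beta_G]$ of (global) abelian $G$-extensions $B$ of $A$, modulo $A$-linear algebra isomorphisms commuting with the $G$-actions. The product is $[B,\beta_G]\ast[B',\beta'_G]=[(B\otimes_AB')^{\delta G},\gamma_G]$, where $(g,h)\in G\times G$ acts as $\beta_g\otimes\beta'_h$ and $\gamma_g(\sum b_i\otimes b'_i)=\sum\beta_g(b_i)\otimes b'_i$. With this product $T(G,A)$ is an abelian group. Kernel. For a semigroup homomorphism $\varphi:\mathcal I\to\mathcal J$, $\ker\varphi=\{(x,y)\in\mathcal I\times\mathcal I:\varphi(x)=\varphi(y)\}$, a congruence on $\mathcal I$; $\rho(a)$ denotes the class of $a$ under $\rho$, and $\mathcal I/\rho$ has the product $\rho(a)\rho(b)=\rho(ab)$. *)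

theory Defs
  imports "HOL-Algebra.Module" "HOL-Algebra.QuotRing" "HOL-Algebra.Free_Abelian_Groups"
begin

section \<open>Partial actions on algebras\<close>

text \<open>
  Algebras over \<open>k\<close> are those of the locale \<^locale>\<open>algebra\<close>: commutative, associative and
  unital. The field \<open>pdom S g\<close> is the ideal \<open>S\<^sub>g\<close>, and \<open>pact S g\<close> is the map
  \<open>\<alpha>\<^sub>g\<close>, which is only meaningful on \<open>pdom S (inv g)\<close>. The field \<open>emb\<close> is the identification
  \<open>R \<simeq> S\<^sup>\<alpha>\<close> that belongs to a partial extension of \<open>R\<close> and makes \<open>S\<close> an \<open>R\<close>-algebra by
  \<open>r \<cdot> s = emb S r \<otimes> s\<close>.
\<close>

record ('k, 's, 'g) partial_algebra = "('k, 's) module" +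
  pdom :: "'g \<Rightarrow> 's set"
  pact :: "'g \<Rightarrow> 's \<Rightarrow> 's"

record ('k, 's, 'g, 'r) extension = "('k, 's, 'g) partial_algebra" +
  emb :: "'r \<Rightarrow> 's"

text \<open>
  Homomorphisms that need not preserve the identity, between subsets \<open>X\<close> of \<open>S\<close> and \<open>Y\<close> of \<open>T\<close>
  (in the applications: ideals).
\<close>

definition nonunital_alg_hom ::
  "('k, 'c) ring_scheme \<Rightarrow> ('k, 's, 'y) module_scheme \<Rightarrow> 's set \<Rightarrow>
   ('k, 't, 'z) module_scheme \<Rightarrow> 't set \<Rightarrow> ('s \<Rightarrow> 't) set" where
  "nonunital_alg_hom k S X T Y =
    {f \<in> X \<rightarrow> Y.
      (\<forall>x\<in>X. \<forall>y\<in>X. f (x \<oplus>\<^bsub>S\<^esub> y) = f x \<oplus>\<^bsub>T\<^esub> f y \<and> f (x \<otimes>\<^bsub>S\<^esub> y) = f x \<otimes>\<^bsub>T\<^esub> f y) \<and>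
      (\<forall>c\<in>carrier k. \<forall>x\<in>X. f (c \<odot>\<^bsub>S\<^esub> x) = c \<odot>\<^bsub>T\<^esub> f x)}"

definition alg_iso ::
  "('k, 'c) ring_scheme \<Rightarrow> ('k, 's, 'y) module_scheme \<Rightarrow> ('k, 't, 'z) module_scheme \<Rightarrow>
   ('s \<Rightarrow> 't) set" where
  "alg_iso k S T =
    {f \<in> ring_iso S T. \<forall>c\<in>carrier k. \<forall>x\<in>carrier S. f (c \<odot>\<^bsub>S\<^esub> x) = c \<odot>\<^bsub>T\<^esub> f x}"

locale partial_action = G: group G + S: algebra k S
  for G :: "('g, 'b) monoid_scheme" and k :: "('k, 'c) ring_scheme"
    and S :: "('k, 's, 'g, 'z) partial_algebra_scheme" +
  assumes pdom_ideal: "g \<in> carrier G \<Longrightarrow> ideal (pdom S g) S"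
    and pact_hom: "g \<in> carrier G \<Longrightarrow>
      pact S g \<in> nonunital_alg_hom k S (pdom S (inv\<^bsub>G\<^esub> g)) S (pdom S g)"
    and pact_bij: "g \<in> carrier G \<Longrightarrow> bij_betw (pact S g) (pdom S (inv\<^bsub>G\<^esub> g)) (pdom S g)"
    and pdom_one: "pdom S \<one>\<^bsub>G\<^esub> = carrier S"
    and pact_one: "s \<in> carrier S \<Longrightarrow> pact S \<one>\<^bsub>G\<^esub> s = s"
    and pact_image: "\<lbrakk>g \<in> carrier G; h \<in> carrier G\<rbrakk> \<Longrightarrow>
      pact S g ` (pdom S (inv\<^bsub>G\<^esub> g) \<inter> pdom S h) = pdom S g \<inter> pdom S (g \<otimes>\<^bsub>G\<^esub> h)"
    and pact_mult:
      "\<lbrakk>g \<in> carrier G; h \<in> carrier G;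
        x \<in> pact S (inv\<^bsub>G\<^esub> h) ` (pdom S h \<inter> pdom S (inv\<^bsub>G\<^esub> g))\<rbrakk> \<Longrightarrow>
      pact S g (pact S h x) = pact S (g \<otimes>\<^bsub>G\<^esub> h) x"

definition idem_generates :: "('k, 's, 'g, 'z) partial_algebra_scheme \<Rightarrow> 'g \<Rightarrow> 's \<Rightarrow> bool" where
  "idem_generates S g e \<longleftrightarrow>
    e \<in> carrier S \<and> e \<otimes>\<^bsub>S\<^esub> e = e \<and> pdom S g = (\<lambda>s. s \<otimes>\<^bsub>S\<^esub> e) ` carrier S"

text \<open>\<open>pone S g\<close> is \<open>1\<^sub>g\<close>; an ideal has at most one idempotent generator.\<close>

definition pone :: "('k, 's, 'g, 'z) partial_algebra_scheme \<Rightarrow> 'g \<Rightarrow> 's" where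
  "pone S g = (THE e. idem_generates S g e)"

locale unital_partial_action = partial_action +
  assumes unital: "g \<in> carrier G \<Longrightarrow> \<exists>e. idem_generates S g e"

locale global_action = partial_action +
  assumes global: "g \<in> carrier G \<Longrightarrow> pdom S g = carrier S"

text \<open>The invariants of the restriction to a subgroup \<open>H\<close> of \<open>G\<close>.\<close>

definition invariants ::
  "('g, 'b) monoid_scheme \<Rightarrow> 'g set \<Rightarrow> ('k, 's, 'g, 'z) partial_algebra_scheme \<Rightarrow> 's set" where
  "invariants G H S =
    {s \<in> carrier S. \<forall>g\<in>H. pact S g (s \<otimes>\<^bsub>S\<^esub> pone S (inv\<^bsub>G\<^esub> g)) = s \<otimes>\<^bsub>S\<^esub> pone S g}"


section \<open>Partial Galois extensions and their classes\<close>

locale partial_extension =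
  unital_partial_action G k S + R: algebra k R
  for G :: "('g, 'b) monoid_scheme" and k :: "('k, 'c) ring_scheme"
    and R :: "('k, 'r, 'd) module_scheme"
    and S :: "('k, 's, 'g, 'r, 'z) extension_scheme" +
  assumes finite_group: "finite (carrier G)"
    and emb_iso: "emb S \<in> alg_iso k R (S\<lparr>carrier := invariants G (carrier G) S\<rparr>)"
    and galois_coordinates:
      "\<exists>(m::nat) x y. x \<in> {..<m} \<rightarrow> carrier S \<and> y \<in> {..<m} \<rightarrow> carrier S \<and>
        (\<forall>g\<in>carrier G.
          (\<Oplus>\<^bsub>S\<^esub>i\<in>{..<m}. x i \<otimes>\<^bsub>S\<^esub> pact S g (y i \<otimes>\<^bsub>S\<^esub> pone S (inv\<^bsub>G\<^esub> g)))
          = (if g = \<one>\<^bsub>G\<^esub> then \<one>\<^bsub>S\<^esub> else \<zero>\<^bsub>S\<^esub>))"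

locale global_extension = partial_extension + global_action

definition partially_isomorphic ::
  "('g, 'b) monoid_scheme \<Rightarrow> ('k, 'c) ring_scheme \<Rightarrow> ('k, 'r, 'd) module_scheme \<Rightarrow>
   ('k, 's, 'g, 'r, 'y) extension_scheme \<Rightarrow> ('k, 't, 'g, 'r, 'z) extension_scheme \<Rightarrow> bool" where
  "partially_isomorphic G k R S S' \<longleftrightarrow>
    (\<exists>f\<in>alg_iso k S S'.
      (\<forall>r\<in>carrier R. \<forall>s\<in>carrier S. f (emb S r \<otimes>\<^bsub>S\<^esub> s) = emb S' r \<otimes>\<^bsub>S'\<^esub> f s) \<and>
      (\<forall>g\<in>carrier G. f ` pdom S g \<subseteq> pdom S' g \<and>
        (\<forall>x\<in>pdom S (inv\<^bsub>G\<^esub> g). f (pact S g x) = pact S' g (f x))))"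

text \<open>
  Classes are formed among the extensions whose elements lie in a fixed type \<open>'u\<close>, which plays
  the role of a universe; the representative \<open>S\<close> itself may live in another type.
\<close>

definition par_class ::
  "('g, 'b) monoid_scheme \<Rightarrow> ('k, 'c) ring_scheme \<Rightarrow> ('k, 'r, 'd) module_scheme \<Rightarrow>
   ('k, 's, 'g, 'r) extension \<Rightarrow> ('k, 'u, 'g, 'r) extension set" where
  "par_class G k R S = {Z. partial_extension G k R Z \<and> partially_isomorphic G k R S Z}"

text \<open>For global actions, partial \<open>G\<close>-isomorphism is equivariant \<open>A\<close>-algebra isomorphism.\<close>

definition glob_class ::
  "('g, 'b) monoid_scheme \<Rightarrow> ('k, 'c) ring_scheme \<Rightarrow> ('k, 'a, 'd) module_scheme \<Rightarrow>
   ('k, 's, 'g, 'a) extension \<Rightarrow> ('k, 'u, 'g, 'a) extension set" where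
  "glob_class G k A B = {Z. global_extension G k A Z \<and> partially_isomorphic G k A B Z}"


section \<open>Tensor products\<close>

definition tensor_relations ::
  "('k, 'r, 'd) module_scheme \<Rightarrow> ('k, 's, 'g, 'r) extension \<Rightarrow> ('k, 't, 'g, 'r) extension \<Rightarrow>
   ('s \<times> 't \<Rightarrow>\<^sub>0 int) set" where
  "tensor_relations R S S' =
    {frag_of (x \<oplus>\<^bsub>S\<^esub> y, z) - frag_of (x, z) - frag_of (y, z) |x y z.
      x \<in> carrier S \<and> y \<in> carrier S \<and> z \<in> carrier S'} \<union>
    {frag_of (x, y \<oplus>\<^bsub>S'\<^esub> z) - frag_of (x, y) - frag_of (x, z) |x y z.
      x \<in> carrier S \<and> y \<in> carrier S' \<and> z \<in> carrier S'} \<union>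
    {frag_of (emb S r \<otimes>\<^bsub>S\<^esub> x, y) - frag_of (x, emb S' r \<otimes>\<^bsub>S'\<^esub> y) |r x y.
      r \<in> carrier R \<and> x \<in> carrier S \<and> y \<in> carrier S'}"

definition tensor_null ::
  "('k, 'r, 'd) module_scheme \<Rightarrow> ('k, 's, 'g, 'r) extension \<Rightarrow> ('k, 't, 'g, 'r) extension \<Rightarrow>
   ('s \<times> 't \<Rightarrow>\<^sub>0 int) set" where
  "tensor_null R S S' =
    generate (free_Abelian_group (carrier S \<times> carrier S')) (tensor_relations R S S')"

text \<open>The element \<open>\<Sum> n\<^sub>i (s\<^sub>i \<otimes> t\<^sub>i)\<close> given by the formal sum \<open>\<Sum> n\<^sub>i (s\<^sub>i, t\<^sub>i)\<close>.\<close>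

definition tensor_elem ::
  "('k, 'r, 'd) module_scheme \<Rightarrow> ('k, 's, 'g, 'r) extension \<Rightarrow> ('k, 't, 'g, 'r) extension \<Rightarrow>
   ('s \<times> 't \<Rightarrow>\<^sub>0 int) \<Rightarrow> ('s \<times> 't \<Rightarrow>\<^sub>0 int) set" where
  "tensor_elem R S S' c =
    tensor_null R S S' #>\<^bsub>free_Abelian_group (carrier S \<times> carrier S')\<^esub> c"

text \<open>
  \<open>S \<otimes>\<^sub>R S'\<close> with the partial action of \<open>G \<times> G\<close>. The ideal \<open>S\<^sub>g \<otimes>\<^sub>R S'\<^sub>h\<close> consists of the elements
  having an expression supported in \<open>S\<^sub>g \<times> S'\<^sub>h\<close>, and \<open>\<alpha>\<^sub>g \<otimes> \<alpha>'\<^sub>h\<close> is evaluated on such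
  expressions. Unions range over the choices of representatives, as in \<^const>\<open>rcoset_mult\<close>.
\<close>

definition tensor ::
  "('g, 'b) monoid_scheme \<Rightarrow> ('k, 'r, 'd) module_scheme \<Rightarrow>
   ('k, 's, 'g, 'r) extension \<Rightarrow> ('k, 't, 'g, 'r) extension \<Rightarrow>
   ('k, ('s \<times> 't \<Rightarrow>\<^sub>0 int) set, 'g \<times> 'g, 'r) extension" where
  "tensor G R S S' =
    \<lparr>carrier =
       carrier (free_Abelian_group (carrier S \<times> carrier S') Mod tensor_null R S S'),
     monoid.mult = (\<lambda>X Y. \<Union>c\<in>X. \<Union>d\<in>Y. tensor_elem R S S'
       (frag_extend (\<lambda>(s, t).
          frag_extend (\<lambda>(s', t'). frag_of (s \<otimes>\<^bsub>S\<^esub> s', t \<otimes>\<^bsub>S'\<^esub> t')) d) c)),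
     one = tensor_elem R S S' (frag_of (\<one>\<^bsub>S\<^esub>, \<one>\<^bsub>S'\<^esub>)),
     ring.zero = tensor_null R S S',
     add = (<#>\<^bsub>free_Abelian_group (carrier S \<times> carrier S')\<^esub>),
     smult = (\<lambda>a X. \<Union>c\<in>X. tensor_elem R S S'
       (frag_extend (\<lambda>(s, t). frag_of (a \<odot>\<^bsub>S\<^esub> s, t)) c)),
     pdom = (\<lambda>(g, h). tensor_elem R S S' `
       {c. Poly_Mapping.keys c \<subseteq> pdom S g \<times> pdom S' h}),
     pact = (\<lambda>(g, h) X.
       \<Union>c\<in>{c \<in> X. Poly_Mapping.keys c \<subseteq> pdom S (inv\<^bsub>G\<^esub> g) \<times> pdom S' (inv\<^bsub>G\<^esub> h)}.
         tensor_elem R S S' (frag_extend (\<lambda>(s, t). frag_of (pact S g s, pact S' h t)) c)),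
     emb = (\<lambda>r. tensor_elem R S S' (frag_of (emb S r, \<one>\<^bsub>S'\<^esub>)))\<rparr>"


section \<open>Globalizations and quotient partial actions\<close>

definition globalization ::
  "('g, 'b) monoid_scheme \<Rightarrow> ('k, 'c) ring_scheme \<Rightarrow>
   ('k, 's, 'g, 'y) partial_algebra_scheme \<Rightarrow> ('k, 't, 'g, 'z) partial_algebra_scheme \<Rightarrow>
   ('s \<Rightarrow> 't) \<Rightarrow> bool" where
  "globalization G k S T \<iota> \<longleftrightarrow>
    global_action G k T \<and>
    \<iota> \<in> nonunital_alg_hom k S (carrier S) T (carrier T) \<and> inj_on \<iota> (carrier S) \<and>
    ideal (\<iota> ` carrier S) T \<and>
    (\<forall>g\<in>carrier G. \<iota> ` pdom S g = \<iota> ` carrier S \<inter> pact T g ` \<iota> ` carrier S) \<and>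
    (\<forall>g\<in>carrier G. \<forall>x\<in>pdom S (inv\<^bsub>G\<^esub> g). pact T g (\<iota> x) = \<iota> (pact S g x)) \<and>
    carrier T =
      {(\<Oplus>\<^bsub>T\<^esub>g\<in>carrier G. pact T g (\<iota> (s g))) |s. s \<in> carrier G \<rightarrow> carrier S}"

text \<open>
  Here \<open>\<phi> : A \<rightarrow> R\<close> identifies the copy \<open>A\<close> of \<open>R\<close>. The last clause says that the structure map
  \<open>A \<rightarrow> T\<^sup>\<beta>\<close>, followed by multiplication by \<open>1\<^sub>S\<close>, is \<open>A \<simeq> R \<simeq> S\<^sup>\<alpha>\<close>.
\<close>

definition extension_globalization ::
  "('g, 'b) monoid_scheme \<Rightarrow> ('k, 'c) ring_scheme \<Rightarrow> ('k, 'a, 'd) module_scheme \<Rightarrow> ('a \<Rightarrow> 'r) \<Rightarrow>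
   ('k, 's, 'g, 'r) extension \<Rightarrow> ('k, 't, 'g, 'a) extension \<Rightarrow> ('s \<Rightarrow> 't) \<Rightarrow> bool" where
  "extension_globalization G k A \<phi> S T \<iota> \<longleftrightarrow>
    globalization G k S T \<iota> \<and>
    (\<forall>a\<in>carrier A. emb T a \<in> invariants G (carrier G) T \<and>
      emb T a \<otimes>\<^bsub>T\<^esub> \<iota> \<one>\<^bsub>S\<^esub> = \<iota> (emb S (\<phi> a)))"

text \<open>
  The normal subgroup \<open>N\<close> is enumerated by a list \<open>hs\<close>, with indices starting at 0. As the list
  starts with the neutral element, \<open>quot_idem\<close> gives \<open>1\<^sub>S\<close> at index 0.
\<close>

definition enumerates :: "('g, 'b) monoid_scheme \<Rightarrow> 'g list \<Rightarrow> 'g set \<Rightarrow> bool" where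
  "enumerates \<Gamma> hs N \<longleftrightarrow> distinct hs \<and> set hs = N \<and> hs \<noteq> [] \<and> hd hs = \<one>\<^bsub>\<Gamma>\<^esub>"

definition quot_idem ::
  "('k, 's, 'g, 'y) partial_algebra_scheme \<Rightarrow> ('k, 't, 'g, 'z) partial_algebra_scheme \<Rightarrow>
   ('s \<Rightarrow> 't) \<Rightarrow> 'g list \<Rightarrow> nat \<Rightarrow> 't" where
  "quot_idem S T \<iota> hs i =
    (\<Otimes>\<^bsub>T\<^esub>j\<in>{..<i}. \<one>\<^bsub>T\<^esub> \<ominus>\<^bsub>T\<^esub> pact T (hs ! j) (\<iota> \<one>\<^bsub>S\<^esub>)) \<otimes>\<^bsub>T\<^esub> pact T (hs ! i) (\<iota> \<one>\<^bsub>S\<^esub>)"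

definition quot_psi ::
  "('k, 's, 'g, 'y) partial_algebra_scheme \<Rightarrow> ('k, 't, 'g, 'z) partial_algebra_scheme \<Rightarrow>
   ('s \<Rightarrow> 't) \<Rightarrow> 'g list \<Rightarrow> 't \<Rightarrow> 't" where
  "quot_psi S T \<iota> hs t =
    (\<Oplus>\<^bsub>T\<^esub>i\<in>{..<length hs}. pact T (hs ! i) t \<otimes>\<^bsub>T\<^esub> quot_idem S T \<iota> hs i)"

text \<open>
  The action of \<open>\<Gamma>/N\<close> on \<open>S\<^sup>N\<close>, indexed by the cosets \<open>c = gN\<close>. Its values, computed in \<open>T\<close>, lie
  in the ideal \<open>\<iota> ` carrier S\<close> and are pulled back along the injection \<open>\<iota>\<close>.
\<close>

definition quotient_action ::
  "('g, 'b) monoid_scheme \<Rightarrow> 'g set \<Rightarrow> ('k, 's, 'g, 'r) extension \<Rightarrow>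
   ('k, 't, 'g) partial_algebra \<Rightarrow> ('s \<Rightarrow> 't) \<Rightarrow> 'g list \<Rightarrow> ('k, 's, 'g set, 'r) extension" where
  "quotient_action \<Gamma> N S T \<iota> hs =
    \<lparr>carrier = invariants \<Gamma> N S, monoid.mult = monoid.mult S, one = \<one>\<^bsub>S\<^esub>, ring.zero = \<zero>\<^bsub>S\<^esub>, add = add S,
     smult = smult S,
     pdom = (\<lambda>c. let g = (SOME g. g \<in> c) in
       (\<lambda>x. inv_into (carrier S) \<iota>
          (\<iota> x \<otimes>\<^bsub>T\<^esub> pact T g (quot_psi S T \<iota> hs (\<iota> \<one>\<^bsub>S\<^esub>)) \<otimes>\<^bsub>T\<^esub> \<iota> \<one>\<^bsub>S\<^esub>)) ` invariants \<Gamma> N S),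
     pact = (\<lambda>c x. let g = (SOME g. g \<in> c) in
       inv_into (carrier S) \<iota> (pact T g (quot_psi S T \<iota> hs (\<iota> x)) \<otimes>\<^bsub>T\<^esub> \<iota> \<one>\<^bsub>S\<^esub>)),
     emb = emb S\<rparr>"

definition anti_diagonal :: "('g, 'b) monoid_scheme \<Rightarrow> ('g \<times> 'g) set" where
  "anti_diagonal G = (\<lambda>g. (g, inv\<^bsub>G\<^esub> g)) ` carrier G"

text \<open>
  \<open>(S \<otimes>\<^sub>R S')\<^sup>\<delta>\<^sup>G\<close> with its partial action of \<open>(G \<times> G)/\<delta>G\<close>, read as one of \<open>G\<close> through
  \<open>g \<leftrightarrow> (g, 1)\<delta>G\<close>. Here \<open>(T, \<iota>)\<close> is to be a globalization of \<open>tensor G R S S'\<close>.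
\<close>

definition par_product ::
  "'g monoid \<Rightarrow> ('k, 'r, 'd) module_scheme \<Rightarrow>
   ('k, 's, 'g, 'r) extension \<Rightarrow> ('k, 't, 'g, 'r) extension \<Rightarrow>
   ('k, 'v, 'g \<times> 'g) partial_algebra \<Rightarrow> (('s \<times> 't \<Rightarrow>\<^sub>0 int) set \<Rightarrow> 'v) \<Rightarrow> ('g \<times> 'g) list \<Rightarrow>
   ('k, ('s \<times> 't \<Rightarrow>\<^sub>0 int) set, 'g, 'r) extension" where
  "par_product G R S S' T \<iota> hs =
    (let Q = quotient_action (G \<times>\<times> G) (anti_diagonal G) (tensor G R S S') T \<iota> hs;
         coset = (\<lambda>g. (g, \<one>\<^bsub>G\<^esub>) <#\<^bsub>G \<times>\<times> G\<^esub> anti_diagonal G)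
     in \<lparr>carrier = carrier Q, monoid.mult = monoid.mult Q, one = \<one>\<^bsub>Q\<^esub>, ring.zero = \<zero>\<^bsub>Q\<^esub>, add = add Q,
         smult = smult Q, pdom = (\<lambda>g. pdom Q (coset g)), pact = (\<lambda>g. pact Q (coset g)),
         emb = emb Q\<rparr>)"

definition harrison_product ::
  "'g monoid \<Rightarrow> ('k, 'a, 'd) module_scheme \<Rightarrow>
   ('k, 's, 'g, 'a) extension \<Rightarrow> ('k, 't, 'g, 'a) extension \<Rightarrow>
   ('k, ('s \<times> 't \<Rightarrow>\<^sub>0 int) set, 'g, 'a) extension" where
  "harrison_product G A B B' =
    (let P = tensor G A B B'; I = invariants (G \<times>\<times> G) (anti_diagonal G) P
     in \<lparr>carrier = I, monoid.mult = monoid.mult P, one = \<one>\<^bsub>P\<^esub>, ring.zero = \<zero>\<^bsub>P\<^esub>, add = add P,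
         smult = smult P, pdom = (\<lambda>g. I), pact = (\<lambda>g. pact P (g, \<one>\<^bsub>G\<^esub>)), emb = emb P\<rparr>)"


section \<open>The semigroups of classes\<close>

text \<open>
  Records for the group theory library require a neutral element; it is determined by the product
  whenever it exists.
\<close>

definition magma :: "'x set \<Rightarrow> ('x \<Rightarrow> 'x \<Rightarrow> 'x) \<Rightarrow> 'x monoid" where
  "magma C m =
    \<lparr>carrier = C, monoid.mult = m, one = (THE e. e \<in> C \<and> (\<forall>x\<in>C. m e x = x \<and> m x e = x))\<rparr>"

text \<open>
  In the following products of classes and in \<open>globalization_map\<close> the unions range over all choices of
  representatives, globalizations and enumerations; all members of a union are meant to be one and
  the same class.
\<close>

definition par_mult ::
  "'g monoid \<Rightarrow> ('k, 'c) ring_scheme \<Rightarrow> ('k, 'r, 'd) module_scheme \<Rightarrow>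
   ('k, 'u, 'g, 'r) extension set \<Rightarrow> ('k, 'u, 'g, 'r) extension set \<Rightarrow>
   ('k, 'u, 'g, 'r) extension set" where
  "par_mult G k R X Y =
    (\<Union>S\<in>X. \<Union>S'\<in>Y.
      \<Union>(T :: ('k, 'u, 'g \<times> 'g) partial_algebra, \<iota>, hs)
        \<in> {(T, \<iota>, hs). globalization (G \<times>\<times> G) k (tensor G R S S') T \<iota> \<and>
                       enumerates (G \<times>\<times> G) hs (anti_diagonal G)}.
        par_class G k R (par_product G R S S' T \<iota> hs))"

definition T_par ::
  "'g monoid \<Rightarrow> ('k, 'c) ring_scheme \<Rightarrow> ('k, 'r, 'd) module_scheme \<Rightarrow>
   ('k, 'u, 'g, 'r) extension set monoid" where
  "T_par G k R =
    magma {par_class G k R S |S :: ('k, 'u, 'g, 'r) extension. partial_extension G k R S}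
      (par_mult G k R)"

definition harrison_mult ::
  "'g monoid \<Rightarrow> ('k, 'c) ring_scheme \<Rightarrow> ('k, 'a, 'd) module_scheme \<Rightarrow>
   ('k, 'u, 'g, 'a) extension set \<Rightarrow> ('k, 'u, 'g, 'a) extension set \<Rightarrow>
   ('k, 'u, 'g, 'a) extension set" where
  "harrison_mult G k A X Y =
    (\<Union>B\<in>X. \<Union>B'\<in>Y. glob_class G k A (harrison_product G A B B'))"

definition Harrison ::
  "'g monoid \<Rightarrow> ('k, 'c) ring_scheme \<Rightarrow> ('k, 'a, 'd) module_scheme \<Rightarrow>
   ('k, 'u, 'g, 'a) extension set monoid" where
  "Harrison G k A =
    magma {glob_class G k A B |B :: ('k, 'u, 'g, 'a) extension. global_extension G k A B}
      (harrison_mult G k A)"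

definition globalization_map ::
  "'g monoid \<Rightarrow> ('k, 'c) ring_scheme \<Rightarrow> ('k, 'a, 'd) module_scheme \<Rightarrow> ('a \<Rightarrow> 'r) \<Rightarrow>
   ('k, 'u, 'g, 'r) extension set \<Rightarrow> ('k, 'u, 'g, 'a) extension set" where
  "globalization_map G k A \<phi> X =
    (\<Union>S\<in>X. \<Union>(T :: ('k, 'u, 'g, 'a) extension, \<iota>)
      \<in> {(T, \<iota>). extension_globalization G k A \<phi> S T \<iota>}. glob_class G k A T)"

definition ker_congruence :: "('x, 'b) monoid_scheme \<Rightarrow> ('x \<Rightarrow> 'y) \<Rightarrow> ('x \<times> 'x) set" where
  "ker_congruence I f = {(x, y). x \<in> carrier I \<and> y \<in> carrier I \<and> f x = f y}"

definition quotient_magma ::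
  "('x, 'b) monoid_scheme \<Rightarrow> ('x \<times> 'x) set \<Rightarrow> 'x set monoid" where
  "quotient_magma I \<rho> =
    magma (carrier I // \<rho>) (\<lambda>X Y. \<Union>x\<in>X. \<Union>y\<in>Y. \<rho> `` {x \<otimes>\<^bsub>I\<^esub> y})"

definition induced_map :: "('x \<Rightarrow> 'y) \<Rightarrow> 'x set \<Rightarrow> 'y" where
  "induced_map f X = the_elem (f ` X)"

end

theory Submission
  imports Defs
begin

text \<open>
  Everything is moved to the globalizations. A partial extension \<open>S\<close> with globalization \<open>T\<close> is the same
  thing as a Galois extension \<open>T\<close> of \<open>A\<close> with an idempotent \<open>e\<close> whose translates generate the unit ideal:
  \<open>S\<close> is the restriction of the action to \<open>eT\<close>. A partial isomorphism extends to the globalizations and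
  maps \<open>e\<close> to \<open>e'\<close>, since Galois coordinates detect the idempotents \<open>1\<^sub>g\<close>. The tensor product of \<open>(T, e)\<close>
  and \<open>(T', e')\<close> is \<open>(T \<otimes> T', e \<otimes> e')\<close>, and the quotient by \<open>N\<close> is \<open>T\<^sup>N\<close> with the least idempotent
  absorbing all \<open>n(e)\<close>, \<open>n \<in> N\<close>. Hence \<open>\<pi>\<close>, which forgets \<open>e\<close>, is a homomorphism to the Harrison group; it
  is onto, as a global extension is its own globalization, and the first isomorphism theorem applies.
  The group laws hold because an equivariant \<open>A\<close>-homomorphism of Galois extensions is bijective.
\<close>

\<comment> \<open>Bijectivity of equivariant homomorphisms replaces all descent arguments, and it
  rests on the trace. An element of trace one exists because the traces form an ideal J of the
  invariants with JT = T, so that Nakayama's lemma applies; the same kind of element yields Galois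
  coordinates for fixed rings and splits A off tensor products, so flatness and projectivity never
  enter. A partial isomorphism is only required to map S_g into S'_g. Equality of the idempotents,
  without which nothing extends to the globalizations, has to be extracted from the coordinates. The
  partial product involves a globalization and an enumeration of the anti-diagonal. Both choices
  disappear once e_N is described intrinsically, as the identity element of the ideal generated by
  the translates n(e). Classes live in one fixed type, so every construction has to be copied back
  into it. This works because a Galois extension is a finite span over A and hence embeds into any
  infinite type that contains a copy of R.\<close>
text \<open>Structure subscripts that are plain names are written without brackets, as in \<open>x \<otimes>\<^sub>T y\<close>.\<close>

syntax "_index" :: "logic \<Rightarrow> index" ("\<^sub>_" [1000] 1000)

section \<open>Galois extensions\<close>

text \<open>
  The span of the functions \<open>g \<mapsto> x g(y)\<close>: Galois coordinates exist iff the indicator function of the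
  neutral element belongs to it. Rule induction replaces computations with indexed sums.
\<close>

inductive coord ::
  "('g, 'm) monoid_scheme \<Rightarrow> ('t, 'z) ring_scheme \<Rightarrow> ('g \<Rightarrow> 't \<Rightarrow> 't) \<Rightarrow> ('g \<Rightarrow> 't) \<Rightarrow> bool"
  for G T act where
  single: "[|x \<in> carrier T; y \<in> carrier T; !!g. g \<in> carrier G ==> f g = x \<otimes>\<^sub>T act g y|]
    ==> coord G T act f"
| add: "[|coord G T act p; coord G T act q; !!g. g \<in> carrier G ==> f g = p g \<oplus>\<^sub>T q g|]
    ==> coord G T act f"

lemma coord_cong:
  assumes "coord G T act f" "!!g. g \<in> carrier G ==> f g = f' g"
  shows "coord G T act f'"
  using assms
proof (induction arbitrary: f')
  case (single x y f)
  show ?case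
    by (rule coord.single[OF single(1,2)]) (simp add: single(3) single(4)[symmetric])
next
  case (add p q f)
  show ?case
    by (rule coord.add[OF add(1,2)]) (simp add: add(3) add(6)[symmetric])
qed

lemma (in abelian_group) minus_zeroD:
  assumes "x \<in> carrier G" "y \<in> carrier G" "x \<ominus> y = \<zero>"
  shows "x = y"
proof -
  have "x = (x \<ominus> y) \<oplus> y" using assms(1,2) by (simp add: minus_eq a_assoc l_neg)
  then show ?thesis using assms by simp
qed

lemma (in abelian_monoid) finsum_append:
  fixes m n :: nat
  assumes f: "f \<in> {..<m} \<rightarrow> carrier G" and h: "h \<in> {..<n} \<rightarrow> carrier G"
  shows "(\<Oplus>i\<in>{..<m + n}. if i < m then f i else h (i - m)) = (\<Oplus>i\<in>{..<m}. f i) \<oplus> (\<Oplus>i\<in>{..<n}. h i)"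
  using h
proof (induction n)
  case 0
  have "(\<Oplus>i\<in>{..<m}. if i < m then f i else h (i - m)) = (\<Oplus>i\<in>{..<m}. f i)"
    using f by (intro finsum_cong') auto
  then show ?case using f by simp
next
  case (Suc n)
  let ?u = "\<lambda>i. if i < m then f i else h (i - m)"
  have h': "h \<in> {..<n} \<rightarrow> carrier G" and hn: "h n \<in> carrier G" using Suc.prems by auto
  have u: "?u \<in> {..<m + n} \<rightarrow> carrier G" using f h' by (auto simp: Pi_iff)
  have "finsum G ?u {..<m + Suc n} = ?u (m + n) \<oplus> finsum G ?u {..<m + n}"
    using u hn by (simp add: lessThan_Suc)
  also have "\<dots> = h n \<oplus> (finsum G f {..<m} \<oplus> finsum G h {..<n})" using Suc.IH[OF h'] by simp
  also have "\<dots> = finsum G f {..<m} \<oplus> (h n \<oplus> finsum G h {..<n})"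
    using f h' hn by (simp add: a_lcomm)
  also have "h n \<oplus> finsum G h {..<n} = finsum G h {..<Suc n}"
    using h' hn by (simp add: lessThan_Suc)
  finally show ?case .
qed

text \<open>The bridge to the indexed families in \<open>galois_coordinates\<close>: in the
  \<open>add\<close> case two families are concatenated, conversely the number of terms is the
  induction parameter. Of \<open>act\<close> only closedness is required, so the lemma also serves
  the maps \<open>tot\<close> of a partial action.\<close>

lemma (in cring) coord_iff:
  assumes act: "!!g x. g \<in> carrier H ==> x \<in> carrier R ==> act g x \<in> carrier R"
  shows "coord H R act f \<longleftrightarrow>
    (\<exists>(m::nat) x y. x \<in> {..<m} \<rightarrow> carrier R \<and> y \<in> {..<m} \<rightarrow> carrier R \<and>
      (\<forall>g\<in>carrier H. (\<Oplus>i\<in>{..<m}. x i \<otimes> act g (y i)) = f g))"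
proof
  assume "coord H R act f"
  then show "\<exists>(m::nat) x y. x \<in> {..<m} \<rightarrow> carrier R \<and> y \<in> {..<m} \<rightarrow> carrier R \<and>
      (\<forall>g\<in>carrier H. (\<Oplus>i\<in>{..<m}. x i \<otimes> act g (y i)) = f g)"
  proof induction
    case (single x y f)
    have "(\<Oplus>i\<in>{..<Suc 0}. x \<otimes> act g y) = f g" if "g \<in> carrier H" for g
      using single act[OF that] that by (simp add: lessThan_Suc)
    with single(1,2) show ?case by (intro exI[of _ "Suc 0"] exI[of _ "\<lambda>_. x"] exI[of _ "\<lambda>_. y"]) auto
  next
    case (add p q f)
    obtain m :: nat and x y where p: "x \<in> {..<m} \<rightarrow> carrier R" "y \<in> {..<m} \<rightarrow> carrier R"
      "!!g. g \<in> carrier H ==> (\<Oplus>i\<in>{..<m}. x i \<otimes> act g (y i)) = p g" using add.IH(1) by blast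
    obtain n :: nat and x' y' where q: "x' \<in> {..<n} \<rightarrow> carrier R" "y' \<in> {..<n} \<rightarrow> carrier R"
      "!!g. g \<in> carrier H ==> (\<Oplus>i\<in>{..<n}. x' i \<otimes> act g (y' i)) = q g" using add.IH(2) by blast
    let ?X = "\<lambda>i. if i < m then x i else x' (i - m)"
    let ?Y = "\<lambda>i. if i < m then y i else y' (i - m)"
    have "(\<Oplus>i\<in>{..<m + n}. ?X i \<otimes> act g (?Y i)) = f g" if g: "g \<in> carrier H" for g
    proof -
      have 1: "(\<lambda>i. x i \<otimes> act g (y i)) \<in> {..<m} \<rightarrow> carrier R" using p act[OF g] by (auto simp: Pi_iff)
      have 2: "(\<lambda>i. x' i \<otimes> act g (y' i)) \<in> {..<n} \<rightarrow> carrier R" using q act[OF g] by (auto simp: Pi_iff)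
      have "(\<Oplus>i\<in>{..<m + n}. ?X i \<otimes> act g (?Y i)) =
        (\<Oplus>i\<in>{..<m + n}. if i < m then x i \<otimes> act g (y i) else x' (i - m) \<otimes> act g (y' (i - m)))"
        by (rule arg_cong[where f = "\<lambda>u. finsum R u {..<m + n}"]) (rule ext, auto)
      also have "\<dots> = p g \<oplus> q g" using finsum_append[OF 1 2] p q g by simp
      finally show ?thesis using add g by simp
    qed
    moreover have "?X \<in> {..<m + n} \<rightarrow> carrier R" "?Y \<in> {..<m + n} \<rightarrow> carrier R"
      using p q by (auto simp: Pi_iff)
    ultimately show ?case by blast
  qed
next
  assume "\<exists>(m::nat) x y. x \<in> {..<m} \<rightarrow> carrier R \<and> y \<in> {..<m} \<rightarrow> carrier R \<and>
      (\<forall>g\<in>carrier H. (\<Oplus>i\<in>{..<m}. x i \<otimes> act g (y i)) = f g)"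
  then obtain m :: nat and x y where p: "x \<in> {..<m} \<rightarrow> carrier R" "y \<in> {..<m} \<rightarrow> carrier R"
      "!!g. g \<in> carrier H ==> (\<Oplus>i\<in>{..<m}. x i \<otimes> act g (y i)) = f g" by blast
  have "coord H R act (\<lambda>g. \<Oplus>i\<in>{..<m}. x i \<otimes> act g (y i))" using p(1,2)
  proof (induction m)
    case 0
    \<comment> \<open>The empty sum: the pair (0, 0) gives the zero function, whatever
      \<open>act g\<close> does to 0.\<close>
    show ?case by (rule coord.single[of "\<zero>" _ "\<zero>"]) (use act in auto)
  next
    case (Suc m)
    have "coord H R act (\<lambda>g. x m \<otimes> act g (y m))"
      using Suc.prems by (intro coord.single[of "x m" _ "y m"]) auto
    moreover have "coord H R act (\<lambda>g. \<Oplus>i\<in>{..<m}. x i \<otimes> act g (y i))"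
      by (rule Suc.IH) (use Suc.prems in auto)
    ultimately show ?case
      by (rule coord.add) (use Suc.prems act in \<open>simp add: lessThan_Suc Pi_iff\<close>)
  qed
  then show "coord H R act f" by (rule coord_cong) (rule p(3))
qed

lemma (in cring) coord_closed:
  assumes "coord H R act f" "g \<in> carrier H"
    and act: "!!g x. g \<in> carrier H ==> x \<in> carrier R ==> act g x \<in> carrier R"
  shows "f g \<in> carrier R"
  using assms(1) by induction (use assms(2) act in auto)

text \<open>For multiplicative \<open>act\<close>, (x g(y)) (x' g(y')) = xx' g(yy'). This produces
  the indicator function of a conjunction from the indicator functions of its parts.\<close>

lemma (in cring) coord_mult:
  assumes p: "coord H R act p" and q: "coord H R act q"
    and act: "!!g x. g \<in> carrier H ==> x \<in> carrier R ==> act g x \<in> carrier R"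
    and act_mult: "!!g x y. g \<in> carrier H ==> x \<in> carrier R ==> y \<in> carrier R ==>
      act g (x \<otimes> y) = act g x \<otimes> act g y"
    and f: "!!g. g \<in> carrier H ==> f g = p g \<otimes> q g"
  shows "coord H R act f"
  using p f
proof (induction arbitrary: f)
  case (single x y p)
  from q single show ?case
  proof (induction arbitrary: f)
    case (single x' y' q)
    show ?case by (rule coord.single[of "x \<otimes> x'" _ "y \<otimes> y'"])
       (use single act act_mult in \<open>auto simp: m_ac\<close>)
  next
    case (add q q' r)
    have "coord H R act (\<lambda>g. p g \<otimes> q g)" "coord H R act (\<lambda>g. p g \<otimes> q' g)"
      using add by auto
    then show ?case
      by (rule coord.add) (use add act coord_closed[OF add(1) _ act] coord_closed[OF add(2) _ act] in \<open>auto simp: r_distr\<close>)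
  qed
next
  case (add p p' r)
  have "coord H R act (\<lambda>g. p g \<otimes> q g)" "coord H R act (\<lambda>g. p' g \<otimes> q g)"
    using add by auto
  then show ?case
    by (rule coord.add) (use add act coord_closed[OF q _ act] coord_closed[OF add(1) _ act] coord_closed[OF add(2) _ act] in \<open>auto simp: l_distr\<close>)
qed

text \<open>Additivity in the coefficient function, to which many \<open>add\<close> cases of rule
  inductions on \<open>coord\<close> reduce.\<close>

lemma (in cring) finsum_mult_add:
  assumes "p \<in> X \<rightarrow> carrier R" "q \<in> X \<rightarrow> carrier R" "y \<in> X \<rightarrow> carrier R"
    "!!g. g \<in> X ==> f g = p g \<oplus> q g"
  shows "(\<Oplus>g\<in>X. f g \<otimes> y g) = (\<Oplus>g\<in>X. p g \<otimes> y g) \<oplus> (\<Oplus>g\<in>X. q g \<otimes> y g)"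
proof -
  have "(\<Oplus>g\<in>X. f g \<otimes> y g) = (\<Oplus>g\<in>X. p g \<otimes> y g \<oplus> q g \<otimes> y g)"
    using assms by (intro finsum_cong') (auto simp: l_distr Pi_iff)
  also have "\<dots> = (\<Oplus>g\<in>X. p g \<otimes> y g) \<oplus> (\<Oplus>g\<in>X. q g \<otimes> y g)"
    using assms by (intro finsum_addf) (auto simp: Pi_iff)
  finally show ?thesis .
qed

section \<open>Finite spans and Nakayama's lemma\<close>

text \<open>Linear combinations of a list with coefficients in \<open>J\<close>, built one generator
  at a time: \<open>nakayama_aux\<close> eliminates the head of the list, and
  \<open>lspan_embeds\<close> encodes an element as a coefficient and a remainder.\<close>

primrec lspan :: "('t, 'z) ring_scheme \<Rightarrow> 't set \<Rightarrow> 't list \<Rightarrow> 't set" where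
  "lspan T J [] = {\<zero>\<^sub>T}"
| "lspan T J (x # xs) = {a \<otimes>\<^sub>T x \<oplus>\<^sub>T y |a y. a \<in> J \<and> y \<in> lspan T J xs}"

context cring begin

lemma lspan_ConsI: "a \<in> J ==> y \<in> lspan R J xs ==> a \<otimes> x \<oplus> y \<in> lspan R J (x # xs)"
  by auto

lemma lspan_closed: "J \<subseteq> carrier R ==> set xs \<subseteq> carrier R ==> lspan R J xs \<subseteq> carrier R"
  by (induction xs) auto

lemma lspan_append:
  "[|J \<subseteq> carrier R; set xs \<subseteq> carrier R; set ys \<subseteq> carrier R; u \<in> lspan R J xs; v \<in> lspan R J ys|]
    ==> u \<oplus> v \<in> lspan R J (xs @ ys)"
proof (induction xs arbitrary: u)
  case Nil
  then show ?case using lspan_closed[of J ys] by auto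
next
  case (Cons x xs)
  then obtain a y where a: "u = a \<otimes> x \<oplus> y" "a \<in> J" "y \<in> lspan R J xs" by auto
  have "y \<in> carrier R" "v \<in> carrier R" using Cons.prems a lspan_closed[of J] by auto
  moreover have "a \<in> carrier R" "x \<in> carrier R" using Cons.prems a by auto
  ultimately have "u \<oplus> v = a \<otimes> x \<oplus> (y \<oplus> v)" using a(1) by (simp add: a_assoc)
  moreover have "y \<oplus> v \<in> lspan R J (xs @ ys)" using Cons a by auto
  ultimately show ?case using lspan_ConsI[OF a(2)] by (simp only: append_Cons)
qed

lemma lspan_add:
  assumes J: "J \<subseteq> carrier R" "!!a b. a \<in> J ==> b \<in> J ==> a \<oplus> b \<in> J" and xs: "set xs \<subseteq> carrier R"
    and u: "u \<in> lspan R J xs" and v: "v \<in> lspan R J xs"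
  shows "u \<oplus> v \<in> lspan R J xs"
  using xs u v
proof (induction xs arbitrary: u v)
  case Nil
  then show ?case by auto
next
  case (Cons x xs)
  then obtain a y b z where a: "u = a \<otimes> x \<oplus> y" "a \<in> J" "y \<in> lspan R J xs"
    "v = b \<otimes> x \<oplus> z" "b \<in> J" "z \<in> lspan R J xs" by auto
  have c: "y \<in> carrier R" "z \<in> carrier R" "a \<in> carrier R" "b \<in> carrier R" "x \<in> carrier R"
    using Cons.prems a lspan_closed[of J xs] J by auto
  then have "u \<oplus> v = (a \<oplus> b) \<otimes> x \<oplus> (y \<oplus> z)" using a by (simp add: l_distr a_ac)
  moreover have "y \<oplus> z \<in> lspan R J xs" using Cons a by auto
  ultimately show ?case using lspan_ConsI[OF J(2)[OF a(2,5)]] by (simp only:)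
qed

lemma lspan_mult:
  assumes "J \<subseteq> carrier R" "!!a. a \<in> J ==> c \<otimes> a \<in> J'" "c \<in> carrier R" "set xs \<subseteq> carrier R"
    "u \<in> lspan R J xs"
  shows "c \<otimes> u \<in> lspan R J' xs"
  using assms(4,5)
proof (induction xs arbitrary: u)
  case Nil
  then show ?case using assms by auto
next
  case (Cons x xs)
  then obtain a y where a: "u = a \<otimes> x \<oplus> y" "a \<in> J" "y \<in> lspan R J xs" by auto
  have "c \<otimes> u = (c \<otimes> a) \<otimes> x \<oplus> c \<otimes> y"
    using a Cons.prems assms lspan_closed[of J xs] by (auto simp: r_distr m_assoc subset_iff)
  then show ?case using a assms(2) Cons by auto
qed

lemma lspan_mono: "J \<subseteq> J' ==> lspan R J xs \<subseteq> lspan R J' xs"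
  by (induction xs) fastforce+

lemma lspan_zero: "\<zero> \<in> J ==> set xs \<subseteq> carrier R ==> \<zero> \<in> lspan R J xs"
  by (induction xs) (auto, metis l_null l_zero zero_closed)

text \<open>Gaussian elimination with a multiplier w that is 1 modulo \<open>J\<close> and maps
  \<open>R\<close> into the \<open>I\<close>-span of the remaining generators. Since
  \<open>R\<close> = \<open>J\<close> \<open>R\<close>, one gets wx = ax + y for the head x, with a
  in \<open>J\<close> and y in the span of the tail; so w - a moves x into the span of the tail.
  With no generators left, w = 0 and 1 = 1 - w lies in \<open>J\<close>.\<close>

lemma nakayama_aux:
  assumes I: "I \<subseteq> carrier R" "\<one> \<in> I" "!!a b. a \<in> I ==> b \<in> I ==> a \<oplus> b \<in> I"
      "!!a b. a \<in> I ==> b \<in> I ==> a \<otimes> b \<in> I" "!!a. a \<in> I ==> \<ominus> a \<in> I"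
    and J: "J \<subseteq> I" "\<zero> \<in> J" "!!a b. a \<in> J ==> b \<in> J ==> a \<oplus> b \<in> J"
      "!!a b. a \<in> J ==> b \<in> I ==> a \<otimes> b \<in> J"
    and gs: "set gs \<subseteq> carrier R" "carrier R \<subseteq> lspan R J gs"
    and xs: "set xs \<subseteq> carrier R" "w \<in> I" "\<one> \<ominus> w \<in> J" "!!b. b \<in> carrier R ==> w \<otimes> b \<in> lspan R I xs"
  shows "\<one> \<in> J"
  using xs
proof (induction xs arbitrary: w)
  case Nil
  then have "w = \<zero>" using I by (metis lspan.simps(1) one_closed r_one singletonD subsetD)
  then show ?case using Nil by (simp add: a_minus_def)
next
  case (Cons x xs)
  note hyp = Cons.prems(4) and xset = Cons.prems(1)
  have w: "w \<in> carrier R" and x: "x \<in> carrier R" and JR: "J \<subseteq> carrier R" using Cons.prems I J by auto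
  \<comment> \<open>Coefficients improve from \<open>I\<close> to \<open>J\<close>: u is a
    \<open>J\<close>-combination of elements g, and each wg is an \<open>I\<close>-combination of x
    and the tail.\<close>
  have "w \<otimes> u \<in> lspan R J (x # xs)" if "u \<in> lspan R J hs" "set hs \<subseteq> carrier R" for u hs
    using that
  proof (induction hs arbitrary: u)
    case Nil
    then show ?case using w lspan_zero[OF J(2), of "x # xs"] Cons.prems(1) by auto
  next
    case (Cons g hs)
    obtain a y where a: "u = a \<otimes> g \<oplus> y" "a \<in> J" "y \<in> lspan R J hs" using Cons.prems by auto
    have c: "a \<in> carrier R" "g \<in> carrier R" "y \<in> carrier R"
      using a Cons.prems JR lspan_closed[OF JR, of hs] by auto
    have "a \<otimes> (w \<otimes> g) \<in> lspan R J (x # xs)"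
      by (rule lspan_mult[OF I(1) J(4)[OF a(2)] c(1) xset hyp[OF c(2)]])
    moreover have "w \<otimes> y \<in> lspan R J (x # xs)" using Cons a by auto
    ultimately have "a \<otimes> (w \<otimes> g) \<oplus> w \<otimes> y \<in> lspan R J (x # xs)"
      by (intro lspan_add[where J = J] JR xset) (auto intro: J(3))
    then show ?case using a c w by (simp add: r_distr m_lcomm)
  qed
  then have "w \<otimes> x \<in> lspan R J (x # xs)" using gs x by auto
  then obtain a y where a: "w \<otimes> x = a \<otimes> x \<oplus> y" "a \<in> J" "y \<in> lspan R J xs" by auto
  have aI: "a \<in> I" and ac: "a \<in> carrier R" and yI: "y \<in> lspan R I xs" and yc: "y \<in> carrier R"
    using a J JR lspan_mono[of J I xs] lspan_closed[of J xs] Cons.prems by auto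
  \<comment> \<open>The factor w writes an arbitrary element through x and the tail, the factor w -
    a then removes x.\<close>
  let ?w = "(w \<ominus> a) \<otimes> w"
  have wa: "w \<ominus> a \<in> I" using aI Cons.prems I by (simp add: a_minus_def)
  have 1: "?w \<in> I" using wa Cons.prems I by auto
  have "\<one> \<ominus> ?w = (\<one> \<ominus> w) \<otimes> (\<one> \<oplus> w) \<oplus> a \<otimes> w" using w ac by algebra
  also have "\<dots> \<in> J" using Cons.prems I J a by auto
  finally have 2: "\<one> \<ominus> ?w \<in> J" .
  have 3: "?w \<otimes> b \<in> lspan R I xs" if b: "b \<in> carrier R" for b
  proof -
    obtain c z where c: "w \<otimes> b = c \<otimes> x \<oplus> z" "c \<in> I" "z \<in> lspan R I xs" using Cons.prems(4)[OF b] by auto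
    have cc: "c \<in> carrier R" and zc: "z \<in> carrier R" using c I lspan_closed[of I xs] Cons.prems by auto
    have "?w \<otimes> b = (w \<ominus> a) \<otimes> (w \<otimes> b)" using w ac b by algebra
    also have "\<dots> = c \<otimes> (w \<otimes> x \<ominus> a \<otimes> x) \<oplus> (w \<ominus> a) \<otimes> z" unfolding c(1) using w ac b cc zc x by algebra
    also have "w \<otimes> x \<ominus> a \<otimes> x = y" unfolding a(1) using ac x yc by algebra
    finally have "?w \<otimes> b = c \<otimes> y \<oplus> (w \<ominus> a) \<otimes> z" .
    moreover have "c \<otimes> y \<in> lspan R I xs" "(w \<ominus> a) \<otimes> z \<in> lspan R I xs"
      using c yI wa I Cons.prems cc ac w by (auto intro!: lspan_mult[of I])
    ultimately show ?thesis using lspan_add[of I xs] I Cons.prems by auto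
  qed
  show ?case using Cons.IH[OF _ 1 2 3] Cons.prems by auto
qed

text \<open>As \<open>I\<close> is a subring of \<open>R\<close>, an element of 1 + \<open>J\<close>
  that annihilates \<open>R\<close> kills 1 and vanishes. The elimination starts from w = 1 with the
  given generators, and no determinants or maximal ideals occur.\<close>

lemma nakayama:
  assumes I: "I \<subseteq> carrier R" "\<one> \<in> I" "!!a b. a \<in> I ==> b \<in> I ==> a \<oplus> b \<in> I"
      "!!a b. a \<in> I ==> b \<in> I ==> a \<otimes> b \<in> I" "!!a. a \<in> I ==> \<ominus> a \<in> I"
    and J: "J \<subseteq> I" "\<zero> \<in> J" "!!a b. a \<in> J ==> b \<in> J ==> a \<oplus> b \<in> J"
      "!!a b. a \<in> J ==> b \<in> I ==> a \<otimes> b \<in> J"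
    and gs: "set gs \<subseteq> carrier R" "carrier R \<subseteq> lspan R J gs"
  shows "\<one> \<in> J"
proof (rule nakayama_aux[OF I J gs gs(1) I(2)])
  show "\<one> \<ominus> \<one> \<in> J" using J by (simp add: a_minus_def r_neg)
  show "\<one> \<otimes> b \<in> lspan R I gs" if "b \<in> carrier R" for b
    using that gs lspan_mono[OF J(1), of gs] by auto
qed

end

section \<open>Global actions, Galois extensions and the trace\<close>

text \<open>A global action of a finite group, with all domains evaluated. There is no clause about
  scalars from \<open>k\<close>: in \<open>galois\<close> they act through invariant elements, which
  yields \<open>act_smult\<close>.\<close>

locale gact = G: group G + T: algebra k T
  for G :: "'g monoid" and k :: "'k ring" and T :: "('k, 't, 'g, 'z) partial_algebra_scheme" (structure) +
  assumes fin: "finite (carrier G)"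
    and dom: "g \<in> carrier G ==> pdom T g = carrier T"
    and act_closed [simp, intro]: "[|g \<in> carrier G; x \<in> carrier T|] ==> pact T g x \<in> carrier T"
    and act_add: "[|g \<in> carrier G; x \<in> carrier T; y \<in> carrier T|] ==>
      pact T g (x \<oplus> y) = pact T g x \<oplus> pact T g y"
    and act_mult: "[|g \<in> carrier G; x \<in> carrier T; y \<in> carrier T|] ==>
      pact T g (x \<otimes> y) = pact T g x \<otimes> pact T g y"
    and act_id [simp]: "x \<in> carrier T ==> pact T \<one>\<^sub>G x = x"
    and act_comp: "[|g \<in> carrier G; h \<in> carrier G; x \<in> carrier T|] ==>
      pact T g (pact T h x) = pact T (g \<otimes>\<^sub>G h) x"
begin

lemma act_inv_cancel [simp]:
  assumes "g \<in> carrier G" "x \<in> carrier T"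
  shows "pact T g (pact T (inv\<^bsub>G\<^esub> g) x) = x" "pact T (inv\<^bsub>G\<^esub> g) (pact T g x) = x"
  using assms by (simp_all add: act_comp)

lemma act_one [simp]: "g \<in> carrier G ==> pact T g \<one> = \<one>"
proof -
  assume g: "g \<in> carrier G"
  have "pact T g \<one> = pact T g \<one> \<otimes> pact T g (pact T (inv\<^bsub>G\<^esub> g) \<one>)" using g by simp
  also have "\<dots> = pact T g (\<one> \<otimes> pact T (inv\<^bsub>G\<^esub> g) \<one>)" using g by (intro act_mult[symmetric]) auto
  also have "\<dots> = \<one>" using g by simp
  finally show ?thesis .
qed

lemma act_hom: "g \<in> carrier G ==> ring_hom_cring T T (pact T g)"
  by (rule ring_hom_cringI[OF ring_hom_ringI2])
     (auto intro!: ring_hom_memI T.M_cring simp: act_add act_mult cring.axioms T.M_cring)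

lemma act_zero [simp]: "g \<in> carrier G ==> pact T g \<zero> = \<zero>"
  by (rule ring_hom_cring.hom_zero[OF act_hom])

lemma act_uminus [simp]: "g \<in> carrier G ==> x \<in> carrier T ==> pact T g (\<ominus> x) = \<ominus> pact T g x"
  by (rule ring_hom_cring.hom_a_inv[OF act_hom])

lemma act_finsum:
  assumes "g \<in> carrier G" "f \<in> X \<rightarrow> carrier T"
  shows "pact T g (\<Oplus>i\<in>X. f i) = (\<Oplus>i\<in>X. pact T g (f i))"
  using ring_hom_cring.hom_finsum[OF act_hom[OF assms(1)] assms(2)] by (simp add: comp_def)

end

text \<open>This is \<open>global_extension\<close> with domains, idempotents and invariants
  evaluated and the coordinates in the form \<open>coord\<close>; see
  \<open>galois_iff_global_extension\<close>.\<close>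

locale galois = gact G k T + A: algebra k A
  for G :: "'g monoid" and k :: "'k ring" and A :: "('k, 'a) module"
    and T :: "('k, 't, 'g, 'a) extension" (structure) +
  assumes emb_closed [simp, intro]: "a \<in> carrier A ==> emb T a \<in> carrier T"
    and emb_add: "[|a \<in> carrier A; b \<in> carrier A|] ==> emb T (a \<oplus>\<^sub>A b) = emb T a \<oplus> emb T b"
    and emb_mult: "[|a \<in> carrier A; b \<in> carrier A|] ==> emb T (a \<otimes>\<^sub>A b) = emb T a \<otimes> emb T b"
    and emb_one [simp]: "emb T \<one>\<^sub>A = \<one>"
    and emb_smult: "[|c \<in> carrier k; a \<in> carrier A|] ==> emb T (c \<odot>\<^sub>A a) = c \<odot>\<^sub>T emb T a"
    and emb_inj: "inj_on (emb T) (carrier A)"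
    and emb_inv [simp]: "[|g \<in> carrier G; a \<in> carrier A|] ==> pact T g (emb T a) = emb T a"
    and emb_surj: "[|x \<in> carrier T; !!g. g \<in> carrier G ==> pact T g x = x|] ==> x \<in> emb T ` carrier A"
    and delta: "coord G T (pact T) (\<lambda>g. if g = \<one>\<^sub>G then \<one> else \<zero>)"
begin

lemma emb_hom: "ring_hom_cring A T (emb T)"
  by (rule ring_hom_cringI[OF ring_hom_ringI2])
     (auto intro!: ring_hom_memI A.M_cring T.M_cring simp: emb_add emb_mult cring.axioms A.M_cring T.M_cring)

lemma emb_zero [simp]: "emb T \<zero>\<^sub>A = \<zero>"
  by (rule ring_hom_cring.hom_zero[OF emb_hom])

lemma smult_eq: "c \<in> carrier k ==> x \<in> carrier T ==> c \<odot>\<^sub>T x = emb T (c \<odot>\<^sub>A \<one>\<^sub>A) \<otimes> x"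
  by (simp add: emb_smult T.smult_assoc2)

lemma act_smult: "[|g \<in> carrier G; c \<in> carrier k; x \<in> carrier T|] ==> pact T g (c \<odot>\<^sub>T x) = c \<odot>\<^sub>T pact T g x"
  by (simp add: smult_eq act_mult)

lemma emb_eq_iff: "a \<in> carrier A ==> b \<in> carrier A ==> emb T a = emb T b \<longleftrightarrow> a = b"
  using emb_inj by (auto dest: inj_onD)

lemma coord_T_closed: "coord G T (pact T) f ==> g \<in> carrier G ==> f g \<in> carrier T"
  by (rule T.coord_closed[where act = "pact T" and H = G]) auto

definition tr :: "'t \<Rightarrow> 't" where "tr x = (\<Oplus>g\<in>carrier G. pact T g x)"

lemma tr_closed [simp, intro]: "x \<in> carrier T ==> tr x \<in> carrier T"
  unfolding tr_def by (rule T.finsum_closed) auto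

lemma tr_add: "x \<in> carrier T ==> y \<in> carrier T ==> tr (x \<oplus> y) = tr x \<oplus> tr y"
proof -
  assume x: "x \<in> carrier T" and y: "y \<in> carrier T"
  have "tr (x \<oplus> y) = (\<Oplus>g\<in>carrier G. pact T g x \<oplus> pact T g y)"
    unfolding tr_def using x y by (intro T.finsum_cong') (auto simp: act_add)
  also have "\<dots> = tr x \<oplus> tr y"
    unfolding tr_def using x y by (intro T.finsum_addf) auto
  finally show ?thesis .
qed

lemma tr_inv [simp]:
  assumes h: "h \<in> carrier G" and x: "x \<in> carrier T"
  shows "pact T h (tr x) = tr x"
proof -
  have bij: "bij_betw ((\<otimes>\<^sub>G) h) (carrier G) (carrier G)"
    by (rule bij_betwI[where g = "(\<otimes>\<^sub>G) (inv\<^bsub>G\<^esub> h)"]) (use h in \<open>auto simp: G.m_assoc[symmetric]\<close>)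
  note inj = bij_betw_imp_inj_on[OF bij] and img = bij_betw_imp_surj_on[OF bij]
  have "pact T h (tr x) = (\<Oplus>g\<in>carrier G. pact T (h \<otimes>\<^sub>G g) x)"
    unfolding tr_def using h x by (subst act_finsum) (auto intro!: T.finsum_cong' simp: act_comp)
  also have "\<dots> = (\<Oplus>g\<in>(\<otimes>\<^sub>G) h ` carrier G. pact T g x)"
    using inj h x by (subst T.finsum_reindex) (auto simp: comp_def)
  finally show ?thesis by (simp add: img tr_def)
qed

lemma tr_in_emb: "x \<in> carrier T ==> tr x \<in> emb T ` carrier A"
  by (rule emb_surj) auto

lemma tr_lin:
  assumes a: "a \<in> carrier T" "!!g. g \<in> carrier G ==> pact T g a = a" and x: "x \<in> carrier T"
  shows "tr (a \<otimes> x) = a \<otimes> tr x"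
  unfolding tr_def using a x
  by (subst T.finsum_rdistr) (auto intro!: T.finsum_cong' simp: act_mult fin)

lemma tr_zero [simp]: "tr \<zero> = \<zero>"
  unfolding tr_def by (rule T.add.finprod_one_eqI) auto

lemma finsum_delta: "f \<in> carrier G \<rightarrow> carrier T ==>
  (\<Oplus>g\<in>carrier G. (if g = \<one>\<^sub>G then \<one> else \<zero>) \<otimes> f g) = f \<one>\<^sub>G"
proof -
  assume f: "f \<in> carrier G \<rightarrow> carrier T"
  have "(\<Oplus>g\<in>carrier G. (if g = \<one>\<^sub>G then \<one> else \<zero>) \<otimes> f g) = (\<Oplus>g\<in>carrier G. if \<one>\<^sub>G = g then f g else \<zero>)"
    using f by (intro T.finsum_cong') (auto simp: Pi_iff)
  also have "\<dots> = f \<one>\<^sub>G" using f by (intro T.finsum_singleton fin) auto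
  finally show ?thesis .
qed

text \<open>If f(g) is the sum of the x_i g(y_i), then the sum of the f(g) g(b) equals the sum of
  the tr(y_i b) x_i. The list of the x_i does not depend on b.\<close>

lemma coord_span:
  assumes "coord G T (pact T) f"
  shows "\<exists>xs. set xs \<subseteq> carrier T \<and>
    (\<forall>b\<in>carrier T. (\<Oplus>g\<in>carrier G. f g \<otimes> pact T g b) \<in> lspan T (tr ` carrier T) xs)"
  using assms
proof induction
  case (single x y f)
  have "(\<Oplus>g\<in>carrier G. f g \<otimes> pact T g b) = tr (y \<otimes> b) \<otimes> x \<oplus> \<zero>" if b: "b \<in> carrier T" for b
  proof -
    have "(\<Oplus>g\<in>carrier G. f g \<otimes> pact T g b) = (\<Oplus>g\<in>carrier G. x \<otimes> pact T g (y \<otimes> b))"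
      using single b by (intro T.finsum_cong') (auto simp: act_mult T.m_assoc)
    also have "\<dots> = x \<otimes> tr (y \<otimes> b)" unfolding tr_def using single b
      by (intro T.finsum_rdistr[symmetric] fin) auto
    finally show ?thesis using single b by (simp add: T.m_comm)
  qed
  moreover have "tr (y \<otimes> b) \<otimes> x \<oplus> \<zero> \<in> lspan T (tr ` carrier T) [x]" if "b \<in> carrier T" for b
    by (rule T.lspan_ConsI) (use single that in auto)
  ultimately show ?case using single by (intro exI[of _ "[x]"]) (simp del: lspan.simps)
next
  case (add p q f)
  obtain xs where xs: "set xs \<subseteq> carrier T"
    "!!b. b\<in>carrier T ==> (\<Oplus>g\<in>carrier G. p g \<otimes> pact T g b) \<in> lspan T (tr ` carrier T) xs" using add.IH(1) by blast
  obtain ys where ys: "set ys \<subseteq> carrier T"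
    "!!b. b\<in>carrier T ==> (\<Oplus>g\<in>carrier G. q g \<otimes> pact T g b) \<in> lspan T (tr ` carrier T) ys" using add.IH(2) by blast
  note c = coord_T_closed[OF add.hyps(1)] coord_T_closed[OF add.hyps(2)]
  have "(\<Oplus>g\<in>carrier G. f g \<otimes> pact T g b) =
    (\<Oplus>g\<in>carrier G. p g \<otimes> pact T g b) \<oplus> (\<Oplus>g\<in>carrier G. q g \<otimes> pact T g b)" if b: "b \<in> carrier T" for b
    using c b add.hyps(3) by (intro T.finsum_mult_add) auto
  then show ?case using T.lspan_append[OF _ xs(1) ys(1) xs(2) ys(2)] xs ys
    by (intro exI[of _ "xs @ ys"]) auto
qed

text \<open>For the indicator function of 1 the sum in \<open>coord_span\<close> is b itself, so T
  is spanned by the x_i with traces as coefficients; in particular T = tr(T) T.\<close>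

lemma lspan_tr: "\<exists>xs. set xs \<subseteq> carrier T \<and> carrier T \<subseteq> lspan T (tr ` carrier T) xs"
proof -
  obtain xs where xs: "set xs \<subseteq> carrier T"
    "!!b. b\<in>carrier T ==> (\<Oplus>g\<in>carrier G. (if g = \<one>\<^sub>G then \<one> else \<zero>) \<otimes> pact T g b) \<in> lspan T (tr ` carrier T) xs"
    using coord_span[OF delta] by blast
  have "b \<in> lspan T (tr ` carrier T) xs" if "b \<in> carrier T" for b
    using xs(2)[OF that] finsum_delta[of "\<lambda>g. pact T g b"] that by auto
  with xs show ?thesis by blast
qed

text \<open>The traces form an ideal of the ring of invariants, by linearity of the trace over
  invariants, and \<open>lspan_tr\<close> is the hypothesis of \<open>nakayama\<close> for this
  ideal.\<close>

lemma trace_one: "\<exists>c\<in>carrier T. tr c = \<one>"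
proof -
  obtain xs where xs: "set xs \<subseteq> carrier T" "carrier T \<subseteq> lspan T (tr ` carrier T) xs" using lspan_tr by blast
  let ?I = "{x \<in> carrier T. \<forall>g\<in>carrier G. pact T g x = x}"
  have "\<one> \<in> tr ` carrier T"
  proof (rule T.nakayama[where I = ?I, OF _ _ _ _ _ _ _ _ _ xs])
    show "a \<oplus> b \<in> tr ` carrier T" if "a \<in> tr ` carrier T" "b \<in> tr ` carrier T" for a b
      using that by (auto simp: tr_add[symmetric])
    show "a \<otimes> b \<in> tr ` carrier T" if ab: "a \<in> tr ` carrier T" "b \<in> ?I" for a b
    proof -
      obtain x where x: "x \<in> carrier T" "a = tr x" using ab by auto
      have "a \<otimes> b = tr (b \<otimes> x)" using ab x by (subst tr_lin) (auto simp: T.m_comm)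
      then show ?thesis using x ab by auto
    qed
    show "\<zero> \<in> tr ` carrier T" by (metis T.zero_closed imageI tr_zero)
  qed (auto simp: act_add act_mult)
  then show ?thesis by auto
qed

text \<open>Finite generation over \<open>A\<close>. It bounds the cardinality of T and thereby
  allows copies inside the universe type (\<open>galois_copy\<close>).\<close>

lemma lspan_emb: "\<exists>xs. set xs \<subseteq> carrier T \<and> carrier T = lspan T (emb T ` carrier A) xs"
proof -
  obtain xs where xs: "set xs \<subseteq> carrier T" "carrier T \<subseteq> lspan T (tr ` carrier T) xs" using lspan_tr by blast
  have "carrier T \<subseteq> lspan T (emb T ` carrier A) xs"
    using xs(2) T.lspan_mono[of "tr ` carrier T" "emb T ` carrier A" xs] tr_in_emb by auto
  then show ?thesis using T.lspan_closed[of "emb T ` carrier A" xs] xs by auto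
qed

end

section \<open>Equivariant homomorphisms\<close>

text \<open>Linearity over \<open>k\<close> is automatic, since scalars act through
  \<open>emb\<close> (see \<open>F_smult\<close>).\<close>

definition ghom ::
  "'g monoid \<Rightarrow> ('k, 'a) module \<Rightarrow> ('k, 't, 'g, 'a) extension \<Rightarrow> ('k, 's, 'g, 'a) extension \<Rightarrow> ('t \<Rightarrow> 's) \<Rightarrow> bool"
  where "ghom G A T T' f \<longleftrightarrow> f \<in> ring_hom T T' \<and>
    (\<forall>g\<in>carrier G. \<forall>x\<in>carrier T. f (pact T g x) = pact T' g (f x)) \<and>
    (\<forall>a\<in>carrier A. f (emb T a) = emb T' a)"

lemma ghom_hom:
  assumes "galois G k A T" "galois G k A T'" "ghom G A T T' f"
  shows "ring_hom_cring T T' f"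
proof -
  interpret T: galois G k A T by fact
  interpret T': galois G k A T' by fact
  show ?thesis using assms(3) unfolding ghom_def
    by (intro ring_hom_cringI ring_hom_ringI2 T.T.ring_axioms T'.T.ring_axioms T.T.M_cring T'.T.M_cring) auto
qed

text \<open>Coordinates reconstruct an element from traces: b is the sum of the tr(y_i b) x_i. The
  traces lie in the copy of \<open>A\<close>, on which f is the identity, so the coordinates of the
  source control the kernel as well as the image of f.\<close>

lemma ghom_bij:
  assumes "galois G k A T" "galois G k A T'" and f: "ghom G A T T' f"
  shows "bij_betw f (carrier T) (carrier T')"
proof -
  interpret T: galois G k A T by fact
  interpret T': galois G k A T' by fact
  interpret f: ring_hom_cring T T' f by (rule ghom_hom) fact+
  have fact: "f (pact T g x) = pact T' g (f x)" if "g \<in> carrier G" "x \<in> carrier T" for g x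
    using f that by (auto simp: ghom_def)
  have femb: "f (emb T a) = emb T' a" if "a \<in> carrier A" for a using f that by (auto simp: ghom_def)
  \<comment> \<open>If f(x) = 0, then f(tr(vx)) = tr(f(vx)) = 0; as tr(vx) comes from
    \<open>A\<close>, it vanishes itself. Hence x, a combination of such traces, is 0.\<close>
  have inj: "x = \<zero>\<^sub>T" if x: "x \<in> carrier T" "f x = \<zero>\<^sub>T'" for x
  proof -
    have "(\<Oplus>\<^sub>T g\<in>carrier G. F g \<otimes>\<^sub>T pact T g x) = \<zero>\<^sub>T" if "coord G T (pact T) F" for F
      using that
    proof induction
      case (single u v F)
      have "tr_zero": "T.tr (v \<otimes>\<^sub>T x) = \<zero>\<^sub>T"
      proof -
        obtain a where a: "a \<in> carrier A" "T.tr (v \<otimes>\<^sub>T x) = emb T a" using T.tr_in_emb[of "v \<otimes>\<^sub>T x"] single x by auto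
        have "f (T.tr (v \<otimes>\<^sub>T x)) = (\<Oplus>\<^sub>T' g\<in>carrier G. f (pact T g (v \<otimes>\<^sub>T x)))"
          unfolding T.tr_def using single x by (subst f.hom_finsum) (auto simp: comp_def)
        also have "\<dots> = \<zero>\<^sub>T'" using single x by (intro T'.T.add.finprod_one_eqI) (simp add: fact)
        finally have "emb T' a = emb T' \<zero>\<^sub>A" using a by (simp add: femb)
        then show ?thesis using a T'.emb_eq_iff[of a "\<zero>\<^sub>A"] by simp
      qed
      have "(\<Oplus>\<^sub>T g\<in>carrier G. F g \<otimes>\<^sub>T pact T g x) = (\<Oplus>\<^sub>T g\<in>carrier G. u \<otimes>\<^sub>T pact T g (v \<otimes>\<^sub>T x))"
        using single x by (intro T.T.finsum_cong') (auto simp: T.act_mult T.T.m_assoc)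
      also have "\<dots> = u \<otimes>\<^sub>T T.tr (v \<otimes>\<^sub>T x)" unfolding T.tr_def using single x
        by (intro T.T.finsum_rdistr[symmetric] T.fin) auto
      finally show ?case using single tr_zero by simp
    next
      case (add p q F)
      note c = T.coord_T_closed[OF add.hyps(1)] T.coord_T_closed[OF add.hyps(2)]
      have "(\<Oplus>\<^sub>T g\<in>carrier G. F g \<otimes>\<^sub>T pact T g x) = (\<Oplus>\<^sub>T g\<in>carrier G. p g \<otimes>\<^sub>T pact T g x) \<oplus>\<^sub>T (\<Oplus>\<^sub>T g\<in>carrier G. q g \<otimes>\<^sub>T pact T g x)"
        using c x add.hyps(3) by (intro T.T.finsum_mult_add) auto
      then show ?case using add by simp
    qed
    from this[OF T.delta] show ?thesis using T.finsum_delta[of "\<lambda>g. pact T g x"] x by auto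
  qed
  \<comment> \<open>The images f(x_i), f(y_i) are coordinates of the target, and y is the sum of the
    f(x_i) tr(f(y_i) y), where the traces come from \<open>A\<close>.\<close>
  have surj: "y \<in> f ` carrier T" if y: "y \<in> carrier T'" for y
  proof -
    have "(\<Oplus>\<^sub>T' g\<in>carrier G. f (F g) \<otimes>\<^sub>T' pact T' g y) \<in> f ` carrier T" if "coord G T (pact T) F" for F
      using that
    proof induction
      case (single u v F)
      have "(\<Oplus>\<^sub>T' g\<in>carrier G. f (F g) \<otimes>\<^sub>T' pact T' g y) = (\<Oplus>\<^sub>T' g\<in>carrier G. f u \<otimes>\<^sub>T' pact T' g (f v \<otimes>\<^sub>T' y))"
        using single y by (intro T'.T.finsum_cong') (auto simp: T'.act_mult T'.T.m_assoc fact)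
      also have "\<dots> = f u \<otimes>\<^sub>T' T'.tr (f v \<otimes>\<^sub>T' y)" unfolding T'.tr_def using single y
        by (intro T'.T.finsum_rdistr[symmetric] T'.fin) auto
      moreover obtain a where "a \<in> carrier A" "T'.tr (f v \<otimes>\<^sub>T' y) = emb T' a"
        using T'.tr_in_emb[of "f v \<otimes>\<^sub>T' y"] single y by auto
      ultimately have "(\<Oplus>\<^sub>T' g\<in>carrier G. f (F g) \<otimes>\<^sub>T' pact T' g y) = f (u \<otimes>\<^sub>T emb T a)" "a \<in> carrier A"
        using single by (auto simp: femb)
      moreover have "u \<otimes>\<^sub>T emb T a \<in> carrier T" using single \<open>a \<in> carrier A\<close> by auto
      ultimately show ?case by (simp only: imageI)
    next
      case (add p q F)
      note c = T.coord_T_closed[OF add.hyps(1)] T.coord_T_closed[OF add.hyps(2)]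
      have "(\<Oplus>\<^sub>T' g\<in>carrier G. f (F g) \<otimes>\<^sub>T' pact T' g y) = (\<Oplus>\<^sub>T' g\<in>carrier G. f (p g) \<otimes>\<^sub>T' pact T' g y) \<oplus>\<^sub>T' (\<Oplus>\<^sub>T' g\<in>carrier G. f (q g) \<otimes>\<^sub>T' pact T' g y)"
        using c y add.hyps(3) by (intro T'.T.finsum_mult_add) auto
      moreover obtain a b where "a \<in> carrier T" "b \<in> carrier T"
         "(\<Oplus>\<^sub>T' g\<in>carrier G. f (p g) \<otimes>\<^sub>T' pact T' g y) = f a" "(\<Oplus>\<^sub>T' g\<in>carrier G. f (q g) \<otimes>\<^sub>T' pact T' g y) = f b"
        using add.IH by (auto simp: image_iff)
      ultimately have "(\<Oplus>\<^sub>T' g\<in>carrier G. f (F g) \<otimes>\<^sub>T' pact T' g y) = f (a \<oplus>\<^sub>T b)" "a \<oplus>\<^sub>T b \<in> carrier T" by auto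
      then show ?case by blast
    qed
    from this[OF T.delta] have "(\<Oplus>\<^sub>T' g\<in>carrier G. f (if g = \<one>\<^sub>G then \<one>\<^sub>T else \<zero>\<^sub>T) \<otimes>\<^sub>T' pact T' g y) \<in> f ` carrier T" .
    also have "(\<Oplus>\<^sub>T' g\<in>carrier G. f (if g = \<one>\<^sub>G then \<one>\<^sub>T else \<zero>\<^sub>T) \<otimes>\<^sub>T' pact T' g y) = y"
      using T'.finsum_delta[of "\<lambda>g. pact T' g y"] y by (simp add: if_distrib[of f] cong: if_cong)
    finally show ?thesis .
  qed
  have "inj_on f (carrier T)"
  proof (rule inj_onI)
    fix x y assume xy: "x \<in> carrier T" "y \<in> carrier T" "f x = f y"
    have "f (x \<ominus>\<^sub>T y) = f x \<ominus>\<^sub>T' f y" using xy(1,2) by (simp add: T.T.minus_eq T'.T.minus_eq)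
    then have "f (x \<ominus>\<^sub>T y) = \<zero>\<^sub>T'" using xy(2,3) by (simp add: T'.T.minus_eq T'.T.r_neg)
    then have "x \<ominus>\<^sub>T y = \<zero>\<^sub>T" using inj[OF T.T.minus_closed[OF xy(1,2)]] by blast
    then show "x = y" by (rule T.T.minus_zeroD[OF xy(1,2)])
  qed
  then show ?thesis using surj by (auto simp: bij_betw_def)
qed

lemma ghom_inv:
  assumes "galois G k A T" "galois G k A T'" and f: "ghom G A T T' f"
  shows "ghom G A T' T (inv_into (carrier T) f)"
proof -
  interpret T: galois G k A T by fact
  interpret T': galois G k A T' by fact
  interpret f: ring_hom_cring T T' f by (rule ghom_hom) fact+
  have bij: "bij_betw f (carrier T) (carrier T')" by (rule ghom_bij) fact+
  let ?h = "inv_into (carrier T) f"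
  have h: "?h y \<in> carrier T" "f (?h y) = y" if "y \<in> carrier T'" for y
    using bij that by (auto simp: bij_betw_def inv_into_into f_inv_into_f)
  have eqI: "x = ?h y" if "x \<in> carrier T" "f x = y" for x y
    using bij that by (auto simp: bij_betw_def)
  show ?thesis unfolding ghom_def
    by (intro conjI ballI ring_hom_memI eqI[symmetric])
      (use f h in \<open>auto simp: ghom_def\<close>)
qed

lemma ghom_comp:
  assumes "galois G k A T" "galois G k A T'" "galois G k A T''"
    and f: "ghom G A T T' f" and h: "ghom G A T' T'' h"
  shows "ghom G A T T'' (h \<circ> f)"
proof -
  interpret f: ring_hom_cring T T' f by (rule ghom_hom) fact+
  show ?thesis using f h unfolding ghom_def by (auto intro!: ring_hom_trans)
qed

section \<open>Tensor products\<close>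

lemma frag_extend_fun_diff:
  "frag_extend (\<lambda>x. f x - g x) c = frag_extend f c - frag_extend g c"
  using subset_UNIV by (induction c rule: frag_induction) (auto simp: frag_extend_diff)

lemma (in abelian_group) add_minus_cancel2:
  assumes "p \<in> carrier G" "q \<in> carrier G"
  shows "p \<oplus> q \<ominus> p \<ominus> q = \<zero>"
proof -
  have "p \<oplus> q \<ominus> p \<ominus> q = (p \<oplus> q) \<oplus> (\<ominus> p \<oplus> \<ominus> q)"
    using assms by (simp add: minus_eq a_assoc)
  also have "\<dots> = (p \<oplus> q) \<oplus> \<ominus> (p \<oplus> q)" using assms by (simp add: minus_add)
  finally show ?thesis using assms by (simp add: r_neg)
qed

text \<open>Of the structure maps only closedness is assumed, so that Galois extensions and partial
  extensions are both covered. \<open>G\<close> occurs because the record \<open>tensor\<close> also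
  contains the action.\<close>

locale tensor_setup = S: algebra k S + S': algebra k S'
  for k :: "'k ring" and R :: "('k, 'r) module"
    and S :: "('k, 's, 'g, 'r) extension" and S' :: "('k, 't, 'g, 'r) extension" +
  fixes G :: "'g monoid"
  assumes embS [simp, intro]: "r \<in> carrier R ==> emb S r \<in> carrier S"
    and embS' [simp, intro]: "r \<in> carrier R ==> emb S' r \<in> carrier S'"
begin

abbreviation "F \<equiv> carrier S \<times> carrier S'"
abbreviation "null \<equiv> tensor_null R S S'"
abbreviation "el \<equiv> tensor_elem R S S'"
abbreviation "P \<equiv> tensor G R S S'"
abbreviation "pure s t \<equiv> tensor_elem R S S' (frag_of (s, t))"

lemma keys_diff_F: "Poly_Mapping.keys a \<subseteq> X ==> Poly_Mapping.keys b \<subseteq> X ==> Poly_Mapping.keys (a - b) \<subseteq> X"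
  using keys_diff[of a b] by blast

lemma keys_add_F: "Poly_Mapping.keys a \<subseteq> X ==> Poly_Mapping.keys b \<subseteq> X ==> Poly_Mapping.keys (a + b) \<subseteq> X"
  using Poly_Mapping.keys_add[of a b] by blast

lemma rel_keys: "h \<in> tensor_relations R S S' ==> Poly_Mapping.keys h \<subseteq> F"
  unfolding tensor_relations_def by (auto dest!: subsetD[OF keys_diff] split: if_splits)

lemma null_zero: "0 \<in> null"
  using generate.one[of "free_Abelian_group F" "tensor_relations R S S'"]
  by (simp add: tensor_null_def)

lemma null_add: "a \<in> null ==> b \<in> null ==> a + b \<in> null"
  using generate.eng[of a "free_Abelian_group F" "tensor_relations R S S'" b]
  by (simp add: tensor_null_def)

lemma null_uminus: "a \<in> null ==> - a \<in> null"
  unfolding tensor_null_def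
proof (induction rule: generate.induct)
  case (incl h)
  then show ?case using generate.inv[OF incl, of "free_Abelian_group F"] rel_keys[OF incl] by simp
next
  case (inv h)
  then show ?case using generate.incl[OF inv, of "free_Abelian_group F"] rel_keys[OF inv] by simp
next
  case (eng a b)
  then show ?case using generate.eng[of "-a" "free_Abelian_group F" "tensor_relations R S S'" "-b"] by simp
qed (use generate.one[of "free_Abelian_group F" "tensor_relations R S S'"] in simp)

lemma null_diff: "a \<in> null ==> b \<in> null ==> a - b \<in> null"
  using null_add[of a "- b"] null_uminus[of b] by simp

text \<open>Differences replace the sums and inverses of \<open>generate\<close>, so that the cases
  fit \<open>frag_extend_diff\<close> and \<open>frag_induction\<close>.\<close>

lemma null_induct [consumes 1, case_names zero left right balance diff]:
  assumes n: "n \<in> null" and "Q 0"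
    and "!!x y z. x \<in> carrier S ==> y \<in> carrier S ==> z \<in> carrier S' ==>
      Q (frag_of (x \<oplus>\<^sub>S y, z) - frag_of (x, z) - frag_of (y, z))"
    and "!!x y z. x \<in> carrier S ==> y \<in> carrier S' ==> z \<in> carrier S' ==>
      Q (frag_of (x, y \<oplus>\<^sub>S' z) - frag_of (x, y) - frag_of (x, z))"
    and "!!r x y. r \<in> carrier R ==> x \<in> carrier S ==> y \<in> carrier S' ==>
      Q (frag_of (emb S r \<otimes>\<^sub>S x, y) - frag_of (x, emb S' r \<otimes>\<^sub>S' y))"
    and diff: "!!a b. a \<in> null ==> b \<in> null ==> Q a ==> Q b ==> Q (a - b)"
  shows "Q n"
proof -
  have rel: "Q h" if "h \<in> tensor_relations R S S'" for h
    using that assms unfolding tensor_relations_def by auto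
  have relnull: "h \<in> null" if "h \<in> tensor_relations R S S'" for h
    using that by (simp add: tensor_null_def generate.incl)
  have "Q n \<and> n \<in> null" using n[unfolded tensor_null_def]
  proof (induction rule: generate.induct)
    case one
    then show ?case using assms(2) null_zero by simp
  next
    case (incl h)
    then show ?case using rel relnull by simp
  next
    case (inv h)
    then show ?case using diff[OF null_zero relnull[OF inv] assms(2) rel[OF inv]] rel_keys[OF inv]
      null_uminus[OF relnull[OF inv]] by simp
  next
    case (eng a b)
    have "Q (0 - b)" using eng diff null_zero assms(2) by blast
    moreover have "0 - b \<in> null" using eng null_diff null_zero by blast
    ultimately show ?case using eng diff[of a "0 - b"] null_add by simp
  qed
  then show ?thesis ..
qed

lemma null_keys: "n \<in> null ==> Poly_Mapping.keys n \<subseteq> F"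
proof (induction rule: null_induct)
  case (diff a b)
  then show ?case by (intro keys_diff_F)
qed (simp_all add: keys_diff_F)

lemma el_def: "el c = (\<lambda>n. n + c) ` null"
  by (auto simp: tensor_elem_def r_coset_def)

lemma in_el_iff: "c' \<in> el c \<longleftrightarrow> c' - c \<in> null"
  by (force simp: el_def image_iff)

lemma in_el_self: "c \<in> el c"
  by (simp add: in_el_iff null_zero)

lemma el_eq_iff: "el c = el d \<longleftrightarrow> c - d \<in> null"
proof
  assume "el c = el d"
  then show "c - d \<in> null" using in_el_self[of c] by (simp add: in_el_iff)
next
  assume cd: "c - d \<in> null"
  have "x - c \<in> null \<longleftrightarrow> x - d \<in> null" for x
    using null_add[OF _ cd, of "x - c"] null_diff[OF _ cd, of "x - d"] by (auto simp: algebra_simps)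
  then show "el c = el d" by (auto simp: in_el_iff)
qed

lemma keys_el: "Poly_Mapping.keys c \<subseteq> F ==> c' \<in> el c ==> Poly_Mapping.keys c' \<subseteq> F"
  using keys_add_F[of "c' - c" F c] null_keys[of "c' - c"] by (simp add: in_el_iff)

lemma carrier_P: "carrier P = el ` {c. Poly_Mapping.keys c \<subseteq> F}"
  by (auto simp: tensor_def carrier_FactGroup tensor_elem_def)

lemma P_cases: assumes "X \<in> carrier P" obtains c where "X = el c" "Poly_Mapping.keys c \<subseteq> F"
  using assms by (auto simp: carrier_P)

lemma el_closed [intro]: "Poly_Mapping.keys c \<subseteq> F ==> el c \<in> carrier P"
  by (auto simp: carrier_P)

lemma zero_P: "\<zero>\<^sub>P = el 0"
  by (auto simp: tensor_def el_def)

lemma add_P: "el c \<oplus>\<^sub>P el d = el (c + d)"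
proof -
  have "el c \<oplus>\<^sub>P el d = (\<Union>x\<in>el c. \<Union>y\<in>el d. {x + y})" by (simp add: tensor_def set_mult_def)
  also have "\<dots> = el (c + d)"
  proof (intro equalityI subsetI)
    fix z assume "z \<in> (\<Union>x\<in>el c. \<Union>y\<in>el d. {x + y})"
    then obtain x y where "x - c \<in> null" "y - d \<in> null" "z = x + y" by (auto simp: in_el_iff)
    then show "z \<in> el (c + d)" using null_add[of "x - c" "y - d"] by (simp add: in_el_iff algebra_simps)
  next
    fix z assume "z \<in> el (c + d)"
    then have "z - d \<in> el c" by (simp add: in_el_iff algebra_simps)
    moreover have "z = (z - d) + d" by simp
    ultimately show "z \<in> (\<Union>x\<in>el c. \<Union>y\<in>el d. {x + y})" using in_el_self[of d] by blast
  qed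
  finally show ?thesis .
qed

text \<open>The well-definedness test for maps on classes: an additive extension only has to respect
  the three kinds of relations.\<close>

lemma null_extend:
  assumes "n \<in> null"
    and N0: "0 \<in> N" and Nd: "!!a b. a \<in> N ==> b \<in> N ==> a - b \<in> N"
    and "!!x y z. x \<in> carrier S ==> y \<in> carrier S ==> z \<in> carrier S' ==>
      f (x \<oplus>\<^sub>S y, z) - f (x, z) - f (y, z) \<in> N"
    and "!!x y z. x \<in> carrier S ==> y \<in> carrier S' ==> z \<in> carrier S' ==>
      f (x, y \<oplus>\<^sub>S' z) - f (x, y) - f (x, z) \<in> N"
    and "!!r x y. r \<in> carrier R ==> x \<in> carrier S ==> y \<in> carrier S' ==>
      f (emb S r \<otimes>\<^sub>S x, y) - f (x, emb S' r \<otimes>\<^sub>S' y) \<in> N"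
  shows "frag_extend f n \<in> N"
  using assms(1) by (induction rule: null_induct) (auto simp: frag_extend_diff N0 Nd assms(4-))

lemma rel_left: "[|x \<in> carrier S; y \<in> carrier S; z \<in> carrier S'|] ==>
    frag_of (x \<oplus>\<^sub>S y, z) - frag_of (x, z) - frag_of (y, z) \<in> null"
  and rel_right: "[|x \<in> carrier S; v \<in> carrier S'; z \<in> carrier S'|] ==>
    frag_of (x, v \<oplus>\<^sub>S' z) - frag_of (x, v) - frag_of (x, z) \<in> null"
  and rel_balance: "[|r \<in> carrier R; x \<in> carrier S; z \<in> carrier S'|] ==>
    frag_of (emb S r \<otimes>\<^sub>S x, z) - frag_of (x, emb S' r \<otimes>\<^sub>S' z) \<in> null"
  unfolding tensor_null_def by (rule generate.incl, force simp: tensor_relations_def)+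

text \<open>The multiplication of \<open>tensor\<close> on the level of formal sums, before passing
  to classes.\<close>

definition mu where
  "mu c d = frag_extend (\<lambda>(s, t). frag_extend (\<lambda>(s', t'). frag_of (s \<otimes>\<^sub>S s', t \<otimes>\<^sub>S' t')) d) c"

lemma mu_diff_left: "mu (a - b) d = mu a d - mu b d"
  by (simp add: mu_def frag_extend_diff)

lemma mu_diff_right: "mu c (a - b) = mu c a - mu c b"
  unfolding mu_def frag_extend_fun_diff[symmetric]
  by (rule arg_cong[where f = "\<lambda>f. frag_extend f c"]) (auto simp: frag_extend_diff)

lemma mu_zero [simp]: "mu 0 d = 0" "mu c 0 = 0"
  using mu_diff_left[of 0 0 d] mu_diff_right[of c 0 0] by auto

lemma mu_add_left: "mu (a + b) d = mu a d + mu b d"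
  using mu_diff_left[of a "0 - b" d] mu_diff_left[of 0 b d] by simp

lemma mu_of: "mu (frag_of (s, t)) (frag_of (s', t')) = frag_of (s \<otimes>\<^sub>S s', t \<otimes>\<^sub>S' t')"
  by (simp add: mu_def)

lemma mu_comm: "Poly_Mapping.keys c \<subseteq> F ==> Poly_Mapping.keys d \<subseteq> F ==> mu c d = mu d c"
proof (induction c rule: frag_induction)
  case (one x)
  from one(2,1) show ?case
  proof (induction d rule: frag_induction)
    case (one y)
    then show ?case by (cases x; cases y) (auto simp: mu_of S.m_comm S'.m_comm)
  qed (auto simp: mu_diff_left mu_diff_right)
qed (auto simp: mu_diff_left mu_diff_right)

lemma keys_mu: "Poly_Mapping.keys c \<subseteq> F ==> Poly_Mapping.keys d \<subseteq> F ==> Poly_Mapping.keys (mu c d) \<subseteq> F"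
proof (induction c rule: frag_induction)
  case (one x)
  from one(2,1) show ?case
  proof (induction d rule: frag_induction)
    case (one y)
    then show ?case by (cases x; cases y) (auto simp: mu_of)
  qed (auto simp: mu_diff_left mu_diff_right keys_diff_F)
qed (auto simp: mu_diff_left mu_diff_right keys_diff_F)

text \<open>The null group is an ideal for \<open>mu\<close>: a defining relation multiplied by a
  pair is a defining relation of the same kind.\<close>

lemma mu_null_left:
  assumes "n \<in> null" and d: "Poly_Mapping.keys d \<subseteq> F"
  shows "mu n d \<in> null"
  using assms(1)
proof (induction rule: null_induct)
  case (left x y z)
  from d show ?case
  proof (induction d rule: frag_induction)
    case (one u)
    then show ?case using left
      by (cases u) (auto simp: mu_diff_left mu_of S.l_distr intro!: rel_left)
  qed (auto simp: mu_diff_right null_zero null_diff)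
next
  case (right x y z)
  from d show ?case
  proof (induction d rule: frag_induction)
    case (one u)
    then show ?case using right
      by (cases u) (auto simp: mu_diff_left mu_of S'.l_distr intro!: rel_right)
  qed (auto simp: mu_diff_right null_zero null_diff)
next
  case (balance r x y)
  from d show ?case
  proof (induction d rule: frag_induction)
    case (one u)
    then show ?case using balance
      by (cases u) (auto simp: mu_diff_left mu_of S.m_assoc S'.m_assoc intro!: rel_balance)
  qed (auto simp: mu_diff_right null_zero null_diff)
qed (auto simp: mu_diff_left null_zero null_diff)

text \<open>Collapses the unions over representatives in \<open>tensor\<close> once all their
  members agree.\<close>

lemma UN_el_const:
  "(!!c'. c' \<in> el c ==> Z c' = W) ==> (\<Union>c'\<in>el c. Z c') = W"
  using in_el_self[of c] by auto

lemma mult_P: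
  assumes "Poly_Mapping.keys c \<subseteq> F" "Poly_Mapping.keys d \<subseteq> F"
  shows "el c \<otimes>\<^sub>P el d = el (mu c d)"
proof -
  have "el c \<otimes>\<^sub>P el d = (\<Union>c'\<in>el c. \<Union>d'\<in>el d. el (mu c' d'))"
    by (simp add: tensor_def mu_def)
  also have "\<dots> = el (mu c d)"
  proof (intro UN_el_const)
    fix c' d' assume c': "c' \<in> el c" and d': "d' \<in> el d"
    have k: "Poly_Mapping.keys c' \<subseteq> F" "Poly_Mapping.keys d' \<subseteq> F" using keys_el assms c' d' by auto
    have 1: "mu (c' - c) d' \<in> null" using c' k by (intro mu_null_left) (auto simp: in_el_iff)
    have "mu (d' - d) c \<in> null" using d' assms by (intro mu_null_left) (auto simp: in_el_iff)
    moreover have "mu (d' - d) c = mu c (d' - d)" using k assms by (intro mu_comm keys_diff_F)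
    ultimately show "el (mu c' d') = el (mu c d)"
      using null_add[OF 1, of "mu c (d' - d)"] by (simp add: el_eq_iff mu_diff_left mu_diff_right)
  qed
  finally show ?thesis .
qed

lemma pure_closed [simp, intro]: "s \<in> carrier S ==> t \<in> carrier S' ==> pure s t \<in> carrier P"
  by (rule el_closed) auto

lemma one_P: "\<one>\<^sub>P = pure \<one>\<^sub>S \<one>\<^sub>S'"
  by (simp add: tensor_def)

lemma emb_P: "emb P r = pure (emb S r) \<one>\<^sub>S'"
  by (simp add: tensor_def)

lemma mult_pure: "[|s \<in> carrier S; t \<in> carrier S'; s' \<in> carrier S; t' \<in> carrier S'|] ==>
   pure s t \<otimes>\<^sub>P pure s' t' = pure (s \<otimes>\<^sub>S s') (t \<otimes>\<^sub>S' t')"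
  by (subst mult_P) (auto simp: mu_of)

lemma pure_add_left: "[|x \<in> carrier S; y \<in> carrier S; z \<in> carrier S'|] ==>
    pure (x \<oplus>\<^sub>S y) z = pure x z \<oplus>\<^sub>P pure y z"
  using rel_left[of x y z] by (simp add: add_P el_eq_iff algebra_simps)

lemma pure_add_right: "[|x \<in> carrier S; y \<in> carrier S'; z \<in> carrier S'|] ==>
    pure x (y \<oplus>\<^sub>S' z) = pure x y \<oplus>\<^sub>P pure x z"
  using rel_right[of x y z] by (simp add: add_P el_eq_iff algebra_simps)

lemma pure_balance: "[|r \<in> carrier R; x \<in> carrier S; z \<in> carrier S'|] ==>
    pure (emb S r \<otimes>\<^sub>S x) z = pure x (emb S' r \<otimes>\<^sub>S' z)"
  using rel_balance[of r x z] by (simp add: el_eq_iff)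

lemma pure_zero: "t \<in> carrier S' ==> pure \<zero>\<^sub>S t = \<zero>\<^sub>P"
  "s \<in> carrier S ==> pure s \<zero>\<^sub>S' = \<zero>\<^sub>P"
  using rel_left[of "\<zero>\<^sub>S" "\<zero>\<^sub>S" t] rel_right[of s "\<zero>\<^sub>S'" "\<zero>\<^sub>S'"]
  by (simp_all add: zero_P el_eq_iff) (use null_uminus in force)+

lemma P_abelian_group: "abelian_group P"
proof (rule abelian_groupI)
  show "\<exists>Y\<in>carrier P. Y \<oplus>\<^sub>P X = \<zero>\<^sub>P" if X: "X \<in> carrier P" for X
  proof -
    from X obtain c where "X = el c" "Poly_Mapping.keys c \<subseteq> F" by (rule P_cases)
    then show ?thesis by (intro bexI[of _ "el (- c)"] el_closed) (simp_all add: add_P zero_P)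
  qed
qed ((elim P_cases)?, simp add: add_P zero_P keys_add_F el_closed add.commute add.left_commute)+

lemma P_mult_closed: "X \<in> carrier P ==> Y \<in> carrier P ==> X \<otimes>\<^sub>P Y \<in> carrier P"
  by (elim P_cases) (simp add: mult_P keys_mu el_closed)

lemma P_l_distr: "X \<in> carrier P ==> Y \<in> carrier P ==> Z \<in> carrier P ==>
    (X \<oplus>\<^sub>P Y) \<otimes>\<^sub>P Z = X \<otimes>\<^sub>P Z \<oplus>\<^sub>P Y \<otimes>\<^sub>P Z"
  by (elim P_cases) (auto simp: mult_P add_P keys_add_F mu_add_left)

lemma P_m_comm: "X \<in> carrier P ==> Y \<in> carrier P ==> X \<otimes>\<^sub>P Y = Y \<otimes>\<^sub>P X"
  by (elim P_cases) (auto simp: mult_P mu_comm)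

text \<open>\<open>frag_induction\<close> builds formal sums by subtraction, whereas Q is only
  closed under addition. Therefore Q is carried along for \<open>el c\<close> and
  \<open>el (- c)\<close> at once; on generators the sign moves into the left factor.\<close>

lemma P_induct [consumes 1, case_names pure add]:
  assumes X: "X \<in> carrier P"
    and pure: "!!s t. s \<in> carrier S ==> t \<in> carrier S' ==> Q (pure s t)"
    and add: "!!X Y. X \<in> carrier P ==> Y \<in> carrier P ==> Q X ==> Q Y ==> Q (X \<oplus>\<^sub>P Y)"
  shows "Q X"
proof -
  from X obtain c where c: "X = el c" "Poly_Mapping.keys c \<subseteq> F" by (rule P_cases)
  have "Poly_Mapping.keys c \<subseteq> F \<and> Q (el c) \<and> Q (el (- c))" using c(2)
  proof (induction c rule: frag_induction)
    case zero
    have "Q (pure \<zero>\<^sub>S \<zero>\<^sub>S')" by (intro pure) auto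
    then show ?case by (simp add: pure_zero zero_P)
  next
    case (one x)
    obtain s t where x: "x = (s, t)" "s \<in> carrier S" "t \<in> carrier S'" using one by auto
    have "pure (\<ominus>\<^sub>S s) t \<oplus>\<^sub>P pure s t = \<zero>\<^sub>P"
      using x pure_add_left[of "\<ominus>\<^sub>S s" s t] by (simp add: S.l_neg pure_zero)
    then have "frag_of (\<ominus>\<^sub>S s, t) + frag_of (s, t) \<in> null"
      by (simp add: zero_P add_P el_eq_iff)
    from null_uminus[OF this] have "el (- frag_of x) = pure (\<ominus>\<^sub>S s) t"
      by (simp add: el_eq_iff x algebra_simps)
    then show ?case using x by (auto intro!: pure)
  next
    case (diff a b)
    have "Q (el (a + (- b)))" "Q (el ((- a) + b))" unfolding add_P[symmetric]
      using diff by (intro add; simp add: el_closed)+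
    then show ?case using diff by (simp add: keys_diff_F)
  qed
  then show ?thesis using c by simp
qed

lemma P_cring: "cring P"
proof -
  interpret abelian_group P by (rule P_abelian_group)
  have r_distr: "Z \<otimes>\<^sub>P (X \<oplus>\<^sub>P Y) = Z \<otimes>\<^sub>P X \<oplus>\<^sub>P Z \<otimes>\<^sub>P Y"
    if "X \<in> carrier P" "Y \<in> carrier P" "Z \<in> carrier P" for X Y Z
    using that P_l_distr[of X Y Z] by (simp add: P_m_comm[of Z])
  have assoc: "X \<otimes>\<^sub>P Y \<otimes>\<^sub>P Z = X \<otimes>\<^sub>P (Y \<otimes>\<^sub>P Z)"
    if "X \<in> carrier P" "Y \<in> carrier P" "Z \<in> carrier P" for X Y Z
    using that
  proof (induction X rule: P_induct)
    case (pure s t)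
    from pure(3,1,2,4) show ?case
    proof (induction Y rule: P_induct)
      case (pure s' t')
      from pure(5,1-4) show ?case
        by (induction Z rule: P_induct) (auto simp: mult_pure S.m_assoc S'.m_assoc r_distr P_mult_closed)
    qed (auto simp: r_distr P_l_distr P_mult_closed)
  qed (auto simp: P_l_distr P_mult_closed)
  have l_one: "\<one>\<^sub>P \<otimes>\<^sub>P X = X" if "X \<in> carrier P" for X
    using that by (induction X rule: P_induct) (auto simp: one_P mult_pure r_distr)
  show ?thesis
  proof (intro cringI P_abelian_group comm_monoidI)
    show "X \<otimes>\<^sub>P Y \<otimes>\<^sub>P Z = X \<otimes>\<^sub>P (Y \<otimes>\<^sub>P Z)"
      if "X \<in> carrier P" "Y \<in> carrier P" "Z \<in> carrier P" for X Y Z using that by (rule assoc)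
    show "X \<otimes>\<^sub>P Y = Y \<otimes>\<^sub>P X" if "X \<in> carrier P" "Y \<in> carrier P" for X Y
      using that by (rule P_m_comm)
  qed (simp_all add: P_mult_closed P_l_distr l_one, simp add: one_P)
qed

lemma smult_P:
  assumes a: "a \<in> carrier k" and c: "Poly_Mapping.keys c \<subseteq> F"
  shows "a \<odot>\<^sub>P el c = el (frag_extend (\<lambda>(s, t). frag_of (a \<odot>\<^sub>S s, t)) c)"
proof -
  let ?f = "\<lambda>(s, t). frag_of (a \<odot>\<^sub>S s, t)"
  have "a \<odot>\<^sub>P el c = (\<Union>c'\<in>el c. el (frag_extend ?f c'))"
    by (simp add: tensor_def)
  also have "\<dots> = el (frag_extend ?f c)"
  proof (intro UN_el_const)
    fix c' assume c': "c' \<in> el c"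
    have "frag_extend ?f (c' - c) \<in> null"
    proof (rule null_extend)
      show "?f (emb S r \<otimes>\<^sub>S x, y) - ?f (x, emb S' r \<otimes>\<^sub>S' y) \<in> null"
        if "r \<in> carrier R" "x \<in> carrier S" "y \<in> carrier S'" for r x y
        using that a rel_balance[of r "a \<odot>\<^sub>S x" y] S.smult_assoc2[of a x "emb S r"]
        by (simp add: S.m_comm)
    qed (use a c' in \<open>auto simp: in_el_iff null_zero null_diff S.smult_r_distr intro!: rel_left rel_right\<close>)
    then show "el (frag_extend ?f c') = el (frag_extend ?f c)"
      by (simp add: el_eq_iff frag_extend_diff)
  qed
  finally show ?thesis .
qed

lemma smult_pure: "[|a \<in> carrier k; s \<in> carrier S; t \<in> carrier S'|] ==> a \<odot>\<^sub>P pure s t = pure (a \<odot>\<^sub>S s) t"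
  by (subst smult_P) auto

lemma smult_P_closed: "a \<in> carrier k ==> X \<in> carrier P ==> a \<odot>\<^sub>P X \<in> carrier P"
  by (elim P_cases) (force simp: smult_P intro!: el_closed dest!: subsetD[OF keys_frag_extend])

lemma smult_P_add: "a \<in> carrier k ==> X \<in> carrier P ==> Y \<in> carrier P ==>
   a \<odot>\<^sub>P (X \<oplus>\<^sub>P Y) = a \<odot>\<^sub>P X \<oplus>\<^sub>P a \<odot>\<^sub>P Y"
  by (elim P_cases) (auto simp: smult_P add_P keys_add_F frag_extend_add)

lemma P_algebra: "algebra k P"
proof -
  interpret cring P by (rule P_cring)
  show ?thesis
  proof (rule algebraI)
    fix a b X assume ab: "a \<in> carrier k" "b \<in> carrier k" and X: "X \<in> carrier P"
    show "(a \<oplus>\<^sub>k b) \<odot>\<^sub>P X = a \<odot>\<^sub>P X \<oplus>\<^sub>P b \<odot>\<^sub>P X"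
      using X by (induction X rule: P_induct)
        (use ab in \<open>auto simp: smult_pure S.smult_l_distr pure_add_left smult_P_add smult_P_closed a_ac\<close>)
    show "(a \<otimes>\<^sub>k b) \<odot>\<^sub>P X = a \<odot>\<^sub>P (b \<odot>\<^sub>P X)"
      using X by (induction X rule: P_induct)
        (use ab in \<open>auto simp: smult_pure S.smult_assoc1 smult_P_add smult_P_closed\<close>)
  next
    fix X assume "X \<in> carrier P"
    then show "\<one>\<^sub>k \<odot>\<^sub>P X = X"
      by (induction X rule: P_induct) (auto simp: smult_pure smult_P_add)
  next
    fix a X Y assume a: "a \<in> carrier k" and X: "X \<in> carrier P" and Y: "Y \<in> carrier P"
    from X show "a \<odot>\<^sub>P X \<otimes>\<^sub>P Y = a \<odot>\<^sub>P (X \<otimes>\<^sub>P Y)"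
    proof (induction X rule: P_induct)
      case (pure s t)
      from Y show ?case
        by (induction Y rule: P_induct)
          (use a pure in \<open>auto simp: smult_pure mult_pure r_distr smult_P_add smult_P_closed S.smult_assoc2\<close>)
    qed (use a Y in \<open>auto simp: l_distr smult_P_add smult_P_closed\<close>)
  qed (auto simp: smult_P_closed smult_P_add S.R_cring P_cring)
qed

text \<open>The universal property of the tensor product for balanced biadditive maps. It is
  obtained from that of the free abelian group, whose homomorphism kills the three kinds of
  relations.\<close>

lemma lift_ex:
  fixes M :: "('m, 'z) ring_scheme"
  assumes "abelian_group M"
    and b: "!!s t. s \<in> carrier S ==> t \<in> carrier S' ==> b s t \<in> carrier M"
    and bl: "!!x y z. x \<in> carrier S ==> y \<in> carrier S ==> z \<in> carrier S' ==>
      b (x \<oplus>\<^sub>S y) z = b x z \<oplus>\<^sub>M b y z"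
    and br: "!!x y z. x \<in> carrier S ==> y \<in> carrier S' ==> z \<in> carrier S' ==>
      b x (y \<oplus>\<^sub>S' z) = b x y \<oplus>\<^sub>M b x z"
    and bb: "!!r x y. r \<in> carrier R ==> x \<in> carrier S ==> y \<in> carrier S' ==>
      b (emb S r \<otimes>\<^sub>S x) y = b x (emb S' r \<otimes>\<^sub>S' y)"
  obtains L where "!!X. X \<in> carrier P ==> L X \<in> carrier M"
    "!!X Y. X \<in> carrier P ==> Y \<in> carrier P ==> L (X \<oplus>\<^sub>P Y) = L X \<oplus>\<^sub>M L Y"
    "!!s t. s \<in> carrier S ==> t \<in> carrier S' ==> L (pure s t) = b s t"
proof -
  interpret M: abelian_group M by fact
  obtain h where h: "h \<in> hom (free_Abelian_group F) (add_monoid M)"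
    "!!x. x \<in> F ==> h (frag_of x) = case_prod b x"
    by (rule comm_group.free_Abelian_group_universal[OF M.a_comm_group, of "case_prod b" F])
      (use b in auto)
  have hc: "h c \<in> carrier M" if "Poly_Mapping.keys c \<subseteq> F" for c
    using h(1) that by (auto simp: hom_def Pi_iff)
  have hadd: "h (c + d) = h c \<oplus>\<^sub>M h d" if "Poly_Mapping.keys c \<subseteq> F" "Poly_Mapping.keys d \<subseteq> F" for c d
    using h(1) that by (auto simp: hom_def)
  have hdiff: "h (c - d) = h c \<ominus>\<^sub>M h d" if "Poly_Mapping.keys c \<subseteq> F" "Poly_Mapping.keys d \<subseteq> F" for c d
  proof -
    have "h c = h (c - d) \<oplus>\<^sub>M h d" using hadd[of "c - d" d] that by (simp add: keys_diff_F)
    moreover have "h (c - d) \<in> carrier M" "h d \<in> carrier M" using that by (simp_all add: hc keys_diff_F)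
    ultimately show ?thesis by (simp add: M.minus_eq M.a_assoc M.r_neg)
  qed
  have h0: "h 0 = \<zero>\<^sub>M" using hdiff[of 0 0] hc[of 0] by (simp add: M.minus_eq M.r_neg)
  have hnull: "h n = \<zero>\<^sub>M" if "n \<in> null" for n
    using that
  proof (induction rule: null_induct)
    case (diff a b)
    then show ?case using null_keys by (simp add: hdiff M.minus_eq M.r_neg)
  next
    case (left x y z)
    then have k: "Poly_Mapping.keys (frag_of (x \<oplus>\<^sub>S y, z)) \<subseteq> F" "Poly_Mapping.keys (frag_of (x, z)) \<subseteq> F"
      "Poly_Mapping.keys (frag_of (y, z)) \<subseteq> F" by auto
    have "h (frag_of (x \<oplus>\<^sub>S y, z) - frag_of (x, z) - frag_of (y, z)) =
      (b x z \<oplus>\<^sub>M b y z) \<ominus>\<^sub>M b x z \<ominus>\<^sub>M b y z"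
      using left k by (simp add: hdiff keys_diff_F h(2) bl)
    also have "\<dots> = \<zero>\<^sub>M" using left b by (simp add: M.add_minus_cancel2)
    finally show ?case .
  next
    case (right x y z)
    then have k: "Poly_Mapping.keys (frag_of (x, y \<oplus>\<^sub>S' z)) \<subseteq> F" "Poly_Mapping.keys (frag_of (x, z)) \<subseteq> F"
      "Poly_Mapping.keys (frag_of (x, y)) \<subseteq> F" by auto
    have "h (frag_of (x, y \<oplus>\<^sub>S' z) - frag_of (x, y) - frag_of (x, z)) =
      (b x y \<oplus>\<^sub>M b x z) \<ominus>\<^sub>M b x y \<ominus>\<^sub>M b x z"
      using right k by (simp add: hdiff keys_diff_F h(2) br)
    also have "\<dots> = \<zero>\<^sub>M" using right b by (simp add: M.add_minus_cancel2)
    finally show ?case .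
  next
    case (balance r x y)
    then have k: "Poly_Mapping.keys (frag_of (emb S r \<otimes>\<^sub>S x, y)) \<subseteq> F"
      "Poly_Mapping.keys (frag_of (x, emb S' r \<otimes>\<^sub>S' y)) \<subseteq> F" by auto
    have "h (frag_of (emb S r \<otimes>\<^sub>S x, y) - frag_of (x, emb S' r \<otimes>\<^sub>S' y)) = \<zero>\<^sub>M"
      using balance k b by (simp add: hdiff h(2) bb M.minus_eq M.r_neg)
    then show ?case .
  qed (simp add: h0)
  \<comment> \<open>A class is evaluated at an arbitrary member; vanishing on \<open>null\<close>
    makes the choice immaterial.\<close>
  define L where "L X = h (SOME c. c \<in> X)" for X
  have L: "L (el c) = h c" if "Poly_Mapping.keys c \<subseteq> F" for c
  proof -
    have "(SOME c'. c' \<in> el c) \<in> el c" using in_el_self by (rule someI)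
    then obtain c' where c': "L (el c) = h c'" "c' \<in> el c" by (auto simp: L_def)
    then have k: "Poly_Mapping.keys c' \<subseteq> F" and n: "c' - c \<in> null"
      using keys_el[OF that, of c'] by (auto simp: in_el_iff)
    have "h c' = h c"
      by (rule M.minus_zeroD) (use hnull[OF n] k that in \<open>simp_all add: hdiff hc\<close>)
    then show ?thesis using c'(1) by simp
  qed
  show thesis
  proof (rule that)
    show "L X \<in> carrier M" if "X \<in> carrier P" for X
      using that by (rule P_cases) (simp add: L hc)
    show "L (X \<oplus>\<^sub>P Y) = L X \<oplus>\<^sub>M L Y" if X: "X \<in> carrier P" and Y: "Y \<in> carrier P" for X Y
      using X Y by (elim P_cases) (simp add: L add_P hadd keys_add_F)
    show "L (pure s t) = b s t" if "s \<in> carrier S" "t \<in> carrier S'" for s t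
      using that by (simp add: L h(2))
  qed
qed

lemma lift_hom:
  assumes "cring W" and u: "u \<in> ring_hom S W" and v: "v \<in> ring_hom S' W"
    and uv: "!!r. r \<in> carrier R ==> u (emb S r) = v (emb S' r)"
  obtains L where "L \<in> ring_hom P W"
    "!!s t. s \<in> carrier S ==> t \<in> carrier S' ==> L (pure s t) = u s \<otimes>\<^sub>W v t"
proof -
  interpret W: cring W by fact
  interpret Pc: cring P by (rule P_cring)
  note uc = ring_hom_closed[OF u] and vc = ring_hom_closed[OF v]
  obtain L where L: "!!X. X \<in> carrier P ==> L X \<in> carrier W"
    "!!X Y. X \<in> carrier P ==> Y \<in> carrier P ==> L (X \<oplus>\<^sub>P Y) = L X \<oplus>\<^sub>W L Y"
    "!!s t. s \<in> carrier S ==> t \<in> carrier S' ==> L (pure s t) = u s \<otimes>\<^sub>W v t"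
    by (rule lift_ex[OF W.abelian_group_axioms, of "\<lambda>s t. u s \<otimes>\<^sub>W v t"])
      (auto simp: uc vc ring_hom_add[OF u] ring_hom_add[OF v] ring_hom_mult[OF u] ring_hom_mult[OF v]
         W.l_distr W.r_distr W.m_ac uv)
  have "L (X \<otimes>\<^sub>P Y) = L X \<otimes>\<^sub>W L Y" if X: "X \<in> carrier P" and Y: "Y \<in> carrier P" for X Y
    using X
  proof (induction X rule: P_induct)
    case (pure s t)
    from Y show ?case
      by (induction Y rule: P_induct)
        (use pure in \<open>auto simp: mult_pure L uc vc ring_hom_mult[OF u] ring_hom_mult[OF v] W.m_ac
          Pc.r_distr W.r_distr\<close>)
  qed (use Y in \<open>auto simp: Pc.l_distr L W.l_distr\<close>)
  then have "L \<in> ring_hom P W"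
    by (intro ring_hom_memI) (auto simp: L one_P ring_hom_one[OF u] ring_hom_one[OF v])
  then show thesis using L(3) by (rule that)
qed

lemma pure_hom: "(\<lambda>s. pure s \<one>\<^sub>S') \<in> ring_hom S P" "(\<lambda>t. pure \<one>\<^sub>S t) \<in> ring_hom S' P"
  by (auto intro!: ring_hom_memI simp: mult_pure pure_add_left pure_add_right one_P)

end

section \<open>Transport of algebra laws\<close>

text \<open>All laws are pulled back along an injection. The image of the identity only has to act
  as an identity on the image, so the lemma covers ideals eT with identity e; with the identity map
  it covers subrings and records that differ in the remaining fields.\<close>

lemma algebra_inj:
  fixes k :: "('k, 'x) ring_scheme" and S :: "('k, 's, 'y) module_scheme" and T :: "('k, 't, 'z) module_scheme"
  assumes T: "algebra k T"
    and \<iota>: "!!x. x \<in> carrier S ==> \<iota> x \<in> carrier T" "inj_on \<iota> (carrier S)"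
    and closed: "\<zero>\<^sub>S \<in> carrier S" "\<one>\<^sub>S \<in> carrier S"
      "!!x y. x \<in> carrier S ==> y \<in> carrier S ==> x \<oplus>\<^sub>S y \<in> carrier S"
      "!!x y. x \<in> carrier S ==> y \<in> carrier S ==> x \<otimes>\<^sub>S y \<in> carrier S"
      "!!c x. c \<in> carrier k ==> x \<in> carrier S ==> c \<odot>\<^sub>S x \<in> carrier S"
    and neg: "!!x. x \<in> carrier S ==> \<exists>y\<in>carrier S. \<iota> y = \<ominus>\<^sub>T \<iota> x"
    and hom: "\<iota> \<zero>\<^sub>S = \<zero>\<^sub>T"
      "!!x. x \<in> carrier S ==> \<iota> \<one>\<^sub>S \<otimes>\<^sub>T \<iota> x = \<iota> x"
      "!!x y. x \<in> carrier S ==> y \<in> carrier S ==> \<iota> (x \<oplus>\<^sub>S y) = \<iota> x \<oplus>\<^sub>T \<iota> y"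
      "!!x y. x \<in> carrier S ==> y \<in> carrier S ==> \<iota> (x \<otimes>\<^sub>S y) = \<iota> x \<otimes>\<^sub>T \<iota> y"
      "!!c x. c \<in> carrier k ==> x \<in> carrier S ==> \<iota> (c \<odot>\<^sub>S x) = c \<odot>\<^sub>T \<iota> x"
  shows "algebra k S"
proof -
  interpret T: algebra k T by fact
  note inj = inj_onD[OF \<iota>(2)]
  have neg': "\<exists>y\<in>carrier S. y \<oplus>\<^sub>S x = \<zero>\<^sub>S" if x: "x \<in> carrier S" for x
  proof -
    from neg[OF x] obtain y where y: "y \<in> carrier S" "\<iota> y = \<ominus>\<^sub>T \<iota> x" by blast
    have "y \<oplus>\<^sub>S x = \<zero>\<^sub>S" by (rule inj) (use x y in \<open>simp_all add: hom closed \<iota> T.l_neg\<close>)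
    with y show ?thesis by blast
  qed
  have one': "\<iota> x \<otimes>\<^sub>T \<iota> \<one>\<^sub>S = \<iota> x" if "x \<in> carrier S" for x
    using hom(2)[OF that] that closed \<iota> by (simp add: T.m_comm)
  have ag: "abelian_group S"
    by (intro abelian_groupI neg' closed; (rule inj)?)
      (simp_all add: hom closed \<iota> T.a_ac)
  have cr: "cring S"
    by (intro cringI ag comm_monoidI closed; (rule inj)?)
      (simp_all add: hom one' closed \<iota> T.m_ac T.l_distr T.r_distr)
  show ?thesis
    by (intro algebraI cr T.R_cring closed; (rule inj)?)
      (simp_all add: hom closed \<iota> T.smult_l_distr T.smult_r_distr T.smult_assoc1 T.smult_assoc2)
qed

lemma (in group) inv_cancel [simp]:
  assumes "x \<in> carrier G" "y \<in> carrier G"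
  shows "x \<otimes> (inv x \<otimes> y) = y" "inv x \<otimes> (x \<otimes> y) = y"
  using assms by (simp_all add: m_assoc[symmetric])

lemma finsum_record_cong:
  fixes R :: "('a, 'x) ring_scheme" and S :: "('a, 'y) ring_scheme"
  assumes "carrier R = carrier S" "add R = add S" "\<zero>\<^sub>R = \<zero>\<^sub>S"
  shows "finsum R f X = finsum S f X"
  by (simp add: finsum_def finprod_def assms)

lemmas galoisI = galois.intro[OF gact.intro[OF _ _ gact_axioms.intro] _ galois_axioms.intro]

lemma (in gact) idem_generates_one: "g \<in> carrier G ==> idem_generates T g e \<longleftrightarrow> e = \<one>"
proof -
  assume g: "g \<in> carrier G"
  have "e = \<one>" if "idem_generates T g e"
  proof -
    have e: "e \<in> carrier T" "e \<otimes> e = e" "carrier T = (\<lambda>s. s \<otimes> e) ` carrier T"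
      using that g by (auto simp: idem_generates_def dom)
    then obtain s where "s \<in> carrier T" "\<one> = s \<otimes> e" by blast
    then have "\<one> \<otimes> e = \<one>" using e by (metis T.m_assoc)
    then show ?thesis using e by simp
  qed
  moreover have "idem_generates T g \<one>" using g by (auto simp: idem_generates_def dom)
  ultimately show ?thesis by blast
qed

lemma (in gact) pone_eq [simp]: "g \<in> carrier G ==> pone T g = \<one>"
  by (simp add: pone_def idem_generates_one)

lemma (in gact) invariants_eq:
  "H \<subseteq> carrier G ==> invariants G H T = {x \<in> carrier T. \<forall>g\<in>H. pact T g x = x}"
  by (auto simp: invariants_def subset_iff)

section \<open>Fixed rings of normal subgroups\<close>

text \<open>The new group acts through a mere set map \<sigma> into the old one. This suffices when
  \<open>N\<close> is normal and \<sigma> picks coset representatives, because \<open>N\<close> acts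
  trivially on the fixed ring.\<close>

definition fixed_ext ::
  "'h set \<Rightarrow> ('k, 't, 'h, 'a) extension \<Rightarrow> ('g \<Rightarrow> 'h) \<Rightarrow> ('k, 't, 'g, 'a) extension" where
  "fixed_ext N W \<sigma> = (let I = {x \<in> carrier W. \<forall>n\<in>N. pact W n x = x} in
    \<lparr>carrier = I, monoid.mult = monoid.mult W, one = \<one>\<^sub>W, ring.zero = \<zero>\<^sub>W, add = add W,
     smult = smult W, pdom = (\<lambda>g. I), pact = (\<lambda>g. pact W (\<sigma> g)), emb = emb W\<rparr>)"

lemma fixed_ext_simps [simp]:
  "monoid.mult (fixed_ext N W \<sigma>) = monoid.mult W" "\<one>\<^bsub>fixed_ext N W \<sigma>\<^esub> = \<one>\<^sub>W"
  "\<zero>\<^bsub>fixed_ext N W \<sigma>\<^esub> = \<zero>\<^sub>W" "add (fixed_ext N W \<sigma>) = add W" "smult (fixed_ext N W \<sigma>) = smult W"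
  "pdom (fixed_ext N W \<sigma>) g = carrier (fixed_ext N W \<sigma>)" "pact (fixed_ext N W \<sigma>) g = pact W (\<sigma> g)"
  "emb (fixed_ext N W \<sigma>) = emb W"
  by (simp_all add: fixed_ext_def Let_def)

lemma carrier_fixed_ext: "carrier (fixed_ext N W \<sigma>) = {x \<in> carrier W. \<forall>n\<in>N. pact W n x = x}"
  by (simp add: fixed_ext_def Let_def)

text \<open>The quotient by a normal subgroup without cosets: a homomorphism \<chi> onto
  \<open>G\<close> with a set-theoretic section \<sigma>; the subgroup is the kernel of \<chi>. In
  particular \<sigma>(1) may differ from 1.\<close>

locale galois_quot = W: galois \<Gamma> k A W + G: group G
  for \<Gamma> :: "'h monoid" and k :: "'k ring" and A :: "('k, 'a) module"
    and W :: "('k, 't, 'h, 'a) extension" (structure) and G :: "'g monoid" +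
  fixes \<chi> :: "'h \<Rightarrow> 'g" and \<sigma> :: "'g \<Rightarrow> 'h"
  assumes finG: "finite (carrier G)" and chi: "\<chi> \<in> hom \<Gamma> G"
    and sec [simp, intro]: "g \<in> carrier G ==> \<sigma> g \<in> carrier \<Gamma>"
    and chi_sec [simp]: "g \<in> carrier G ==> \<chi> (\<sigma> g) = g"
begin

definition "N = {n \<in> carrier \<Gamma>. \<chi> n = \<one>\<^sub>G}"

abbreviation "V \<equiv> fixed_ext N W \<sigma>"

sublocale chi: group_hom \<Gamma> G \<chi>
  using chi by unfold_locales

lemma N_sub: "n \<in> N ==> n \<in> carrier \<Gamma>" and N_chi: "n \<in> N ==> \<chi> n = \<one>\<^sub>G"
  by (auto simp: N_def)

lemma N_finite: "finite N"
  using W.fin by (auto simp: N_def)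

lemma V_carrier: "x \<in> carrier V \<longleftrightarrow> x \<in> carrier W \<and> (\<forall>n\<in>N. pact W n x = x)"
  by (auto simp: carrier_fixed_ext)

lemma subgroup_N: "subgroup N \<Gamma>"
  by (rule W.G.subgroupI) (auto simp: N_def)

text \<open>Two elements with the same image under \<chi> differ by an element of the kernel, which
  fixes x.\<close>

lemma act_chi:
  assumes "x \<in> carrier V" "\<gamma> \<in> carrier \<Gamma>" "\<gamma>' \<in> carrier \<Gamma>" "\<chi> \<gamma> = \<chi> \<gamma>'"
  shows "pact W \<gamma> x = pact W \<gamma>' x"
proof -
  let ?n = "inv\<^bsub>\<Gamma>\<^esub> \<gamma>' \<otimes>\<^sub>\<Gamma> \<gamma>"
  have "?n \<in> N" using assms by (simp add: N_def)
  then have "pact W \<gamma>' (pact W ?n x) = pact W \<gamma>' x" using assms(1) by (simp add: V_carrier)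
  moreover have "pact W \<gamma>' (pact W ?n x) = pact W \<gamma> x"
    using assms by (simp add: V_carrier W.act_comp W.G.m_assoc[symmetric])
  ultimately show ?thesis by simp
qed

lemma act_V: "x \<in> carrier V ==> \<gamma> \<in> carrier \<Gamma> ==> pact W \<gamma> x \<in> carrier V"
  unfolding V_carrier
proof (intro conjI ballI)
  fix n assume x: "x \<in> carrier W \<and> (\<forall>n\<in>N. pact W n x = x)" and \<gamma>: "\<gamma> \<in> carrier \<Gamma>" and n: "n \<in> N"
  have "pact W n (pact W \<gamma> x) = pact W (n \<otimes>\<^sub>\<Gamma> \<gamma>) x" using x \<gamma> n N_sub by (simp add: W.act_comp)
  also have "\<dots> = pact W \<gamma> x" using x \<gamma> n N_sub N_chi by (intro act_chi) (auto simp: V_carrier)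
  finally show "pact W n (pact W \<gamma> x) = pact W \<gamma> x" .
qed auto

lemma algebra_fixed:
  fixes X :: "('k, 't, 'x) module_scheme"
  assumes "carrier X = carrier V" "monoid.mult X = monoid.mult W" "\<one>\<^sub>X = \<one>" "\<zero>\<^sub>X = \<zero>"
    "add X = add W" "smult X = smult W"
  shows "algebra k X"
proof (rule algebra_inj[OF W.T.algebra_axioms, where \<iota> = "\<lambda>x. x"])
  show "\<exists>y\<in>carrier X. y = \<ominus> x" if "x \<in> carrier X" for x
    using that by (intro bexI[of _ "\<ominus> x"]) (auto simp: assms V_carrier N_sub)
qed (auto simp: assms V_carrier N_sub W.act_add W.act_mult W.act_smult)

definition "VM = \<lparr>carrier = carrier V, monoid.mult = monoid.mult W, one = \<one>, ring.zero = \<zero>, add = add W,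
     smult = smult W\<rparr>"

text \<open>\<open>W\<close> over its own fixed ring \<open>VM\<close>, as an extension with group
  \<open>N\<close>: the structure map is the inclusion.\<close>

definition "WN = \<lparr>carrier = carrier W, monoid.mult = monoid.mult W, one = \<one>, ring.zero = \<zero>, add = add W,
     smult = smult W, pdom = pdom W, pact = pact W, emb = (\<lambda>x. x)\<rparr>"

text \<open>Coordinates restrict to subgroups. The purpose is \<open>N_trace\<close>: an element
  whose trace over \<open>N\<close> is 1.\<close>

lemma galois_N: "galois (\<Gamma>\<lparr>carrier := N\<rparr>) k VM WN"
proof -
  have c: "coord (\<Gamma>\<lparr>carrier := N\<rparr>) WN (pact WN) f" if "coord \<Gamma> W (pact W) f" for f
    using that
  proof induction
    case (single x y f)
    then show ?case by (intro coord.single[of x _ y]) (auto simp: WN_def N_sub)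
  next
    case (add p q f)
    show ?case by (rule coord.add[OF add.IH]) (use add.hyps in \<open>auto simp: WN_def N_sub\<close>)
  qed
  have WN: "algebra k WN"
    by (rule algebra_inj[OF W.T.algebra_axioms, where \<iota> = "\<lambda>x. x"]) (auto simp: WN_def intro: W.T.a_inv_closed)
  have VM: "algebra k VM" by (rule algebra_fixed) (auto simp: VM_def)
  have c': "coord (\<Gamma>\<lparr>carrier := N\<rparr>) WN (pact WN) (\<lambda>g. if g = \<one>\<^bsub>\<Gamma>\<lparr>carrier := N\<rparr>\<^esub> then \<one>\<^sub>WN else \<zero>\<^sub>WN)"
    using c[OF W.delta] by (simp add: WN_def cong: if_cong)
  have sel: "carrier WN = carrier W" "monoid.mult WN = monoid.mult W" "\<one>\<^sub>WN = \<one>"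
    "add WN = add W" "smult WN = smult W" "pdom WN = pdom W" "pact WN = pact W" "emb WN x = x"
    "carrier VM = carrier V" "monoid.mult VM = monoid.mult W" "\<one>\<^sub>VM = \<one>" "add VM = add W" "smult VM = smult W" for x
    by (simp_all add: WN_def VM_def)
  have NG: "group (\<Gamma>\<lparr>carrier := N\<rparr>)" by (rule W.G.subgroup_imp_group[OF subgroup_N])
  show ?thesis
  proof (rule galoisI[OF NG WN])
    show "x \<in> emb WN ` carrier VM" if "x \<in> carrier WN" "!!g. g \<in> carrier (\<Gamma>\<lparr>carrier := N\<rparr>) ==> pact WN g x = x" for x
    proof -
      have "x \<in> carrier VM" using that by (simp add: sel V_carrier)
      then show ?thesis by (metis imageI sel(8))
    qed
    show "inj_on (emb WN) (carrier VM)" by (auto simp: inj_on_def sel)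
    show "pact WN g (pact WN h x) = pact WN (g \<otimes>\<^bsub>\<Gamma>\<lparr>carrier := N\<rparr>\<^esub> h) x"
      if "g \<in> carrier (\<Gamma>\<lparr>carrier := N\<rparr>)" "h \<in> carrier (\<Gamma>\<lparr>carrier := N\<rparr>)" "x \<in> carrier WN" for g h x
      using that by (simp add: sel W.act_comp N_sub)
    show "coord (\<Gamma>\<lparr>carrier := N\<rparr>) WN (pact WN) (\<lambda>g. if g = \<one>\<^bsub>\<Gamma>\<lparr>carrier := N\<rparr>\<^esub> then \<one>\<^sub>WN else \<zero>\<^sub>WN)"
      by (rule c')
  qed (simp_all add: VM sel N_sub N_finite W.dom W.act_add W.act_mult, simp_all add: V_carrier)
qed

lemma N_tr_eq: "galois.tr (\<Gamma>\<lparr>carrier := N\<rparr>) WN x = (\<Oplus>n\<in>N. pact W n x)"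
proof -
  have "finsum WN f X = finsum W f X" for f :: "'h \<Rightarrow> 't" and X
    by (rule finsum_record_cong) (simp_all add: WN_def)
  then show ?thesis unfolding galois.tr_def[OF galois_N] by (simp add: WN_def)
qed

lemma N_trace: "\<exists>c\<in>carrier W. (\<Oplus>n\<in>N. pact W n c) = \<one>"
  using galois.trace_one[OF galois_N] unfolding N_tr_eq by (simp add: WN_def)

lemma N_tr_inv:
  assumes x: "x \<in> carrier W"
  shows "(\<Oplus>n\<in>N. pact W n x) \<in> carrier V"
  using galois.tr_inv[OF galois_N, of _ x] galois.tr_closed[OF galois_N, of x] x
  unfolding N_tr_eq by (simp add: V_carrier WN_def)

text \<open>With c of \<open>N\<close>-trace 1 and coordinates x_i, y_i of \<open>W\<close>, the
  fixed ring has the coordinates tr(c x_i), tr(y_i), where tr is the trace over \<open>N\<close>.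
  Expanding both traces gives a double sum over \<open>N\<close> of the coordinates of
  \<open>W\<close>, twisted by n(c).\<close>

lemma V_delta: "coord G V (pact V) (\<lambda>g. if g = \<one>\<^sub>G then \<one>\<^sub>V else \<zero>\<^sub>V)"
proof -
  obtain c where c: "c \<in> carrier W" "(\<Oplus>n\<in>N. pact W n c) = \<one>" using N_trace by blast
  \<comment> \<open>The double sum for an arbitrary coefficient function \<open>F\<close>, so that
    rule induction applies; for a single product it factors into the two traces.\<close>
  define D where "D F g = (\<Oplus>n\<in>N. pact W n c \<otimes> (\<Oplus>n'\<in>N. pact W n (F (inv\<^bsub>\<Gamma>\<^esub> n \<otimes>\<^sub>\<Gamma> \<sigma> g \<otimes>\<^sub>\<Gamma> n'))))" for F g
  have D: "coord G V (pact V) (D F)" if "coord \<Gamma> W (pact W) F" for F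
    using that
  proof induction
    case (single x y F)
    have "D F g = (\<Oplus>n\<in>N. pact W n (c \<otimes> x)) \<otimes> pact W (\<sigma> g) (\<Oplus>n\<in>N. pact W n y)" if g: "g \<in> carrier G" for g
    proof -
      let ?t = "pact W (\<sigma> g) (\<Oplus>n\<in>N. pact W n y)"
      have t: "?t \<in> carrier W" using g single by (auto intro!: W.act_closed W.T.finsum_closed simp: N_sub)
      have 1: "(\<Oplus>n'\<in>N. pact W n (F (inv\<^bsub>\<Gamma>\<^esub> n \<otimes>\<^sub>\<Gamma> \<sigma> g \<otimes>\<^sub>\<Gamma> n'))) = pact W n x \<otimes> ?t" if n: "n \<in> N" for n
      proof -
        have "pact W n (F (inv\<^bsub>\<Gamma>\<^esub> n \<otimes>\<^sub>\<Gamma> \<sigma> g \<otimes>\<^sub>\<Gamma> n')) = pact W n x \<otimes> pact W (\<sigma> g) (pact W n' y)" if "n' \<in> N" for n'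
          using that n g single N_sub by (simp add: W.act_mult W.act_comp W.G.m_assoc[symmetric])
        then have "(\<Oplus>n'\<in>N. pact W n (F (inv\<^bsub>\<Gamma>\<^esub> n \<otimes>\<^sub>\<Gamma> \<sigma> g \<otimes>\<^sub>\<Gamma> n'))) =
          (\<Oplus>n'\<in>N. pact W n x \<otimes> pact W (\<sigma> g) (pact W n' y))"
          using single n g N_sub by (intro W.T.finsum_cong') auto
        also have "\<dots> = pact W n x \<otimes> (\<Oplus>n'\<in>N. pact W (\<sigma> g) (pact W n' y))"
          using single n g N_sub by (intro W.T.finsum_rdistr[symmetric] N_finite) auto
        also have "(\<Oplus>n'\<in>N. pact W (\<sigma> g) (pact W n' y)) = ?t"
          using single g N_sub by (intro W.act_finsum[symmetric]) auto
        finally show ?thesis .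
      qed
      have "D F g = (\<Oplus>n\<in>N. pact W n (c \<otimes> x) \<otimes> ?t)"
        unfolding D_def using single c t N_sub
        by (intro W.T.finsum_cong') (auto simp: 1 W.act_mult W.T.m_assoc)
      also have "\<dots> = (\<Oplus>n\<in>N. pact W n (c \<otimes> x)) \<otimes> ?t"
        using single c t N_sub by (intro W.T.finsum_ldistr[symmetric] N_finite) auto
      finally show ?thesis .
    qed
    then show ?case
      by (intro coord.single[of "\<Oplus>n\<in>N. pact W n (c \<otimes> x)" _ "\<Oplus>n\<in>N. pact W n y"])
        (use single c in \<open>auto intro!: N_tr_inv\<close>)
  next
    case (add p q F)
    note cl = W.coord_T_closed[OF add.hyps(1)] W.coord_T_closed[OF add.hyps(2)]
    have "D F g = D p g \<oplus> D q g" if g: "g \<in> carrier G" for g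
    proof -
      let ?I = "\<lambda>F n. (\<Oplus>n'\<in>N. pact W n (F (inv\<^bsub>\<Gamma>\<^esub> n \<otimes>\<^sub>\<Gamma> \<sigma> g \<otimes>\<^sub>\<Gamma> n')))"
      have 1: "?I F n = ?I p n \<oplus> ?I q n" if n: "n \<in> N" for n
      proof -
        have "?I F n = (\<Oplus>n'\<in>N. pact W n (p (inv\<^bsub>\<Gamma>\<^esub> n \<otimes>\<^sub>\<Gamma> \<sigma> g \<otimes>\<^sub>\<Gamma> n')) \<oplus> pact W n (q (inv\<^bsub>\<Gamma>\<^esub> n \<otimes>\<^sub>\<Gamma> \<sigma> g \<otimes>\<^sub>\<Gamma> n')))"
          using add.hyps(3) cl n g N_sub by (intro W.T.finsum_cong') (auto simp: W.act_add)
        also have "\<dots> = ?I p n \<oplus> ?I q n" using cl n g N_sub by (intro W.T.finsum_addf) auto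
        finally show ?thesis .
      qed
      have 2: "?I F n \<in> carrier W" if "n \<in> N" "!!\<gamma>. \<gamma> \<in> carrier \<Gamma> ==> F \<gamma> \<in> carrier W" for n F
        using that g N_sub by (intro W.T.finsum_closed) auto
      have "D F g = (\<Oplus>n\<in>N. pact W n c \<otimes> ?I p n \<oplus> pact W n c \<otimes> ?I q n)"
        unfolding D_def using c cl N_sub 2[of _ p] 2[of _ q]
        by (intro W.T.finsum_cong') (auto simp: 1 W.T.r_distr)
      also have "\<dots> = D p g \<oplus> D q g"
        unfolding D_def using c cl N_sub 2[of _ p] 2[of _ q] by (intro W.T.finsum_addf) auto
      finally show ?thesis .
    qed
    then show ?case by (intro coord.add[OF add.IH]) auto
  qed
  have "D (\<lambda>\<gamma>. if \<gamma> = \<one>\<^sub>\<Gamma> then \<one> else \<zero>) g = (if g = \<one>\<^sub>G then \<one> else \<zero>)" if g: "g \<in> carrier G" for g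
  proof (cases "g = \<one>\<^sub>G")
    case True
    have "(\<Oplus>n'\<in>N. pact W n (if inv\<^bsub>\<Gamma>\<^esub> n \<otimes>\<^sub>\<Gamma> \<sigma> g \<otimes>\<^sub>\<Gamma> n' = \<one>\<^sub>\<Gamma> then \<one> else \<zero>)) = \<one>" if n: "n \<in> N" for n
    proof -
      \<comment> \<open>For g = 1 exactly one n' contributes for each n, and it need not be n
        because \<sigma>(1) is only an element of the kernel. What remains is the trace of
        c.\<close>
      let ?m = "inv\<^bsub>\<Gamma>\<^esub> \<sigma> g \<otimes>\<^sub>\<Gamma> n"
      have m: "?m \<in> N" using n g True by (simp add: N_def)
      have "inv\<^bsub>\<Gamma>\<^esub> n \<otimes>\<^sub>\<Gamma> \<sigma> g \<otimes>\<^sub>\<Gamma> n' = \<one>\<^sub>\<Gamma> \<longleftrightarrow> ?m = n'" if "n' \<in> N" for n'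
      proof
        have c: "n \<in> carrier \<Gamma>" "n' \<in> carrier \<Gamma>" using that n N_sub by auto
        have "n' = inv\<^bsub>\<Gamma>\<^esub> \<sigma> g \<otimes>\<^sub>\<Gamma> n \<otimes>\<^sub>\<Gamma> (inv\<^bsub>\<Gamma>\<^esub> n \<otimes>\<^sub>\<Gamma> \<sigma> g \<otimes>\<^sub>\<Gamma> n')"
          using c g by (simp add: W.G.m_assoc)
        also assume "inv\<^bsub>\<Gamma>\<^esub> n \<otimes>\<^sub>\<Gamma> \<sigma> g \<otimes>\<^sub>\<Gamma> n' = \<one>\<^sub>\<Gamma>"
        finally show "?m = n'" using c g by simp
      next
        assume "?m = n'"
        then show "inv\<^bsub>\<Gamma>\<^esub> n \<otimes>\<^sub>\<Gamma> \<sigma> g \<otimes>\<^sub>\<Gamma> n' = \<one>\<^sub>\<Gamma>"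
          using n g N_sub by (auto simp: W.G.m_assoc)
      qed
      then have "(\<Oplus>n'\<in>N. pact W n (if inv\<^bsub>\<Gamma>\<^esub> n \<otimes>\<^sub>\<Gamma> \<sigma> g \<otimes>\<^sub>\<Gamma> n' = \<one>\<^sub>\<Gamma> then \<one> else \<zero>)) =
        (\<Oplus>n'\<in>N. if ?m = n' then \<one> else \<zero>)"
        using n N_sub by (intro W.T.finsum_cong') auto
      also have "\<dots> = \<one>" using m by (intro W.T.finsum_singleton N_finite) auto
      finally show ?thesis .
    qed
    then have "D (\<lambda>\<gamma>. if \<gamma> = \<one>\<^sub>\<Gamma> then \<one> else \<zero>) g = (\<Oplus>n\<in>N. pact W n c)"
      unfolding D_def using c N_sub by (intro W.T.finsum_cong') auto
    then show ?thesis using c True by simp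
  next
    case False
    \<comment> \<open>The image under \<chi> of the element is g, which is not 1, so every term of
      the double sum vanishes.\<close>
    have "inv\<^bsub>\<Gamma>\<^esub> n \<otimes>\<^sub>\<Gamma> \<sigma> g \<otimes>\<^sub>\<Gamma> n' \<noteq> \<one>\<^sub>\<Gamma>" if "n \<in> N" "n' \<in> N" for n n'
    proof
      assume "inv\<^bsub>\<Gamma>\<^esub> n \<otimes>\<^sub>\<Gamma> \<sigma> g \<otimes>\<^sub>\<Gamma> n' = \<one>\<^sub>\<Gamma>"
      then have "\<chi> (inv\<^bsub>\<Gamma>\<^esub> n \<otimes>\<^sub>\<Gamma> \<sigma> g \<otimes>\<^sub>\<Gamma> n') = \<one>\<^sub>G" by simp
      then show False using that g False N_sub by (simp add: N_chi)
    qed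
    then have "(\<Oplus>n'\<in>N. pact W n (if inv\<^bsub>\<Gamma>\<^esub> n \<otimes>\<^sub>\<Gamma> \<sigma> g \<otimes>\<^sub>\<Gamma> n' = \<one>\<^sub>\<Gamma> then \<one> else \<zero>)) = \<zero>" if n: "n \<in> N" for n
      using n N_sub by (intro W.T.add.finprod_one_eqI) auto
    then have "D (\<lambda>\<gamma>. if \<gamma> = \<one>\<^sub>\<Gamma> then \<one> else \<zero>) g = \<zero>"
      unfolding D_def using c N_sub by (intro W.T.add.finprod_one_eqI) auto
    then show ?thesis using False by simp
  qed
  then show ?thesis by (intro coord_cong[OF D[OF W.delta]]) simp
qed

lemma galois_V: "galois G k A V"
proof -
  have surj: "x \<in> emb W ` carrier A" if "x \<in> carrier V" "!!g. g \<in> carrier G ==> pact W (\<sigma> g) x = x" for x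
  proof (rule W.emb_surj)
    fix \<gamma> assume \<gamma>: "\<gamma> \<in> carrier \<Gamma>"
    have "pact W \<gamma> x = pact W (\<sigma> (\<chi> \<gamma>)) x" using that \<gamma> by (intro act_chi) auto
    then show "pact W \<gamma> x = x" using that \<gamma> by simp
  qed (use that in \<open>auto simp: V_carrier\<close>)
  have comp: "pact W (\<sigma> g) (pact W (\<sigma> h) x) = pact W (\<sigma> (g \<otimes>\<^sub>G h)) x"
    if "g \<in> carrier G" "h \<in> carrier G" "x \<in> carrier V" for g h x
    using that act_chi[of x "\<sigma> g \<otimes>\<^sub>\<Gamma> \<sigma> h" "\<sigma> (g \<otimes>\<^sub>G h)"] by (simp add: W.act_comp V_carrier)
  have id: "pact W (\<sigma> \<one>\<^sub>G) x = x" if "x \<in> carrier V" for x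
    using that act_chi[of x "\<sigma> \<one>\<^sub>G" "\<one>\<^sub>\<Gamma>"] by (simp add: V_carrier)
  have alg: "algebra k V" by (rule algebra_fixed) simp_all
  have inj: "inj_on (emb V) (carrier A)" using W.emb_inj by simp
  have surj': "x \<in> emb V ` carrier A" if "x \<in> carrier V" "!!g. g \<in> carrier G ==> pact V g x = x" for x
    using surj that by simp
  show ?thesis
    by (rule galoisI[OF G.group_axioms alg finG _ _ _ _ _ _ _ _ _ _ _ _ inj _ surj' V_delta])
      (simp_all add: W.A.algebra_axioms act_V comp id W.emb_add W.emb_mult W.emb_smult,
       simp_all add: V_carrier W.act_add W.act_mult N_sub)
qed

end

section \<open>The Harrison product\<close>

locale galois_tensor = B: galois G k A B + B': galois G k A B'
  for G :: "'g monoid" and k :: "'k ring" and A :: "('k, 'a) module"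
    and B :: "('k, 's, 'g, 'a) extension" and B' :: "('k, 't, 'g, 'a) extension"
begin

sublocale tensor_setup k A B B' G
  by unfold_locales auto

sublocale Pc: cring P by (rule P_cring)

lemma act_el:
  assumes g: "g \<in> carrier G" and h: "h \<in> carrier G" and c: "Poly_Mapping.keys c \<subseteq> F"
  shows "pact P (g, h) (el c) = el (frag_extend (\<lambda>(s, t). frag_of (pact B g s, pact B' h t)) c)"
proof -
  let ?f = "\<lambda>(s, t). frag_of (pact B g s, pact B' h t)"
  have "pact P (g, h) (el c) = (\<Union>c'\<in>{c' \<in> el c. Poly_Mapping.keys c' \<subseteq> F}. el (frag_extend ?f c'))"
    using g h by (simp add: tensor_def B.dom B'.dom)
  also have "{c' \<in> el c. Poly_Mapping.keys c' \<subseteq> F} = el c" using keys_el[OF c] by blast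
  also have "(\<Union>c'\<in>el c. el (frag_extend ?f c')) = el (frag_extend ?f c)"
  proof (intro UN_el_const)
    fix c' assume c': "c' \<in> el c"
    have "frag_extend ?f (c' - c) \<in> null"
    proof (rule null_extend)
      show "?f (emb B r \<otimes>\<^sub>B x, y) - ?f (x, emb B' r \<otimes>\<^sub>B' y) \<in> null"
        if "r \<in> carrier A" "x \<in> carrier B" "y \<in> carrier B'" for r x y
        using that g h rel_balance[of r "pact B g x" "pact B' h y"]
        by (simp add: B.act_mult B'.act_mult)
    qed (use g h c' in \<open>auto simp: in_el_iff null_zero null_diff B.act_add B'.act_add intro!: rel_left rel_right\<close>)
    then show "el (frag_extend ?f c') = el (frag_extend ?f c)"
      by (simp add: el_eq_iff frag_extend_diff)
  qed
  finally show ?thesis .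
qed

lemma act_pure: "[|g \<in> carrier G; h \<in> carrier G; s \<in> carrier B; t \<in> carrier B'|] ==>
    pact P (g, h) (pure s t) = pure (pact B g s) (pact B' h t)"
  by (subst act_el) auto

lemma act_P_add: "[|g \<in> carrier G; h \<in> carrier G; X \<in> carrier P; Y \<in> carrier P|] ==>
    pact P (g, h) (X \<oplus>\<^sub>P Y) = pact P (g, h) X \<oplus>\<^sub>P pact P (g, h) Y"
  by (elim P_cases) (simp add: add_P act_el keys_add_F frag_extend_add)

lemma act_P_closed: "[|X \<in> carrier P; g \<in> carrier G; h \<in> carrier G|] ==> pact P (g, h) X \<in> carrier P"
  by (induction X rule: P_induct) (simp_all add: act_pure act_P_add)

lemma act_P_mult:
  assumes g: "g \<in> carrier G" "h \<in> carrier G" and X: "X \<in> carrier P" and Y: "Y \<in> carrier P"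
  shows "pact P (g, h) (X \<otimes>\<^sub>P Y) = pact P (g, h) X \<otimes>\<^sub>P pact P (g, h) Y"
  using X
proof (induction X rule: P_induct)
  case (pure s t)
  from Y show ?case
    by (induction Y rule: P_induct)
      (simp_all add: g pure mult_pure act_pure B.act_mult B'.act_mult Pc.r_distr act_P_add act_P_closed)
qed (simp add: g Y Pc.l_distr act_P_add act_P_closed)

lemma act_P_id: "X \<in> carrier P ==> pact P (\<one>\<^sub>G, \<one>\<^sub>G) X = X"
  by (induction X rule: P_induct) (simp_all add: act_pure act_P_add)

lemma act_P_comp: "[|X \<in> carrier P; g \<in> carrier G; h \<in> carrier G; g' \<in> carrier G; h' \<in> carrier G|] ==>
    pact P (g, h) (pact P (g', h') X) = pact P (g \<otimes>\<^sub>G g', h \<otimes>\<^sub>G h') X"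
  by (induction X rule: P_induct) (simp_all add: act_pure act_P_add act_P_closed B.act_comp B'.act_comp)

lemma dom_P: "g \<in> carrier G ==> h \<in> carrier G ==> pdom P (g, h) = carrier P"
  by (simp add: carrier_P) (simp add: tensor_def B.dom B'.dom)

lemma finsum_pure_left:
  assumes "finite I" "f \<in> I \<rightarrow> carrier B" "t \<in> carrier B'"
  shows "(\<Oplus>\<^sub>P i\<in>I. pure (f i) t) = pure (\<Oplus>\<^sub>B i\<in>I. f i) t"
  using assms
proof (induction I rule: finite_induct)
  case (insert i I)
  then have "f \<in> I \<rightarrow> carrier B" "f i \<in> carrier B" by auto
  with insert show ?case by (simp add: pure_add_left B.T.finsum_closed Pi_iff)
qed (simp add: pure_zero)

lemma finsum_pure_right:
  assumes "finite I" "f \<in> I \<rightarrow> carrier B'" "s \<in> carrier B"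
  shows "(\<Oplus>\<^sub>P i\<in>I. pure s (f i)) = pure s (\<Oplus>\<^sub>B' i\<in>I. f i)"
  using assms
proof (induction I rule: finite_induct)
  case (insert i I)
  then have "f \<in> I \<rightarrow> carrier B'" "f i \<in> carrier B'" by auto
  with insert show ?case by (simp add: pure_add_right B'.T.finsum_closed Pi_iff)
qed (simp add: pure_zero)

text \<open>The traces over the two factors of the group. Their composite is the trace over
  \<open>G \<times>\<times> G\<close>.\<close>

definition "t1 X = (\<Oplus>\<^sub>P g\<in>carrier G. pact P (g, \<one>\<^sub>G) X)"
definition "t2 X = (\<Oplus>\<^sub>P h\<in>carrier G. pact P (\<one>\<^sub>G, h) X)"

lemma t_pure: "s \<in> carrier B ==> t \<in> carrier B' ==> t1 (pure s t) = pure (B.tr s) t"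
  "s \<in> carrier B ==> t \<in> carrier B' ==> t2 (pure s t) = pure s (B'.tr t)"
proof -
  assume st: "s \<in> carrier B" "t \<in> carrier B'"
  have "t1 (pure s t) = (\<Oplus>\<^sub>P g\<in>carrier G. pure (pact B g s) t)"
    unfolding t1_def using st by (intro Pc.finsum_cong') (simp_all add: act_pure Pi_iff)
  then show "t1 (pure s t) = pure (B.tr s) t"
    using st by (simp add: finsum_pure_left B.fin B.tr_def Pi_iff)
  have "t2 (pure s t) = (\<Oplus>\<^sub>P g\<in>carrier G. pure s (pact B' g t))"
    unfolding t2_def using st by (intro Pc.finsum_cong') (simp_all add: act_pure Pi_iff)
  then show "t2 (pure s t) = pure s (B'.tr t)"
    using st by (simp add: finsum_pure_right B.fin B'.tr_def Pi_iff)
qed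

lemma t_closed: "X \<in> carrier P ==> t1 X \<in> carrier P" "X \<in> carrier P ==> t2 X \<in> carrier P"
  unfolding t1_def t2_def by (intro Pc.finsum_closed; simp add: act_P_closed)+

lemma t_add: "X \<in> carrier P ==> Y \<in> carrier P ==> t1 (X \<oplus>\<^sub>P Y) = t1 X \<oplus>\<^sub>P t1 Y"
  "X \<in> carrier P ==> Y \<in> carrier P ==> t2 (X \<oplus>\<^sub>P Y) = t2 X \<oplus>\<^sub>P t2 Y"
proof -
  assume XY: "X \<in> carrier P" "Y \<in> carrier P"
  have "t1 (X \<oplus>\<^sub>P Y) = (\<Oplus>\<^sub>P g\<in>carrier G. pact P (g, \<one>\<^sub>G) X \<oplus>\<^sub>P pact P (g, \<one>\<^sub>G) Y)"
    unfolding t1_def using XY by (intro Pc.finsum_cong') (simp_all add: act_P_add act_P_closed Pi_iff)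
  then show "t1 (X \<oplus>\<^sub>P Y) = t1 X \<oplus>\<^sub>P t1 Y"
    unfolding t1_def using XY by (simp add: Pc.finsum_addf act_P_closed Pi_iff)
  have "t2 (X \<oplus>\<^sub>P Y) = (\<Oplus>\<^sub>P h\<in>carrier G. pact P (\<one>\<^sub>G, h) X \<oplus>\<^sub>P pact P (\<one>\<^sub>G, h) Y)"
    unfolding t2_def using XY by (intro Pc.finsum_cong') (simp_all add: act_P_add act_P_closed Pi_iff)
  then show "t2 (X \<oplus>\<^sub>P Y) = t2 X \<oplus>\<^sub>P t2 Y"
    unfolding t2_def using XY by (simp add: Pc.finsum_addf act_P_closed Pi_iff)
qed

lemma t_lin:
  assumes X: "X \<in> carrier P" and Y: "Y \<in> carrier P"
    and inv: "!!g h. g \<in> carrier G ==> h \<in> carrier G ==> pact P (g, h) X = X"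
  shows "t1 (X \<otimes>\<^sub>P Y) = X \<otimes>\<^sub>P t1 Y" "t2 (X \<otimes>\<^sub>P Y) = X \<otimes>\<^sub>P t2 Y"
proof -
  have "t1 (X \<otimes>\<^sub>P Y) = (\<Oplus>\<^sub>P g\<in>carrier G. X \<otimes>\<^sub>P pact P (g, \<one>\<^sub>G) Y)"
    unfolding t1_def using X Y by (intro Pc.finsum_cong') (simp_all add: act_P_mult inv act_P_closed Pi_iff)
  then show "t1 (X \<otimes>\<^sub>P Y) = X \<otimes>\<^sub>P t1 Y"
    unfolding t1_def using X Y by (simp add: Pc.finsum_rdistr B.fin act_P_closed Pi_iff)
  have "t2 (X \<otimes>\<^sub>P Y) = (\<Oplus>\<^sub>P h\<in>carrier G. X \<otimes>\<^sub>P pact P (\<one>\<^sub>G, h) Y)"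
    unfolding t2_def using X Y by (intro Pc.finsum_cong') (simp_all add: act_P_mult inv act_P_closed Pi_iff)
  then show "t2 (X \<otimes>\<^sub>P Y) = X \<otimes>\<^sub>P t2 Y"
    unfolding t2_def using X Y by (simp add: Pc.finsum_rdistr B.fin act_P_closed Pi_iff)
qed

lemma emb_P_hom:
  assumes "a \<in> carrier A" "b \<in> carrier A"
  shows "emb P (a \<oplus>\<^sub>A b) = emb P a \<oplus>\<^sub>P emb P b" "emb P (a \<otimes>\<^sub>A b) = emb P a \<otimes>\<^sub>P emb P b"
  using assms by (simp_all add: emb_P B.emb_add B.emb_mult pure_add_left mult_pure)

lemma pure_emb: "a \<in> carrier A ==> b \<in> carrier A ==> pure (emb B a) (emb B' b) = emb P (a \<otimes>\<^sub>A b)"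
  using pure_balance[of b "emb B a" "\<one>\<^sub>B'"] by (simp add: emb_P B.emb_mult B.T.m_comm)

lemma t12_emb: "Y \<in> carrier P ==> t1 (t2 Y) \<in> emb P ` carrier A"
proof (induction Y rule: P_induct)
  case (pure s t)
  obtain a b where "a \<in> carrier A" "b \<in> carrier A" "B.tr s = emb B a" "B'.tr t = emb B' b"
    using B.tr_in_emb[of s] B'.tr_in_emb[of t] pure by blast
  then show ?case using pure by (simp add: t_pure pure_emb)
next
  case (add X Y)
  then obtain a b where "a \<in> carrier A" "b \<in> carrier A" "t1 (t2 X) = emb P a" "t1 (t2 Y) = emb P b" by blast
  then have "t1 (t2 (X \<oplus>\<^sub>P Y)) = emb P (a \<oplus>\<^sub>A b)" "a \<oplus>\<^sub>A b \<in> carrier A"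
    using add by (simp_all add: t_add t_closed emb_P_hom)
  then show ?case by blast
qed

text \<open>Multiply an invariant X by the tensor of two elements of trace one and take both traces:
  linearity returns X, while \<open>t12_emb\<close> places the result in the image of
  \<open>A\<close>.\<close>

lemma emb_P_surj:
  assumes X: "X \<in> carrier P"
    and inv: "!!g h. g \<in> carrier G ==> h \<in> carrier G ==> pact P (g, h) X = X"
  shows "X \<in> emb P ` carrier A"
proof -
  obtain c c' where c: "c \<in> carrier B" "B.tr c = \<one>\<^sub>B" and c': "c' \<in> carrier B'" "B'.tr c' = \<one>\<^sub>B'"
    using B.trace_one B'.trace_one by blast
  have "t1 (t2 (X \<otimes>\<^sub>P pure c c')) = X \<otimes>\<^sub>P pure \<one>\<^sub>B \<one>\<^sub>B'"
    using X inv c c' by (simp add: t_lin t_pure)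
  also have "\<dots> = X" using X by (simp add: one_P[symmetric])
  finally show ?thesis using t12_emb[of "X \<otimes>\<^sub>P pure c c'"] X c c' by simp
qed

text \<open>Elements of trace one split the structure map: x \<otimes> y goes to tr(xc) times
  tr(yc'), the latter read in \<open>A\<close>. This is a well-defined map to \<open>B\<close>
  taking \<open>emb P a\<close> to \<open>emb B a\<close>.\<close>

lemma emb_P_inj: "inj_on (emb P) (carrier A)"
proof -
  obtain c c' where c: "c \<in> carrier B" "B.tr c = \<one>\<^sub>B" and c': "c' \<in> carrier B'" "B'.tr c' = \<one>\<^sub>B'"
    using B.trace_one B'.trace_one by blast
  \<comment> \<open>The inverse of the structure map of \<open>B'\<close> on its image;
    \<open>q\<close> is then a retraction of \<open>B'\<close> onto \<open>A\<close>.\<close>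
  define p where "p x = (THE a. a \<in> carrier A \<and> emb B' a = x)" for x
  have p: "p (emb B' a) = a" if "a \<in> carrier A" for a
    unfolding p_def using that by (intro the_equality) (auto simp: B'.emb_eq_iff)
  define q where "q y = p (B'.tr (y \<otimes>\<^sub>B' c'))" for y
  have q: "q y \<in> carrier A \<and> emb B' (q y) = B'.tr (y \<otimes>\<^sub>B' c')" if y: "y \<in> carrier B'" for y
    using B'.tr_in_emb[of "y \<otimes>\<^sub>B' c'"] y c' by (auto simp: q_def p)
  have q_add: "q (y \<oplus>\<^sub>B' z) = q y \<oplus>\<^sub>A q z" if "y \<in> carrier B'" "z \<in> carrier B'" for y z
    using that q c' B'.emb_eq_iff[of "q (y \<oplus>\<^sub>B' z)" "q y \<oplus>\<^sub>A q z"]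
    by (simp add: B'.emb_add B'.T.l_distr B'.tr_add)
  have q_lin: "q (emb B' r \<otimes>\<^sub>B' y) = r \<otimes>\<^sub>A q y" if "r \<in> carrier A" "y \<in> carrier B'" for r y
    using that q c' B'.emb_eq_iff[of "q (emb B' r \<otimes>\<^sub>B' y)" "r \<otimes>\<^sub>A q y"]
    by (simp add: B'.emb_mult B'.T.m_assoc B'.tr_lin)
  let ?b = "\<lambda>x y. B.tr (x \<otimes>\<^sub>B c) \<otimes>\<^sub>B emb B (q y)"
  have bal: "?b (emb B r \<otimes>\<^sub>B x) y = ?b x (emb B' r \<otimes>\<^sub>B' y)"
    if "r \<in> carrier A" "x \<in> carrier B" "y \<in> carrier B'" for r x y
  proof -
    have "B.tr (emb B r \<otimes>\<^sub>B x \<otimes>\<^sub>B c) = emb B r \<otimes>\<^sub>B B.tr (x \<otimes>\<^sub>B c)"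
      using that c by (simp add: B.T.m_assoc B.tr_lin)
    then show ?thesis using that c q by (simp add: q_lin B.emb_mult B.T.m_ac)
  qed
  obtain L where "!!X. X \<in> carrier P ==> L X \<in> carrier B"
    "!!X Y. X \<in> carrier P ==> Y \<in> carrier P ==> L (X \<oplus>\<^sub>P Y) = L X \<oplus>\<^sub>B L Y"
    and L: "!!s t. s \<in> carrier B ==> t \<in> carrier B' ==> L (pure s t) = ?b s t"
  proof (rule lift_ex[OF B.T.abelian_group_axioms, of ?b])
    show "?b (emb B r \<otimes>\<^sub>B x) y = ?b x (emb B' r \<otimes>\<^sub>B' y)"
      if "r \<in> carrier A" "x \<in> carrier B" "y \<in> carrier B'" for r x y using that by (rule bal)
  qed (use c q in \<open>simp_all add: q_add B.emb_add B.T.l_distr B.T.r_distr B.tr_add\<close>, blast)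
  have "q \<one>\<^sub>B' = \<one>\<^sub>A" using q[of "\<one>\<^sub>B'"] c' B'.emb_eq_iff[of "q \<one>\<^sub>B'" "\<one>\<^sub>A"] by simp
  then have "L (emb P a) = emb B a" if "a \<in> carrier A" for a
    using that c by (simp add: emb_P L B.tr_lin)
  then have "a = b" if "a \<in> carrier A" "b \<in> carrier A" "emb P a = emb P b" for a b
    using that B.emb_eq_iff by metis
  then show ?thesis by (auto intro: inj_onI)
qed

lemma act_P_closed': "\<gamma> \<in> carrier (G \<times>\<times> G) ==> X \<in> carrier P ==> pact P \<gamma> X \<in> carrier P"
  by (cases \<gamma>) (simp add: act_P_closed)

lemma coord_left:
  assumes "coord G B (pact B) f"
  shows "coord (G \<times>\<times> G) P (pact P) (\<lambda>(g, h). pure (f g) \<one>\<^sub>B')"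
  using assms
proof induction
  case (single x y f)
  show ?case by (rule coord.single[of "pure x \<one>\<^sub>B'" _ "pure y \<one>\<^sub>B'"])
    (use single in \<open>auto simp del: set_eq_iff simp: act_pure mult_pure\<close>)
next
  case (add p q f)
  note c = B.coord_T_closed[OF add.hyps(1)] B.coord_T_closed[OF add.hyps(2)]
  show ?case by (rule coord.add[OF add.IH]) (use add.hyps(3) c in \<open>clarsimp simp: pure_add_left\<close>)
qed

lemma coord_right:
  assumes "coord G B' (pact B') f"
  shows "coord (G \<times>\<times> G) P (pact P) (\<lambda>(g, h). pure \<one>\<^sub>B (f h))"
  using assms
proof induction
  case (single x y f)
  show ?case by (rule coord.single[of "pure \<one>\<^sub>B x" _ "pure \<one>\<^sub>B y"])
    (use single in \<open>auto simp del: set_eq_iff simp: act_pure mult_pure\<close>)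
next
  case (add p q f)
  note c = B'.coord_T_closed[OF add.hyps(1)] B'.coord_T_closed[OF add.hyps(2)]
  show ?case by (rule coord.add[OF add.IH]) (use add.hyps(3) c in \<open>clarsimp simp: pure_add_right\<close>)
qed

text \<open>The indicator of (1, 1) is the product of the indicators of g = 1 and h = 1, each pulled
  back from one factor.\<close>

lemma delta_P: "coord (G \<times>\<times> G) P (pact P) (\<lambda>g. if g = \<one>\<^bsub>G \<times>\<times> G\<^esub> then \<one>\<^sub>P else \<zero>\<^sub>P)"
proof (rule Pc.coord_mult[OF coord_left[OF B.delta] coord_right[OF B'.delta]])
  fix \<gamma> x y assume "\<gamma> \<in> carrier (G \<times>\<times> G)" "x \<in> carrier P" "y \<in> carrier P"
  then show "pact P \<gamma> (x \<otimes>\<^sub>P y) = pact P \<gamma> x \<otimes>\<^sub>P pact P \<gamma> y"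
    by (cases \<gamma>) (simp add: act_P_mult)
next
  fix \<gamma> assume "\<gamma> \<in> carrier (G \<times>\<times> G)"
  then show "(if \<gamma> = \<one>\<^bsub>G \<times>\<times> G\<^esub> then \<one>\<^sub>P else \<zero>\<^sub>P) =
    (case \<gamma> of (g, h) \<Rightarrow> pure (if g = \<one>\<^sub>G then \<one>\<^sub>B else \<zero>\<^sub>B) \<one>\<^sub>B') \<otimes>\<^sub>P
    (case \<gamma> of (g, h) \<Rightarrow> pure \<one>\<^sub>B (if h = \<one>\<^sub>G then \<one>\<^sub>B' else \<zero>\<^sub>B'))"
    by (cases \<gamma>) (simp add: pure_zero one_P[symmetric])
qed (rule act_P_closed')

lemma galois_P: "galois (G \<times>\<times> G) k A P"
proof (rule galoisI[OF DirProd_group[OF B.G.group_axioms B.G.group_axioms] P_algebra])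
  show "X \<in> emb P ` carrier A" if "X \<in> carrier P" "!!\<gamma>. \<gamma> \<in> carrier (G \<times>\<times> G) ==> pact P \<gamma> X = X" for X
    using that by (intro emb_P_surj) simp_all
  show "pact P \<gamma> (pact P \<gamma>' x) = pact P (\<gamma> \<otimes>\<^bsub>G \<times>\<times> G\<^esub> \<gamma>') x"
    if "\<gamma> \<in> carrier (G \<times>\<times> G)" "\<gamma>' \<in> carrier (G \<times>\<times> G)" "x \<in> carrier P" for \<gamma> \<gamma>' x
    using that by (cases \<gamma>; cases \<gamma>') (simp add: act_P_comp)
  show "pact P \<gamma> (x \<oplus>\<^sub>P y) = pact P \<gamma> x \<oplus>\<^sub>P pact P \<gamma> y"
    "pact P \<gamma> (x \<otimes>\<^sub>P y) = pact P \<gamma> x \<otimes>\<^sub>P pact P \<gamma> y"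
    if "\<gamma> \<in> carrier (G \<times>\<times> G)" "x \<in> carrier P" "y \<in> carrier P" for \<gamma> x y
    using that by (cases \<gamma>; simp add: act_P_add act_P_mult)+
  show "pdom P \<gamma> = carrier P" if "\<gamma> \<in> carrier (G \<times>\<times> G)" for \<gamma>
    using that by (cases \<gamma>) (simp add: dom_P)
  show "pact P \<gamma> (emb P a) = emb P a" if "\<gamma> \<in> carrier (G \<times>\<times> G)" "a \<in> carrier A" for \<gamma> a
    using that by (cases \<gamma>) (simp add: emb_P act_pure)
  show "coord (G \<times>\<times> G) P (pact P) (\<lambda>g. if g = \<one>\<^bsub>G \<times>\<times> G\<^esub> then \<one>\<^sub>P else \<zero>\<^sub>P)" by (rule delta_P)
qed (simp_all add: B.A.algebra_axioms B.fin emb_P_inj emb_P_hom act_P_closed' act_P_id, simp_all add: emb_P smult_pure B.emb_smult one_P)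

text \<open>Equivariance is compared for one group element at a time, so the target may carry the
  action of a larger group \<Gamma>, as happens in \<open>hp_assoc\<close>.\<close>

lemma lift_equiv:
  assumes W: "galois \<Gamma> k A W" and u: "u \<in> ring_hom B W" and v: "v \<in> ring_hom B' W"
    and L: "L \<in> ring_hom P W" "!!s t. s \<in> carrier B ==> t \<in> carrier B' ==> L (pure s t) = u s \<otimes>\<^sub>W v t"
    and \<gamma>: "\<gamma> \<in> carrier \<Gamma>" "g \<in> carrier G" "h \<in> carrier G"
      "!!s. s \<in> carrier B ==> pact W \<gamma> (u s) = u (pact B g s)"
      "!!t. t \<in> carrier B' ==> pact W \<gamma> (v t) = v (pact B' h t)"
    and X: "X \<in> carrier P"
  shows "L (pact P (g, h) X) = pact W \<gamma> (L X)"
proof -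
  interpret W: galois \<Gamma> k A W by fact
  show ?thesis using X
  proof (induction X rule: P_induct)
    case (pure s t)
    then show ?case using \<gamma> by (simp add: act_pure L W.act_mult ring_hom_closed[OF u] ring_hom_closed[OF v])
  next
    case (add X Y)
    then show ?case using \<gamma> by (simp add: act_P_add act_P_closed ring_hom_add[OF L(1)] ring_hom_closed[OF L(1)] W.act_add)
  qed
qed

lemma emb_pure_left: "a \<in> carrier A ==> pure (emb B a) \<one>\<^sub>B' = emb P a"
  by (simp add: emb_P)

lemma emb_pure_right: "a \<in> carrier A ==> pure \<one>\<^sub>B (emb B' a) = emb P a"
  using pure_emb[of "\<one>\<^sub>A" a] by simp

end

section \<open>The Harrison product as a fixed ring\<close>

lemma (in comm_group) anti_diagonal_eq:
  "{n \<in> carrier (G \<times>\<times> G). (case n of (g, h) \<Rightarrow> g \<otimes> h) = \<one>} = anti_diagonal G"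
proof -
  have "h = inv g" if "g \<in> carrier G" "h \<in> carrier G" "g \<otimes> h = \<one>" for g h
    using that inv_equality[of h g] by (simp add: m_comm)
  then show ?thesis by (auto simp: anti_diagonal_def)
qed

text \<open>For abelian \<open>G\<close> multiplication is a homomorphism from
  \<open>G \<times>\<times> G\<close> onto \<open>G\<close> with the anti-diagonal as kernel. The
  section g \<mapsto> (g, 1) reproduces the identification of the quotient with
  \<open>G\<close>.\<close>

lemma galois_quot_mult:
  fixes G :: "'g monoid"
  assumes "comm_group G" "finite (carrier G)" "galois (G \<times>\<times> G) k A W"
  shows "galois_quot (G \<times>\<times> G) k A W G (\<lambda>(g, h). g \<otimes>\<^sub>G h) (\<lambda>g. (g, \<one>\<^sub>G))"
    and "galois_quot.N (G \<times>\<times> G) G (\<lambda>(g, h). g \<otimes>\<^sub>G h) = anti_diagonal G"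
proof -
  interpret G: comm_group G by fact
  show *: "galois_quot (G \<times>\<times> G) k A W G (\<lambda>(g, h). g \<otimes>\<^sub>G h) (\<lambda>g. (g, \<one>\<^sub>G))"
    by (intro galois_quot.intro assms G.group_axioms galois_quot_axioms.intro) (auto simp: hom_def G.m_ac)
  show "galois_quot.N (G \<times>\<times> G) G (\<lambda>(g, h). g \<otimes>\<^sub>G h) = anti_diagonal G"
    unfolding galois_quot.N_def[OF *] by (rule G.anti_diagonal_eq)
qed

locale harrison = galois_tensor + G: comm_group G
begin

sublocale Q: galois_quot "G \<times>\<times> G" k A P G "\<lambda>(g, h). g \<otimes>\<^sub>G h" "\<lambda>g. (g, \<one>\<^sub>G)"
  rewrites "galois_quot.N (G \<times>\<times> G) G (\<lambda>(g, h). g \<otimes>\<^sub>G h) = anti_diagonal G"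
  using galois_quot_mult[OF G.comm_group_axioms B.fin galois_P] by simp_all

lemma harrison_product_eq: "harrison_product G A B B' = fixed_ext (anti_diagonal G) P (\<lambda>g. (g, \<one>\<^sub>G))"
proof -
  have "anti_diagonal G \<subseteq> carrier (G \<times>\<times> G)" by (auto simp: anti_diagonal_def)
  from gact.invariants_eq[OF galois.axioms(1)[OF galois_P] this] show ?thesis
    by (simp add: harrison_product_def fixed_ext_def Let_def)
qed

lemma galois_hp: "galois G k A (harrison_product G A B B')"
  unfolding harrison_product_eq by (rule Q.galois_V)

end

text \<open>Kernel elements act on the image of \<open>j\<close> as 1 acts on \<open>C\<close>, so
  \<open>j\<close> lands in the fixed ring.\<close>

lemma (in galois_quot) ghom_fixed:
  assumes C: "galois G k A C" and j: "j \<in> ring_hom C W"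
    "!!\<gamma> x. \<gamma> \<in> carrier \<Gamma> ==> x \<in> carrier C ==> j (pact C (\<chi> \<gamma>) x) = pact W \<gamma> (j x)"
    "!!a. a \<in> carrier A ==> j (emb C a) = emb W a"
  shows "ghom G A C V j"
proof -
  interpret C: galois G k A C by fact
  have "j x \<in> carrier V" if "x \<in> carrier C" for x
    unfolding V_carrier
  proof (intro conjI ballI)
    fix n assume n: "n \<in> N"
    show "pact W n (j x) = j x" using j(2)[of n x] n N_sub N_chi that by simp
  qed (rule ring_hom_closed[OF j(1) that])
  moreover have "j (pact C g x) = pact W (\<sigma> g) (j x)" if "g \<in> carrier G" "x \<in> carrier C" for g x
    using j(2)[of "\<sigma> g" x] that by simp
  ultimately show ?thesis unfolding ghom_def using j(3)
    by (auto intro!: ring_hom_memI simp: ring_hom_mult[OF j(1)] ring_hom_add[OF j(1)] ring_hom_one[OF j(1)])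
qed

text \<open>A criterion that avoids computing in tensor products: it suffices to find one Galois
  extension \<open>W\<close> for \<open>G \<times>\<times> G\<close> that receives \<open>B\<close>
  through the first projection, \<open>B'\<close> through the second and \<open>C\<close> through
  multiplication. The induced map from the tensor product to \<open>W\<close> is bijective by
  \<open>ghom_bij\<close>, and \<open>C\<close> is carried back into its fixed ring.\<close>

lemma (in harrison) hp_char:
  assumes C: "galois G k A C" and W: "galois (G \<times>\<times> G) k A W"
    and i: "i \<in> ring_hom B W"
      "!!g h b. g \<in> carrier G ==> h \<in> carrier G ==> b \<in> carrier B ==> i (pact B g b) = pact W (g, h) (i b)"
      "!!a. a \<in> carrier A ==> i (emb B a) = emb W a"
    and i': "i' \<in> ring_hom B' W"
      "!!g h b. g \<in> carrier G ==> h \<in> carrier G ==> b \<in> carrier B' ==> i' (pact B' h b) = pact W (g, h) (i' b)"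
      "!!a. a \<in> carrier A ==> i' (emb B' a) = emb W a"
    and j: "j \<in> ring_hom C W"
      "!!g h c. g \<in> carrier G ==> h \<in> carrier G ==> c \<in> carrier C ==> j (pact C (g \<otimes>\<^sub>G h) c) = pact W (g, h) (j c)"
      "!!a. a \<in> carrier A ==> j (emb C a) = emb W a"
  shows "\<exists>f. ghom G A C (harrison_product G A B B') f"
proof -
  interpret C: galois G k A C by fact
  interpret W: galois "G \<times>\<times> G" k A W by fact
  obtain L where L: "L \<in> ring_hom P W"
    "!!s t. s \<in> carrier B ==> t \<in> carrier B' ==> L (pure s t) = i s \<otimes>\<^sub>W i' t"
    by (rule lift_hom[OF W.T.M_cring i(1) i'(1)]) (auto simp: i i')
  have "L (pact P \<gamma> X) = pact W \<gamma> (L X)" if "\<gamma> \<in> carrier (G \<times>\<times> G)" "X \<in> carrier P" for \<gamma> X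
  proof -
    obtain g h where \<gamma>: "\<gamma> = (g, h)" "g \<in> carrier G" "h \<in> carrier G" using \<open>\<gamma> \<in> carrier (G \<times>\<times> G)\<close> by (cases \<gamma>) auto
    show ?thesis unfolding \<gamma>(1)
      by (rule lift_equiv[OF W i(1) i'(1) L]) (use that \<gamma> in \<open>simp_all add: i(2)[of g h] i'(2)[of g h]\<close>)
  qed
  then have gL: "ghom (G \<times>\<times> G) A P W L"
    using L i(3) by (auto simp: ghom_def emb_P ring_hom_one[OF i'(1)])
  define K where "K = inv_into (carrier P) L"
  have gK: "ghom (G \<times>\<times> G) A W P K" unfolding K_def by (rule ghom_inv[OF galois_P W gL])
  have K: "K \<in> ring_hom W P" "!!\<gamma> x. \<gamma> \<in> carrier (G \<times>\<times> G) ==> x \<in> carrier W ==> K (pact W \<gamma> x) = pact P \<gamma> (K x)"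
     "!!a. a \<in> carrier A ==> K (emb W a) = emb P a"
    using gK by (auto simp: ghom_def)
  have "ghom G A C (fixed_ext (anti_diagonal G) P (\<lambda>g. (g, \<one>\<^sub>G))) (K \<circ> j)"
  proof (rule Q.ghom_fixed[OF C])
    show "K \<circ> j \<in> ring_hom C P" by (rule ring_hom_trans[OF j(1) K(1)])
    show "(K \<circ> j) (pact C (case \<gamma> of (g, h) \<Rightarrow> g \<otimes>\<^sub>G h) x) = pact P \<gamma> ((K \<circ> j) x)"
      if "\<gamma> \<in> carrier (G \<times>\<times> G)" "x \<in> carrier C" for \<gamma> x
      using that K(2)[OF that(1), of "j x"] ring_hom_closed[OF j(1)] by (cases \<gamma>) (simp add: j(2))
  qed (simp add: j(3) K(3))
  then show ?thesis unfolding harrison_product_eq by blast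
qed

text \<open>Here \<open>W\<close> is the tensor product of \<open>B1\<close> and \<open>B1'\<close>.
  It receives \<open>B2\<close> and \<open>B2'\<close> through the inverses of the given maps and
  the first Harrison product by inclusion.\<close>

lemma hp_cong:
  assumes G: "comm_group G" and gal: "galois G k A B1" "galois G k A B1'" "galois G k A B2" "galois G k A B2'"
    and f: "ghom G A B1 B2 f" and f': "ghom G A B1' B2' f'"
  shows "\<exists>h. ghom G A (harrison_product G A B1 B1') (harrison_product G A B2 B2') h"
proof -
  interpret H1: harrison G k A B1 B1' by (intro harrison.intro galois_tensor.intro gal G)
  interpret H2: harrison G k A B2 B2' by (intro harrison.intro galois_tensor.intro gal G)
  have hp1: "harrison_product G A B1 B1' = fixed_ext (anti_diagonal G) H1.P (\<lambda>g. (g, \<one>\<^sub>G))" by (rule H1.harrison_product_eq)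
  obtain p where p: "ghom G A B2 B1 p" using ghom_inv[OF gal(1,3) f] by blast
  obtain p' where p': "ghom G A B2' B1' p'" using ghom_inv[OF gal(2,4) f'] by blast
  note pp = p[unfolded ghom_def] p'[unfolded ghom_def]
  have pc: "p b \<in> carrier B1" if "b \<in> carrier B2" for b using pp that by (auto intro: ring_hom_closed)
  have pc': "p' b \<in> carrier B1'" if "b \<in> carrier B2'" for b using pp that by (auto intro: ring_hom_closed)
  show ?thesis
  proof (rule H2.hp_char[OF H1.galois_hp H1.galois_P])
    show "(\<lambda>s. H1.pure s \<one>\<^sub>B1') \<circ> p \<in> ring_hom B2 H1.P"
      using ring_hom_trans[OF _ H1.pure_hom(1)] pp by blast
    show "(\<lambda>t. H1.pure \<one>\<^sub>B1 t) \<circ> p' \<in> ring_hom B2' H1.P"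
      using ring_hom_trans[OF _ H1.pure_hom(2)] pp by blast
    show "(\<lambda>x. x) \<in> ring_hom (harrison_product G A B1 B1') H1.P"
      unfolding hp1 by (rule ring_hom_memI) (auto simp: H1.Q.V_carrier)
    show "pact (harrison_product G A B1 B1') (g \<otimes>\<^sub>G h) c = pact H1.P (g, h) c"
      if "g \<in> carrier G" "h \<in> carrier G" "c \<in> carrier (harrison_product G A B1 B1')" for g h c
      using that unfolding hp1 by (simp, intro H1.Q.act_chi) simp_all
  qed (use pp in \<open>simp_all add: H1.act_pure pc pc' H1.emb_pure_left H1.emb_pure_right hp1\<close>)
qed

lemma (in harrison) hp_sub_hom: "f \<in> ring_hom P W ==> f \<in> ring_hom (harrison_product G A B B') W"
  unfolding harrison_product_eq
  by (rule ring_hom_memI) (auto simp: Q.V_carrier ring_hom_closed ring_hom_mult ring_hom_add dest: ring_hom_one)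

text \<open>Both bracketings map to the same Galois extension for \<open>G\<close>, the fixed ring
  of the kernel of (a, b, c, d) \<mapsto> abc on a fourfold tensor product. One of these maps is
  inverted by \<open>ghom_inv\<close>.\<close>

lemma hp_assoc:
  assumes G: "comm_group G" and gal: "galois G k A B" "galois G k A B'" "galois G k A B''"
  shows "\<exists>h. ghom G A (harrison_product G A (harrison_product G A B B') B'')
    (harrison_product G A B (harrison_product G A B' B'')) h"
proof -
  interpret G: comm_group G by fact
  let ?C1 = "harrison_product G A B B'" and ?C2 = "harrison_product G A B' B''"
  interpret H1: harrison G k A B B' by (intro harrison.intro galois_tensor.intro gal G)
  interpret H2: harrison G k A B' B'' by (intro harrison.intro galois_tensor.intro gal G)
  interpret D1: harrison G k A ?C1 B'' by (intro harrison.intro galois_tensor.intro gal G H1.galois_hp)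
  interpret D2: harrison G k A B ?C2 by (intro harrison.intro galois_tensor.intro gal G H2.galois_hp)
  \<comment> \<open>The second copy of \<open>B''\<close> is padding: a tensor product in
    \<open>galois_tensor\<close> needs the same group, here \<open>G \<times>\<times> G\<close>, on
    both sides. No embedding uses the fourth factor and \<chi> ignores its coordinate d.\<close>
  interpret X2: galois_tensor G k A B'' B'' by (intro galois_tensor.intro gal)
  interpret W: galois_tensor "G \<times>\<times> G" k A H1.P X2.P by (intro galois_tensor.intro H1.galois_P X2.galois_P)
  let ?\<Gamma> = "(G \<times>\<times> G) \<times>\<times> (G \<times>\<times> G)"
  let ?\<chi> = "\<lambda>((a, b), (c, d)). a \<otimes>\<^sub>G b \<otimes>\<^sub>G c" and ?\<sigma> = "\<lambda>g. ((g, \<one>\<^sub>G), (\<one>\<^sub>G, \<one>\<^sub>G))"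
  interpret Q: galois_quot ?\<Gamma> k A W.P G ?\<chi> ?\<sigma>
    by (intro galois_quot.intro W.galois_P G.group_axioms galois_quot_axioms.intro)
      (auto simp: H1.B.fin hom_def G.m_ac)
  have C1: "?C1 = fixed_ext (anti_diagonal G) H1.P (\<lambda>g. (g, \<one>\<^sub>G))" by (rule H1.harrison_product_eq)
  have C2: "?C2 = fixed_ext (anti_diagonal G) H2.P (\<lambda>g. (g, \<one>\<^sub>G))" by (rule H2.harrison_product_eq)
  have D1: "harrison_product G A ?C1 B'' = fixed_ext (anti_diagonal G) D1.P (\<lambda>g. (g, \<one>\<^sub>G))" by (rule D1.harrison_product_eq)
  have D2: "harrison_product G A B ?C2 = fixed_ext (anti_diagonal G) D2.P (\<lambda>g. (g, \<one>\<^sub>G))" by (rule D2.harrison_product_eq)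
  define iB where "iB = (\<lambda>b. W.pure (H1.pure b \<one>\<^sub>B') \<one>\<^sub>X2.P)"
  define iB' where "iB' = (\<lambda>b. W.pure (H1.pure \<one>\<^sub>B b) \<one>\<^sub>X2.P)"
  define iB'' where "iB'' = (\<lambda>b. W.pure \<one>\<^sub>H1.P (X2.pure b \<one>\<^sub>B''))"
  have iB: "iB \<in> ring_hom B W.P" unfolding iB_def using ring_hom_trans[OF H1.pure_hom(1) W.pure_hom(1)] by (simp add: comp_def)
  have iB': "iB' \<in> ring_hom B' W.P" unfolding iB'_def using ring_hom_trans[OF H1.pure_hom(2) W.pure_hom(1)] by (simp add: comp_def)
  have iB'': "iB'' \<in> ring_hom B'' W.P" unfolding iB''_def using ring_hom_trans[OF X2.pure_hom(1) W.pure_hom(2)] by (simp add: comp_def)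
  have one: "pact H1.P (a, b) \<one>\<^sub>H1.P = \<one>\<^sub>H1.P" "pact X2.P (a, b) \<one>\<^sub>X2.P = \<one>\<^sub>X2.P"
    if "a \<in> carrier G" "b \<in> carrier G" for a b
    using that gact.act_one[OF galois.axioms(1)[OF H1.galois_P], of "(a, b)"] gact.act_one[OF galois.axioms(1)[OF X2.galois_P], of "(a, b)"] by auto
  have cl: "\<one>\<^sub>H1.P \<in> carrier H1.P" "\<one>\<^sub>X2.P \<in> carrier X2.P" by auto
  have act_iB: "pact W.P ((a, b), (c, d)) (iB x) = iB (pact B a x)"
    if "a \<in> carrier G" "b \<in> carrier G" "c \<in> carrier G" "d \<in> carrier G" "x \<in> carrier B" for a b c d x
    using that cl unfolding iB_def by (subst W.act_pure) (simp_all add: H1.act_pure one)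
  have act_iB': "pact W.P ((a, b), (c, d)) (iB' x) = iB' (pact B' b x)"
    if "a \<in> carrier G" "b \<in> carrier G" "c \<in> carrier G" "d \<in> carrier G" "x \<in> carrier B'" for a b c d x
    using that cl unfolding iB'_def by (subst W.act_pure) (simp_all add: H1.act_pure one)
  have act_iB'': "pact W.P ((a, b), (c, d)) (iB'' x) = iB'' (pact B'' c x)"
    if "a \<in> carrier G" "b \<in> carrier G" "c \<in> carrier G" "d \<in> carrier G" "x \<in> carrier B''" for a b c d x
    using that cl unfolding iB''_def by (subst W.act_pure) (simp_all add: X2.act_pure one)
  have emb_iB: "iB (emb B a) = emb W.P a" "iB' (emb B' a) = emb W.P a" "iB'' (emb B'' a) = emb W.P a"
    if "a \<in> carrier A" for a
    using that by (simp_all add: iB_def iB'_def iB''_def H1.emb_pure_left H1.emb_pure_right X2.emb_pure_left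
      W.emb_pure_left W.emb_pure_right)
  have "ghom G A (harrison_product G A ?C1 B'') Q.V j1" if
    j1: "j1 \<in> ring_hom D1.P W.P" "!!s t. s \<in> carrier ?C1 ==> t \<in> carrier B'' ==>
       j1 (D1.pure s t) = W.pure s \<one>\<^sub>X2.P \<otimes>\<^sub>W.P iB'' t" for j1
  proof (rule Q.ghom_fixed[OF D1.galois_hp])
    show "j1 \<in> ring_hom (harrison_product G A ?C1 B'') W.P" by (rule D1.hp_sub_hom[OF j1(1)])
    show "j1 (emb (harrison_product G A ?C1 B'') a) = emb W.P a" if "a \<in> carrier A" for a
      unfolding D1 using that by (simp add: D1.emb_P j1(2) ring_hom_one[OF iB'']) (simp add: C1 W.emb_P)
    fix \<gamma> x assume \<gamma>: "\<gamma> \<in> carrier ?\<Gamma>" and x: "x \<in> carrier (harrison_product G A ?C1 B'')"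
    obtain a b c d where abcd: "\<gamma> = ((a, b), (c, d))" "a \<in> carrier G" "b \<in> carrier G" "c \<in> carrier G" "d \<in> carrier G"
      using \<gamma> by (cases \<gamma>) auto
    have u: "(\<lambda>s. W.pure s \<one>\<^sub>X2.P) \<in> ring_hom ?C1 W.P" by (rule H1.hp_sub_hom[OF W.pure_hom(1)])
    \<comment> \<open>On elements fixed by the anti-diagonal, (a, b) acts as (ab, 1); so the four
      coordinates act on \<open>D1.P\<close> as the pair (ab, c).\<close>
    have eq: "j1 (pact D1.P (a \<otimes>\<^sub>G b, c) x) = pact W.P \<gamma> (j1 x)"
    proof (rule D1.lift_equiv[OF W.galois_P u iB'' j1 \<gamma>])
      fix s assume s: "s \<in> carrier ?C1"
      have "pact W.P \<gamma> (W.pure s \<one>\<^sub>X2.P) = W.pure (pact H1.P (a, b) s) \<one>\<^sub>X2.P"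
        unfolding abcd(1) using s abcd cl by (subst W.act_pure) (simp_all add: one C1 H1.Q.V_carrier)
      also have "pact H1.P (a, b) s = pact H1.P (a \<otimes>\<^sub>G b, \<one>\<^sub>G) s"
        using s abcd by (intro H1.Q.act_chi) (simp_all add: C1)
      finally show "pact W.P \<gamma> (W.pure s \<one>\<^sub>X2.P) = W.pure (pact ?C1 (a \<otimes>\<^sub>G b) s) \<one>\<^sub>X2.P" by (simp add: C1)
    next
      show "x \<in> carrier D1.P" using x by (simp add: D1 D1.Q.V_carrier)
    qed (use abcd in \<open>simp_all add: act_iB''\<close>)
    have "pact (harrison_product G A ?C1 B'') (?\<chi> \<gamma>) x = pact D1.P (a \<otimes>\<^sub>G b \<otimes>\<^sub>G c, \<one>\<^sub>G) x" by (simp add: D1 abcd(1))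
    also have "\<dots> = pact D1.P (a \<otimes>\<^sub>G b, c) x" using x abcd by (intro D1.Q.act_chi) (simp_all add: D1)
    finally show "j1 (pact (harrison_product G A ?C1 B'') (?\<chi> \<gamma>) x) = pact W.P \<gamma> (j1 x)" using eq by simp
  qed
  moreover obtain j1 where "j1 \<in> ring_hom D1.P W.P" "!!s t. s \<in> carrier ?C1 ==> t \<in> carrier B'' ==>
       j1 (D1.pure s t) = W.pure s \<one>\<^sub>X2.P \<otimes>\<^sub>W.P iB'' t"
    by (rule D1.lift_hom[OF W.P_cring H1.hp_sub_hom[OF W.pure_hom(1)] iB'']) (auto simp: emb_iB C1 W.emb_pure_left)
  ultimately have j1: "ghom G A (harrison_product G A ?C1 B'') Q.V j1" by blast
  obtain M where M: "M \<in> ring_hom H2.P W.P" "!!s t. s \<in> carrier B' ==> t \<in> carrier B'' ==>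
       M (H2.pure s t) = iB' s \<otimes>\<^sub>W.P iB'' t"
    by (rule H2.lift_hom[OF W.P_cring iB' iB'']) (auto simp: emb_iB)
  have M_emb: "M (emb H2.P a) = emb W.P a" if "a \<in> carrier A" for a
    using that by (simp add: H2.emb_P M(2) ring_hom_one[OF iB''] emb_iB)
  have M': "M \<in> ring_hom ?C2 W.P" by (rule H2.hp_sub_hom[OF M(1)])
  obtain j2 where j2: "j2 \<in> ring_hom D2.P W.P" "!!s t. s \<in> carrier B ==> t \<in> carrier ?C2 ==>
       j2 (D2.pure s t) = iB s \<otimes>\<^sub>W.P M t"
    by (rule D2.lift_hom[OF W.P_cring iB M']) (auto simp: emb_iB C2 M_emb)
  have "ghom G A (harrison_product G A B ?C2) Q.V j2"
  proof (rule Q.ghom_fixed[OF D2.galois_hp])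
    show "j2 \<in> ring_hom (harrison_product G A B ?C2) W.P" by (rule D2.hp_sub_hom[OF j2(1)])
    show "j2 (emb (harrison_product G A B ?C2) a) = emb W.P a" if "a \<in> carrier A" for a
      unfolding D2 using that by (simp add: D2.emb_P j2(2) ring_hom_one[OF M'] emb_iB)
    fix \<gamma> x assume \<gamma>: "\<gamma> \<in> carrier ?\<Gamma>" and x: "x \<in> carrier (harrison_product G A B ?C2)"
    obtain a b c d where abcd: "\<gamma> = ((a, b), (c, d))" "a \<in> carrier G" "b \<in> carrier G" "c \<in> carrier G" "d \<in> carrier G"
      using \<gamma> by (cases \<gamma>) auto
    have eq: "j2 (pact D2.P (a, b \<otimes>\<^sub>G c) x) = pact W.P \<gamma> (j2 x)"
    proof (rule D2.lift_equiv[OF W.galois_P iB M' j2 \<gamma>])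
      fix s assume s: "s \<in> carrier ?C2"
      have "M (pact H2.P (b, c) s) = pact W.P \<gamma> (M s)"
        by (rule H2.lift_equiv[OF W.galois_P iB' iB'' M \<gamma>]) (use s abcd in \<open>simp_all add: act_iB' act_iB'' C2 H2.Q.V_carrier\<close>)
      also have "pact H2.P (b, c) s = pact H2.P (b \<otimes>\<^sub>G c, \<one>\<^sub>G) s"
        using s abcd by (intro H2.Q.act_chi) (simp_all add: C2)
      finally show "pact W.P \<gamma> (M s) = M (pact ?C2 (b \<otimes>\<^sub>G c) s)" by (simp add: C2)
    next
      show "x \<in> carrier D2.P" using x by (simp add: D2 D2.Q.V_carrier)
    qed (use abcd in \<open>simp_all add: act_iB\<close>)
    have "pact (harrison_product G A B ?C2) (?\<chi> \<gamma>) x = pact D2.P (a \<otimes>\<^sub>G b \<otimes>\<^sub>G c, \<one>\<^sub>G) x" by (simp add: D2 abcd(1))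
    also have "\<dots> = pact D2.P (a, b \<otimes>\<^sub>G c) x" using x abcd by (intro D2.Q.act_chi) (simp_all add: D2 G.m_assoc)
    finally show "j2 (pact (harrison_product G A B ?C2) (?\<chi> \<gamma>) x) = pact W.P \<gamma> (j2 x)" using eq by simp
  qed
  from ghom_inv[OF D2.galois_hp Q.galois_V this] j1 show ?thesis
    using ghom_comp[OF D1.galois_hp Q.galois_V D2.galois_hp] by blast
qed

section \<open>Function algebras: neutral element and inverses\<close>

text \<open>Functions on \<open>G\<close> with values in \<open>B\<close>. The twist \<zeta> adapts
  one construction to several uses: the trivial twist yields the split extension and the neutral
  law, the identity yields inverses. As a bare algebra it also hosts the globalization in
  \<open>globalization_exists\<close>.\<close>

definition fun_ext ::
  "'g monoid \<Rightarrow> ('h \<Rightarrow> 'g) \<Rightarrow> ('k, 't, 'h, 'a) extension \<Rightarrow> ('k, 'g \<Rightarrow> 't, 'g \<times> 'h, 'a) extension" where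
  "fun_ext G \<zeta> B = \<lparr>carrier = carrier G \<rightarrow>\<^sub>E carrier B,
    monoid.mult = (\<lambda>v w. \<lambda>x\<in>carrier G. v x \<otimes>\<^sub>B w x), one = (\<lambda>x\<in>carrier G. \<one>\<^sub>B),
    ring.zero = (\<lambda>x\<in>carrier G. \<zero>\<^sub>B), add = (\<lambda>v w. \<lambda>x\<in>carrier G. v x \<oplus>\<^sub>B w x),
    smult = (\<lambda>c w. \<lambda>x\<in>carrier G. c \<odot>\<^sub>B w x), pdom = (\<lambda>\<gamma>. carrier G \<rightarrow>\<^sub>E carrier B),
    pact = (\<lambda>(g, h) w. \<lambda>x\<in>carrier G. pact B h (w (x \<otimes>\<^sub>G g \<otimes>\<^sub>G \<zeta> h))),
    emb = (\<lambda>a. \<lambda>x\<in>carrier G. emb B a)\<rparr>"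

lemma fun_ext_simps [simp]:
  "carrier (fun_ext G \<zeta> B) = carrier G \<rightarrow>\<^sub>E carrier B"
  "v \<otimes>\<^bsub>fun_ext G \<zeta> B\<^esub> w = (\<lambda>x\<in>carrier G. v x \<otimes>\<^sub>B w x)"
  "\<one>\<^bsub>fun_ext G \<zeta> B\<^esub> = (\<lambda>x\<in>carrier G. \<one>\<^sub>B)" "\<zero>\<^bsub>fun_ext G \<zeta> B\<^esub> = (\<lambda>x\<in>carrier G. \<zero>\<^sub>B)"
  "v \<oplus>\<^bsub>fun_ext G \<zeta> B\<^esub> w = (\<lambda>x\<in>carrier G. v x \<oplus>\<^sub>B w x)"
  "c \<odot>\<^bsub>fun_ext G \<zeta> B\<^esub> w = (\<lambda>x\<in>carrier G. c \<odot>\<^sub>B w x)"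
  "pdom (fun_ext G \<zeta> B) \<gamma> = carrier G \<rightarrow>\<^sub>E carrier B"
  "pact (fun_ext G \<zeta> B) (g, h) w = (\<lambda>x\<in>carrier G. pact B h (w (x \<otimes>\<^sub>G g \<otimes>\<^sub>G \<zeta> h)))"
  "emb (fun_ext G \<zeta> B) a = (\<lambda>x\<in>carrier G. emb B a)"
  by (simp_all add: fun_ext_def)

lemma PiE_app: "v \<in> X \<rightarrow>\<^sub>E Y ==> x \<in> X ==> v x \<in> Y"
  by auto

lemma fun_ext_algebra:
  assumes "group G" "algebra k B"
  shows "algebra k (fun_ext G \<zeta> B)"
proof -
  interpret G: group G by fact
  interpret B: algebra k B by fact
  let ?W = "fun_ext G \<zeta> B"
  have eqI: "v = w" if "v \<in> carrier G \<rightarrow>\<^sub>E carrier B" "w \<in> carrier G \<rightarrow>\<^sub>E carrier B"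
    "!!x. x \<in> carrier G ==> v x = w x" for v w using that by (rule PiE_ext)
  have ag: "abelian_group ?W"
  proof (rule abelian_groupI)
    show "\<exists>y\<in>carrier ?W. y \<oplus>\<^sub>?W x = \<zero>\<^sub>?W" if "x \<in> carrier ?W" for x
      using that by (intro bexI[of _ "\<lambda>z\<in>carrier G. \<ominus>\<^sub>B x z"]) (simp_all add: B.l_neg PiE_app cong: restrict_cong)
  qed ((rule eqI)?, simp_all add: PiE_app B.a_ac)+
  have cr: "cring ?W"
    by (intro cringI ag comm_monoidI; (rule eqI)?; simp add: PiE_app B.m_ac B.l_distr B.r_distr)
  show ?thesis
    by (intro algebraI cr B.R_cring; (rule eqI)?;
        simp add: PiE_app B.smult_l_distr B.smult_r_distr B.smult_assoc1 B.smult_assoc2)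
qed

text \<open>The pair (g, h) is (1, 1) iff h = 1 and g \<zeta>(h) = 1. The coordinates of
  \<open>B\<close>, as constant functions, detect the first condition, the delta functions on
  \<open>G\<close> detect the second, and \<open>coord_mult\<close> combines them.\<close>

lemma fun_ext_galois:
  assumes G: "comm_group G" "finite (carrier G)" and B: "galois H k A B" and \<zeta>: "\<zeta> \<in> hom H G"
  shows "galois (G \<times>\<times> H) k A (fun_ext G \<zeta> B)"
proof -
  interpret G: comm_group G by fact
  interpret B: galois H k A B by fact
  interpret \<zeta>: group_hom H G \<zeta> using \<zeta> by unfold_locales
  let ?W = "fun_ext G \<zeta> B"
  have eqI: "v = w" if "v \<in> carrier G \<rightarrow>\<^sub>E carrier B" "w \<in> carrier G \<rightarrow>\<^sub>E carrier B"
    "!!x. x \<in> carrier G ==> v x = w x" for v w using that by (rule PiE_ext)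
  have alg: "algebra k ?W" by (rule fun_ext_algebra[OF G.group_axioms B.T.algebra_axioms])
  interpret W: algebra k ?W by (rule alg)
  have act: "pact ?W \<gamma> w \<in> carrier ?W" if "\<gamma> \<in> carrier (G \<times>\<times> H)" "w \<in> carrier ?W" for \<gamma> w
    using that by (cases \<gamma>) (auto simp: PiE_app)
  have act_mult: "pact ?W \<gamma> (v \<otimes>\<^sub>?W w) = pact ?W \<gamma> v \<otimes>\<^sub>?W pact ?W \<gamma> w"
    if "\<gamma> \<in> carrier (G \<times>\<times> H)" "v \<in> carrier ?W" "w \<in> carrier ?W" for \<gamma> v w
    using that by (cases \<gamma>) (auto simp: PiE_app B.act_mult intro!: restrict_ext)
  have c1: "coord (G \<times>\<times> H) ?W (pact ?W) (\<lambda>(g, h). \<lambda>x\<in>carrier G. f h)" if "coord H B (pact B) f" for f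
    using that
  proof induction
    case (single x y f)
    show ?case by (rule coord.single[of "\<lambda>z\<in>carrier G. x" _ "\<lambda>z\<in>carrier G. y"])
      (use single in \<open>auto intro!: restrict_ext\<close>)
  next
    case (add p q f)
    show ?case by (rule coord.add[OF add.IH]) (use add.hyps in \<open>auto intro!: restrict_ext\<close>)
  qed
  \<comment> \<open>The sum over z in Z of delta_z times its translate: at x this is 1 exactly if x
    lies in Z and the translation is trivial.\<close>
  have c2: "coord (G \<times>\<times> H) ?W (pact ?W)
    (\<lambda>(g, h). \<lambda>x\<in>carrier G. if x \<in> Z \<and> g \<otimes>\<^sub>G \<zeta> h = \<one>\<^sub>G then \<one>\<^sub>B else \<zero>\<^sub>B)"
    if "finite Z" "Z \<subseteq> carrier G" for Z
    using that
  proof (induction Z rule: finite_induct)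
    case empty
    show ?case by (rule coord.single[of "\<zero>\<^sub>?W" _ "\<zero>\<^sub>?W"]) (auto intro!: restrict_ext)
  next
    case (insert z Z)
    let ?d = "\<lambda>x\<in>carrier G. if x = z then \<one>\<^sub>B else \<zero>\<^sub>B"
    have cancel: "x \<otimes>\<^sub>G g \<otimes>\<^sub>G \<zeta> h = x \<longleftrightarrow> g \<otimes>\<^sub>G \<zeta> h = \<one>\<^sub>G"
      if "x \<in> carrier G" "g \<in> carrier G" "h \<in> carrier H" for x g h
      using that G.l_cancel_one[of x "g \<otimes>\<^sub>G \<zeta> h"] by (simp add: G.m_assoc)
    have 1: "coord (G \<times>\<times> H) ?W (pact ?W) (\<lambda>\<gamma>. ?d \<otimes>\<^sub>?W pact ?W \<gamma> ?d)"
      by (rule coord.single[of ?d _ ?d]) auto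
    have 2: "coord (G \<times>\<times> H) ?W (pact ?W)
      (\<lambda>(g, h). \<lambda>x\<in>carrier G. if x \<in> Z \<and> g \<otimes>\<^sub>G \<zeta> h = \<one>\<^sub>G then \<one>\<^sub>B else \<zero>\<^sub>B)"
      using insert by blast
    show ?case
    proof (rule coord.add[OF 1 2])
      fix \<gamma> assume "\<gamma> \<in> carrier (G \<times>\<times> H)"
      then obtain g h where gh: "\<gamma> = (g, h)" "g \<in> carrier G" "h \<in> carrier H" by (cases \<gamma>) auto
      show "(case \<gamma> of (g, h) \<Rightarrow> \<lambda>x\<in>carrier G. if x \<in> insert z Z \<and> g \<otimes>\<^sub>G \<zeta> h = \<one>\<^sub>G then \<one>\<^sub>B else \<zero>\<^sub>B) =
        ?d \<otimes>\<^sub>?W pact ?W \<gamma> ?d \<oplus>\<^sub>?W (case \<gamma> of (g, h) \<Rightarrow> \<lambda>x\<in>carrier G. if x \<in> Z \<and> g \<otimes>\<^sub>G \<zeta> h = \<one>\<^sub>G then \<one>\<^sub>B else \<zero>\<^sub>B)"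
        using gh insert by (auto simp: cancel intro!: restrict_ext)
    qed
  qed
  have delta: "coord (G \<times>\<times> H) ?W (pact ?W) (\<lambda>\<gamma>. if \<gamma> = \<one>\<^bsub>G \<times>\<times> H\<^esub> then \<one>\<^sub>?W else \<zero>\<^sub>?W)"
    by (rule W.coord_mult[OF c1[OF B.delta] c2[OF G(2) subset_refl] act act_mult])
      (auto intro!: restrict_ext split: if_splits)
  have surj: "w \<in> emb ?W ` carrier A"
    if w: "w \<in> carrier ?W" and inv: "!!\<gamma>. \<gamma> \<in> carrier (G \<times>\<times> H) ==> pact ?W \<gamma> w = w" for w
  proof -
    have const: "w x = w \<one>\<^sub>G" if x: "x \<in> carrier G" for x
    proof -
      have "pact ?W (x, \<one>\<^sub>H) w \<one>\<^sub>G = w \<one>\<^sub>G" using inv[of "(x, \<one>\<^sub>H)"] x by simp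
      then show ?thesis using x w by (simp add: PiE_app)
    qed
    have "w \<one>\<^sub>G \<in> emb B ` carrier A"
    proof (rule B.emb_surj)
      fix h assume h: "h \<in> carrier H"
      have "pact ?W (\<one>\<^sub>G, h) w \<one>\<^sub>G = w \<one>\<^sub>G" using inv[of "(\<one>\<^sub>G, h)"] h by simp
      then show "pact B h (w \<one>\<^sub>G) = w \<one>\<^sub>G" using h const[of "\<zeta> h"] by simp
    qed (use w in \<open>simp add: PiE_app\<close>)
    then obtain a where a: "a \<in> carrier A" "w \<one>\<^sub>G = emb B a" by blast
    have "w = emb ?W a"
    proof (rule eqI)
      show "w x = emb ?W a x" if "x \<in> carrier G" for x using const[OF that] a that by simp
    qed (use w a in simp_all)
    then show ?thesis using a by blast
  qed
  have inj: "inj_on (emb ?W) (carrier A)"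
  proof (rule inj_onI)
    fix a b assume ab: "a \<in> carrier A" "b \<in> carrier A" "emb ?W a = emb ?W b"
    then have "emb ?W a \<one>\<^sub>G = emb ?W b \<one>\<^sub>G" by simp
    then show "a = b" using ab B.emb_eq_iff by simp
  qed
  have comp: "pact ?W \<gamma> (pact ?W \<gamma>' w) = pact ?W (\<gamma> \<otimes>\<^bsub>G \<times>\<times> H\<^esub> \<gamma>') w"
    if c: "\<gamma> \<in> carrier (G \<times>\<times> H)" "\<gamma>' \<in> carrier (G \<times>\<times> H)" "w \<in> carrier ?W" for \<gamma> \<gamma>' w
  proof -
    obtain g h g' h' where gh: "\<gamma> = (g, h)" "\<gamma>' = (g', h')" "g \<in> carrier G" "h \<in> carrier H" "g' \<in> carrier G" "h' \<in> carrier H"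
      using c by (cases \<gamma>; cases \<gamma>') auto
    have "x \<otimes>\<^sub>G g \<otimes>\<^sub>G \<zeta> h \<otimes>\<^sub>G g' \<otimes>\<^sub>G \<zeta> h' = x \<otimes>\<^sub>G (g \<otimes>\<^sub>G g') \<otimes>\<^sub>G (\<zeta> h \<otimes>\<^sub>G \<zeta> h')" if "x \<in> carrier G" for x
      using that gh by (simp add: G.m_ac)
    then show ?thesis using gh c(3) by (auto simp: B.act_comp PiE_app intro!: restrict_ext)
  qed
  show ?thesis
  proof (rule galoisI[OF DirProd_group[OF G.group_axioms B.G.group_axioms] alg])
    show "pact ?W \<gamma> (v \<oplus>\<^sub>?W w) = pact ?W \<gamma> v \<oplus>\<^sub>?W pact ?W \<gamma> w"
      if "\<gamma> \<in> carrier (G \<times>\<times> H)" "v \<in> carrier ?W" "w \<in> carrier ?W" for \<gamma> v w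
      using that by (cases \<gamma>) (auto simp: PiE_app B.act_add intro!: restrict_ext)
    show "pact ?W \<one>\<^bsub>G \<times>\<times> H\<^esub> w = w" if "w \<in> carrier ?W" for w
      using that by (auto intro!: eqI simp: PiE_app)
    show "pact ?W \<gamma> (emb ?W a) = emb ?W a" if "\<gamma> \<in> carrier (G \<times>\<times> H)" "a \<in> carrier A" for \<gamma> a
      using that by (cases \<gamma>) (auto intro!: restrict_ext)
    show "finite (carrier (G \<times>\<times> H))" using G(2) B.fin by simp
    show "coord (G \<times>\<times> H) ?W (pact ?W) (\<lambda>\<gamma>. if \<gamma> = \<one>\<^bsub>G \<times>\<times> H\<^esub> then \<one>\<^sub>?W else \<zero>\<^sub>?W)" by (rule delta)
    show "inj_on (emb ?W) (carrier A)" by (rule inj)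
    show "pact ?W \<gamma> w \<in> carrier ?W" if "\<gamma> \<in> carrier (G \<times>\<times> H)" "w \<in> carrier ?W" for \<gamma> w
      using that by (rule act)
    show "pact ?W \<gamma> (v \<otimes>\<^sub>?W w) = pact ?W \<gamma> v \<otimes>\<^sub>?W pact ?W \<gamma> w"
      if "\<gamma> \<in> carrier (G \<times>\<times> H)" "v \<in> carrier ?W" "w \<in> carrier ?W" for \<gamma> v w using that by (rule act_mult)
    show "pact ?W \<gamma> (pact ?W \<gamma>' w) = pact ?W (\<gamma> \<otimes>\<^bsub>G \<times>\<times> H\<^esub> \<gamma>') w"
      if "\<gamma> \<in> carrier (G \<times>\<times> H)" "\<gamma>' \<in> carrier (G \<times>\<times> H)" "w \<in> carrier ?W" for \<gamma> \<gamma>' w using that by (rule comp)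
    show "w \<in> emb ?W ` carrier A"
      if "w \<in> carrier ?W" "!!\<gamma>. \<gamma> \<in> carrier (G \<times>\<times> H) ==> pact ?W \<gamma> w = w" for w using that by (rule surj)
  qed (auto intro!: restrict_ext simp: B.A.algebra_axioms B.emb_add B.emb_mult B.emb_smult)
qed

definition base_ext :: "('k, 'a) module \<Rightarrow> ('k, 'a, 'g, 'a) extension" where
  "base_ext A = \<lparr>carrier = carrier A, monoid.mult = monoid.mult A, one = \<one>\<^sub>A, ring.zero = \<zero>\<^sub>A,
    add = add A, smult = smult A, pdom = (\<lambda>g. carrier A), pact = (\<lambda>g x. x), emb = (\<lambda>x. x)\<rparr>"

lemma base_ext_simps [simp]:
  "carrier (base_ext A) = carrier A" "monoid.mult (base_ext A) = monoid.mult A" "\<one>\<^bsub>base_ext A\<^esub> = \<one>\<^sub>A"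
  "\<zero>\<^bsub>base_ext A\<^esub> = \<zero>\<^sub>A" "add (base_ext A) = add A" "smult (base_ext A) = smult A"
  "pdom (base_ext A) g = carrier A" "pact (base_ext A) g x = x" "emb (base_ext A) x = x"
  by (simp_all add: base_ext_def)

lemma base_ext_galois:
  assumes "algebra k A" and G: "group G" "carrier G = {\<one>\<^sub>G}"
  shows "galois G k A (base_ext A)"
proof -
  interpret A: algebra k A by fact
  have alg: "algebra k (base_ext A)"
    by (rule algebra_inj[OF assms(1), where \<iota> = "\<lambda>x. x"]) auto
  show ?thesis
  proof (rule galoisI[OF G(1) alg])
    show "coord G (base_ext A) (pact (base_ext A)) (\<lambda>g. if g = \<one>\<^sub>G then \<one>\<^bsub>base_ext A\<^esub> else \<zero>\<^bsub>base_ext A\<^esub>)"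
      by (rule coord.single[of "\<one>\<^sub>A" _ "\<one>\<^sub>A"]) (use G in auto)
  qed (auto simp: assms(1) G(2) inj_on_def)
qed

text \<open>The split extension of functions from \<open>G\<close> to \<open>A\<close>. Passing to
  the fixed ring of the trivial subgroup merely renames the group, from \<open>G\<close> times a
  trivial group to \<open>G\<close>.\<close>

definition triv_ext :: "'g monoid \<Rightarrow> ('k, 'a) module \<Rightarrow> ('k, 'g \<Rightarrow> 'a, 'g, 'a) extension" where
  "triv_ext G A = fixed_ext {(\<one>\<^sub>G, \<one>\<^sub>G)} (fun_ext G (\<lambda>h. \<one>\<^sub>G) (base_ext A)) (\<lambda>g. (g, \<one>\<^sub>G))"

lemma triv_ext_carrier: "group G ==> carrier (triv_ext G A) = carrier G \<rightarrow>\<^sub>E carrier A"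
proof -
  assume "group G"
  then interpret G: group G .
  have "(\<lambda>x\<in>carrier G. w (x \<otimes>\<^sub>G \<one>\<^sub>G \<otimes>\<^sub>G \<one>\<^sub>G)) = w" if w: "w \<in> carrier G \<rightarrow>\<^sub>E carrier A" for w
    by (rule PiE_ext[OF _ w]) (simp_all add: PiE_app[OF w])
  then show ?thesis unfolding triv_ext_def carrier_fixed_ext by simp blast
qed

lemma triv_ext_galois:
  assumes G: "comm_group G" "finite (carrier G)" and "algebra k A"
  shows "galois G k A (triv_ext G A)"
proof -
  interpret G: comm_group G by fact
  let ?H = "G\<lparr>carrier := {\<one>\<^sub>G}\<rparr>"
  have H: "group ?H" by (rule G.subgroup_imp_group[OF G.triv_subgroup])
  have B: "galois ?H k A (base_ext A)" by (rule base_ext_galois[OF assms(3) H]) simp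
  have W: "galois (G \<times>\<times> ?H) k A (fun_ext G (\<lambda>h. \<one>\<^sub>G) (base_ext A))"
    by (rule fun_ext_galois[OF G B]) (auto simp: hom_def)
  interpret Q: galois_quot "G \<times>\<times> ?H" k A "fun_ext G (\<lambda>h. \<one>\<^sub>G) (base_ext A)" G fst "\<lambda>g. (g, \<one>\<^sub>G)"
    by (intro galois_quot.intro W G.group_axioms galois_quot_axioms.intro G) (auto simp: hom_def)
  have "Q.N = {(\<one>\<^sub>G, \<one>\<^sub>G)}" by (auto simp: Q.N_def)
  then show ?thesis using Q.galois_V by (simp add: triv_ext_def)
qed

lemma triv_to_fun:
  assumes G: "comm_group G" and B: "galois H k A B"
  shows "(\<lambda>f. \<lambda>x\<in>carrier G. emb B (f x)) \<in> ring_hom (triv_ext G A) (fun_ext G \<zeta> B)"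
proof -
  interpret G: comm_group G by fact
  interpret B: galois H k A B by fact
  note c = triv_ext_carrier[OF G.group_axioms]
  show ?thesis
    by (rule ring_hom_memI) (unfold c, auto simp: triv_ext_def B.emb_mult B.emb_add PiE_app intro!: restrict_ext)
qed

text \<open>With trivial twist, the split extension enters \<open>W\<close> valuewise,
  \<open>B\<close> as second factor enters by constants, and \<open>B\<close> as prospective product
  enters by b \<mapsto> (x \<mapsto> x(b)), on which (g, h) acts as gh.\<close>

lemma hp_one:
  assumes G: "comm_group G" and B: "galois G k A B"
  shows "\<exists>h. ghom G A B (harrison_product G A (triv_ext G A) B) h"
proof -
  interpret G: comm_group G by fact
  interpret B: galois G k A B by fact
  let ?E = "triv_ext G A" and ?W = "fun_ext G (\<lambda>h. \<one>\<^sub>G) B"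
  have E: "galois G k A ?E" by (rule triv_ext_galois[OF G B.fin B.A.algebra_axioms])
  interpret H: harrison G k A ?E B by (intro harrison.intro galois_tensor.intro E B G)
  have W: "galois (G \<times>\<times> G) k A ?W" by (rule fun_ext_galois[OF G B.fin B]) (auto simp: hom_def)
  note c = triv_ext_carrier[OF G.group_axioms]
  show ?thesis
  proof (rule H.hp_char[OF B W triv_to_fun[OF G B]])
    show "(\<lambda>b. \<lambda>x\<in>carrier G. b) \<in> ring_hom B ?W" by (rule ring_hom_memI) (auto intro!: restrict_ext)
    show "(\<lambda>b. \<lambda>x\<in>carrier G. pact B x b) \<in> ring_hom B ?W"
      by (rule ring_hom_memI) (auto intro!: restrict_ext simp: B.act_mult B.act_add)
  qed (unfold c, auto simp: triv_ext_def B.act_comp G.m_ac PiE_app intro!: restrict_ext)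
qed

text \<open>Represents the inverse class. Commutativity of \<open>G\<close> makes the inverted
  action an action.\<close>

definition opp_ext :: "'g monoid \<Rightarrow> ('k, 't, 'g, 'a) extension \<Rightarrow> ('k, 't, 'g, 'a) extension" where
  "opp_ext G B = B\<lparr>pact := (\<lambda>g. pact B (inv\<^bsub>G\<^esub> g))\<rparr>"

lemma opp_ext_simps [simp]:
  "carrier (opp_ext G B) = carrier B" "monoid.mult (opp_ext G B) = monoid.mult B" "\<one>\<^bsub>opp_ext G B\<^esub> = \<one>\<^sub>B"
  "\<zero>\<^bsub>opp_ext G B\<^esub> = \<zero>\<^sub>B" "add (opp_ext G B) = add B" "smult (opp_ext G B) = smult B"
  "pdom (opp_ext G B) = pdom B" "pact (opp_ext G B) g = pact B (inv\<^bsub>G\<^esub> g)" "emb (opp_ext G B) = emb B"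
  by (simp_all add: opp_ext_def)

lemma opp_ext_galois:
  assumes G: "comm_group G" and B: "galois G k A B"
  shows "galois G k A (opp_ext G B)"
proof -
  interpret G: comm_group G by fact
  interpret B: galois G k A B by fact
  have alg: "algebra k (opp_ext G B)"
    by (rule algebra_inj[OF B.T.algebra_axioms, where \<iota> = "\<lambda>x. x"]) (auto intro: B.T.a_inv_closed)
  have c: "coord G (opp_ext G B) (pact (opp_ext G B)) (\<lambda>g. f (inv\<^bsub>G\<^esub> g))" if "coord G B (pact B) f" for f
    using that
  proof induction
    case (single x y f)
    show ?case by (rule coord.single[of x _ y]) (use single in auto)
  next
    case (add p q f)
    show ?case by (rule coord.add[OF add.IH]) (use add.hyps in auto)
  qed
  have delta: "coord G (opp_ext G B) (pact (opp_ext G B)) (\<lambda>g. if g = \<one>\<^sub>G then \<one>\<^bsub>opp_ext G B\<^esub> else \<zero>\<^bsub>opp_ext G B\<^esub>)"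
    by (rule coord_cong[OF c[OF B.delta]]) (auto simp: G.inv_eq_1_iff)
  have surj: "x \<in> emb B ` carrier A" if "x \<in> carrier B" "!!g. g \<in> carrier G ==> pact B (inv\<^bsub>G\<^esub> g) x = x" for x
  proof (rule B.emb_surj[OF that(1)])
    show "pact B g x = x" if "g \<in> carrier G" for g using \<open>!!g. g \<in> carrier G ==> pact B (inv\<^bsub>G\<^esub> g) x = x\<close>[of "inv\<^bsub>G\<^esub> g"] that by simp
  qed
  show ?thesis
  proof (rule galoisI[OF G.group_axioms alg])
    show "coord G (opp_ext G B) (pact (opp_ext G B)) (\<lambda>g. if g = \<one>\<^sub>G then \<one>\<^bsub>opp_ext G B\<^esub> else \<zero>\<^bsub>opp_ext G B\<^esub>)"
      by (rule delta)
    show "x \<in> emb (opp_ext G B) ` carrier A" if "x \<in> carrier (opp_ext G B)"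
      "!!g. g \<in> carrier G ==> pact (opp_ext G B) g x = x" for x using surj that by simp
    show "pact (opp_ext G B) g (pact (opp_ext G B) h x) = pact (opp_ext G B) (g \<otimes>\<^sub>G h) x"
      if "g \<in> carrier G" "h \<in> carrier G" "x \<in> carrier (opp_ext G B)" for g h x
      using that by (simp add: B.act_comp G.inv_mult)
    show "inj_on (emb (opp_ext G B)) (carrier A)" using B.emb_inj by simp
  qed (simp_all add: B.A.algebra_axioms B.fin B.dom B.act_add B.act_mult B.emb_add B.emb_mult B.emb_smult)
qed

text \<open>With the twist \<zeta>(h) = h, the opposite extension enters by b \<mapsto> (x \<mapsto>
  \<open>inv\<close> x (b)) and \<open>B\<close> by constants. The pair (g, h) shifts the argument
  by gh, which is how the product acts on the split extension.\<close>

lemma hp_inverse: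
  assumes G: "comm_group G" and B: "galois G k A B"
  shows "\<exists>h. ghom G A (triv_ext G A) (harrison_product G A (opp_ext G B) B) h"
proof -
  interpret G: comm_group G by fact
  interpret B: galois G k A B by fact
  let ?E = "triv_ext G A" and ?W = "fun_ext G (\<lambda>h. h) B" and ?O = "opp_ext G B"
  have E: "galois G k A ?E" by (rule triv_ext_galois[OF G B.fin B.A.algebra_axioms])
  have O: "galois G k A ?O" by (rule opp_ext_galois[OF G B])
  interpret H: harrison G k A ?O B by (intro harrison.intro galois_tensor.intro O B G)
  have W: "galois (G \<times>\<times> G) k A ?W" by (rule fun_ext_galois[OF G B.fin B]) (auto simp: hom_def)
  note c = triv_ext_carrier[OF G.group_axioms]
  show ?thesis
  proof (rule H.hp_char[OF E W])
    show "(\<lambda>f. \<lambda>x\<in>carrier G. emb B (f x)) \<in> ring_hom ?E ?W" by (rule triv_to_fun[OF G B])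
    show "(\<lambda>b. \<lambda>x\<in>carrier G. b) \<in> ring_hom B ?W" by (rule ring_hom_memI) (auto intro!: restrict_ext)
    show "(\<lambda>b. \<lambda>x\<in>carrier G. pact B (inv\<^bsub>G\<^esub> x) b) \<in> ring_hom ?O ?W"
      by (rule ring_hom_memI) (auto intro!: restrict_ext simp: B.act_mult B.act_add)
    show "(\<lambda>x\<in>carrier G. pact B (inv\<^bsub>G\<^esub> x) (pact ?O g b)) = pact ?W (g, h) (\<lambda>x\<in>carrier G. pact B (inv\<^bsub>G\<^esub> x) b)"
      if c': "g \<in> carrier G" "h \<in> carrier G" "b \<in> carrier ?O" for g h b
    proof -
      have "pact B (inv\<^bsub>G\<^esub> x) (pact B (inv\<^bsub>G\<^esub> g) b) = pact B h (pact B (inv\<^bsub>G\<^esub> (x \<otimes>\<^sub>G g \<otimes>\<^sub>G h)) b)"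
        if x: "x \<in> carrier G" for x
      proof -
        have "inv\<^bsub>G\<^esub> (x \<otimes>\<^sub>G g \<otimes>\<^sub>G h) = inv\<^bsub>G\<^esub> h \<otimes>\<^sub>G (inv\<^bsub>G\<^esub> x \<otimes>\<^sub>G inv\<^bsub>G\<^esub> g)"
          using c' x by (simp add: G.inv_mult G.m_ac)
        then show ?thesis using c' x by (simp add: B.act_comp)
      qed
      then show ?thesis using c' by (auto intro!: restrict_ext)
    qed
  qed (unfold c, auto simp: triv_ext_def G.m_ac PiE_app intro!: restrict_ext)
qed

section \<open>Globalizations\<close>

context gact
begin

text \<open>That the translates of e generate the unit ideal, stated by annihilators. This form is
  easy to verify and to transport; \<open>full_sum\<close> recovers the representation of 1.\<close>

definition full :: "'t \<Rightarrow> bool" where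
  "full e \<longleftrightarrow> e \<in> carrier T \<and> e \<otimes> e = e \<and>
    (\<forall>z\<in>carrier T. (\<forall>g\<in>carrier G. z \<otimes> pact T g e = \<zero>) \<longrightarrow> z = \<zero>)"

lemma fullD: "full e ==> e \<in> carrier T" "full e ==> e \<otimes> e = e"
  by (auto simp: full_def)

lemma full_zero: "full e ==> z \<in> carrier T ==> (!!g. g \<in> carrier G ==> z \<otimes> pact T g e = \<zero>) ==> z = \<zero>"
  by (auto simp: full_def)

lemma full_one: "full \<one>"
  unfolding full_def by (metis G.one_closed T.one_closed T.r_one act_id)

lemma full_eqI:
  assumes "full e" "t \<in> carrier T" "t' \<in> carrier T"
    "!!g. g \<in> carrier G ==> t \<otimes> pact T g e = t' \<otimes> pact T g e"
  shows "t = t'"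
proof (rule T.minus_zeroD[OF assms(2,3)], rule full_zero[OF assms(1)])
  show "(t \<ominus> t') \<otimes> pact T g e = \<zero>" if "g \<in> carrier G" for g
    using assms(2,3) assms(4)[OF that] fullD[OF assms(1)] that
    by (simp add: T.minus_eq T.l_distr T.l_minus T.r_neg)
qed (use assms in simp)

lemma eps_idem: "full e ==> g \<in> carrier G ==> pact T g e \<otimes> pact T g e = pact T g e"
  using act_mult[of g e e] fullD[of e] by simp

text \<open>If z = 1 - s kills the translates treated so far, giving the next translate m(e) the
  coefficient z leaves the defect z(1 - m(e)), which kills m(e) as well because m(e) is
  idempotent.\<close>

lemma full_sum_aux:
  assumes e: "full e" and "finite X" "X \<subseteq> carrier G"
  shows "\<exists>u. u \<in> X \<rightarrow> carrier T \<and> (\<forall>g\<in>X. (\<one> \<ominus> (\<Oplus>h\<in>X. u h \<otimes> pact T h e)) \<otimes> pact T g e = \<zero>)"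
  using assms(2,3)
proof (induction X rule: finite_induct)
  case empty
  then show ?case by simp
next
  case (insert m X)
  then obtain u where u: "u \<in> X \<rightarrow> carrier T"
    "!!g. g \<in> X ==> (\<one> \<ominus> (\<Oplus>h\<in>X. u h \<otimes> pact T h e)) \<otimes> pact T g e = \<zero>" by blast
  note ec = fullD(1)[OF e]
  define s where "s = (\<Oplus>h\<in>X. u h \<otimes> pact T h e)"
  define z where "z = \<one> \<ominus> s"
  have s: "s \<in> carrier T" unfolding s_def using u insert.prems ec by (intro T.finsum_closed) (auto simp: Pi_iff subset_iff)
  then have z: "z \<in> carrier T" by (simp add: z_def)
  have m: "pact T m e \<in> carrier T" using insert.prems ec by auto
  have sum: "(\<Oplus>h\<in>insert m X. (u(m := z)) h \<otimes> pact T h e) = z \<otimes> pact T m e \<oplus> s"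
  proof -
    have "(\<Oplus>h\<in>insert m X. (u(m := z)) h \<otimes> pact T h e) =
      z \<otimes> pact T m e \<oplus> (\<Oplus>h\<in>X. (u(m := z)) h \<otimes> pact T h e)"
      using insert u z m ec by (subst T.finsum_insert) (auto simp: Pi_iff subset_iff)
    also have "(\<Oplus>h\<in>X. (u(m := z)) h \<otimes> pact T h e) = s"
      unfolding s_def using insert u ec by (intro T.finsum_cong') (auto simp: Pi_iff subset_iff)
    finally show ?thesis .
  qed
  have z': "\<one> \<ominus> (z \<otimes> pact T m e \<oplus> s) = z \<ominus> z \<otimes> pact T m e"
    unfolding z_def using s m by (simp add: T.minus_eq T.minus_add T.a_ac)
  have "(\<one> \<ominus> (z \<otimes> pact T m e \<oplus> s)) \<otimes> pact T g e = \<zero>" if g: "g \<in> insert m X" for g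
  proof -
    have gc: "g \<in> carrier G" using g insert.prems by auto
    have "(z \<ominus> z \<otimes> pact T m e) \<otimes> pact T g e = z \<otimes> pact T g e \<ominus> z \<otimes> pact T m e \<otimes> pact T g e"
      using z m gc ec by (simp add: T.minus_eq T.l_distr T.l_minus)
    also have "\<dots> = \<zero>"
    proof (cases "g = m")
      case True
      have "z \<otimes> pact T m e \<otimes> pact T m e = z \<otimes> pact T m e"
        using z m True gc e by (simp add: T.m_assoc eps_idem)
      then show ?thesis using True z m by (simp add: T.minus_eq T.r_neg)
    next
      case False
      then have 0: "z \<otimes> pact T g e = \<zero>" using u(2) g by (simp add: z_def s_def)
      have "z \<otimes> pact T m e \<otimes> pact T g e = (z \<otimes> pact T g e) \<otimes> pact T m e"
        using z m gc ec by (simp add: T.m_ac)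
      then show ?thesis using 0 m by (simp add: T.minus_eq)
    qed
    finally show ?thesis unfolding z' .
  qed
  then show ?case unfolding sum[symmetric] using u z by (intro exI[of _ "u(m := z)"]) auto
qed

lemma full_sum:
  assumes e: "full e"
  shows "\<exists>u. u \<in> carrier G \<rightarrow> carrier T \<and> \<one> = (\<Oplus>h\<in>carrier G. u h \<otimes> pact T h e)"
proof -
  obtain u where u: "u \<in> carrier G \<rightarrow> carrier T"
    "!!g. g \<in> carrier G ==> (\<one> \<ominus> (\<Oplus>h\<in>carrier G. u h \<otimes> pact T h e)) \<otimes> pact T g e = \<zero>"
    using full_sum_aux[OF e fin subset_refl] by blast
  have c: "(\<Oplus>h\<in>carrier G. u h \<otimes> pact T h e) \<in> carrier T"
    using u fullD[OF e] by (intro T.finsum_closed) (auto simp: Pi_iff)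
  have "\<one> \<ominus> (\<Oplus>h\<in>carrier G. u h \<otimes> pact T h e) = \<zero>" by (rule full_zero[OF e]) (use u c in auto)
  then have "\<one> = (\<Oplus>h\<in>carrier G. u h \<otimes> pact T h e)" by (rule T.minus_zeroD[OF T.one_closed c])
  with u show ?thesis by blast
qed

text \<open>Gluing of local data. With 1 written as the sum of the u_g g(e), the element t is the
  sum of the u_g s_g: by compatibility u_g s_g h(e) = u_g g(e) s_h, and these terms add up to
  s_h.\<close>

lemma patch:
  assumes e: "full e" and s: "!!g. g \<in> carrier G ==> s g \<in> carrier T"
    "!!g. g \<in> carrier G ==> s g \<otimes> pact T g e = s g"
    "!!g h. g \<in> carrier G ==> h \<in> carrier G ==> s g \<otimes> pact T h e = s h \<otimes> pact T g e"
  shows "\<exists>t\<in>carrier T. \<forall>h\<in>carrier G. t \<otimes> pact T h e = s h"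
proof -
  obtain u where u: "u \<in> carrier G \<rightarrow> carrier T" "\<one> = (\<Oplus>h\<in>carrier G. u h \<otimes> pact T h e)"
    using full_sum[OF e] by blast
  note ec = fullD(1)[OF e]
  let ?t = "\<Oplus>g\<in>carrier G. u g \<otimes> s g"
  have "?t \<otimes> pact T h e = s h" if h: "h \<in> carrier G" for h
  proof -
    have 1: "u g \<otimes> s g \<otimes> pact T h e = u g \<otimes> pact T g e \<otimes> s h" if g: "g \<in> carrier G" for g
    proof -
      have "u g \<otimes> s g \<otimes> pact T h e = u g \<otimes> (s h \<otimes> pact T g e)"
        using g h u s(1) ec s(3)[OF g h] by (simp add: T.m_assoc Pi_iff)
      also have "\<dots> = u g \<otimes> pact T g e \<otimes> s h" using g h u s(1) ec by (simp add: T.m_ac Pi_iff)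
      finally show ?thesis .
    qed
    have "?t \<otimes> pact T h e = (\<Oplus>g\<in>carrier G. u g \<otimes> s g \<otimes> pact T h e)"
      using h u s(1) ec by (intro T.finsum_ldistr fin) (auto simp: Pi_iff)
    also have "\<dots> = (\<Oplus>g\<in>carrier G. u g \<otimes> pact T g e \<otimes> s h)"
      using h u s(1) ec by (intro T.finsum_cong') (auto simp: Pi_iff 1)
    also have "\<dots> = (\<Oplus>g\<in>carrier G. u g \<otimes> pact T g e) \<otimes> s h"
      using h u s(1) ec by (intro T.finsum_ldistr[symmetric] fin) (auto simp: Pi_iff)
    also have "\<dots> = s h" using s(1) h by (simp add: u(2)[symmetric])
    finally show ?thesis .
  qed
  moreover have "?t \<in> carrier T" using u s(1) by (intro T.finsum_closed) auto
  ultimately show ?thesis by blast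
qed

lemma full_inv_eqI:
  assumes e: "full e" and t: "t \<in> carrier T" "!!g. g \<in> carrier G ==> pact T g t = t"
    and t': "t' \<in> carrier T" "!!g. g \<in> carrier G ==> pact T g t' = t'" and "t \<otimes> e = t' \<otimes> e"
  shows "t = t'"
proof (rule full_eqI[OF e t(1) t'(1)])
  fix g assume g: "g \<in> carrier G"
  have "t \<otimes> pact T g e = pact T g (t \<otimes> e)" using t g fullD[OF e] by (simp add: act_mult)
  also have "\<dots> = t' \<otimes> pact T g e" using assms(6) t' g fullD[OF e] by (simp add: act_mult)
  finally show "t \<otimes> pact T g e = t' \<otimes> pact T g e" .
qed

text \<open>The family h(s) is compatible precisely by the invariance of s under the partial action,
  and the glued element is invariant because its translates glue the same family. This lifts the
  invariants of eT to those of T.\<close>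

lemma patch_inv:
  assumes e: "full e" and s: "s \<in> carrier T" "s \<otimes> e = s"
    "!!g. g \<in> carrier G ==> pact T g s \<otimes> e = s \<otimes> pact T g e"
  shows "\<exists>t\<in>carrier T. (\<forall>g\<in>carrier G. pact T g t = t) \<and> t \<otimes> e = s"
proof -
  note ec = fullD(1)[OF e]
  have "\<exists>t\<in>carrier T. \<forall>h\<in>carrier G. t \<otimes> pact T h e = pact T h s"
  proof (rule patch[OF e])
    fix g assume g: "g \<in> carrier G"
    show "pact T g s \<in> carrier T" using g s by simp
    show "pact T g s \<otimes> pact T g e = pact T g s" using g s ec by (simp add: act_mult[symmetric])
    fix h assume h: "h \<in> carrier G"
    have "pact T g s \<otimes> pact T h e = pact T g (s \<otimes> pact T (inv\<^bsub>G\<^esub> g \<otimes>\<^sub>G h) e)"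
      using g h s ec by (simp add: act_mult act_comp G.m_assoc[symmetric])
    also have "\<dots> = pact T g (pact T (inv\<^bsub>G\<^esub> g \<otimes>\<^sub>G h) s \<otimes> e)" using g h s by simp
    also have "\<dots> = pact T h s \<otimes> pact T g e"
      using g h s(1) ec by (simp add: act_mult act_comp G.m_assoc[symmetric])
    finally show "pact T g s \<otimes> pact T h e = pact T h s \<otimes> pact T g e" .
  qed
  then obtain t where t: "t \<in> carrier T" "!!h. h \<in> carrier G ==> t \<otimes> pact T h e = pact T h s" by blast
  have "pact T g t = t" if g: "g \<in> carrier G" for g
  proof (rule full_eqI[OF e])
    fix h assume h: "h \<in> carrier G"
    have "pact T g t \<otimes> pact T h e = pact T g (t \<otimes> pact T (inv\<^bsub>G\<^esub> g \<otimes>\<^sub>G h) e)"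
      using g h t(1) ec by (simp add: act_mult act_comp G.m_assoc[symmetric])
    also have "\<dots> = t \<otimes> pact T h e" using g h t s(1) by (simp add: act_comp G.m_assoc[symmetric])
    finally show "pact T g t \<otimes> pact T h e = t \<otimes> pact T h e" .
  qed (use t g in auto)
  moreover have "t \<otimes> e = s" using t(2)[of "\<one>\<^sub>G"] ec s by simp
  ultimately show ?thesis using t by blast
qed

end

lemma global_action_gact:
  assumes "global_action G k T" "finite (carrier G)"
  shows "gact G k T"
proof -
  interpret global_action G k T by fact
  have hom: "pact T g \<in> nonunital_alg_hom k T (carrier T) T (carrier T)" if "g \<in> carrier G" for g
    using pact_hom[OF that] that by (simp add: global)
  show ?thesis
  proof (rule gact.intro[OF _ _ gact_axioms.intro])
    show "pact T g (pact T h x) = pact T (g \<otimes>\<^sub>G h) x"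
      if "g \<in> carrier G" "h \<in> carrier G" "x \<in> carrier T" for g h x
    proof (rule pact_mult)
      have "pact T (inv\<^bsub>G\<^esub> h) ` carrier T = carrier T"
        using pact_bij[of "inv\<^bsub>G\<^esub> h"] that by (simp add: global bij_betw_def)
      then show "x \<in> pact T (inv\<^bsub>G\<^esub> h) ` (pdom T h \<inter> pdom T (inv\<^bsub>G\<^esub> g))"
        using that by (simp add: global)
    qed (use that in auto)
  qed (use hom pact_one assms(2) in \<open>auto simp: nonunital_alg_hom_def Pi_iff global G.group_axioms S.algebra_axioms\<close>)
qed

lemma global_action_smult:
  assumes "global_action G k T" "g \<in> carrier G" "c \<in> carrier k" "x \<in> carrier T"
  shows "pact T g (c \<odot>\<^sub>T x) = c \<odot>\<^sub>T pact T g x"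
proof -
  interpret global_action G k T by fact
  show ?thesis using pact_hom[OF assms(2)] assms by (simp add: global nonunital_alg_hom_def)
qed

text \<open>Everything is expressed by the idempotent e: S is eT, its translate by g is g(e)T, and
  S_g is their intersection. That the translates add up to T is \<open>full_sum\<close> in
  disguise.\<close>

lemma globalizationI:
  fixes G :: "'g monoid" and k :: "'k ring" and T :: "('k, 't, 'g, 'z) partial_algebra_scheme" (structure)
  assumes ga: "global_action G k T" and fin: "finite (carrier G)" and full: "gact.full G T e"
    and hom: "\<iota> \<in> nonunital_alg_hom k S (carrier S) T (carrier T)" and inj: "inj_on \<iota> (carrier S)"
    and range: "\<iota> ` carrier S = {t \<in> carrier T. t \<otimes> e = t}"
    and pdom: "!!g. g \<in> carrier G ==> pdom S g = {x \<in> carrier S. \<iota> x \<otimes> pact T g e = \<iota> x}"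
    and act: "!!g x. g \<in> carrier G ==> x \<in> pdom S (inv\<^bsub>G\<^esub> g) ==> pact T g (\<iota> x) = \<iota> (pact S g x)"
  shows "globalization G k S T \<iota>"
proof -
  interpret gact G k T by (rule global_action_gact[OF ga fin])
  note ee = fullD[OF full]
  have io: "\<iota> x \<in> carrier T" if "x \<in> carrier S" for x using range that by blast
  have shift: "pact T g ` \<iota> ` carrier S = {t \<in> carrier T. t \<otimes> pact T g e = t}" if g: "g \<in> carrier G" for g
    unfolding range
  proof (intro equalityI subsetI)
    fix t assume "t \<in> pact T g ` {t \<in> carrier T. t \<otimes> e = t}"
    then obtain u where u: "t = pact T g u" "u \<in> carrier T" "u \<otimes> e = u" by blast
    have "pact T g u \<otimes> pact T g e = pact T g (u \<otimes> e)" using g u(2) ee by (simp add: act_mult)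
    then show "t \<in> {t \<in> carrier T. t \<otimes> pact T g e = t}" using u g by simp
  next
    fix t assume t: "t \<in> {t \<in> carrier T. t \<otimes> pact T g e = t}"
    let ?u = "pact T (inv\<^bsub>G\<^esub> g) t"
    have "pact T (inv\<^bsub>G\<^esub> g) (t \<otimes> pact T g e) = ?u \<otimes> e" using g t ee act_mult[of "inv\<^bsub>G\<^esub> g" t "pact T g e"] by simp
    then have "?u \<otimes> e = ?u" using t by simp
    then have "?u \<in> {t \<in> carrier T. t \<otimes> e = t}" using g t by simp
    moreover have "t = pact T g ?u" using g t by simp
    ultimately show "t \<in> pact T g ` {t \<in> carrier T. t \<otimes> e = t}" by blast
  qed
  have gen: "\<exists>s. t = (\<Oplus>g\<in>carrier G. pact T g (\<iota> (s g))) \<and> s \<in> carrier G \<rightarrow> carrier S" if t: "t \<in> carrier T" for t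
  proof -
    obtain u where u: "u \<in> carrier G \<rightarrow> carrier T" "\<one> = (\<Oplus>h\<in>carrier G. u h \<otimes> pact T h e)"
      using full_sum[OF full] by blast
    have uc: "u g \<in> carrier T" if "g \<in> carrier G" for g using u(1) that by auto
    \<comment> \<open>Chosen such that g takes it to t u_g g(e), the g-th term of t times the
      representation of 1.\<close>
    let ?v = "\<lambda>g. pact T (inv\<^bsub>G\<^esub> g) (t \<otimes> u g) \<otimes> e"
    have v: "?v g \<in> \<iota> ` carrier S" if "g \<in> carrier G" for g
      unfolding range using that uc t ee by (simp add: T.m_assoc)
    let ?s = "\<lambda>g. inv_into (carrier S) \<iota> (?v g)"
    have s: "?s g \<in> carrier S" "\<iota> (?s g) = ?v g" if "g \<in> carrier G" for g
      using v[OF that] by (rule inv_into_into, rule f_inv_into_f)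
    have eq: "pact T g (\<iota> (?s g)) = t \<otimes> (u g \<otimes> pact T g e)" if g: "g \<in> carrier G" for g
      unfolding s(2)[OF g] using g uc t ee by (simp add: act_mult T.m_assoc)
    have "t = t \<otimes> (\<Oplus>h\<in>carrier G. u h \<otimes> pact T h e)" using t by (simp add: u(2)[symmetric])
    also have "\<dots> = (\<Oplus>h\<in>carrier G. t \<otimes> (u h \<otimes> pact T h e))"
      using t uc ee by (intro T.finsum_rdistr fin) auto
    also have "\<dots> = (\<Oplus>g\<in>carrier G. pact T g (\<iota> (?s g)))"
      using t uc ee s(1) io by (intro T.finsum_cong' refl) (auto simp only: eq Pi_iff intro: act_closed)
    finally show ?thesis using s(1) by (intro exI[of _ ?s]) auto
  qed
  show ?thesis
    unfolding globalization_def
  proof (intro conjI ballI ga hom inj act)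
    show "ideal (\<iota> ` carrier S) T"
      unfolding range
    proof (rule idealI[OF T.ring_axioms])
      show "subgroup {t \<in> carrier T. t \<otimes> e = t} (add_monoid T)"
        by (rule T.add.subgroupI) (use ee in \<open>auto simp: T.l_distr T.l_minus intro: exI[of _ e]\<close>)
      show "x \<otimes> a \<in> {t \<in> carrier T. t \<otimes> e = t}" "a \<otimes> x \<in> {t \<in> carrier T. t \<otimes> e = t}"
        if "a \<in> {t \<in> carrier T. t \<otimes> e = t}" "x \<in> carrier T" for a x
        using that ee by (auto simp: T.m_assoc T.m_comm[of a x])
    qed
    show "\<iota> ` pdom S g = \<iota> ` carrier S \<inter> pact T g ` \<iota> ` carrier S" if g: "g \<in> carrier G" for g
      unfolding shift[OF g] using g io by (auto simp: pdom)
    show "carrier T = {(\<Oplus>g\<in>carrier G. pact T g (\<iota> (s g))) |s. s \<in> carrier G \<rightarrow> carrier S}"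
    proof (intro equalityI subsetI)
      fix t assume "t \<in> {(\<Oplus>g\<in>carrier G. pact T g (\<iota> (s g))) |s. s \<in> carrier G \<rightarrow> carrier S}"
      then show "t \<in> carrier T" by (auto intro!: T.finsum_closed simp: Pi_iff io)
    qed (use gen in blast)
  qed
qed

section \<open>Unital partial actions\<close>

context unital_partial_action
begin

lemma idem_generates_unique:
  assumes "idem_generates S g e" "idem_generates S g e'"
  shows "e = e'"
proof -
  have e: "e \<in> carrier S" "e \<otimes>\<^sub>S e = e" "e' \<in> carrier S" "e' \<otimes>\<^sub>S e' = e'"
    and eq: "(\<lambda>s. s \<otimes>\<^sub>S e) ` carrier S = (\<lambda>s. s \<otimes>\<^sub>S e') ` carrier S"
    using assms by (auto simp: idem_generates_def)
  have "e \<in> (\<lambda>s. s \<otimes>\<^sub>S e') ` carrier S" using e eq by (metis imageI)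
  then have 1: "e \<otimes>\<^sub>S e' = e" using e by (auto simp: S.m_assoc)
  have "e' \<in> (\<lambda>s. s \<otimes>\<^sub>S e) ` carrier S" using e eq by (metis imageI)
  then have "e' \<otimes>\<^sub>S e = e'" using e by (auto simp: S.m_assoc)
  with 1 e show ?thesis by (simp add: S.m_comm)
qed

lemma pone_generates: "g \<in> carrier G ==> idem_generates S g (pone S g)"
  unfolding pone_def using unital[of g] idem_generates_unique[of g] by (metis theI)

lemma pone_eqI: "g \<in> carrier G ==> idem_generates S g e ==> pone S g = e"
  using idem_generates_unique pone_generates by blast

lemma pone_closed [simp, intro]: "g \<in> carrier G ==> pone S g \<in> carrier S"
  and pone_idem [simp]: "g \<in> carrier G ==> pone S g \<otimes>\<^sub>S pone S g = pone S g"
  using pone_generates[of g] by (auto simp: idem_generates_def)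

lemma pdom_iff: "g \<in> carrier G ==> x \<in> pdom S g \<longleftrightarrow> x \<in> carrier S \<and> x \<otimes>\<^sub>S pone S g = x"
proof -
  assume g: "g \<in> carrier G"
  have p: "pdom S g = (\<lambda>s. s \<otimes>\<^sub>S pone S g) ` carrier S"
    using pone_generates[OF g] by (simp add: idem_generates_def)
  show ?thesis unfolding p using g by (auto simp: S.m_assoc image_iff) metis
qed

lemma pone_pdom: "g \<in> carrier G ==> x \<in> carrier S ==> x \<otimes>\<^sub>S pone S g \<in> pdom S g"
  by (simp add: pdom_iff S.m_assoc)

lemma pact_homD:
  assumes "g \<in> carrier G" "x \<in> pdom S (inv\<^bsub>G\<^esub> g)"
  shows "pact S g x \<in> pdom S g" "y \<in> pdom S (inv\<^bsub>G\<^esub> g) ==> pact S g (x \<oplus>\<^sub>S y) = pact S g x \<oplus>\<^sub>S pact S g y"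
    "y \<in> pdom S (inv\<^bsub>G\<^esub> g) ==> pact S g (x \<otimes>\<^sub>S y) = pact S g x \<otimes>\<^sub>S pact S g y"
    "c \<in> carrier k ==> pact S g (c \<odot>\<^sub>S x) = c \<odot>\<^sub>S pact S g x"
  using pact_hom[OF assms(1)] assms(2) by (auto simp: nonunital_alg_hom_def)

text \<open>The partial map of g, made total by cutting its argument down to the domain. It is the
  expression in the definitions of invariants and of Galois coordinates, and it is additive and
  multiplicative on all of S.\<close>

definition tot where "tot g x = pact S g (x \<otimes>\<^sub>S pone S (inv\<^bsub>G\<^esub> g))"

lemma tot_pdom: "g \<in> carrier G ==> x \<in> carrier S ==> tot g x \<in> pdom S g"
  unfolding tot_def by (intro pact_homD pone_pdom) auto

lemma tot_closed [simp, intro]: "g \<in> carrier G ==> x \<in> carrier S ==> tot g x \<in> carrier S"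
  and tot_pone [simp]: "g \<in> carrier G ==> x \<in> carrier S ==> tot g x \<otimes>\<^sub>S pone S g = tot g x"
  using tot_pdom[of g x] by (auto simp: pdom_iff)

lemma coord_tot_iff: "coord G S tot f \<longleftrightarrow>
  (\<exists>(m::nat) x y. x \<in> {..<m} \<rightarrow> carrier S \<and> y \<in> {..<m} \<rightarrow> carrier S \<and>
    (\<forall>g\<in>carrier G. (\<Oplus>\<^sub>S i\<in>{..<m}. x i \<otimes>\<^sub>S pact S g (y i \<otimes>\<^sub>S pone S (inv\<^bsub>G\<^esub> g))) = f g))"
  unfolding tot_def[symmetric] by (rule S.coord_iff) (rule tot_closed)

lemma tot_pact: "g \<in> carrier G ==> x \<in> pdom S (inv\<^bsub>G\<^esub> g) ==> tot g x = pact S g x"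
  by (simp add: tot_def pdom_iff)

lemma tot_add: "[|g \<in> carrier G; x \<in> carrier S; y \<in> carrier S|] ==> tot g (x \<oplus>\<^sub>S y) = tot g x \<oplus>\<^sub>S tot g y"
  unfolding tot_def by (simp add: S.l_distr pact_homD pone_pdom)

lemma tot_mult: "[|g \<in> carrier G; x \<in> carrier S; y \<in> carrier S|] ==> tot g (x \<otimes>\<^sub>S y) = tot g x \<otimes>\<^sub>S tot g y"
proof -
  assume g: "g \<in> carrier G" and x: "x \<in> carrier S" and y: "y \<in> carrier S"
  let ?p = "pone S (inv\<^bsub>G\<^esub> g)"
  have "x \<otimes>\<^sub>S y \<otimes>\<^sub>S ?p = (x \<otimes>\<^sub>S ?p) \<otimes>\<^sub>S (y \<otimes>\<^sub>S ?p)"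
  proof -
    have "(x \<otimes>\<^sub>S ?p) \<otimes>\<^sub>S (y \<otimes>\<^sub>S ?p) = (x \<otimes>\<^sub>S y) \<otimes>\<^sub>S (?p \<otimes>\<^sub>S ?p)"
      using g x y by (simp add: S.m_ac del: pone_idem)
    then show ?thesis using g by simp
  qed
  then show ?thesis unfolding tot_def using g x y by (simp add: pact_homD pone_pdom)
qed

lemma tot_smult: "[|g \<in> carrier G; c \<in> carrier k; x \<in> carrier S|] ==> tot g (c \<odot>\<^sub>S x) = c \<odot>\<^sub>S tot g x"
  unfolding tot_def by (simp add: S.smult_assoc2 pact_homD pone_pdom)

lemma pdom_one': "pone S \<one>\<^sub>G = \<one>\<^sub>S"
  by (rule pone_eqI) (auto simp: idem_generates_def pdom_one)

lemma tot_id [simp]: "x \<in> carrier S ==> tot \<one>\<^sub>G x = x"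
  by (simp add: tot_def pdom_one' pact_one)

lemma tot_one: "g \<in> carrier G ==> tot g \<one>\<^sub>S = pone S g"
proof -
  assume g: "g \<in> carrier G"
  have "pone S g \<in> pact S g ` pdom S (inv\<^bsub>G\<^esub> g)"
    using pact_bij[OF g] g by (simp add: bij_betw_def pdom_iff)
  then obtain y where y: "y \<in> pdom S (inv\<^bsub>G\<^esub> g)" "pone S g = tot g y" using g by (auto simp: tot_pact)
  have "tot g \<one>\<^sub>S = tot g \<one>\<^sub>S \<otimes>\<^sub>S tot g y" using g by (simp add: y(2)[symmetric])
  also have "\<dots> = tot g y" using g y by (simp add: tot_mult[symmetric] pdom_iff)
  finally show ?thesis using y by simp
qed

lemma pact_inverse:
  assumes "g \<in> carrier G" "x \<in> pdom S (inv\<^bsub>G\<^esub> g)"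
  shows "pact S (inv\<^bsub>G\<^esub> g) (pact S g x) = x"
proof -
  have "pact S (inv\<^bsub>G\<^esub> g) ` pdom S g = pdom S (inv\<^bsub>G\<^esub> g)"
    using pact_bij[of "inv\<^bsub>G\<^esub> g"] assms by (simp add: bij_betw_def)
  then have "pact S (inv\<^bsub>G\<^esub> g) (pact S g x) = pact S (inv\<^bsub>G\<^esub> g \<otimes>\<^sub>G g) x"
    using assms by (intro pact_mult) auto
  then show ?thesis using assms by (simp add: pact_one pdom_iff)
qed

text \<open>The image axiom identifies two ideals with the identities 1_{g^-1} 1_h and 1_g 1_{gh}; a
  multiplicative bijection between them matches the identities.\<close>

lemma tot_pone_eq:
  assumes g: "g \<in> carrier G" and h: "h \<in> carrier G"
  shows "tot g (pone S h) = pone S g \<otimes>\<^sub>S pone S (g \<otimes>\<^sub>G h)"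
proof -
  let ?a = "pone S (inv\<^bsub>G\<^esub> g) \<otimes>\<^sub>S pone S h" and ?b = "pone S g \<otimes>\<^sub>S pone S (g \<otimes>\<^sub>G h)"
  have mem: "x \<in> pdom S (inv\<^bsub>G\<^esub> g) \<inter> pdom S h \<longleftrightarrow> x \<in> carrier S \<and> x \<otimes>\<^sub>S pone S (inv\<^bsub>G\<^esub> g) = x \<and> x \<otimes>\<^sub>S pone S h = x"
    "x \<in> pdom S g \<inter> pdom S (g \<otimes>\<^sub>G h) \<longleftrightarrow> x \<in> carrier S \<and> x \<otimes>\<^sub>S pone S g = x \<and> x \<otimes>\<^sub>S pone S (g \<otimes>\<^sub>G h) = x" for x
    using g h by (auto simp: pdom_iff)
  have a_in: "?a \<in> pdom S (inv\<^bsub>G\<^esub> g) \<inter> pdom S h" unfolding mem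
  proof (intro conjI)
    show "?a \<otimes>\<^sub>S pone S (inv\<^bsub>G\<^esub> g) = ?a"
      using g h S.m_assoc[of "pone S h" "pone S (inv\<^bsub>G\<^esub> g)" "pone S (inv\<^bsub>G\<^esub> g)"] by (simp add: S.m_comm)
    show "?a \<otimes>\<^sub>S pone S h = ?a" using g h by (simp add: S.m_assoc)
  qed (use g h in auto)
  have b_in: "?b \<in> pdom S g \<inter> pdom S (g \<otimes>\<^sub>G h)" unfolding mem
  proof (intro conjI)
    show "?b \<otimes>\<^sub>S pone S g = ?b"
      using g h S.m_assoc[of "pone S (g \<otimes>\<^sub>G h)" "pone S g" "pone S g"] by (simp add: S.m_comm)
    show "?b \<otimes>\<^sub>S pone S (g \<otimes>\<^sub>G h) = ?b" using g h by (simp add: S.m_assoc)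
  qed (use g h in auto)
  have img: "tot g ` (pdom S (inv\<^bsub>G\<^esub> g) \<inter> pdom S h) = pdom S g \<inter> pdom S (g \<otimes>\<^sub>G h)"
    using pact_image[OF g h] g by (simp add: tot_pact image_def cong: conj_cong)
  obtain y where y: "y \<in> pdom S (inv\<^bsub>G\<^esub> g) \<inter> pdom S h" "?b = tot g y" using b_in img by blast
  have yS: "y \<in> carrier S" using y(1) unfolding mem by simp
  have "tot g ?a \<in> pdom S g \<inter> pdom S (g \<otimes>\<^sub>G h)" using a_in img by blast
  then have "tot g ?a = tot g ?a \<otimes>\<^sub>S ?b" using g h unfolding mem by (simp add: S.m_assoc[symmetric])
  also have "\<dots> = tot g (?a \<otimes>\<^sub>S y)" unfolding y(2) using g h yS by (simp add: tot_mult)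
  also have "?a \<otimes>\<^sub>S y = y" using g h y(1) unfolding mem by (simp add: S.m_comm S.m_assoc[symmetric])
  finally have "tot g ?a = ?b" using y(2) by simp
  moreover have "tot g ?a = tot g (pone S h)"
    using g h S.m_assoc[of "pone S h" "pone S (inv\<^bsub>G\<^esub> g)" "pone S (inv\<^bsub>G\<^esub> g)"] by (simp add: tot_def S.m_comm)
  ultimately show ?thesis by simp
qed

text \<open>Total maps compose up to the idempotent 1_g, by which the left side is automatically
  cut. The composition axiom only speaks of elements from a certain image, so x is first cut down to
  such an element.\<close>

lemma tot_comp:
  assumes g: "g \<in> carrier G" and h: "h \<in> carrier G" and x: "x \<in> carrier S"
  shows "tot g (tot h x) = tot (g \<otimes>\<^sub>G h) x \<otimes>\<^sub>S pone S g"
proof -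
  let ?x = "x \<otimes>\<^sub>S pone S (inv\<^bsub>G\<^esub> h)" and ?p = "pone S (inv\<^bsub>G\<^esub> g)" and ?q = "pone S (inv\<^bsub>G\<^esub> h \<otimes>\<^sub>G inv\<^bsub>G\<^esub> g)"
  \<comment> \<open>\<open>?y\<close> is the part of the h-image of x on which g is defined;
    \<open>?w\<close> is its preimage under h, the element to which \<open>pact_mult\<close>
    applies.\<close>
  let ?y = "tot h x \<otimes>\<^sub>S ?p" and ?w = "?x \<otimes>\<^sub>S ?q"
  have w: "tot (inv\<^bsub>G\<^esub> h) ?y = ?w"
  proof -
    have "tot (inv\<^bsub>G\<^esub> h) ?y = tot (inv\<^bsub>G\<^esub> h) (tot h x) \<otimes>\<^sub>S tot (inv\<^bsub>G\<^esub> h) ?p"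
      using g h x by (simp add: tot_mult)
    also have "tot (inv\<^bsub>G\<^esub> h) (tot h x) = ?x"
    proof -
      have "tot (inv\<^bsub>G\<^esub> h) (tot h x) = pact S (inv\<^bsub>G\<^esub> h) (tot h x)"
        by (rule tot_pact) (use tot_pdom[OF h x] h in simp_all)
      moreover have "tot h x = pact S h ?x" by (simp add: tot_def)
      ultimately have "tot (inv\<^bsub>G\<^esub> h) (tot h x) = pact S (inv\<^bsub>G\<^esub> h) (pact S h ?x)" by simp
      then show ?thesis using h x by (simp add: pact_inverse pone_pdom)
    qed
    also have "tot (inv\<^bsub>G\<^esub> h) ?p = pone S (inv\<^bsub>G\<^esub> h) \<otimes>\<^sub>S ?q" using g h by (simp add: tot_pone_eq)
    also have "?x \<otimes>\<^sub>S (pone S (inv\<^bsub>G\<^esub> h) \<otimes>\<^sub>S ?q) = ?w"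
    proof -
      have "?x \<otimes>\<^sub>S (pone S (inv\<^bsub>G\<^esub> h) \<otimes>\<^sub>S ?q) = x \<otimes>\<^sub>S (pone S (inv\<^bsub>G\<^esub> h) \<otimes>\<^sub>S pone S (inv\<^bsub>G\<^esub> h)) \<otimes>\<^sub>S ?q"
        using g h x by (simp add: S.m_assoc del: pone_idem)
      then show ?thesis using h by simp
    qed
    finally show ?thesis .
  qed
  have y_in: "?y \<in> pdom S h \<inter> pdom S (inv\<^bsub>G\<^esub> g)"
  proof -
    have "?y \<otimes>\<^sub>S pone S h = (tot h x \<otimes>\<^sub>S pone S h) \<otimes>\<^sub>S ?p" using g h x by (simp add: S.m_ac del: tot_pone)
    then show ?thesis using g h x by (simp add: pdom_iff S.m_assoc)
  qed
  have w_img: "?w \<in> pact S (inv\<^bsub>G\<^esub> h) ` (pdom S h \<inter> pdom S (inv\<^bsub>G\<^esub> g))"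
  proof -
    have "tot (inv\<^bsub>G\<^esub> h) ?y = pact S (inv\<^bsub>G\<^esub> h) ?y" using y_in h by (intro tot_pact) auto
    then show ?thesis using y_in w by (metis imageI)
  qed
  have w_dom: "?w \<in> pdom S (inv\<^bsub>G\<^esub> h)"
  proof -
    have "?w \<otimes>\<^sub>S pone S (inv\<^bsub>G\<^esub> h) = x \<otimes>\<^sub>S (pone S (inv\<^bsub>G\<^esub> h) \<otimes>\<^sub>S pone S (inv\<^bsub>G\<^esub> h)) \<otimes>\<^sub>S ?q"
      using g h x by (simp add: S.m_ac del: pone_idem)
    then show ?thesis using g h x by (simp add: pdom_iff)
  qed
  have hw: "pact S h ?w = ?y"
  proof -
    have "pact S h (pact S (inv\<^bsub>G\<^esub> h) ?y) = ?y"
      using pact_inverse[of "inv\<^bsub>G\<^esub> h" ?y] y_in h by simp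
    moreover have "tot (inv\<^bsub>G\<^esub> h) ?y = pact S (inv\<^bsub>G\<^esub> h) ?y" using y_in h by (intro tot_pact) auto
    ultimately show ?thesis using w by simp
  qed
  have "tot g (tot h x) = pact S g ?y" by (simp add: tot_def)
  also have "\<dots> = pact S (g \<otimes>\<^sub>G h) ?w" using pact_mult[OF g h w_img] hw by simp
  also have "\<dots> = tot (g \<otimes>\<^sub>G h) ?x" using g h by (simp add: tot_def G.inv_mult_group)
  also have "\<dots> = tot (g \<otimes>\<^sub>G h) x \<otimes>\<^sub>S tot (g \<otimes>\<^sub>G h) (pone S (inv\<^bsub>G\<^esub> h))" using g h x by (simp add: tot_mult)
  also have "\<dots> = tot (g \<otimes>\<^sub>G h) x \<otimes>\<^sub>S pone S g"
    using g h x by (simp add: tot_pone_eq G.m_assoc S.m_assoc[symmetric])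
  finally show ?thesis .
qed

end

text \<open>T consists of all functions f on \<open>G\<close> with g(f(h) 1_{g^-1}) = f(gh) 1_g,
  with right translation as action, and s goes to the function h \<mapsto> h(s 1_{h^-1}). Taking all
  compatible functions makes T visibly an algebra with identity; that the translates of S span it
  follows from fullness of the image of 1.\<close>

lemma globalization_exists:
  fixes G :: "'g monoid" and k :: "'k ring" and S :: "('k, 's, 'g, 'r) extension"
  assumes "unital_partial_action G k S" and fin: "finite (carrier G)"
  shows "\<exists>(T :: ('k, 'g \<Rightarrow> 's, 'g) partial_algebra) \<iota>. globalization G k S T \<iota>"
proof -
  interpret unital_partial_action G k S by fact
  let ?W = "fun_ext G (\<lambda>h::'g. h) S"
  define C where "C = {f \<in> carrier ?W. \<forall>g\<in>carrier G. \<forall>h\<in>carrier G. tot g (f h) = f (g \<otimes>\<^sub>G h) \<otimes>\<^sub>S pone S g}"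
  define T :: "('k, 'g \<Rightarrow> 's, 'g) partial_algebra" where
    "T = \<lparr>carrier = C, monoid.mult = monoid.mult ?W, one = \<one>\<^sub>?W, ring.zero = \<zero>\<^sub>?W, add = add ?W,
      smult = smult ?W, pdom = (\<lambda>g. C), pact = (\<lambda>g f. \<lambda>x\<in>carrier G. f (x \<otimes>\<^sub>G g))\<rparr>"
  have W: "algebra k ?W" by (rule fun_ext_algebra[OF G.group_axioms S.algebra_axioms])
  interpret W: algebra k ?W by (rule W)
  have T_sel: "carrier T = C" "u \<otimes>\<^sub>T v = u \<otimes>\<^sub>?W v" "\<one>\<^sub>T = \<one>\<^sub>?W" "\<zero>\<^sub>T = \<zero>\<^sub>?W" "u \<oplus>\<^sub>T v = u \<oplus>\<^sub>?W v"
    "c \<odot>\<^sub>T u = c \<odot>\<^sub>?W u" "pdom T g = C" "pact T g u = (\<lambda>x\<in>carrier G. u (x \<otimes>\<^sub>G g))" for u v c g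
    by (simp_all add: T_def)
  have C_W: "f \<in> carrier ?W" if "f \<in> C" for f using that unfolding C_def by blast
  have C_c: "f h \<in> carrier S" if "f \<in> C" "h \<in> carrier G" for f h using PiE_app[OF C_W[OF that(1), unfolded fun_ext_simps] that(2)] .
  have C_tot: "tot g (f h) = f (g \<otimes>\<^sub>G h) \<otimes>\<^sub>S pone S g" if "f \<in> C" "g \<in> carrier G" "h \<in> carrier G" for f g h
    using that by (simp add: C_def)
  have eqI: "u = v" if "u \<in> C" "v \<in> C" "!!x. x \<in> carrier G ==> u x = v x" for u v
    by (rule PiE_ext[OF C_W[OF that(1), unfolded fun_ext_simps] C_W[OF that(2), unfolded fun_ext_simps] that(3)])
  have CI: "f \<in> C" if "f \<in> carrier ?W" "!!g h. g \<in> carrier G ==> h \<in> carrier G ==> tot g (f h) = f (g \<otimes>\<^sub>G h) \<otimes>\<^sub>S pone S g" for f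
    using that by (simp add: C_def)
  have tot_zero: "tot g \<zero>\<^sub>S = \<zero>\<^sub>S" if g: "g \<in> carrier G" for g
  proof -
    have "tot g \<zero>\<^sub>S \<oplus>\<^sub>S tot g \<zero>\<^sub>S = tot g \<zero>\<^sub>S" using g tot_add[of g "\<zero>\<^sub>S" "\<zero>\<^sub>S"] by simp
    then show ?thesis using g by (simp add: S.add.r_cancel_one)
  qed
  have tot_uminus: "tot g (\<ominus>\<^sub>S x) = \<ominus>\<^sub>S tot g x" if g: "g \<in> carrier G" and x: "x \<in> carrier S" for g x
  proof -
    have "tot g (\<ominus>\<^sub>S x) \<oplus>\<^sub>S tot g x = \<zero>\<^sub>S"
      using g x tot_add[of g "\<ominus>\<^sub>S x" x] by (simp add: S.l_neg tot_zero)
    then show ?thesis using g x by (simp add: S.minus_equality)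
  qed
  have W_uminus: "\<ominus>\<^sub>?W f = (\<lambda>x\<in>carrier G. \<ominus>\<^sub>S f x)" if "f \<in> C" for f
  proof (rule W.minus_equality[OF _ C_W[OF that]])
    show "(\<lambda>x\<in>carrier G. \<ominus>\<^sub>S f x) \<oplus>\<^sub>?W f = \<zero>\<^sub>?W"
      using C_c[OF that] by (simp add: S.l_neg cong: restrict_cong)
    show "(\<lambda>x\<in>carrier G. \<ominus>\<^sub>S f x) \<in> carrier ?W" using C_c[OF that] by simp
  qed
  have C_one: "\<one>\<^sub>?W \<in> C" by (rule CI) (simp_all add: tot_one)
  have C_zero: "\<zero>\<^sub>?W \<in> C" by (rule CI) (simp_all add: tot_zero)
  have C_add: "u \<oplus>\<^sub>?W v \<in> C" if "u \<in> C" "v \<in> C" for u v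
    by (rule CI) (use that in \<open>simp_all add: tot_add C_c C_tot S.l_distr\<close>)
  have C_mult: "u \<otimes>\<^sub>?W v \<in> C" if u: "u \<in> C" and v: "v \<in> C" for u v
  proof (rule CI)
    fix g h assume gh: "g \<in> carrier G" "h \<in> carrier G"
    have "u (g \<otimes>\<^sub>G h) \<otimes>\<^sub>S pone S g \<otimes>\<^sub>S (v (g \<otimes>\<^sub>G h) \<otimes>\<^sub>S pone S g) =
      u (g \<otimes>\<^sub>G h) \<otimes>\<^sub>S v (g \<otimes>\<^sub>G h) \<otimes>\<^sub>S (pone S g \<otimes>\<^sub>S pone S g)"
      using gh u v by (simp add: S.m_ac C_c del: pone_idem)
    then show "tot g ((u \<otimes>\<^sub>?W v) h) = (u \<otimes>\<^sub>?W v) (g \<otimes>\<^sub>G h) \<otimes>\<^sub>S pone S g"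
      using gh u v by (simp add: tot_mult C_c C_tot)
  qed (use u v C_c in simp)
  have C_smult: "c \<odot>\<^sub>?W u \<in> C" if "c \<in> carrier k" "u \<in> C" for c u
    by (rule CI) (use that in \<open>simp_all add: tot_smult C_c C_tot S.smult_assoc2\<close>)
  have C_neg: "\<ominus>\<^sub>?W u \<in> C" if "u \<in> C" for u
    unfolding W_uminus[OF that]
    by (rule CI) (use that in \<open>simp_all add: C_c C_tot tot_uminus S.l_minus\<close>)
  have algT: "algebra k T"
    by (rule algebra_inj[OF W, where \<iota> = "\<lambda>x. x"])
      (simp_all add: T_sel C_one C_zero C_add C_mult C_smult C_neg C_W inj_on_def del: fun_ext_simps)
  interpret T: algebra k T by (rule algT)
  have act_C: "pact T g f \<in> C" if g: "g \<in> carrier G" and f: "f \<in> C" for g f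
    by (rule CI) (use g f in \<open>simp_all add: C_c C_tot T_sel G.m_assoc\<close>)
  have act_id: "pact T \<one>\<^sub>G f = f" if f: "f \<in> C" for f
    by (rule eqI[OF act_C[OF _ f] f]) (simp_all add: T_sel)
  have act_comp: "pact T g (pact T h f) = pact T (g \<otimes>\<^sub>G h) f" if "g \<in> carrier G" "h \<in> carrier G" "f \<in> C" for g h f
    by (rule eqI[OF act_C[OF that(1) act_C[OF that(2,3)]] act_C[OF G.m_closed[OF that(1,2)] that(3)]])
      (use that in \<open>simp_all add: T_sel G.m_assoc\<close>)
  have act_bij: "bij_betw (pact T g) C C" if g: "g \<in> carrier G" for g
    by (rule bij_betw_byWitness[where f' = "pact T (inv\<^bsub>G\<^esub> g)"]) (use g act_C in \<open>auto simp: act_comp act_id simp del: T_sel\<close>)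
  have act_hom: "pact T g \<in> nonunital_alg_hom k T C T C" if g: "g \<in> carrier G" for g
    using g act_C unfolding nonunital_alg_hom_def by (auto simp: T_sel intro!: restrict_ext)
  have glob: "global_action G k T"
  proof (intro global_action.intro partial_action.intro G.group_axioms algT partial_action_axioms.intro global_action_axioms.intro)
    show "ideal (pdom T g) T" for g using T.oneideal by (simp add: T_sel)
    show "pact T g ` (pdom T (inv\<^bsub>G\<^esub> g) \<inter> pdom T h) = pdom T g \<inter> pdom T (g \<otimes>\<^sub>G h)"
      if "g \<in> carrier G" "h \<in> carrier G" for g h
      using act_bij[OF that(1)] by (simp add: T_def bij_betw_def)
    show "pact T g (pact T h x) = pact T (g \<otimes>\<^sub>G h) x"
      if "g \<in> carrier G" "h \<in> carrier G" "x \<in> pact T (inv\<^bsub>G\<^esub> h) ` (pdom T h \<inter> pdom T (inv\<^bsub>G\<^esub> g))" for g h x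
    proof -
      have "x \<in> C" using that act_C[of "inv\<^bsub>G\<^esub> h"] by (auto simp: T_def)
      then show ?thesis using that by (intro act_comp)
    qed
  qed (use act_hom act_bij act_id in \<open>simp_all add: T_sel\<close>)
  interpret T: gact G k T by (rule global_action_gact[OF glob fin])
  define \<iota> where "\<iota> s = (\<lambda>h\<in>carrier G. tot h s)" for s
  have \<iota>_app: "\<iota> s h = tot h s" if "h \<in> carrier G" for s h using that by (simp add: \<iota>_def)
  have \<iota>_C: "\<iota> s \<in> C" if "s \<in> carrier S" for s
    by (rule CI) (use that in \<open>auto simp: \<iota>_def tot_comp\<close>)
  have \<iota>_hom: "\<iota> \<in> nonunital_alg_hom k S (carrier S) T (carrier T)"
    using \<iota>_C unfolding nonunital_alg_hom_def
    by (auto simp: T_sel tot_add tot_mult tot_smult \<iota>_def intro!: restrict_ext)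
  have \<iota>_inj: "inj_on \<iota> (carrier S)"
    by (rule inj_on_inverseI[where g = "\<lambda>f. f \<one>\<^sub>G"]) (simp add: \<iota>_def)
  \<comment> \<open>Compatibility of f, applied at h = 1, shows that multiplying the image of s by f
    only depends on f(1). This is the ideal property.\<close>
  have \<iota>_mult: "f \<otimes>\<^sub>T \<iota> s = \<iota> (f \<one>\<^sub>G \<otimes>\<^sub>S s)" if f: "f \<in> C" and s: "s \<in> carrier S" for f s
  proof (rule eqI)
    fix x assume x: "x \<in> carrier G"
    have "tot x (f \<one>\<^sub>G \<otimes>\<^sub>S s) = f x \<otimes>\<^sub>S pone S x \<otimes>\<^sub>S tot x s"
      using x f s by (simp add: tot_mult C_c C_tot)
    also have "\<dots> = f x \<otimes>\<^sub>S (tot x s \<otimes>\<^sub>S pone S x)" using x f s by (simp add: S.m_ac C_c del: tot_pone)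
    finally show "(f \<otimes>\<^sub>T \<iota> s) x = \<iota> (f \<one>\<^sub>G \<otimes>\<^sub>S s) x" using x s by (simp add: T_sel \<iota>_app)
  qed (use f s in \<open>simp_all add: T_sel C_mult \<iota>_C C_c del: fun_ext_simps\<close>)
  have act_\<iota>: "pact T g (\<iota> x) = \<iota> (pact S g x)" if g: "g \<in> carrier G" and x: "x \<in> pdom S (inv\<^bsub>G\<^esub> g)" for g x
  proof -
    have xS: "x \<in> carrier S" "x \<otimes>\<^sub>S pone S (inv\<^bsub>G\<^esub> g) = x" using x g by (auto simp: pdom_iff)
    have p: "pact S g x = tot g x" using g x by (simp add: tot_pact)
    have "tot (h \<otimes>\<^sub>G g) x = tot h (tot g x)" if h: "h \<in> carrier G" for h
    proof -
      have "tot (h \<otimes>\<^sub>G g) x = tot (h \<otimes>\<^sub>G g) x \<otimes>\<^sub>S tot (h \<otimes>\<^sub>G g) (pone S (inv\<^bsub>G\<^esub> g))"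
        using xS g h by (simp add: tot_mult[symmetric])
      also have "tot (h \<otimes>\<^sub>G g) (pone S (inv\<^bsub>G\<^esub> g)) = pone S (h \<otimes>\<^sub>G g) \<otimes>\<^sub>S pone S h"
        using g h by (simp add: tot_pone_eq G.m_assoc)
      also have "tot (h \<otimes>\<^sub>G g) x \<otimes>\<^sub>S (pone S (h \<otimes>\<^sub>G g) \<otimes>\<^sub>S pone S h) = tot (h \<otimes>\<^sub>G g) x \<otimes>\<^sub>S pone S h"
        using g h xS by (simp add: S.m_assoc[symmetric])
      finally show ?thesis using g h xS by (simp add: tot_comp)
    qed
    then show ?thesis unfolding p T_sel using g by (auto simp: \<iota>_def intro!: restrict_ext)
  qed
  have dom: "pdom S g = {x \<in> carrier S. \<iota> x \<otimes>\<^sub>T pact T g (\<iota> \<one>\<^sub>S) = \<iota> x}" if g: "g \<in> carrier G" for g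
  proof (intro equalityI subsetI)
    fix x assume "x \<in> pdom S g"
    then have x: "x \<in> carrier S" "x \<otimes>\<^sub>S pone S g = x" using g by (auto simp: pdom_iff)
    have "tot h x \<otimes>\<^sub>S pone S (h \<otimes>\<^sub>G g) = tot h x" if h: "h \<in> carrier G" for h
    proof -
      have "tot h x = tot h x \<otimes>\<^sub>S (pone S h \<otimes>\<^sub>S pone S (h \<otimes>\<^sub>G g))"
        using x tot_mult[OF h x(1) pone_closed[OF g]] tot_pone_eq[OF h g] by simp
      then show ?thesis using g h x(1) by (simp add: S.m_assoc[symmetric])
    qed
    then show "x \<in> {x \<in> carrier S. \<iota> x \<otimes>\<^sub>T pact T g (\<iota> \<one>\<^sub>S) = \<iota> x}"
      using g x(1) by (auto simp: T_sel \<iota>_def tot_one intro!: restrict_ext)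
  next
    fix x assume x: "x \<in> {x \<in> carrier S. \<iota> x \<otimes>\<^sub>T pact T g (\<iota> \<one>\<^sub>S) = \<iota> x}"
    then have "(\<iota> x \<otimes>\<^sub>T pact T g (\<iota> \<one>\<^sub>S)) \<one>\<^sub>G = \<iota> x \<one>\<^sub>G" by simp
    then show "x \<in> pdom S g" using x g by (simp add: T_sel \<iota>_def tot_one pdom_iff)
  qed
  have range: "\<iota> ` carrier S = {t \<in> carrier T. t \<otimes>\<^sub>T \<iota> \<one>\<^sub>S = t}"
  proof (intro equalityI subsetI)
    fix t assume "t \<in> \<iota> ` carrier S"
    then show "t \<in> {t \<in> carrier T. t \<otimes>\<^sub>T \<iota> \<one>\<^sub>S = t}"
      using \<iota>_mult[OF \<iota>_C, of _ "\<one>\<^sub>S"] \<iota>_C by (auto simp: T_sel(1) \<iota>_app)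
  next
    fix t assume t: "t \<in> {t \<in> carrier T. t \<otimes>\<^sub>T \<iota> \<one>\<^sub>S = t}"
    then have tC: "t \<in> C" "t \<otimes>\<^sub>T \<iota> \<one>\<^sub>S = t" by (simp_all add: T_sel(1))
    have "t = \<iota> (t \<one>\<^sub>G \<otimes>\<^sub>S \<one>\<^sub>S)" using \<iota>_mult[OF tC(1) S.one_closed] tC(2) by (rule trans[OF sym, rotated])
    then show "t \<in> \<iota> ` carrier S" by (rule image_eqI) (use C_c[OF tC(1)] in simp)
  qed
  have full: "T.full (\<iota> \<one>\<^sub>S)"
    unfolding T.full_def
  proof (intro conjI ballI impI)
    show "\<iota> \<one>\<^sub>S \<in> carrier T" using \<iota>_C by (simp add: T_sel)
    show "\<iota> \<one>\<^sub>S \<otimes>\<^sub>T \<iota> \<one>\<^sub>S = \<iota> \<one>\<^sub>S" using \<iota>_mult[OF \<iota>_C] by (simp add: \<iota>_app)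
    fix z assume z: "z \<in> carrier T" "\<forall>g\<in>carrier G. z \<otimes>\<^sub>T pact T g (\<iota> \<one>\<^sub>S) = \<zero>\<^sub>T"
    show "z = \<zero>\<^sub>T"
    proof (rule eqI)
      fix x assume x: "x \<in> carrier G"
      \<comment> \<open>The translate by the inverse of x takes the value 1 at x, so the product
        shows z(x).\<close>
      have "(z \<otimes>\<^sub>T pact T (inv\<^bsub>G\<^esub> x) (\<iota> \<one>\<^sub>S)) x = \<zero>\<^sub>T x" using z x by simp
      then show "z x = \<zero>\<^sub>T x" using x z C_c by (simp add: T_sel \<iota>_app)
    qed (use z C_zero in \<open>simp_all add: T_sel\<close>)
  qed
  have "globalization G k S T \<iota>"
    by (rule globalizationI[OF glob fin full \<iota>_hom \<iota>_inj range dom act_\<iota>])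
  then show ?thesis by blast
qed

section \<open>Partial extensions as cuts of Galois extensions\<close>

text \<open>
  \<open>S\<close> is the restriction of the Galois extension \<open>T\<close> to the ideal \<open>eT\<close>, where the translates of \<open>e\<close>
  generate the unit ideal. This is what a globalization of \<open>S\<close> amounts to.
\<close>

locale model = T: galois G k A T + R: algebra k R
  for G :: "'g monoid" and k :: "'k ring" and A :: "('k, 'a) module" and R :: "('k, 'r) module"
    and T :: "('k, 't, 'g, 'a) extension" (structure) +
  fixes \<phi> :: "'a \<Rightarrow> 'r" and S :: "('k, 's, 'g, 'r) extension" and e :: 't and \<iota> :: "'s \<Rightarrow> 't"
  assumes phi: "\<phi> \<in> alg_iso k A R"
    and full: "T.full e"
    and io_closed [simp, intro]: "x \<in> carrier S ==> \<iota> x \<in> carrier T"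
    and io_e [simp]: "x \<in> carrier S ==> \<iota> x \<otimes> e = \<iota> x"
    and io_inj: "inj_on \<iota> (carrier S)"
    and io_surj: "[|t \<in> carrier T; t \<otimes> e = t|] ==> t \<in> \<iota> ` carrier S"
    and S_closed: "\<zero>\<^sub>S \<in> carrier S" "\<one>\<^sub>S \<in> carrier S"
      "[|x \<in> carrier S; y \<in> carrier S|] ==> x \<oplus>\<^sub>S y \<in> carrier S"
      "[|x \<in> carrier S; y \<in> carrier S|] ==> x \<otimes>\<^sub>S y \<in> carrier S"
      "[|c \<in> carrier k; x \<in> carrier S|] ==> c \<odot>\<^sub>S x \<in> carrier S"
    and io_hom: "\<iota> \<zero>\<^sub>S = \<zero>" "\<iota> \<one>\<^sub>S = e"
      "[|x \<in> carrier S; y \<in> carrier S|] ==> \<iota> (x \<oplus>\<^sub>S y) = \<iota> x \<oplus> \<iota> y"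
      "[|x \<in> carrier S; y \<in> carrier S|] ==> \<iota> (x \<otimes>\<^sub>S y) = \<iota> x \<otimes> \<iota> y"
      "[|c \<in> carrier k; x \<in> carrier S|] ==> \<iota> (c \<odot>\<^sub>S x) = c \<odot>\<^sub>T \<iota> x"
    and dom: "g \<in> carrier G ==> pdom S g = {x \<in> carrier S. \<iota> x \<otimes> pact T g e = \<iota> x}"
    and act: "[|g \<in> carrier G; x \<in> pdom S (inv\<^bsub>G\<^esub> g)|] ==>
      pact S g x \<in> carrier S \<and> \<iota> (pact S g x) = pact T g (\<iota> x)"
    and emb: "a \<in> carrier A ==> emb S (\<phi> a) \<in> carrier S \<and> \<iota> (emb S (\<phi> a)) = emb T a \<otimes> e"
begin

lemma e_closed [simp, intro]: "e \<in> carrier T" and e_idem [simp]: "e \<otimes> e = e"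
  using T.fullD[OF full] by auto

lemma phi_hom: "\<phi> \<in> ring_hom A R" and phi_bij: "bij_betw \<phi> (carrier A) (carrier R)"
  and phi_smult: "[|c \<in> carrier k; a \<in> carrier A|] ==> \<phi> (c \<odot>\<^sub>A a) = c \<odot>\<^sub>R \<phi> a"
  using phi by (auto simp: alg_iso_def ring_iso_def)

lemma phi_surj: "r \<in> carrier R ==> \<exists>a\<in>carrier A. r = \<phi> a"
  using phi_bij by (auto simp: bij_betw_def)

lemma io_eqD: "[|x \<in> carrier S; y \<in> carrier S; \<iota> x = \<iota> y|] ==> x = y"
  using io_inj by (auto dest: inj_onD)

definition "pre = inv_into (carrier S) \<iota>"

lemma pre_closed: "t \<in> carrier T ==> t \<otimes> e = t ==> pre t \<in> carrier S"
  and io_pre: "t \<in> carrier T ==> t \<otimes> e = t ==> \<iota> (pre t) = t"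
  using io_surj[of t] by (auto simp: pre_def inv_into_into f_inv_into_f)

lemma algebra_S: "algebra k S"
proof (rule algebra_inj[OF T.T.algebra_axioms, where \<iota> = \<iota>])
  show "\<exists>y\<in>carrier S. \<iota> y = \<ominus> \<iota> x" if "x \<in> carrier S" for x
    using that T.T.l_minus[of "\<iota> x" e] by (intro bexI[of _ "pre (\<ominus> \<iota> x)"]) (auto intro!: pre_closed io_pre)
  show "\<iota> \<one>\<^sub>S \<otimes> \<iota> x = \<iota> x" if "x \<in> carrier S" for x
    using that T.T.m_comm[of e "\<iota> x"] by (simp add: io_hom)
qed (use io_inj in \<open>auto simp: S_closed io_hom\<close>)

sublocale S: algebra k S by (rule algebra_S)

lemma eps: "g \<in> carrier G ==> pact T g e \<otimes> pact T g e = pact T g e"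
  by (rule T.eps_idem[OF full])

lemma eps_assoc: "g \<in> carrier G ==> t \<in> carrier T ==> t \<otimes> pact T g e \<otimes> pact T g e = t \<otimes> pact T g e"
  by (simp add: T.T.m_assoc eps)

lemma pdomD: "g \<in> carrier G ==> x \<in> pdom S g ==> x \<in> carrier S \<and> \<iota> x \<otimes> pact T g e = \<iota> x"
  by (simp add: dom)

lemma pact_dom:
  assumes "g \<in> carrier G" "x \<in> pdom S (inv\<^bsub>G\<^esub> g)"
  shows "pact S g x \<in> pdom S g"
proof -
  note x = pdomD[OF _ assms(2)] act[OF assms]
  have "pact T g (\<iota> x) \<otimes> pact T g e = pact T g (\<iota> x \<otimes> e)" using x assms by (simp add: T.act_mult del: io_e)
  then show ?thesis using x assms by (simp add: dom)
qed

lemma pact_pact_inv: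
  assumes "g \<in> carrier G" "x \<in> pdom S (inv\<^bsub>G\<^esub> g)"
  shows "pact S (inv\<^bsub>G\<^esub> g) (pact S g x) = x"
  using assms pact_dom[OF assms] act[OF assms] act[of "inv\<^bsub>G\<^esub> g" "pact S g x"] pdomD[OF _ assms(2)]
  by (intro io_eqD) auto

lemma eps_shift:
  assumes "g \<in> carrier G" "h \<in> carrier G" "t \<in> carrier T" "t \<otimes> pact T h e = t"
  shows "pact T g t \<otimes> pact T (g \<otimes>\<^sub>G h) e = pact T g t"
  using assms T.act_mult[of g t "pact T h e"] by (simp add: T.act_comp)

lemma idem_gen:
  assumes g: "g \<in> carrier G"
  shows "idem_generates S g (pre (e \<otimes> pact T g e))"
proof -
  let ?p = "pre (e \<otimes> pact T g e)"
  have c: "e \<otimes> pact T g e \<in> carrier T" "e \<otimes> pact T g e \<otimes> e = e \<otimes> pact T g e"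
    using g by (simp_all add: T.T.m_ac) (simp add: T.T.m_assoc[symmetric])
  note p = pre_closed[OF c] io_pre[OF c]
  have pp: "?p \<otimes>\<^sub>S ?p = ?p"
  proof (rule io_eqD)
    have "e \<otimes> pact T g e \<otimes> (e \<otimes> pact T g e) = (e \<otimes> e) \<otimes> (pact T g e \<otimes> pact T g e)"
      using g by (simp add: T.T.m_ac del: e_idem)
    then show "\<iota> (?p \<otimes>\<^sub>S ?p) = \<iota> ?p" using g p by (simp add: io_hom eps)
  qed (use p in auto)
  have "pdom S g = (\<lambda>s. s \<otimes>\<^sub>S ?p) ` carrier S"
  proof (intro equalityI subsetI)
    fix x assume "x \<in> pdom S g"
    then have x: "x \<in> carrier S" "\<iota> x \<otimes> pact T g e = \<iota> x" using g pdomD by auto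
    have "x = x \<otimes>\<^sub>S ?p"
      by (rule io_eqD) (use x p g in \<open>simp_all add: io_hom T.T.m_assoc[symmetric]\<close>)
    then show "x \<in> (\<lambda>s. s \<otimes>\<^sub>S ?p) ` carrier S" using x by blast
  next
    fix x assume "x \<in> (\<lambda>s. s \<otimes>\<^sub>S ?p) ` carrier S"
    then obtain s where s: "s \<in> carrier S" "x = s \<otimes>\<^sub>S ?p" by blast
    have "\<iota> x = \<iota> s \<otimes> pact T g e" using s p g by (simp add: io_hom T.T.m_assoc[symmetric])
    then show "x \<in> pdom S g" using s p g by (simp add: dom eps_assoc)
  qed
  then show ?thesis using p pp by (simp add: idem_generates_def)
qed

lemma pdom_pact_image:
  assumes g: "g \<in> carrier G" and h: "h \<in> carrier G"
  shows "pact S g ` (pdom S (inv\<^bsub>G\<^esub> g) \<inter> pdom S h) = pdom S g \<inter> pdom S (g \<otimes>\<^sub>G h)"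
proof (intro equalityI subsetI)
  fix y assume "y \<in> pact S g ` (pdom S (inv\<^bsub>G\<^esub> g) \<inter> pdom S h)"
  then obtain x where x: "x \<in> pdom S (inv\<^bsub>G\<^esub> g)" "x \<in> pdom S h" "y = pact S g x" by blast
  have "y \<in> pdom S g" using pact_dom[OF g x(1)] x by simp
  moreover have "pact T g (\<iota> x) \<otimes> pact T (g \<otimes>\<^sub>G h) e = pact T g (\<iota> x)"
    using g h pdomD[OF h x(2)] by (intro eps_shift) auto
  then have "y \<in> pdom S (g \<otimes>\<^sub>G h)" using g h act[OF g x(1)] x(3) by (simp add: dom)
  ultimately show "y \<in> pdom S g \<inter> pdom S (g \<otimes>\<^sub>G h)" by blast
next
  fix y assume "y \<in> pdom S g \<inter> pdom S (g \<otimes>\<^sub>G h)"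
  then have y: "y \<in> pdom S (inv\<^bsub>G\<^esub> (inv\<^bsub>G\<^esub> g))" "y \<in> pdom S (g \<otimes>\<^sub>G h)" using g by auto
  have gi: "inv\<^bsub>G\<^esub> g \<in> carrier G" using g by simp
  let ?x = "pact S (inv\<^bsub>G\<^esub> g) y"
  have x: "?x \<in> pdom S (inv\<^bsub>G\<^esub> g)" by (rule pact_dom[OF gi y(1)])
  have "pact T (inv\<^bsub>G\<^esub> g) (\<iota> y) \<otimes> pact T (inv\<^bsub>G\<^esub> g \<otimes>\<^sub>G (g \<otimes>\<^sub>G h)) e = pact T (inv\<^bsub>G\<^esub> g) (\<iota> y)"
    using g h pdomD[OF _ y(2)] by (intro eps_shift) auto
  then have "?x \<in> pdom S h" using g h act[OF gi y(1)] by (simp add: dom)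
  moreover have "pact S g ?x = y" using pact_pact_inv[OF gi y(1)] g by simp
  ultimately show "y \<in> pact S g ` (pdom S (inv\<^bsub>G\<^esub> g) \<inter> pdom S h)" using x by (metis IntI imageI)
qed

lemma unital_S: "unital_partial_action G k S"
proof (intro unital_partial_action.intro partial_action.intro T.G.group_axioms algebra_S
    partial_action_axioms.intro unital_partial_action_axioms.intro)
  fix g assume g: "g \<in> carrier G"
  show "\<exists>x. idem_generates S g x" using idem_gen[OF g] by blast
  show "ideal (pdom S g) S"
  proof (rule idealI[OF S.ring_axioms])
    show "subgroup (pdom S g) (add_monoid S)"
    proof (rule S.add.subgroupI)
      show "\<ominus>\<^sub>S x \<in> pdom S g" if x: "x \<in> pdom S g" for x
      proof -
        have xc: "x \<in> carrier S" "\<iota> x \<otimes> pact T g e = \<iota> x" using pdomD[OF g x] by auto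
        have "\<iota> (\<ominus>\<^sub>S x) \<oplus> \<iota> x = \<zero>" using xc io_hom(3)[of "\<ominus>\<^sub>S x" x] by (simp add: S.l_neg io_hom(1))
        then have "\<iota> (\<ominus>\<^sub>S x) = \<ominus> \<iota> x" using xc by (intro T.T.minus_equality[symmetric]) auto
        then show ?thesis using xc g T.T.l_minus[of "\<iota> x" "pact T g e"] by (simp add: dom)
      qed
      show "x \<oplus>\<^sub>S y \<in> pdom S g" if "x \<in> pdom S g" "y \<in> pdom S g" for x y
        using that g by (simp add: dom io_hom T.T.l_distr)
    qed (use g S_closed(1) in \<open>auto simp: dom io_hom intro!: exI[of _ "\<zero>\<^sub>S"]\<close>)
    show "x \<otimes>\<^sub>S y \<in> pdom S g" "y \<otimes>\<^sub>S x \<in> pdom S g" if "x \<in> pdom S g" "y \<in> carrier S" for x y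
    proof -
      have x: "x \<in> carrier S" "\<iota> x \<otimes> pact T g e = \<iota> x" using pdomD[OF g that(1)] by auto
      have "\<iota> y \<otimes> \<iota> x \<otimes> pact T g e = \<iota> y \<otimes> \<iota> x" using x g that by (simp add: T.T.m_assoc)
      then show "y \<otimes>\<^sub>S x \<in> pdom S g" using x g that by (simp add: dom io_hom)
      then show "x \<otimes>\<^sub>S y \<in> pdom S g" using x that by (simp add: S.m_comm)
    qed
  qed
  have gi: "inv\<^bsub>G\<^esub> g \<in> carrier G" using g by simp
  note d = pdomD[OF gi] act[OF g] pact_dom[OF g]
  have dc: "x \<oplus>\<^sub>S y \<in> pdom S (inv\<^bsub>G\<^esub> g)" "x \<otimes>\<^sub>S y \<in> pdom S (inv\<^bsub>G\<^esub> g)"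
    if "x \<in> pdom S (inv\<^bsub>G\<^esub> g)" "y \<in> pdom S (inv\<^bsub>G\<^esub> g)" for x y
    using that g by (simp_all add: dom io_hom T.T.l_distr T.T.m_assoc)
  have ds: "c \<odot>\<^sub>S x \<in> pdom S (inv\<^bsub>G\<^esub> g)" if "c \<in> carrier k" "x \<in> pdom S (inv\<^bsub>G\<^esub> g)" for c x
    using that g by (simp add: dom io_hom T.T.smult_assoc2)
  show "pact S g \<in> nonunital_alg_hom k S (pdom S (inv\<^bsub>G\<^esub> g)) S (pdom S g)"
    unfolding nonunital_alg_hom_def
  proof (intro CollectI conjI ballI)
    fix x y assume xy: "x \<in> pdom S (inv\<^bsub>G\<^esub> g)" "y \<in> pdom S (inv\<^bsub>G\<^esub> g)"
    note D = d(1)[OF xy(1)] d(1)[OF xy(2)] d(2)[OF xy(1)] d(2)[OF xy(2)] d(2)[OF dc(1)[OF xy]] d(2)[OF dc(2)[OF xy]]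
    show "pact S g (x \<oplus>\<^sub>S y) = pact S g x \<oplus>\<^sub>S pact S g y"
      by (rule io_eqD) (use D g in \<open>simp_all add: io_hom T.act_add\<close>)
    show "pact S g (x \<otimes>\<^sub>S y) = pact S g x \<otimes>\<^sub>S pact S g y"
      by (rule io_eqD) (use D g in \<open>simp_all add: io_hom T.act_mult\<close>)
  next
    fix c x assume cx: "c \<in> carrier k" "x \<in> pdom S (inv\<^bsub>G\<^esub> g)"
    note D = d(1)[OF cx(2)] d(2)[OF cx(2)] d(2)[OF ds[OF cx]]
    show "pact S g (c \<odot>\<^sub>S x) = c \<odot>\<^sub>S pact S g x"
      by (rule io_eqD) (use D g cx in \<open>simp_all add: io_hom T.act_smult\<close>)
  qed (use d in blast)
  show "bij_betw (pact S g) (pdom S (inv\<^bsub>G\<^esub> g)) (pdom S g)"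
  proof (rule bij_betw_byWitness[where f' = "pact S (inv\<^bsub>G\<^esub> g)"])
    show "\<forall>x\<in>pdom S (inv\<^bsub>G\<^esub> g). pact S (inv\<^bsub>G\<^esub> g) (pact S g x) = x" using pact_pact_inv[OF g] by blast
    show "\<forall>x\<in>pdom S g. pact S g (pact S (inv\<^bsub>G\<^esub> g) x) = x" using pact_pact_inv[OF gi] g by simp
    show "pact S g ` pdom S (inv\<^bsub>G\<^esub> g) \<subseteq> pdom S g" using d by blast
    show "pact S (inv\<^bsub>G\<^esub> g) ` pdom S g \<subseteq> pdom S (inv\<^bsub>G\<^esub> g)" using pact_dom[OF gi] g by auto
  qed
  fix h assume h: "h \<in> carrier G"
  show "pact S g ` (pdom S (inv\<^bsub>G\<^esub> g) \<inter> pdom S h) = pdom S g \<inter> pdom S (g \<otimes>\<^sub>G h)"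
    by (rule pdom_pact_image[OF g h])
  fix x assume "x \<in> pact S (inv\<^bsub>G\<^esub> h) ` (pdom S h \<inter> pdom S (inv\<^bsub>G\<^esub> g))"
  then obtain y where y: "y \<in> pdom S h" "y \<in> pdom S (inv\<^bsub>G\<^esub> g)" "x = pact S (inv\<^bsub>G\<^esub> h) y" by blast
  have hi: "inv\<^bsub>G\<^esub> h \<in> carrier G" using h by simp
  have "y \<in> pdom S (inv\<^bsub>G\<^esub> (inv\<^bsub>G\<^esub> h))" using y h by simp
  note x1 = pact_dom[OF hi this] act[OF hi this] pact_pact_inv[OF hi this]
  have hx: "pact S h x = y" using x1(3) y(3) h by simp
  have "pact T (inv\<^bsub>G\<^esub> h) (\<iota> y) \<otimes> pact T (inv\<^bsub>G\<^esub> h \<otimes>\<^sub>G inv\<^bsub>G\<^esub> g) e = pact T (inv\<^bsub>G\<^esub> h) (\<iota> y)"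
    using h g pdomD[OF gi y(2)] by (intro eps_shift) auto
  then have x2: "x \<in> pdom S (inv\<^bsub>G\<^esub> (g \<otimes>\<^sub>G h))" using x1(2) y(3) g h by (simp add: dom T.G.inv_mult_group)
  show "pact S g (pact S h x) = pact S (g \<otimes>\<^sub>G h) x"
  proof (rule io_eqD)
    have "\<iota> (pact S (g \<otimes>\<^sub>G h) x) = pact T (g \<otimes>\<^sub>G h) (pact T (inv\<^bsub>G\<^esub> h) (\<iota> y))"
      using act[OF _ x2] g h x1(2) y(3) by simp
    also have "\<dots> = pact T g (\<iota> y)" using g h pdomD[OF gi y(2)] by (simp add: T.act_comp T.G.m_assoc)
    also have "\<dots> = \<iota> (pact S g y)" using act[OF g y(2)] by simp
    finally show "\<iota> (pact S g (pact S h x)) = \<iota> (pact S (g \<otimes>\<^sub>G h) x)" unfolding hx by simp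
    show "pact S g (pact S h x) \<in> carrier S" unfolding hx using act[OF g y(2)] by simp
    show "pact S (g \<otimes>\<^sub>G h) x \<in> carrier S" using act[OF _ x2] g h by simp
  qed
next
  show "pdom S \<one>\<^sub>G = carrier S" by (auto simp: dom)
  show "pact S \<one>\<^sub>G s = s" if "s \<in> carrier S" for s
    by (rule io_eqD) (use act[of "\<one>\<^sub>G" s] that in \<open>auto simp: dom\<close>)
qed

sublocale U: unital_partial_action G k S by (rule unital_S)

lemma io_pone: "g \<in> carrier G ==> \<iota> (pone S g) = e \<otimes> pact T g e"
proof -
  assume g: "g \<in> carrier G"
  have "e \<otimes> pact T g e \<otimes> e = e \<otimes> pact T g e"
    using g T.T.m_assoc[of "pact T g e" e e] by (simp add: T.T.m_comm[of e])
  then show ?thesis using U.pone_eqI[OF g idem_gen[OF g]] g by (simp add: io_pre)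
qed

lemma io_tot: "g \<in> carrier G ==> s \<in> carrier S ==> \<iota> (U.tot g s) = pact T g (\<iota> s) \<otimes> e"
proof -
  assume g: "g \<in> carrier G" and s: "s \<in> carrier S"
  have "s \<otimes>\<^sub>S pone S (inv\<^bsub>G\<^esub> g) \<in> pdom S (inv\<^bsub>G\<^esub> g)" using g s by (intro U.pone_pdom) auto
  from act[OF g this] have "\<iota> (U.tot g s) = pact T g (\<iota> s \<otimes> (e \<otimes> pact T (inv\<^bsub>G\<^esub> g) e))"
    using g s by (simp add: U.tot_def io_hom io_pone)
  also have "\<iota> s \<otimes> (e \<otimes> pact T (inv\<^bsub>G\<^esub> g) e) = \<iota> s \<otimes> pact T (inv\<^bsub>G\<^esub> g) e"
    using g s by (simp add: T.T.m_assoc[symmetric])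
  finally show ?thesis using g s by (simp add: T.act_mult)
qed

text \<open>Stated for an arbitrary set of group elements because the quotient action needs it for
  the anti-diagonal.\<close>

lemma invariants_sub_iff:
  assumes H: "H \<subseteq> carrier G"
  shows "s \<in> invariants G H S \<longleftrightarrow>
    s \<in> carrier S \<and> (\<forall>g\<in>H. pact T g (\<iota> s) \<otimes> e = \<iota> s \<otimes> pact T g e)"
proof -
  have "U.tot g s = s \<otimes>\<^sub>S pone S g \<longleftrightarrow> pact T g (\<iota> s) \<otimes> e = \<iota> s \<otimes> pact T g e"
    if g: "g \<in> carrier G" and s: "s \<in> carrier S" for g
  proof -
    have "U.tot g s = s \<otimes>\<^sub>S pone S g \<longleftrightarrow> \<iota> (U.tot g s) = \<iota> (s \<otimes>\<^sub>S pone S g)"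
      using io_eqD[of "U.tot g s" "s \<otimes>\<^sub>S pone S g"] g s by auto
    also have "\<iota> (s \<otimes>\<^sub>S pone S g) = \<iota> s \<otimes> pact T g e"
      using g s by (simp add: io_hom io_pone T.T.m_assoc[symmetric])
    finally show ?thesis using g s by (simp add: io_tot)
  qed
  then show ?thesis using H by (auto simp: invariants_def U.tot_def subset_iff)
qed

lemmas invariants_iff = invariants_sub_iff[OF subset_refl]

text \<open>Invariants of T are determined by their cut with e (\<open>full_inv_eqI\<close>), and
  every invariant of S is such a cut (\<open>patch_inv\<close>). So T and S have the same
  invariants, and the two structure maps correspond under \<phi>.\<close>

lemma emb_iso: "emb S \<in> alg_iso k R (S\<lparr>carrier := invariants G (carrier G) S\<rparr>)"
proof -
  note hom = ring_hom_closed[OF phi_hom] ring_hom_mult[OF phi_hom] ring_hom_add[OF phi_hom] ring_hom_one[OF phi_hom]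
  have emb_inv: "emb S (\<phi> a) \<in> invariants G (carrier G) S" if a: "a \<in> carrier A" for a
    using emb[OF a] a by (auto simp: invariants_iff T.act_mult T.T.m_ac)
  have P: "Q r" if "r \<in> carrier R" "!!a. a \<in> carrier A ==> Q (\<phi> a)" for Q and r
    using phi_surj[OF that(1)] that(2) by blast
  have embc: "emb S r \<in> carrier S" if "r \<in> carrier R" for r using that by (rule P) (simp add: emb)
  have add: "emb S (r \<oplus>\<^sub>R r') = emb S r \<oplus>\<^sub>S emb S r'" if r: "r \<in> carrier R" "r' \<in> carrier R" for r r'
  proof -
    obtain a b where ab: "a \<in> carrier A" "r = \<phi> a" "b \<in> carrier A" "r' = \<phi> b" using phi_surj r by blast
    have "emb S (\<phi> (a \<oplus>\<^sub>A b)) = emb S (\<phi> a) \<oplus>\<^sub>S emb S (\<phi> b)"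
      by (rule io_eqD) (use ab emb in \<open>simp_all add: io_hom T.emb_add T.T.l_distr\<close>)
    then show ?thesis using ab by (simp add: hom)
  qed
  have mult: "emb S (r \<otimes>\<^sub>R r') = emb S r \<otimes>\<^sub>S emb S r'" if r: "r \<in> carrier R" "r' \<in> carrier R" for r r'
  proof -
    obtain a b where ab: "a \<in> carrier A" "r = \<phi> a" "b \<in> carrier A" "r' = \<phi> b" using phi_surj r by blast
    have "emb T a \<otimes> e \<otimes> (emb T b \<otimes> e) = emb T a \<otimes> emb T b \<otimes> (e \<otimes> e)" using ab by (simp add: T.T.m_ac del: e_idem)
    then have "emb S (\<phi> (a \<otimes>\<^sub>A b)) = emb S (\<phi> a) \<otimes>\<^sub>S emb S (\<phi> b)"
      by (intro io_eqD) (use ab emb in \<open>simp_all add: io_hom T.emb_mult\<close>)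
    then show ?thesis using ab by (simp add: hom)
  qed
  have one: "emb S \<one>\<^sub>R = \<one>\<^sub>S"
  proof -
    have "emb S (\<phi> \<one>\<^sub>A) = \<one>\<^sub>S" by (rule io_eqD) (use emb[of "\<one>\<^sub>A"] in \<open>simp_all add: io_hom\<close>)
    then show ?thesis by (simp add: hom)
  qed
  have smult: "emb S (c \<odot>\<^sub>R r) = c \<odot>\<^sub>S emb S r" if c: "c \<in> carrier k" and r: "r \<in> carrier R" for c r
  proof -
    obtain a where a: "a \<in> carrier A" "r = \<phi> a" using phi_surj r by blast
    have "emb S (\<phi> (c \<odot>\<^sub>A a)) = c \<odot>\<^sub>S emb S (\<phi> a)"
      by (rule io_eqD) (use a c emb in \<open>simp_all add: io_hom T.emb_smult T.T.smult_assoc2\<close>)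
    then show ?thesis using a c by (simp add: phi_smult)
  qed
  have inj: "inj_on (emb S) (carrier R)"
  proof (rule inj_onI)
    fix r r' assume r: "r \<in> carrier R" "r' \<in> carrier R" "emb S r = emb S r'"
    obtain a b where ab: "a \<in> carrier A" "r = \<phi> a" "b \<in> carrier A" "r' = \<phi> b" using phi_surj r by blast
    have eq: "emb T a \<otimes> e = emb T b \<otimes> e" using emb[OF ab(1)] emb[OF ab(3)] r(3) ab by metis
    have "emb T a = emb T b"
      by (rule T.full_inv_eqI[OF full _ _ _ _ eq]) (use ab in simp_all)
    then show "r = r'" using ab T.emb_eq_iff by simp
  qed
  have surj: "s \<in> emb S ` carrier R" if s: "s \<in> invariants G (carrier G) S" for s
  proof -
    have sc: "s \<in> carrier S" using s by (simp add: invariants_iff)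
    obtain t where t: "t \<in> carrier T" "\<forall>g\<in>carrier G. pact T g t = t" "t \<otimes> e = \<iota> s"
      using T.patch_inv[OF full, of "\<iota> s"] s by (auto simp: invariants_iff)
    obtain a where a: "a \<in> carrier A" "t = emb T a" using T.emb_surj[OF t(1)] t(2) by blast
    have "s = emb S (\<phi> a)" by (rule io_eqD) (use sc emb[OF a(1)] a t in auto)
    then show ?thesis using a hom by auto
  qed
  have "emb S ` carrier R = invariants G (carrier G) S"
  proof (intro equalityI subsetI)
    fix s assume "s \<in> emb S ` carrier R"
    then show "s \<in> invariants G (carrier G) S" using phi_surj emb_inv by blast
  qed (rule surj)
  then show ?thesis unfolding alg_iso_def ring_iso_def using inj
    by (auto simp: bij_betw_def add mult one smult intro!: ring_hom_memI)
qed

text \<open>The cuts x_i e, y_i e of coordinates of T are coordinates of S: the function f turns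
  into f(g) e g(e), and for the indicator of 1 this is e at g = 1 and 0 elsewhere.\<close>

lemma partial_extension_S: "partial_extension G k R S"
proof (intro partial_extension.intro unital_S R.algebra_axioms partial_extension_axioms.intro T.fin emb_iso)
  have ee: "e \<otimes> pact T g e \<otimes> e = e \<otimes> pact T g e" if "g \<in> carrier G" for g
    using that T.T.m_assoc[of "pact T g e" e e] by (simp add: T.T.m_comm[of e])
  have c: "coord G S U.tot (\<lambda>g. pre (f g \<otimes> (e \<otimes> pact T g e)))" if "coord G T (pact T) f" for f
    using that
  proof induction
    case (single x y f)
    have ye: "y \<otimes> e \<in> carrier T" "y \<otimes> e \<otimes> e = y \<otimes> e" "x \<otimes> e \<in> carrier T" "x \<otimes> e \<otimes> e = x \<otimes> e"
      using single by (simp_all add: T.T.m_assoc)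
    note p = pre_closed[OF ye(1,2)] pre_closed[OF ye(3,4)] io_pre[OF ye(1,2)] io_pre[OF ye(3,4)]
    show ?case
    proof (rule coord.single[OF p(2,1)])
      fix g assume g: "g \<in> carrier G"
      have 1: "f g \<otimes> (e \<otimes> pact T g e) \<otimes> e = f g \<otimes> (e \<otimes> pact T g e)"
        using single g ee[OF g] by (simp add: T.T.m_assoc)
      have 2: "f g \<otimes> (e \<otimes> pact T g e) \<in> carrier T" using single g by simp
      have "\<iota> (pre (x \<otimes> e) \<otimes>\<^sub>S U.tot g (pre (y \<otimes> e))) = x \<otimes> e \<otimes> (pact T g y \<otimes> pact T g e \<otimes> e)"
        using p g single by (simp add: io_hom io_tot T.act_mult)
      also have "\<dots> = x \<otimes> pact T g y \<otimes> (e \<otimes> e \<otimes> pact T g e)" using g single by (simp add: T.T.m_ac del: e_idem)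
      also have "\<dots> = f g \<otimes> (e \<otimes> pact T g e)" using g single by simp
      finally show "pre (f g \<otimes> (e \<otimes> pact T g e)) = pre (x \<otimes> e) \<otimes>\<^sub>S U.tot g (pre (y \<otimes> e))"
        using pre_closed[OF 2 1] io_pre[OF 2 1] p g by (intro io_eqD) auto
    qed
  next
    case (add p q f)
    note cl = T.coord_T_closed[OF add.hyps(1)] T.coord_T_closed[OF add.hyps(2)]
    show ?case
    proof (rule coord.add[OF add.IH])
      fix g assume g: "g \<in> carrier G"
      have m: "t \<otimes> (e \<otimes> pact T g e) \<otimes> e = t \<otimes> (e \<otimes> pact T g e)" if "t \<in> carrier T" for t
        using that g ee[OF g] by (simp add: T.T.m_assoc)
      have f: "f g = p g \<oplus> q g" using add.hyps(3) g by simp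
      show "pre (f g \<otimes> (e \<otimes> pact T g e)) = pre (p g \<otimes> (e \<otimes> pact T g e)) \<oplus>\<^sub>S pre (q g \<otimes> (e \<otimes> pact T g e))"
        using cl[OF g] g by (intro io_eqD) (simp_all add: pre_closed io_pre m io_hom f T.T.l_distr)
    qed
  qed
  have "coord G S U.tot (\<lambda>g. if g = \<one>\<^sub>G then \<one>\<^sub>S else \<zero>\<^sub>S)"
  proof (rule coord_cong[OF c[OF T.delta]])
    fix g assume g: "g \<in> carrier G"
    have "pre e = \<one>\<^sub>S" by (rule io_eqD) (simp_all add: pre_closed io_pre io_hom)
    moreover have "pre \<zero> = \<zero>\<^sub>S" by (rule io_eqD) (simp_all add: pre_closed io_pre io_hom)
    ultimately show "pre ((if g = \<one>\<^sub>G then \<one> else \<zero>) \<otimes> (e \<otimes> pact T g e)) = (if g = \<one>\<^sub>G then \<one>\<^sub>S else \<zero>\<^sub>S)"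
      using g by simp
  qed
  then show "\<exists>(m::nat) x y. x \<in> {..<m} \<rightarrow> carrier S \<and> y \<in> {..<m} \<rightarrow> carrier S \<and>
        (\<forall>g\<in>carrier G.
          (\<Oplus>\<^sub>S i\<in>{..<m}. x i \<otimes>\<^sub>S pact S g (y i \<otimes>\<^sub>S pone S (inv\<^bsub>G\<^esub> g)))
          = (if g = \<one>\<^sub>G then \<one>\<^sub>S else \<zero>\<^sub>S))"
    unfolding U.coord_tot_iff .
qed

end

section \<open>From globalizations to models\<close>

lemma galois_model_self:
  assumes "galois G k A T"
  shows "model G k A A T (\<lambda>a. a) T \<one>\<^sub>T (\<lambda>t. t)"
proof -
  interpret T: galois G k A T by fact
  show ?thesis
    by (intro model.intro assms T.A.algebra_axioms model_axioms.intro T.full_one)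
      (auto simp: alg_iso_def ring_iso_def ring_hom_def bij_betw_def T.dom)
qed

lemma galois_global_extension:
  assumes "galois G k A T"
  shows "global_extension G k A T"
proof -
  interpret T: galois G k A T by fact
  interpret M: model G k A A T "\<lambda>a. a" T "\<one>\<^sub>T" "\<lambda>t. t" by (rule galois_model_self[OF assms])
  show ?thesis
    by (intro global_extension.intro M.partial_extension_S global_action.intro global_action_axioms.intro
      M.U.partial_action_axioms) (simp add: T.dom)
qed

text \<open>The converse direction: an arbitrary globalization of a partial extension is shown to
  have the properties required in \<open>model\<close>. The record type of \<open>T\<close> stays
  open, since globalizations occur with and without a structure map.\<close>

locale glob = P: partial_extension G k R S
  for G :: "'g monoid" and k :: "'k ring" and R :: "('k, 'r) module" and S :: "('k, 's, 'g, 'r) extension" +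
  fixes T :: "('k, 't, 'g, 'z) partial_algebra_scheme" (structure) and \<iota> :: "'s \<Rightarrow> 't"
  assumes glob: "globalization G k S T \<iota>"
begin

lemma globD: "global_action G k T" "\<iota> \<in> nonunital_alg_hom k S (carrier S) T (carrier T)" "inj_on \<iota> (carrier S)"
    "ideal (\<iota> ` carrier S) T" "!!g. g \<in> carrier G ==> \<iota> ` pdom S g = \<iota> ` carrier S \<inter> pact T g ` \<iota> ` carrier S"
    "!!g x. g \<in> carrier G ==> x \<in> pdom S (inv\<^bsub>G\<^esub> g) ==> pact T g (\<iota> x) = \<iota> (pact S g x)"
    "carrier T = {(\<Oplus>\<^sub>T g\<in>carrier G. pact T g (\<iota> (s g))) |s. s \<in> carrier G \<rightarrow> carrier S}"
  using glob unfolding globalization_def by blast+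

sublocale T: gact G k T
  by (rule global_action_gact[OF globD(1) P.finite_group])

abbreviation "e \<equiv> \<iota> \<one>\<^sub>S"

lemma io_closed [simp, intro]: "x \<in> carrier S ==> \<iota> x \<in> carrier T"
  and io_add: "[|x \<in> carrier S; y \<in> carrier S|] ==> \<iota> (x \<oplus>\<^sub>S y) = \<iota> x \<oplus> \<iota> y"
  and io_mult: "[|x \<in> carrier S; y \<in> carrier S|] ==> \<iota> (x \<otimes>\<^sub>S y) = \<iota> x \<otimes> \<iota> y"
  and io_smult: "[|c \<in> carrier k; x \<in> carrier S|] ==> \<iota> (c \<odot>\<^sub>S x) = c \<odot>\<^sub>T \<iota> x"
  using globD(2) by (auto simp: nonunital_alg_hom_def)

lemma io_zero: "\<iota> \<zero>\<^sub>S = \<zero>"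
proof -
  have "\<iota> \<zero>\<^sub>S \<oplus> \<iota> \<zero>\<^sub>S = \<iota> \<zero>\<^sub>S" by (simp add: io_add[symmetric])
  then show ?thesis by (simp add: T.T.add.r_cancel_one)
qed

lemma io_eqD: "[|x \<in> carrier S; y \<in> carrier S; \<iota> x = \<iota> y|] ==> x = y"
  using globD(3) by (auto dest: inj_onD)

lemma io_e [simp]: "x \<in> carrier S ==> \<iota> x \<otimes> e = \<iota> x"
  by (simp add: io_mult[symmetric])

lemma e_idem [simp]: "e \<otimes> e = e"
  by (rule io_e) simp

lemma e_closed [simp, intro]: "e \<in> carrier T"
  by (rule io_closed) simp

lemma io_surj: "t \<in> carrier T ==> t \<otimes> e = t ==> t \<in> \<iota> ` carrier S"
  using ideal.I_l_closed[OF globD(4), of e t] by (metis P.S.one_closed imageI)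

text \<open>The element 1 is a sum of translates g(s_g) with s_g = s_g e, so whatever kills all
  translates of e kills 1.\<close>

lemma full_e: "T.full e"
  unfolding T.full_def
proof (intro conjI ballI impI)
  fix z assume z: "z \<in> carrier T" "\<forall>g\<in>carrier G. z \<otimes> pact T g e = \<zero>"
  obtain s where s: "\<one> = (\<Oplus>g\<in>carrier G. pact T g (\<iota> (s g)))" "s \<in> carrier G \<rightarrow> carrier S"
    using globD(7) T.T.one_closed by blast
  have 0: "z \<otimes> pact T g (\<iota> (s g)) = \<zero>" if g: "g \<in> carrier G" for g
  proof -
    have sg: "s g \<in> carrier S" using s g by auto
    have "z \<otimes> pact T g (\<iota> (s g) \<otimes> e) = z \<otimes> pact T g e \<otimes> pact T g (\<iota> (s g))"
      using sg z(1) g by (simp add: T.act_mult T.T.m_ac del: io_e)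
    then show ?thesis using sg z g by simp
  qed
  have "z = z \<otimes> (\<Oplus>g\<in>carrier G. pact T g (\<iota> (s g)))" using z by (simp add: s(1)[symmetric])
  also have "\<dots> = (\<Oplus>g\<in>carrier G. z \<otimes> pact T g (\<iota> (s g)))"
    using z s by (intro T.T.finsum_rdistr T.fin) (auto simp: Pi_iff)
  also have "\<dots> = \<zero>" by (rule T.T.add.finprod_one_eqI) (rule 0)
  finally show "z = \<zero>" .
qed auto

lemma dom: "g \<in> carrier G ==> pdom S g = {x \<in> carrier S. \<iota> x \<otimes> pact T g e = \<iota> x}"
proof -
  assume g: "g \<in> carrier G"
  have "x \<in> pdom S g \<longleftrightarrow> \<iota> x \<otimes> pact T g e = \<iota> x" if x: "x \<in> carrier S" for x
  proof
    assume "x \<in> pdom S g"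
    then have "\<iota> x \<in> pact T g ` \<iota> ` carrier S" using globD(5)[OF g] by blast
    then obtain y where y: "y \<in> carrier S" "\<iota> x = pact T g (\<iota> y)" by blast
    have "pact T g (\<iota> y) \<otimes> pact T g e = pact T g (\<iota> y \<otimes> e)" using g y by (simp add: T.act_mult del: io_e)
    then show "\<iota> x \<otimes> pact T g e = \<iota> x" using y by simp
  next
    assume xe: "\<iota> x \<otimes> pact T g e = \<iota> x"
    let ?t = "pact T (inv\<^bsub>G\<^esub> g) (\<iota> x)"
    have "pact T (inv\<^bsub>G\<^esub> g) (\<iota> x \<otimes> pact T g e) = ?t \<otimes> pact T (inv\<^bsub>G\<^esub> g) (pact T g e)"
      using g x by (intro T.act_mult) auto
    then have "?t = ?t \<otimes> pact T (inv\<^bsub>G\<^esub> g) (pact T g e)" unfolding xe .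
    then have "?t \<otimes> e = ?t" using g by simp
    then have "?t \<in> \<iota> ` carrier S" using g x by (intro io_surj) auto
    then have "pact T g ?t \<in> pact T g ` \<iota> ` carrier S" by blast
    then have "\<iota> x \<in> \<iota> ` pdom S g" using globD(5)[OF g] g x by simp
    then obtain y where y: "y \<in> pdom S g" "\<iota> x = \<iota> y" by blast
    then have "x = y" using x g by (intro io_eqD) (auto simp: P.pdom_iff)
    then show "x \<in> pdom S g" using y by simp
  qed
  moreover have "pdom S g \<subseteq> carrier S" using g by (auto simp: P.pdom_iff)
  ultimately show ?thesis by blast
qed

lemma act:
  "g \<in> carrier G ==> x \<in> pdom S (inv\<^bsub>G\<^esub> g) ==> pact S g x \<in> carrier S \<and> \<iota> (pact S g x) = pact T g (\<iota> x)"
  using P.pact_homD(1)[of g x] globD(6) by (simp add: P.pdom_iff)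

lemma io_pone: "g \<in> carrier G ==> \<iota> (pone S g) = e \<otimes> pact T g e"
proof -
  assume g: "g \<in> carrier G"
  have "e \<otimes> pact T g e \<otimes> e = e \<otimes> pact T g e"
    using g T.T.m_assoc[of "pact T g e" e e] by (simp add: T.T.m_comm[of e])
  then have "e \<otimes> pact T g e \<in> \<iota> ` carrier S" using g by (intro io_surj) auto
  then obtain x where x: "x \<in> carrier S" "\<iota> x = e \<otimes> pact T g e" by (metis imageE)
  have "x \<in> pdom S g" using g x by (simp add: dom T.T.m_assoc T.eps_idem[OF full_e])
  then have 1: "pone S g \<otimes>\<^sub>S x = x" using g x by (simp add: P.pdom_iff P.S.m_comm)
  have "pone S g \<in> pdom S g" using g by (simp add: P.pdom_iff)
  then have "\<iota> (pone S g) \<otimes> pact T g e = \<iota> (pone S g)" using g by (simp add: dom)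
  then have "\<iota> (pone S g) = \<iota> (pone S g) \<otimes> (e \<otimes> pact T g e)" using g by (simp add: T.T.m_assoc[symmetric])
  also have "\<dots> = \<iota> (pone S g \<otimes>\<^sub>S x)" using g x by (simp add: io_mult)
  finally show ?thesis using 1 x by simp
qed

lemma io_tot: "g \<in> carrier G ==> s \<in> carrier S ==> \<iota> (P.tot g s) = pact T g (\<iota> s) \<otimes> e"
proof -
  assume g: "g \<in> carrier G" and s: "s \<in> carrier S"
  have "s \<otimes>\<^sub>S pone S (inv\<^bsub>G\<^esub> g) \<in> pdom S (inv\<^bsub>G\<^esub> g)" using g s by (intro P.pone_pdom) auto
  from act[OF g this] have "\<iota> (P.tot g s) = pact T g (\<iota> s \<otimes> (e \<otimes> pact T (inv\<^bsub>G\<^esub> g) e))"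
    using g s by (simp add: P.tot_def io_mult io_pone)
  also have "\<iota> s \<otimes> (e \<otimes> pact T (inv\<^bsub>G\<^esub> g) e) = \<iota> s \<otimes> pact T (inv\<^bsub>G\<^esub> g) e"
    using g s by (simp add: T.T.m_assoc[symmetric])
  finally show ?thesis using g s by (simp add: T.act_mult)
qed

lemma invariants_iff: "s \<in> invariants G (carrier G) S \<longleftrightarrow>
  s \<in> carrier S \<and> (\<forall>g\<in>carrier G. pact T g (\<iota> s) \<otimes> e = \<iota> s \<otimes> pact T g e)"
proof -
  have "P.tot g s = s \<otimes>\<^sub>S pone S g \<longleftrightarrow> pact T g (\<iota> s) \<otimes> e = \<iota> s \<otimes> pact T g e"
    if g: "g \<in> carrier G" and s: "s \<in> carrier S" for g
  proof -
    have "P.tot g s = s \<otimes>\<^sub>S pone S g \<longleftrightarrow> \<iota> (P.tot g s) = \<iota> (s \<otimes>\<^sub>S pone S g)"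
      using io_eqD[of "P.tot g s" "s \<otimes>\<^sub>S pone S g"] g s by auto
    also have "\<iota> (s \<otimes>\<^sub>S pone S g) = \<iota> s \<otimes> pact T g e"
      using g s by (simp add: io_mult io_pone T.T.m_assoc[symmetric])
    finally show ?thesis using g s by (simp add: io_tot)
  qed
  then show ?thesis by (auto simp: invariants_def P.tot_def)
qed

lemma inv_lift:
  assumes "s \<in> invariants G (carrier G) S"
  shows "\<exists>t\<in>carrier T. (\<forall>g\<in>carrier G. pact T g t = t) \<and> t \<otimes> e = \<iota> s"
  using T.patch_inv[OF full_e, of "\<iota> s"] assms by (auto simp: invariants_iff)

text \<open>Coordinates x_i, y_i of S are moved by g: the products of g(s x_i) and h(g(y_i)), summed
  over i, give g(s) at h = 1 and 0 elsewhere. Summing over g with 1 equal to the sum of the g(s_g)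
  gives the indicator.\<close>

lemma delta: "coord G T (pact T) (\<lambda>g. if g = \<one>\<^sub>G then \<one> else \<zero>)"
proof -
  \<comment> \<open>Writing h(g(y)) as g applied to (\<open>inv\<close> g)hg (y) explains the
    conjugate in the argument of f.\<close>
  have c: "coord G T (pact T) (\<lambda>h. pact T g (\<iota> (s \<otimes>\<^sub>S f (inv\<^bsub>G\<^esub> g \<otimes>\<^sub>G h \<otimes>\<^sub>G g))))"
    if g: "g \<in> carrier G" and s: "s \<in> carrier S" and "coord G S P.tot f" for g s f
    using that(3)
  proof induction
    case (single x y f)
    show ?case
    proof (rule coord.single)
      fix h assume h: "h \<in> carrier G"
      let ?u = "inv\<^bsub>G\<^esub> g \<otimes>\<^sub>G h \<otimes>\<^sub>G g"
      have u: "?u \<in> carrier G" using g h by simp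
      have "\<iota> (s \<otimes>\<^sub>S f ?u) = \<iota> s \<otimes> \<iota> x \<otimes> pact T ?u (\<iota> y) \<otimes> e"
        using single u s by (simp add: io_mult io_tot T.T.m_assoc)
      also have "\<dots> = \<iota> s \<otimes> e \<otimes> \<iota> x \<otimes> pact T ?u (\<iota> y)" using single u s by (simp add: T.T.m_ac del: io_e)
      also have "\<dots> = \<iota> (s \<otimes>\<^sub>S x) \<otimes> pact T ?u (\<iota> y)" using single s by (simp add: io_mult)
      finally have "pact T g (\<iota> (s \<otimes>\<^sub>S f ?u)) = pact T g (\<iota> (s \<otimes>\<^sub>S x)) \<otimes> pact T (g \<otimes>\<^sub>G ?u) (\<iota> y)"
        using g u s single by (simp add: T.act_mult T.act_comp)
      also have "g \<otimes>\<^sub>G ?u = h \<otimes>\<^sub>G g" using g h by (simp add: P.G.m_assoc[symmetric])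
      finally show "pact T g (\<iota> (s \<otimes>\<^sub>S f ?u)) = pact T g (\<iota> (s \<otimes>\<^sub>S x)) \<otimes> pact T h (pact T g (\<iota> y))"
        using g h single by (simp add: T.act_comp)
    qed (use single g s in auto)
  next
    case (add p q f)
    have cl: "p h \<in> carrier S" "q h \<in> carrier S" if "h \<in> carrier G" for h
      using P.S.coord_closed[OF add.hyps(1) that] P.S.coord_closed[OF add.hyps(2) that] by auto
    show ?case
      by (rule coord.add[OF add.IH]) (use g s cl add.hyps(3) in \<open>simp_all add: P.S.r_distr io_add T.act_add\<close>)
  qed
  have dS: "coord G S P.tot (\<lambda>g. if g = \<one>\<^sub>G then \<one>\<^sub>S else \<zero>\<^sub>S)"
    unfolding P.coord_tot_iff by (rule P.galois_coordinates)
  have c1: "coord G T (pact T) (\<lambda>h. if h = \<one>\<^sub>G then pact T g (\<iota> s) else \<zero>)"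
    if g: "g \<in> carrier G" and s: "s \<in> carrier S" for g s
  proof (rule coord_cong[OF c[OF g s dS]])
    fix h assume h: "h \<in> carrier G"
    have "inv\<^bsub>G\<^esub> g \<otimes>\<^sub>G h \<otimes>\<^sub>G g = \<one>\<^sub>G \<longleftrightarrow> h = \<one>\<^sub>G"
    proof
      assume "inv\<^bsub>G\<^esub> g \<otimes>\<^sub>G h \<otimes>\<^sub>G g = \<one>\<^sub>G"
      then have "g \<otimes>\<^sub>G (inv\<^bsub>G\<^esub> g \<otimes>\<^sub>G h \<otimes>\<^sub>G g) \<otimes>\<^sub>G inv\<^bsub>G\<^esub> g = \<one>\<^sub>G" using g by simp
      then show "h = \<one>\<^sub>G" using g h by (simp add: P.G.m_assoc)
    qed (use g in simp)
    then show "pact T g (\<iota> (s \<otimes>\<^sub>S (if inv\<^bsub>G\<^esub> g \<otimes>\<^sub>G h \<otimes>\<^sub>G g = \<one>\<^sub>G then \<one>\<^sub>S else \<zero>\<^sub>S))) =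
      (if h = \<one>\<^sub>G then pact T g (\<iota> s) else \<zero>)" using g s by (simp add: io_zero)
  qed
  obtain s where s: "\<one> = (\<Oplus>g\<in>carrier G. pact T g (\<iota> (s g)))" "s \<in> carrier G \<rightarrow> carrier S"
    using globD(7) T.T.one_closed by blast
  have "coord G T (pact T) (\<lambda>h. if h = \<one>\<^sub>G then (\<Oplus>g\<in>X. pact T g (\<iota> (s g))) else \<zero>)"
    if "finite X" "X \<subseteq> carrier G" for X
    using that
  proof (induction X rule: finite_induct)
    case empty
    show ?case by (rule coord.single[of "\<zero>" _ "\<zero>"]) auto
  next
    case (insert g X)
    have sX: "(\<lambda>g. pact T g (\<iota> (s g))) \<in> X \<rightarrow> carrier T" "pact T g (\<iota> (s g)) \<in> carrier T"
      using insert.prems s(2) by (auto simp: Pi_iff subset_iff)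
    have "coord G T (pact T) (\<lambda>h. if h = \<one>\<^sub>G then pact T g (\<iota> (s g)) else \<zero>)"
      using insert.prems s(2) by (intro c1) auto
    moreover have "coord G T (pact T) (\<lambda>h. if h = \<one>\<^sub>G then (\<Oplus>g\<in>X. pact T g (\<iota> (s g))) else \<zero>)"
      using insert by blast
    ultimately show ?case
      by (rule coord.add) (use insert.hyps sX in \<open>simp add: T.T.finsum_closed\<close>)
  qed
  from this[OF T.fin subset_refl] show ?thesis unfolding s(1) .
qed

end

text \<open>The homomorphism laws of the structure map are verified after multiplication by e, where
  they are those of \<open>emb S\<close>; invariants are determined by this cut.\<close>

lemma (in glob) model_ext:
  fixes A :: "('k, 'a) module" and T' :: "('k, 't, 'g, 'a) extension"
  assumes A: "algebra k A" and phi: "\<phi> \<in> alg_iso k A R"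
    and eqs: "carrier T' = carrier T" "monoid.mult T' = monoid.mult T" "\<one>\<^sub>T' = \<one>" "\<zero>\<^sub>T' = \<zero>"
      "add T' = add T" "smult T' = smult T" "pdom T' = pdom T" "pact T' = pact T"
    and E: "!!a. a \<in> carrier A ==> emb T' a \<in> carrier T"
      "!!a g. a \<in> carrier A ==> g \<in> carrier G ==> pact T g (emb T' a) = emb T' a"
      "!!a. a \<in> carrier A ==> emb T' a \<otimes> e = \<iota> (emb S (\<phi> a))"
  shows "model G k A R T' \<phi> S e \<iota>"
proof -
  interpret A: algebra k A by fact
  have phi': "\<phi> \<in> ring_hom A R" "bij_betw \<phi> (carrier A) (carrier R)"
    "!!c a. c \<in> carrier k ==> a \<in> carrier A ==> \<phi> (c \<odot>\<^sub>A a) = c \<odot>\<^sub>R \<phi> a"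
    using phi by (auto simp: alg_iso_def ring_iso_def)
  note ph = ring_hom_closed[OF phi'(1)] ring_hom_mult[OF phi'(1)] ring_hom_add[OF phi'(1)] ring_hom_one[OF phi'(1)] phi'(3)
  have es: "emb S \<in> ring_hom R (S\<lparr>carrier := invariants G (carrier G) S\<rparr>)"
    "bij_betw (emb S) (carrier R) (invariants G (carrier G) S)"
    "!!c a. c \<in> carrier k ==> a \<in> carrier R ==> emb S (c \<odot>\<^sub>R a) = c \<odot>\<^sub>S emb S a"
    using P.emb_iso by (auto simp: alg_iso_def ring_iso_def)
  have sinv: "s \<in> carrier S" if "s \<in> invariants G (carrier G) S" for s using that by (simp add: invariants_def)
  have eh: "r \<in> carrier R ==> emb S r \<in> carrier S"
    "r \<in> carrier R ==> r' \<in> carrier R ==> emb S (r \<otimes>\<^sub>R r') = emb S r \<otimes>\<^sub>S emb S r'"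
    "r \<in> carrier R ==> r' \<in> carrier R ==> emb S (r \<oplus>\<^sub>R r') = emb S r \<oplus>\<^sub>S emb S r'"
    "emb S \<one>\<^sub>R = \<one>\<^sub>S" for r r'
    using ring_hom_closed[OF es(1)] ring_hom_mult[OF es(1)] ring_hom_add[OF es(1)] ring_hom_one[OF es(1)] sinv by auto
  have algT': "algebra k T'"
    by (rule algebra_inj[OF T.T.algebra_axioms, where \<iota> = "\<lambda>x. x"]) (auto simp: eqs)
  have gT': "gact G k T'"
    by (rule gact.intro[OF P.G.group_axioms algT' gact_axioms.intro])
      (simp_all add: eqs T.fin T.dom T.act_add T.act_mult T.act_comp)
  interpret T': gact G k T' by (rule gT')
  have uniq: "t = t'" if "t \<in> carrier T" "t' \<in> carrier T" "!!g. g \<in> carrier G ==> pact T g t = t"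
    "!!g. g \<in> carrier G ==> pact T g t' = t'" "t \<otimes> e = t' \<otimes> e" for t t'
    using T.full_inv_eqI[OF full_e that(1,3,2,4,5)] .
  have coordT': "coord G T' (pact T') f" if "coord G T (pact T) f" for f
    using that
  proof induction
    case (single x y f)
    show ?case by (rule coord.single[of x _ y]) (use single in \<open>auto simp: eqs\<close>)
  next
    case (add p q f)
    show ?case by (rule coord.add[OF add.IH]) (use add.hyps in \<open>auto simp: eqs\<close>)
  qed
  have gal: "galois G k A T'"
  proof (rule galois.intro[OF gT' A galois_axioms.intro])
    show "emb T' a \<in> carrier T'" if "a \<in> carrier A" for a using that E by (simp add: eqs)
    show "emb T' (a \<oplus>\<^sub>A b) = emb T' a \<oplus>\<^sub>T' emb T' b" if "a \<in> carrier A" "b \<in> carrier A" for a b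
      unfolding eqs by (rule uniq) (use that E in \<open>simp_all add: T.act_add T.T.l_distr ph eh io_add\<close>)
    show "emb T' (a \<otimes>\<^sub>A b) = emb T' a \<otimes>\<^sub>T' emb T' b" if ab: "a \<in> carrier A" "b \<in> carrier A" for a b
      unfolding eqs
    proof (rule uniq)
      have "emb T' a \<otimes> emb T' b \<otimes> e = emb T' a \<otimes> emb T' b \<otimes> (e \<otimes> e)" by simp
      also have "\<dots> = (emb T' a \<otimes> e) \<otimes> (emb T' b \<otimes> e)" using ab E(1) by (simp add: T.T.m_ac del: e_idem)
      finally show "emb T' (a \<otimes>\<^sub>A b) \<otimes> e = emb T' a \<otimes> emb T' b \<otimes> e"
        using ab E(3) by (simp add: ph eh io_mult)
    qed (use ab E(1,2) in \<open>simp_all add: T.act_mult\<close>)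
    show "emb T' \<one>\<^sub>A = \<one>\<^sub>T'"
      unfolding eqs by (rule uniq) (use E in \<open>simp_all add: ph eh\<close>)
    show "emb T' (c \<odot>\<^sub>A a) = c \<odot>\<^sub>T' emb T' a" if "c \<in> carrier k" "a \<in> carrier A" for c a
      unfolding eqs by (rule uniq)
        (use that E es(3) in \<open>simp_all add: global_action_smult[OF globD(1)] T.T.smult_assoc2 ph eh io_smult\<close>)
    show "inj_on (emb T') (carrier A)"
    proof (rule inj_onI)
      fix a b assume ab: "a \<in> carrier A" "b \<in> carrier A" "emb T' a = emb T' b"
      then have "\<iota> (emb S (\<phi> a)) = \<iota> (emb S (\<phi> b))" using E(3) by metis
      then have "emb S (\<phi> a) = emb S (\<phi> b)" using ab by (intro io_eqD) (simp_all add: ph eh)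
      then have "\<phi> a = \<phi> b" using es(2) ab ph(1) by (auto simp: bij_betw_def dest: inj_onD)
      then show "a = b" using phi'(2) ab by (auto simp: bij_betw_def dest: inj_onD)
    qed
    show "x \<in> emb T' ` carrier A" if x: "x \<in> carrier T'" "!!g. g \<in> carrier G ==> pact T' g x = x" for x
    proof -
      have x': "x \<in> carrier T" "!!g. g \<in> carrier G ==> pact T g x = x" using x by (simp_all add: eqs)
      have "x \<otimes> e \<in> \<iota> ` carrier S" using x' by (intro io_surj) (simp_all add: T.T.m_assoc)
      then obtain s where s: "s \<in> carrier S" "\<iota> s = x \<otimes> e" by (metis imageE)
      have "s \<in> invariants G (carrier G) S" using s x' by (simp add: invariants_iff T.act_mult T.T.m_ac)
      then obtain r where r: "r \<in> carrier R" "s = emb S r" using es(2) by (auto simp: bij_betw_def)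
      obtain a where a: "a \<in> carrier A" "r = \<phi> a" using r phi'(2) by (auto simp: bij_betw_def)
      have "x = emb T' a" by (rule uniq) (use x' a r s E in simp_all)
      then show ?thesis using a by blast
    qed
    show "coord G T' (pact T') (\<lambda>g. if g = \<one>\<^sub>G then \<one>\<^sub>T' else \<zero>\<^sub>T')"
      unfolding eqs(3,4) by (rule coordT'[OF delta])
  qed (use E in \<open>simp add: eqs\<close>)
  interpret T': galois G k A T' by (rule gal)
  have "T'.full e" using full_e by (simp add: T'.full_def T.full_def eqs)
  then show ?thesis
    by (intro model.intro gal P.R.algebra_axioms model_axioms.intro phi)
      (simp_all add: eqs io_surj globD(3) io_zero io_add io_mult io_smult dom act E ph eh del: e_idem)
qed

lemma extension_globalization_model:
  assumes S: "partial_extension G k R S" and A: "algebra k A" "\<phi> \<in> alg_iso k A R"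
    and T: "extension_globalization G k A \<phi> S T \<iota>"
  shows "model G k A R T \<phi> S (\<iota> \<one>\<^sub>S) \<iota>"
proof -
  interpret S: partial_extension G k R S by fact
  interpret glob G k R S T \<iota>
    using T by unfold_locales (simp add: extension_globalization_def)
  have "emb T a \<in> {x \<in> carrier T. \<forall>g\<in>carrier G. pact T g x = x}" if "a \<in> carrier A" for a
    using T that T.invariants_eq[OF subset_refl] by (simp add: extension_globalization_def)
  then show ?thesis using T by (intro model_ext A) (auto simp: extension_globalization_def)
qed

text \<open>A globalization carries no structure map; it is constructed by lifting each invariant
  \<open>emb S (\<phi> a)\<close> to an invariant element.\<close>

lemma globalization_model:
  fixes V :: "('k, 'v, 'g) partial_algebra" and A :: "('k, 'a) module"
  assumes S: "partial_extension G k R S" and A: "algebra k A" "\<phi> \<in> alg_iso k A R"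
    and V: "globalization G k S V \<iota>"
  obtains T :: "('k, 'v, 'g, 'a) extension" where "model G k A R T \<phi> S (\<iota> \<one>\<^sub>S) \<iota>"
    "carrier T = carrier V" "monoid.mult T = monoid.mult V" "\<one>\<^sub>T = \<one>\<^sub>V" "\<zero>\<^sub>T = \<zero>\<^sub>V"
    "add T = add V" "smult T = smult V" "pdom T = pdom V" "pact T = pact V"
proof -
  interpret S: partial_extension G k R S by fact
  interpret glob G k R S V \<iota> by unfold_locales (rule V)
  have phi: "\<phi> a \<in> carrier R" if "a \<in> carrier A" for a
    using A(2) that by (auto simp: alg_iso_def ring_iso_def ring_hom_closed)
  have "\<forall>a\<in>carrier A. \<exists>t. t \<in> carrier V \<and> (\<forall>g\<in>carrier G. pact V g t = t) \<and> t \<otimes>\<^sub>V e = \<iota> (emb S (\<phi> a))"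
  proof
    fix a assume a: "a \<in> carrier A"
    have "emb S (\<phi> a) \<in> invariants G (carrier G) S"
      using S.emb_iso phi[OF a] by (auto simp: alg_iso_def ring_iso_def dest: ring_hom_closed)
    from inv_lift[OF this] show "\<exists>t. t \<in> carrier V \<and> (\<forall>g\<in>carrier G. pact V g t = t) \<and> t \<otimes>\<^sub>V e = \<iota> (emb S (\<phi> a))"
      by blast
  qed
  then obtain E where E: "\<forall>a\<in>carrier A. E a \<in> carrier V \<and> (\<forall>g\<in>carrier G. pact V g (E a) = E a) \<and> E a \<otimes>\<^sub>V e = \<iota> (emb S (\<phi> a))"
    by (rule bchoice[THEN exE])
  define T :: "('k, 'v, 'g, 'a) extension" where "T = \<lparr>carrier = carrier V, monoid.mult = monoid.mult V,
    one = \<one>\<^sub>V, ring.zero = \<zero>\<^sub>V, add = add V, smult = smult V, pdom = pdom V, pact = pact V, emb = E\<rparr>"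
  have "model G k A R T \<phi> S e \<iota>"
    by (rule model_ext[OF A]) (use E in \<open>simp_all add: T_def\<close>)
  then show thesis by (rule that) (simp_all add: T_def)
qed

lemma model_exists:
  fixes S :: "('k, 's, 'g, 'r) extension" and A :: "('k, 'a) module"
  assumes S: "partial_extension G k R S" and A: "algebra k A" "\<phi> \<in> alg_iso k A R"
  obtains T :: "('k, 'g \<Rightarrow> 's, 'g, 'a) extension" and e \<iota> where "model G k A R T \<phi> S e \<iota>"
proof -
  interpret S: partial_extension G k R S by fact
  obtain V :: "('k, 'g \<Rightarrow> 's, 'g) partial_algebra" and \<iota> where "globalization G k S V \<iota>"
    using globalization_exists[OF S.unital_partial_action_axioms S.finite_group] by blast
  from globalization_model[OF assms this] show thesis using that by metis
qed

text \<open>A global extension is its own globalization with e = 1, so the general passage from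
  globalizations to \<open>model\<close> applies.\<close>

lemma global_extension_galois:
  assumes "global_extension G k A T"
  shows "galois G k A T"
proof -
  interpret E: global_extension G k A T by fact
  interpret T: gact G k T by (rule global_action_gact[OF E.global_action_axioms E.finite_group])
  have gl: "globalization G k T T (\<lambda>t. t)"
    by (rule globalizationI[OF E.global_action_axioms E.finite_group T.full_one])
      (auto simp: nonunital_alg_hom_def T.dom)
  have emb: "emb T a \<in> invariants G (carrier G) T" if "a \<in> carrier A" for a
    using E.emb_iso that by (auto simp: alg_iso_def ring_iso_def dest: ring_hom_closed)
  then have ec: "emb T a \<in> carrier T" if "a \<in> carrier A" for a using that by (simp add: invariants_def)
  have "model G k A A T (\<lambda>a. a) T \<one>\<^sub>T (\<lambda>t. t)"
  proof (rule extension_globalization_model[OF E.partial_extension_axioms])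
    show "algebra k A" by (rule E.R.algebra_axioms)
    show "(\<lambda>a. a) \<in> alg_iso k A A" by (auto simp: alg_iso_def ring_iso_def ring_hom_def bij_betw_def)
    show "extension_globalization G k A (\<lambda>a. a) T T (\<lambda>t. t)"
      unfolding extension_globalization_def using gl emb ec by simp
  qed
  then show ?thesis by (rule model.axioms(1))
qed

lemma galois_iff_global_extension: "galois G k A T \<longleftrightarrow> global_extension G k A T"
  using galois_global_extension global_extension_galois by blast

context model
begin

lemma phi_closed: "a \<in> carrier A ==> \<phi> a \<in> carrier R"
  by (rule ring_hom_closed[OF phi_hom])

lemma extension_globalization: "extension_globalization G k A \<phi> S T \<iota>"
proof -
  interpret GE: global_extension G k A T by (rule galois_global_extension[OF T.galois_axioms])
  have "\<iota> ` carrier S = {t \<in> carrier T. t \<otimes> e = t}" using io_surj by auto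
  then have "globalization G k S T \<iota>"
    by (intro globalizationI[OF GE.global_action_axioms T.fin full _ io_inj])
      (use act in \<open>auto simp: nonunital_alg_hom_def io_hom dom\<close>)
  then show ?thesis
    unfolding extension_globalization_def using emb by (simp add: T.invariants_eq io_hom)
qed

end

text \<open>The cut eT as an extension of \<open>R\<close>, realizing every pair (T, e). The maps of
  T are kept as they are, since values outside the domains carry no meaning.\<close>

definition res_ext ::
  "('k, 'a) module \<Rightarrow> ('a \<Rightarrow> 'r) \<Rightarrow> ('k, 't, 'g, 'a) extension \<Rightarrow> 't \<Rightarrow> ('k, 't, 'g, 'r) extension" where
  "res_ext A \<phi> T e = \<lparr>carrier = {t \<in> carrier T. t \<otimes>\<^sub>T e = t}, monoid.mult = monoid.mult T, one = e,
    ring.zero = \<zero>\<^sub>T, add = add T, smult = smult T,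
    pdom = (\<lambda>g. {t \<in> carrier T. t \<otimes>\<^sub>T e = t \<and> t \<otimes>\<^sub>T pact T g e = t}), pact = pact T,
    emb = (\<lambda>r. emb T (inv_into (carrier A) \<phi> r) \<otimes>\<^sub>T e)\<rparr>"

lemma res_ext_model:
  assumes T: "galois G k A T" and R: "algebra k R" and phi: "\<phi> \<in> alg_iso k A R" and e: "gact.full G T e"
  shows "model G k A R T \<phi> (res_ext A \<phi> T e) e (\<lambda>t. t)"
proof -
  interpret T: galois G k A T by fact
  note ee = T.fullD[OF e]
  have inv: "inv_into (carrier A) \<phi> (\<phi> a) = a" if "a \<in> carrier A" for a
    using phi that by (auto simp: alg_iso_def ring_iso_def bij_betw_def)
  have act: "pact T g x \<otimes>\<^sub>T e = pact T g x"
    if "g \<in> carrier G" "x \<in> carrier T" "x \<otimes>\<^sub>T pact T (inv\<^bsub>G\<^esub> g) e = x" for g x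
    using that ee T.act_mult[of g x "pact T (inv\<^bsub>G\<^esub> g) e"] by simp
  show ?thesis
    by (intro model.intro T R model_axioms.intro phi e)
      (use ee act in \<open>auto simp: res_ext_def inv T.T.l_distr T.T.m_assoc T.T.smult_assoc2\<close>)
qed

text \<open>A bijective equivariant map with F(e) = e' sends eT onto e'T' and g(e) to g(e'), so it
  restricts to the cuts with their domains.\<close>

lemma partially_isomorphic_of_ghom:
  assumes "model G k A R T \<phi> S e \<iota>" "model G k A R T' \<phi> S' e' \<iota>'"
    and F: "ghom G A T T' F" "F e = e'"
  shows "partially_isomorphic G k R S S'"
proof -
  interpret M: model G k A R T \<phi> S e \<iota> by fact
  interpret M': model G k A R T' \<phi> S' e' \<iota>' by fact
  have bij: "bij_betw F (carrier T) (carrier T')" by (rule ghom_bij[OF M.T.galois_axioms M'.T.galois_axioms F(1)])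
  have Fh: "F \<in> ring_hom T T'" and Fact: "!!g x. g \<in> carrier G ==> x \<in> carrier T ==> F (pact T g x) = pact T' g (F x)"
    and Femb: "!!a. a \<in> carrier A ==> F (emb T a) = emb T' a"
    using F(1) by (auto simp: ghom_def)
  note h = ring_hom_closed[OF Fh] ring_hom_mult[OF Fh] ring_hom_add[OF Fh] ring_hom_one[OF Fh]
  have Fe: "F t \<otimes>\<^sub>T' e' = F (t \<otimes>\<^sub>T e)" if "t \<in> carrier T" for t using that by (simp add: h F(2))
  have Finj: "t = u" if "t \<in> carrier T" "u \<in> carrier T" "F t = F u" for t u
    using bij that by (auto simp: bij_betw_def dest: inj_onD)
  define f where "f x = M'.pre (F (\<iota> x))" for x
  have f: "f x \<in> carrier S'" "\<iota>' (f x) = F (\<iota> x)" if "x \<in> carrier S" for x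
    unfolding f_def using that by (auto intro!: M'.pre_closed M'.io_pre simp: h Fe)
  have dom: "f x \<in> pdom S' g" if "g \<in> carrier G" "x \<in> pdom S g" for g x
  proof -
    have x: "x \<in> carrier S" "\<iota> x \<otimes>\<^sub>T pact T g e = \<iota> x" using M.pdomD[OF that] by auto
    have "F (\<iota> x) \<otimes>\<^sub>T' pact T' g e' = F (\<iota> x \<otimes>\<^sub>T pact T g e)" using x(1) that(1) by (simp add: h Fact F(2))
    then show ?thesis using x that(1) f by (simp add: M'.dom)
  qed
  have smult: "f (c \<odot>\<^sub>S x) = c \<odot>\<^sub>S' f x" if "c \<in> carrier k" "x \<in> carrier S" for c x
  proof (rule M'.io_eqD)
    have "F (c \<odot>\<^sub>T \<iota> x) = c \<odot>\<^sub>T' F (\<iota> x)"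
      using that M.T.smult_eq[of c "\<iota> x"] M'.T.smult_eq[of c "F (\<iota> x)"] by (simp add: h Femb)
    then show "\<iota>' (f (c \<odot>\<^sub>S x)) = \<iota>' (c \<odot>\<^sub>S' f x)" using that by (simp add: f M.io_hom M'.io_hom)
  qed (use that f in simp_all)
  have emb: "f (emb S r \<otimes>\<^sub>S x) = emb S' r \<otimes>\<^sub>S' f x" if r: "r \<in> carrier R" and x: "x \<in> carrier S" for r x
  proof -
    obtain a where a: "a \<in> carrier A" "r = \<phi> a" using M.phi_surj[OF r] by blast
    show ?thesis unfolding a(2)
    proof (rule M'.io_eqD)
      have "emb T' a \<otimes>\<^sub>T' F (\<iota> x) = emb T' a \<otimes>\<^sub>T' e' \<otimes>\<^sub>T' F (\<iota> x)"
        using a x Fe[of "\<iota> x"] by (simp add: h M'.T.T.m_assoc M'.T.T.m_comm[of e'])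
      then show "\<iota>' (f (emb S (\<phi> a) \<otimes>\<^sub>S x)) = \<iota>' (emb S' (\<phi> a) \<otimes>\<^sub>S' f x)"
        using M.emb[OF a(1)] M'.emb[OF a(1)] a x by (simp add: f M.io_hom M'.io_hom h Femb F(2))
    qed (use M.emb[OF a(1)] M'.emb[OF a(1)] x f in simp_all)
  qed
  have hom: "f \<in> ring_hom S S'"
  proof (rule ring_hom_memI)
    show "f \<one>\<^sub>S = \<one>\<^sub>S'" by (rule M'.io_eqD) (simp_all add: f M.io_hom M'.io_hom F(2))
    show "f (x \<otimes>\<^sub>S y) = f x \<otimes>\<^sub>S' f y" if "x \<in> carrier S" "y \<in> carrier S" for x y
      by (rule M'.io_eqD) (use that in \<open>simp_all add: f M.io_hom M'.io_hom h\<close>)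
    show "f (x \<oplus>\<^sub>S y) = f x \<oplus>\<^sub>S' f y" if "x \<in> carrier S" "y \<in> carrier S" for x y
      by (rule M'.io_eqD) (use that in \<open>simp_all add: f M.io_hom M'.io_hom h\<close>)
  qed (rule f)
  have inj: "inj_on f (carrier S)"
  proof (rule inj_onI)
    fix x y assume xy: "x \<in> carrier S" "y \<in> carrier S" "f x = f y"
    then have "F (\<iota> x) = F (\<iota> y)" using f(2) by metis
    then show "x = y" using xy(1,2) by (intro M.io_eqD Finj) simp_all
  qed
  have surj: "y \<in> f ` carrier S" if y: "y \<in> carrier S'" for y
  proof -
    obtain t where t: "t \<in> carrier T" "F t = \<iota>' y"
      using bij y by (metis M'.io_closed bij_betw_def imageE)
    have te: "t \<otimes>\<^sub>T e = t" by (rule Finj) (use t y in \<open>simp_all add: Fe[symmetric]\<close>)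
    have "y = f (M.pre t)"
      by (rule M'.io_eqD) (use y t te in \<open>simp_all add: f M.pre_closed M.io_pre\<close>)
    then show ?thesis using M.pre_closed[OF t(1) te] by blast
  qed
  have "f \<in> alg_iso k S S'"
    using hom inj surj f(1) smult by (auto simp: alg_iso_def ring_iso_def bij_betw_def)
  moreover have "f (pact S g x) = pact S' g (f x)" if "g \<in> carrier G" "x \<in> pdom S (inv\<^bsub>G\<^esub> g)" for g x
  proof (rule M'.io_eqD)
    have x: "x \<in> carrier S" using M.pdomD[OF _ that(2)] that(1) by simp
    have fx: "f x \<in> pdom S' (inv\<^bsub>G\<^esub> g)" using dom[OF _ that(2)] that(1) by simp
    show "\<iota>' (f (pact S g x)) = \<iota>' (pact S' g (f x))"
      using M.act[OF that] M'.act[OF that(1) fx] x that(1) by (simp add: f Fact)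
    show "f (pact S g x) \<in> carrier S'" "pact S' g (f x) \<in> carrier S'"
      using M.act[OF that] M'.act[OF that(1) fx] f by simp_all
  qed
  ultimately show ?thesis unfolding partially_isomorphic_def using dom emb by (intro bexI[of _ f]) auto
qed

section \<open>Extension of partial isomorphisms to globalizations\<close>

locale model_map = M: model G k A R T \<phi> S e \<iota> + M': model G k A R T' \<phi> S' e' \<iota>'
  for G :: "'g monoid" and k :: "'k ring" and A :: "('k, 'a) module" and R :: "('k, 'r) module"
    and T :: "('k, 't, 'g, 'a) extension" and \<phi> and S :: "('k, 's, 'g, 'r) extension" and e \<iota>
    and T' :: "('k, 't1, 'g, 'a) extension" and S' :: "('k, 's1, 'g, 'r) extension" and e' \<iota>' +
  fixes f :: "'s \<Rightarrow> 's1"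
  assumes f_iso: "f \<in> alg_iso k S S'"
    and f_lin: "!!r s. r \<in> carrier R ==> s \<in> carrier S ==> f (emb S r \<otimes>\<^sub>S s) = emb S' r \<otimes>\<^sub>S' f s"
    and f_dom: "!!g x. g \<in> carrier G ==> x \<in> pdom S g ==> f x \<in> pdom S' g"
    and f_act: "!!g x. g \<in> carrier G ==> x \<in> pdom S (inv\<^bsub>G\<^esub> g) ==> f (pact S g x) = pact S' g (f x)"
begin

abbreviation "inD x \<equiv> x \<in> carrier T \<and> x \<otimes>\<^sub>T e = x"
abbreviation "eps g \<equiv> pact T g e"
abbreviation "eps' g \<equiv> pact T' g e'"

text \<open>The isomorphism f read as a map from eT onto e'T'.\<close>

definition "p x = \<iota>' (f (M.pre x))"
text \<open>The image of 1_g under f. From f(S_g) being contained in S'_g one only knows that it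
  lies below the idempotent of S'_g (\<open>d_eps\<close>); equality is \<open>d_eq\<close>.\<close>

definition "d g = p (e \<otimes>\<^sub>T eps g)"

lemma f_hom: "f \<in> ring_hom S S'" and f_bij: "bij_betw f (carrier S) (carrier S')"
  using f_iso by (auto simp: alg_iso_def ring_iso_def)

lemmas fh = ring_hom_closed[OF f_hom] ring_hom_mult[OF f_hom] ring_hom_add[OF f_hom] ring_hom_one[OF f_hom]

lemma pre_io: "s \<in> carrier S ==> M.pre (\<iota> s) = s"
  by (intro M.io_eqD M.pre_closed) (auto simp: M.io_pre)

lemma p_io: "s \<in> carrier S ==> p (\<iota> s) = \<iota>' (f s)"
  by (simp add: p_def pre_io)

lemma inD_cases: assumes "inD x" obtains s where "s \<in> carrier S" "x = \<iota> s"
  using M.io_surj[of x] assms by blast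

lemma inD_ops: "inD x ==> inD y ==> inD (x \<oplus>\<^sub>T y)" "inD x ==> inD y ==> inD (x \<otimes>\<^sub>T y)"
  "x \<in> carrier T ==> inD (x \<otimes>\<^sub>T e)" "inD e" "inD \<zero>\<^sub>T"
  "x \<in> carrier T ==> inD y ==> inD (x \<otimes>\<^sub>T y)"
  by (simp_all add: M.T.T.l_distr M.T.T.m_assoc)

lemma inD_eps: "inD x ==> g \<in> carrier G ==> inD (x \<otimes>\<^sub>T eps g)"
  using M.T.T.m_assoc[of x "eps g" e] M.T.T.m_assoc[of x e "eps g"] by (simp add: M.T.T.m_comm[of e "eps g"])

lemma p_closed: "inD x ==> p x \<in> carrier T'" "inD x ==> p x \<otimes>\<^sub>T' e' = p x"
  by (erule inD_cases; simp add: p_io fh)+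

lemma p_add: assumes "inD x" "inD y" shows "p (x \<oplus>\<^sub>T y) = p x \<oplus>\<^sub>T' p y"
proof -
  obtain s s' where "s \<in> carrier S" "x = \<iota> s" "s' \<in> carrier S" "y = \<iota> s'" using assms inD_cases by metis
  then show ?thesis by (simp add: M.io_hom[symmetric] p_io fh M'.io_hom)
qed

lemma p_mult: assumes "inD x" "inD y" shows "p (x \<otimes>\<^sub>T y) = p x \<otimes>\<^sub>T' p y"
proof -
  obtain s s' where "s \<in> carrier S" "x = \<iota> s" "s' \<in> carrier S" "y = \<iota> s'" using assms inD_cases by metis
  then show ?thesis by (simp add: M.io_hom[symmetric] p_io fh M'.io_hom)
qed

lemma p_e: "p e = e'"
  using p_io[of "\<one>\<^sub>S"] by (simp add: M.io_hom M'.io_hom fh)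

lemma p_zero: "p \<zero>\<^sub>T = \<zero>\<^sub>T'"
proof -
  have "p \<zero>\<^sub>T \<oplus>\<^sub>T' p \<zero>\<^sub>T = p \<zero>\<^sub>T" using p_add[OF inD_ops(5) inD_ops(5)] by simp
  then show ?thesis using p_closed(1)[OF inD_ops(5)] by (simp add: M'.T.T.add.r_cancel_one)
qed

lemma p_surj: assumes "b \<in> carrier T'" "b \<otimes>\<^sub>T' e' = b" shows "\<exists>x. inD x \<and> p x = b"
proof -
  obtain s' where s': "s' \<in> carrier S'" "\<iota>' s' = b" using M'.io_surj[OF assms] by (metis imageE)
  obtain s where "s \<in> carrier S" "f s = s'" using f_bij s' by (metis bij_betw_def imageE)
  then show ?thesis using s' p_io[of s] by (intro exI[of _ "\<iota> s"]) simp
qed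

lemma p_emb: "a \<in> carrier A ==> p (emb T a \<otimes>\<^sub>T e) = emb T' a \<otimes>\<^sub>T' e'"
  using M.emb[of a] M'.emb[of a] f_lin[of "\<phi> a" "\<one>\<^sub>S"] p_io[of "emb S (\<phi> a)"]
  by (simp add: M.phi_closed fh)

lemma pre_dom: "inD x ==> g \<in> carrier G ==> x \<otimes>\<^sub>T eps g = x ==> M.pre x \<in> pdom S g"
  by (simp add: M.dom M.pre_closed M.io_pre)

lemma p_dom: "inD x ==> g \<in> carrier G ==> x \<otimes>\<^sub>T eps g = x ==> p x \<otimes>\<^sub>T' eps' g = p x"
  using M'.pdomD[OF _ f_dom[OF _ pre_dom]] by (simp add: p_def)

lemma p_act: assumes "inD x" "g \<in> carrier G" "x \<otimes>\<^sub>T eps (inv\<^bsub>G\<^esub> g) = x"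
  shows "inD (pact T g x)" "p (pact T g x) = pact T' g (p x)"
proof -
  have gi: "inv\<^bsub>G\<^esub> g \<in> carrier G" using assms by simp
  note x = pre_dom[OF assms(1) gi assms(3)]
  have s: "pact S g (M.pre x) \<in> carrier S" "\<iota> (pact S g (M.pre x)) = pact T g x"
    using M.act[OF assms(2) x] assms(1) by (simp_all add: M.io_pre)
  show "inD (pact T g x)" using s(1) by (simp add: s(2)[symmetric])
  show "p (pact T g x) = pact T' g (p x)"
    using p_io[OF s(1)] s(2) f_act[OF assms(2) x] M'.act[OF assms(2) f_dom[OF gi x]] by (simp add: p_def)
qed

lemma d_closed: "g \<in> carrier G ==> d g \<in> carrier T'" "g \<in> carrier G ==> d g \<otimes>\<^sub>T' e' = d g"
  unfolding d_def using inD_eps[OF inD_ops(4)] p_closed by blast+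

lemma d_idem: "g \<in> carrier G ==> d g \<otimes>\<^sub>T' d g = d g"
proof -
  assume g: "g \<in> carrier G"
  have "e \<otimes>\<^sub>T eps g \<otimes>\<^sub>T (e \<otimes>\<^sub>T eps g) = (e \<otimes>\<^sub>T e) \<otimes>\<^sub>T (eps g \<otimes>\<^sub>T eps g)"
    using g by (simp add: M.T.T.m_ac del: M.e_idem)
  also have "\<dots> = e \<otimes>\<^sub>T eps g" using g by (simp add: M.eps)
  finally show ?thesis unfolding d_def using p_mult[OF inD_eps[OF inD_ops(4) g] inD_eps[OF inD_ops(4) g]] by simp
qed

lemma d_eps: "g \<in> carrier G ==> d g \<otimes>\<^sub>T' eps' g = d g"
  unfolding d_def using inD_eps[OF inD_ops(4)] by (intro p_dom) (auto simp: M.eps_assoc)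

lemma p_eps: "inD x ==> g \<in> carrier G ==> p (x \<otimes>\<^sub>T eps g) = p x \<otimes>\<^sub>T' d g"
proof -
  assume x: "inD x" and g: "g \<in> carrier G"
  have "x \<otimes>\<^sub>T eps g = x \<otimes>\<^sub>T (e \<otimes>\<^sub>T eps g)" using x g by (simp add: M.T.T.m_assoc[symmetric])
  then show ?thesis unfolding d_def using p_mult[OF x inD_eps[OF inD_ops(4) g]] by simp
qed

text \<open>Equivariance on the domain first yields the factor g(d(\<open>inv\<close> g)); the case
  x = e identifies it with d(g).\<close>

lemma p_tot:
  assumes x: "inD x" and g: "g \<in> carrier G"
  shows "p (pact T g x \<otimes>\<^sub>T e) = pact T' g (p x) \<otimes>\<^sub>T' d g"
proof -
  have gi: "inv\<^bsub>G\<^esub> g \<in> carrier G" using g by simp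
  have step: "p (pact T g x \<otimes>\<^sub>T e) = pact T' g (p x) \<otimes>\<^sub>T' pact T' g (d (inv\<^bsub>G\<^esub> g))" if x: "inD x" for x
  proof -
    have z: "inD (x \<otimes>\<^sub>T eps (inv\<^bsub>G\<^esub> g))" using inD_eps[OF x gi] .
    have "pact T g (x \<otimes>\<^sub>T eps (inv\<^bsub>G\<^esub> g)) = pact T g x \<otimes>\<^sub>T e" using x g by (simp add: M.T.act_mult)
    moreover have "p (pact T g (x \<otimes>\<^sub>T eps (inv\<^bsub>G\<^esub> g))) = pact T' g (p (x \<otimes>\<^sub>T eps (inv\<^bsub>G\<^esub> g)))"
      using x g gi by (intro p_act(2)[OF z g]) (simp add: M.eps_assoc)
    ultimately show ?thesis using x g gi p_closed d_closed by (simp add: p_eps M'.T.act_mult)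
  qed
  have "d g = p (pact T g e \<otimes>\<^sub>T e)" using g by (simp add: d_def M.T.T.m_comm)
  also have "\<dots> = pact T' g (d (inv\<^bsub>G\<^esub> g))"
    using step[OF inD_ops(4)] g d_closed[OF gi] M'.T.act_mult[of g e' "d (inv\<^bsub>G\<^esub> g)"]
    by (simp add: p_e M'.T.T.m_comm[of e'])
  finally show ?thesis using step[OF x] by simp
qed

lemma p_finsum:
  assumes "finite X" "!!h. h \<in> X ==> inD (u h)"
  shows "inD (\<Oplus>\<^sub>T h\<in>X. u h) \<and> p (\<Oplus>\<^sub>T h\<in>X. u h) = (\<Oplus>\<^sub>T' h\<in>X. p (u h))"
  using assms
proof (induction X rule: finite_induct)
  case empty
  then show ?case by (simp add: p_zero)
next
  case (insert h X)
  have c: "u \<in> X \<rightarrow> carrier T" "u h \<in> carrier T" "(\<lambda>h. p (u h)) \<in> X \<rightarrow> carrier T'" "p (u h) \<in> carrier T'"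
    using insert.prems p_closed by auto
  have "inD (\<Oplus>\<^sub>T h\<in>X. u h)" "p (\<Oplus>\<^sub>T h\<in>X. u h) = (\<Oplus>\<^sub>T' h\<in>X. p (u h))" "inD (u h)" using insert by auto
  then show ?case using insert.hyps c p_add inD_ops(1) by simp
qed

text \<open>The sum is the image under p of tr(y)e for the preimage y of b, and tr(y) comes from
  \<open>A\<close>.\<close>

lemma d_trace:
  assumes b: "b \<in> carrier T'" "b \<otimes>\<^sub>T' e' = b"
  shows "\<exists>a\<in>carrier A. (\<Oplus>\<^sub>T' h\<in>carrier G. pact T' h b \<otimes>\<^sub>T' d h) = emb T' a \<otimes>\<^sub>T' e'"
proof -
  obtain y where y: "inD y" "p y = b" using p_surj[OF b] by blast
  obtain a where a: "a \<in> carrier A" "M.T.tr y = emb T a" using M.T.tr_in_emb[of y] y by blast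
  have "(\<Oplus>\<^sub>T' h\<in>carrier G. pact T' h b \<otimes>\<^sub>T' d h) = (\<Oplus>\<^sub>T' h\<in>carrier G. p (pact T h y \<otimes>\<^sub>T e))"
    using b d_closed y p_closed(1)[OF inD_ops(3)] by (intro M'.T.T.finsum_cong') (auto simp: p_tot)
  also have "\<dots> = p (\<Oplus>\<^sub>T h\<in>carrier G. pact T h y \<otimes>\<^sub>T e)"
    using p_finsum[OF M.T.fin, of "\<lambda>h. pact T h y \<otimes>\<^sub>T e"] inD_ops(3) y by simp
  also have "(\<Oplus>\<^sub>T h\<in>carrier G. pact T h y \<otimes>\<^sub>T e) = M.T.tr y \<otimes>\<^sub>T e"
    unfolding M.T.tr_def using y by (intro M.T.T.finsum_ldistr[symmetric] M.T.fin) auto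
  finally show ?thesis using a p_emb by auto
qed

text \<open>
  Each \<open>pact T' g\<close>, cut down to \<open>S'\<close>, is a combination of the maps \<open>pact T' h\<close> whose coefficients
  are supported on the images \<open>d h\<close> of the idempotents of \<open>S\<close>. Comparing coefficients by means of
  the Galois coordinates of \<open>T'\<close> gives \<open>d g = eps' g \<otimes> e'\<close>.
\<close>

lemma d_eq:
  assumes g: "g \<in> carrier G"
  shows "d g = eps' g \<otimes>\<^sub>T' e'"
proof -
  \<comment> \<open>The coefficients are sums of g(p(x_i e)) h(p(y_i e)) d(h). The inner sum of the
    h(p(y_i e) b) d(h) comes from \<open>A\<close> by \<open>d_trace\<close>, so g can be moved past
    it.\<close>
  have cexp: "\<exists>m. m \<in> carrier G \<rightarrow> carrier T' \<and> (\<forall>h\<in>carrier G. m h \<otimes>\<^sub>T' d h = m h) \<and>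
     (\<forall>b\<in>carrier T'. b \<otimes>\<^sub>T' e' = b \<longrightarrow>
        pact T' g (\<Oplus>\<^sub>T' h\<in>carrier G. p (F h \<otimes>\<^sub>T (e \<otimes>\<^sub>T eps h)) \<otimes>\<^sub>T' pact T' h b) \<otimes>\<^sub>T' e' =
        (\<Oplus>\<^sub>T' h\<in>carrier G. m h \<otimes>\<^sub>T' pact T' h b))"
    if "coord G T (pact T) F" for F
    using that
  proof induction
    case (single x y F)
    let ?x = "p (x \<otimes>\<^sub>T e)" and ?y = "p (y \<otimes>\<^sub>T e)"
    let ?m = "\<lambda>h. pact T' g ?x \<otimes>\<^sub>T' pact T' h ?y \<otimes>\<^sub>T' d h"
    have xD: "inD (x \<otimes>\<^sub>T e)" "inD (y \<otimes>\<^sub>T e)" using single inD_ops(3) by blast+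
    note c = p_closed(1)[OF xD(1)] p_closed(1)[OF xD(2)] p_closed(2)[OF xD(1)] p_closed(2)[OF xD(2)]
    have F: "p (F h \<otimes>\<^sub>T (e \<otimes>\<^sub>T eps h)) = ?x \<otimes>\<^sub>T' (pact T' h ?y \<otimes>\<^sub>T' d h)" if h: "h \<in> carrier G" for h
    proof -
      have "F h \<otimes>\<^sub>T (e \<otimes>\<^sub>T eps h) = x \<otimes>\<^sub>T pact T h y \<otimes>\<^sub>T (e \<otimes>\<^sub>T e \<otimes>\<^sub>T eps h)" using single h by simp
      also have "\<dots> = (x \<otimes>\<^sub>T e) \<otimes>\<^sub>T (pact T h (y \<otimes>\<^sub>T e) \<otimes>\<^sub>T e)"
        using single h by (simp add: M.T.act_mult M.T.T.m_ac del: M.e_idem)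
      finally show ?thesis
        using p_mult[OF xD(1) inD_ops(3)[of "pact T h (y \<otimes>\<^sub>T e)"]] p_tot[OF xD(2) h] single h by simp
    qed
    have "pact T' g (\<Oplus>\<^sub>T' h\<in>carrier G. p (F h \<otimes>\<^sub>T (e \<otimes>\<^sub>T eps h)) \<otimes>\<^sub>T' pact T' h b) \<otimes>\<^sub>T' e' =
        (\<Oplus>\<^sub>T' h\<in>carrier G. ?m h \<otimes>\<^sub>T' pact T' h b)" if b: "b \<in> carrier T'" "b \<otimes>\<^sub>T' e' = b" for b
    proof -
      have yb: "?y \<otimes>\<^sub>T' b \<in> carrier T'" "?y \<otimes>\<^sub>T' b \<otimes>\<^sub>T' e' = ?y \<otimes>\<^sub>T' b" using c b by (simp_all add: M'.T.T.m_assoc)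
      let ?\<Sigma> = "\<Oplus>\<^sub>T' h\<in>carrier G. pact T' h (?y \<otimes>\<^sub>T' b) \<otimes>\<^sub>T' d h"
      have \<Sigma>c: "?\<Sigma> \<in> carrier T'" using yb d_closed by (intro M'.T.T.finsum_closed) auto
      obtain a where a: "a \<in> carrier A" "?\<Sigma> = emb T' a \<otimes>\<^sub>T' e'" using d_trace[OF yb] by blast
      have "(\<Oplus>\<^sub>T' h\<in>carrier G. p (F h \<otimes>\<^sub>T (e \<otimes>\<^sub>T eps h)) \<otimes>\<^sub>T' pact T' h b) =
        (\<Oplus>\<^sub>T' h\<in>carrier G. ?x \<otimes>\<^sub>T' (pact T' h (?y \<otimes>\<^sub>T' b) \<otimes>\<^sub>T' d h))"
        using b c d_closed by (intro M'.T.T.finsum_cong') (auto simp: F M'.T.act_mult M'.T.T.m_ac)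
      also have "\<dots> = ?x \<otimes>\<^sub>T' ?\<Sigma>" using b c d_closed by (intro M'.T.T.finsum_rdistr[symmetric] M'.T.fin) auto
      also have "\<dots> = ?x \<otimes>\<^sub>T' emb T' a" unfolding a(2) using a c
        by (simp add: M'.T.T.m_comm[of "emb T' a"] M'.T.T.m_assoc[symmetric])
      finally have "pact T' g (\<Oplus>\<^sub>T' h\<in>carrier G. p (F h \<otimes>\<^sub>T (e \<otimes>\<^sub>T eps h)) \<otimes>\<^sub>T' pact T' h b) \<otimes>\<^sub>T' e' =
        pact T' g ?x \<otimes>\<^sub>T' ?\<Sigma>" unfolding a(2) using a c g by (simp add: M'.T.act_mult M'.T.T.m_assoc)
      also have "\<dots> = (\<Oplus>\<^sub>T' h\<in>carrier G. pact T' g ?x \<otimes>\<^sub>T' (pact T' h (?y \<otimes>\<^sub>T' b) \<otimes>\<^sub>T' d h))"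
        using b c d_closed g by (intro M'.T.T.finsum_rdistr M'.T.fin) auto
      also have "\<dots> = (\<Oplus>\<^sub>T' h\<in>carrier G. ?m h \<otimes>\<^sub>T' pact T' h b)"
        using b c d_closed g by (intro M'.T.T.finsum_cong') (auto simp: M'.T.act_mult M'.T.T.m_ac)
      finally show ?thesis .
    qed
    moreover have "?m h \<otimes>\<^sub>T' d h = ?m h" if "h \<in> carrier G" for h
      using that c d_closed g by (simp add: M'.T.T.m_assoc d_idem)
    ultimately show ?case using c d_closed g by (intro exI[of _ ?m]) auto
  next
    case (add q r F)
    let ?I = "\<lambda>F b. (\<Oplus>\<^sub>T' h\<in>carrier G. p (F h \<otimes>\<^sub>T (e \<otimes>\<^sub>T eps h)) \<otimes>\<^sub>T' pact T' h b)"
    obtain m where m: "m \<in> carrier G \<rightarrow> carrier T'" "!!h. h \<in> carrier G ==> m h \<otimes>\<^sub>T' d h = m h"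
      "!!b. b \<in> carrier T' ==> b \<otimes>\<^sub>T' e' = b ==> pact T' g (?I q b) \<otimes>\<^sub>T' e' = (\<Oplus>\<^sub>T' h\<in>carrier G. m h \<otimes>\<^sub>T' pact T' h b)"
      using add.IH(1) by blast
    obtain n where n: "n \<in> carrier G \<rightarrow> carrier T'" "!!h. h \<in> carrier G ==> n h \<otimes>\<^sub>T' d h = n h"
      "!!b. b \<in> carrier T' ==> b \<otimes>\<^sub>T' e' = b ==> pact T' g (?I r b) \<otimes>\<^sub>T' e' = (\<Oplus>\<^sub>T' h\<in>carrier G. n h \<otimes>\<^sub>T' pact T' h b)"
      using add.IH(2) by blast
    note cl = M.T.coord_T_closed[OF add.hyps(1)] M.T.coord_T_closed[OF add.hyps(2)]
    have D: "inD (t \<otimes>\<^sub>T (e \<otimes>\<^sub>T eps h))" if "t \<in> carrier T" "h \<in> carrier G" for t h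
      using inD_ops(6)[OF that(1) inD_eps[OF inD_ops(4) that(2)]] .
    have pc: "p (t \<otimes>\<^sub>T (e \<otimes>\<^sub>T eps h)) \<in> carrier T'" if "t \<in> carrier T" "h \<in> carrier G" for t h
      using p_closed(1)[OF D[OF that]] .
    have F: "p (F h \<otimes>\<^sub>T (e \<otimes>\<^sub>T eps h)) = p (q h \<otimes>\<^sub>T (e \<otimes>\<^sub>T eps h)) \<oplus>\<^sub>T' p (r h \<otimes>\<^sub>T (e \<otimes>\<^sub>T eps h))" if h: "h \<in> carrier G" for h
      using p_add[OF D[OF cl(1)[OF h] h] D[OF cl(2)[OF h] h]] add.hyps(3)[OF h] cl[OF h] h by (simp add: M.T.T.l_distr)
    have "pact T' g (?I F b) \<otimes>\<^sub>T' e' = (\<Oplus>\<^sub>T' h\<in>carrier G. (m h \<oplus>\<^sub>T' n h) \<otimes>\<^sub>T' pact T' h b)"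
      if b: "b \<in> carrier T'" "b \<otimes>\<^sub>T' e' = b" for b
    proof -
      have "?I F b = ?I q b \<oplus>\<^sub>T' ?I r b"
        using b cl pc F by (intro M'.T.T.finsum_mult_add) auto
      moreover have "?I q b \<in> carrier T'" "?I r b \<in> carrier T'"
        using b cl pc by (auto intro!: M'.T.T.finsum_closed)
      ultimately have "pact T' g (?I F b) \<otimes>\<^sub>T' e' = pact T' g (?I q b) \<otimes>\<^sub>T' e' \<oplus>\<^sub>T' pact T' g (?I r b) \<otimes>\<^sub>T' e'"
        using g by (simp add: M'.T.act_add M'.T.T.l_distr)
      also have "\<dots> = (\<Oplus>\<^sub>T' h\<in>carrier G. (m h \<oplus>\<^sub>T' n h) \<otimes>\<^sub>T' pact T' h b)"
        unfolding m(3)[OF b] n(3)[OF b] using m(1) n(1) b by (intro M'.T.T.finsum_mult_add[symmetric]) auto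
      finally show ?thesis .
    qed
    moreover have "(m h \<oplus>\<^sub>T' n h) \<otimes>\<^sub>T' d h = m h \<oplus>\<^sub>T' n h" if h: "h \<in> carrier G" for h
    proof -
      have "m h \<in> carrier T'" "n h \<in> carrier T'" using m(1) n(1) h by auto
      then show ?thesis using m(2)[OF h] n(2)[OF h] d_closed[OF h] by (simp add: M'.T.T.l_distr)
    qed
    ultimately show ?case using m(1) n(1) by (intro exI[of _ "\<lambda>h. m h \<oplus>\<^sub>T' n h"]) auto
  qed
  obtain m where m: "m \<in> carrier G \<rightarrow> carrier T'" "!!h. h \<in> carrier G ==> m h \<otimes>\<^sub>T' d h = m h"
    and m_eq: "!!b. b \<in> carrier T' ==> b \<otimes>\<^sub>T' e' = b ==>
      pact T' g (\<Oplus>\<^sub>T' h\<in>carrier G. p ((if h = \<one>\<^sub>G then \<one>\<^sub>T else \<zero>\<^sub>T) \<otimes>\<^sub>T (e \<otimes>\<^sub>T eps h)) \<otimes>\<^sub>T' pact T' h b) \<otimes>\<^sub>T' e' =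
        (\<Oplus>\<^sub>T' h\<in>carrier G. m h \<otimes>\<^sub>T' pact T' h b)" using cexp[OF M.T.delta] by blast
  \<comment> \<open>For the indicator function the sum to which g is applied is b itself.\<close>
  have 1: "pact T' g b \<otimes>\<^sub>T' e' = (\<Oplus>\<^sub>T' h\<in>carrier G. m h \<otimes>\<^sub>T' pact T' h b)"
    if b: "b \<in> carrier T'" "b \<otimes>\<^sub>T' e' = b" for b
  proof -
    have "(\<Oplus>\<^sub>T' h\<in>carrier G. p ((if h = \<one>\<^sub>G then \<one>\<^sub>T else \<zero>\<^sub>T) \<otimes>\<^sub>T (e \<otimes>\<^sub>T eps h)) \<otimes>\<^sub>T' pact T' h b) =
      (\<Oplus>\<^sub>T' h\<in>carrier G. (if h = \<one>\<^sub>G then \<one>\<^sub>T' else \<zero>\<^sub>T') \<otimes>\<^sub>T' (e' \<otimes>\<^sub>T' pact T' h b))"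
      using b by (intro M'.T.T.finsum_cong') (auto simp: p_e p_zero)
    also have "\<dots> = b" using b by (subst M'.T.finsum_delta) (auto simp: M'.T.T.m_comm[of e'])
    finally show ?thesis using m_eq[OF b] by simp
  qed
  \<comment> \<open>Insert b = y_i e' for coordinates y_i of T' and multiply by g(x_i): the sum over
    i turns into g(F(\<open>inv\<close> g h)), and for the indicator function only h = g
    survives.\<close>
  have 2: "pact T' g (F \<one>\<^sub>G) \<otimes>\<^sub>T' eps' g \<otimes>\<^sub>T' e' =
    (\<Oplus>\<^sub>T' h\<in>carrier G. pact T' g (F (inv\<^bsub>G\<^esub> g \<otimes>\<^sub>G h)) \<otimes>\<^sub>T' (m h \<otimes>\<^sub>T' eps' h))"
    if "coord G T' (pact T') F" for F
    using that
  proof induction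
    case (single x y F)
    have ye: "y \<otimes>\<^sub>T' e' \<in> carrier T'" "y \<otimes>\<^sub>T' e' \<otimes>\<^sub>T' e' = y \<otimes>\<^sub>T' e'" using single by (simp_all add: M'.T.T.m_assoc)
    have "pact T' g (F \<one>\<^sub>G) \<otimes>\<^sub>T' eps' g \<otimes>\<^sub>T' e' = pact T' g x \<otimes>\<^sub>T' (pact T' g (y \<otimes>\<^sub>T' e') \<otimes>\<^sub>T' e')"
      using single g by (simp add: M'.T.act_mult M'.T.T.m_assoc)
    also have "\<dots> = pact T' g x \<otimes>\<^sub>T' (\<Oplus>\<^sub>T' h\<in>carrier G. m h \<otimes>\<^sub>T' pact T' h (y \<otimes>\<^sub>T' e'))" unfolding 1[OF ye] ..
    also have "\<dots> = (\<Oplus>\<^sub>T' h\<in>carrier G. pact T' g x \<otimes>\<^sub>T' (m h \<otimes>\<^sub>T' pact T' h (y \<otimes>\<^sub>T' e')))"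
      using single g m(1) by (intro M'.T.T.finsum_rdistr M'.T.fin) (auto simp: Pi_iff)
    also have "\<dots> = (\<Oplus>\<^sub>T' h\<in>carrier G. pact T' g (F (inv\<^bsub>G\<^esub> g \<otimes>\<^sub>G h)) \<otimes>\<^sub>T' (m h \<otimes>\<^sub>T' eps' h))"
      using single g m(1)
      by (intro M'.T.T.finsum_cong') (auto simp: M'.T.act_mult M'.T.act_comp M'.T.T.m_ac Pi_iff)
    finally show ?case .
  next
    case (add q r F)
    note cl = M'.T.coord_T_closed[OF add.hyps(1)] M'.T.coord_T_closed[OF add.hyps(2)]
    have "(\<Oplus>\<^sub>T' h\<in>carrier G. pact T' g (F (inv\<^bsub>G\<^esub> g \<otimes>\<^sub>G h)) \<otimes>\<^sub>T' (m h \<otimes>\<^sub>T' eps' h)) =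
      (\<Oplus>\<^sub>T' h\<in>carrier G. pact T' g (q (inv\<^bsub>G\<^esub> g \<otimes>\<^sub>G h)) \<otimes>\<^sub>T' (m h \<otimes>\<^sub>T' eps' h)) \<oplus>\<^sub>T'
      (\<Oplus>\<^sub>T' h\<in>carrier G. pact T' g (r (inv\<^bsub>G\<^esub> g \<otimes>\<^sub>G h)) \<otimes>\<^sub>T' (m h \<otimes>\<^sub>T' eps' h))"
      using cl g m(1) add.hyps(3) by (intro M'.T.T.finsum_mult_add) (auto simp: M'.T.act_add Pi_iff)
    then show ?case using add cl g by (simp add: M'.T.act_add M'.T.T.l_distr)
  qed
  have "eps' g \<otimes>\<^sub>T' e' = (\<Oplus>\<^sub>T' h\<in>carrier G. if g = h then m h \<otimes>\<^sub>T' eps' h else \<zero>\<^sub>T')"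
  proof -
    have "inv\<^bsub>G\<^esub> g \<otimes>\<^sub>G h = \<one>\<^sub>G \<longleftrightarrow> g = h" if "h \<in> carrier G" for h
    proof
      assume gh: "inv\<^bsub>G\<^esub> g \<otimes>\<^sub>G h = \<one>\<^sub>G"
      have "h = g \<otimes>\<^sub>G (inv\<^bsub>G\<^esub> g \<otimes>\<^sub>G h)" using that g by simp
      then show "g = h" unfolding gh using g by simp
    qed (use that in auto)
    then have "(\<Oplus>\<^sub>T' h\<in>carrier G. pact T' g (if inv\<^bsub>G\<^esub> g \<otimes>\<^sub>G h = \<one>\<^sub>G then \<one>\<^sub>T' else \<zero>\<^sub>T') \<otimes>\<^sub>T' (m h \<otimes>\<^sub>T' eps' h)) =
      (\<Oplus>\<^sub>T' h\<in>carrier G. if g = h then m h \<otimes>\<^sub>T' eps' h else \<zero>\<^sub>T')"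
      using g m(1) by (intro M'.T.T.finsum_cong') (auto simp: Pi_iff)
    then show ?thesis using 2[OF M'.T.delta] g by simp
  qed
  also have "\<dots> = m g \<otimes>\<^sub>T' eps' g" using g m(1) by (intro M'.T.T.finsum_singleton M'.T.fin) (auto simp: Pi_iff)
  finally have mg: "eps' g \<otimes>\<^sub>T' e' = m g \<otimes>\<^sub>T' eps' g" .
  have mc: "m g \<in> carrier T'" using m(1) g by auto
  \<comment> \<open>d(g) lies below g(e')e', which equals m(g)g(e'); since m(g) absorbs d(g), the
    product of the two idempotents is g(e')e' again.\<close>
  have "d g = d g \<otimes>\<^sub>T' eps' g \<otimes>\<^sub>T' e'" using d_eps[OF g] d_closed[OF g] by simp
  also have "\<dots> = (eps' g \<otimes>\<^sub>T' e') \<otimes>\<^sub>T' d g" using d_closed[OF g] g by (simp add: M'.T.T.m_ac)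
  also have "\<dots> = (m g \<otimes>\<^sub>T' d g) \<otimes>\<^sub>T' eps' g" unfolding mg using d_closed[OF g] g mc by (simp add: M'.T.T.m_ac del: m(2))
  also have "\<dots> = eps' g \<otimes>\<^sub>T' e'" using m(2)[OF g] mg by simp
  finally show ?thesis .
qed

lemma p_eps': "inD x ==> g \<in> carrier G ==> p (x \<otimes>\<^sub>T eps g) = p x \<otimes>\<^sub>T' eps' g"
proof -
  assume x: "inD x" and g: "g \<in> carrier G"
  have "p x \<otimes>\<^sub>T' (eps' g \<otimes>\<^sub>T' e') = (p x \<otimes>\<^sub>T' e') \<otimes>\<^sub>T' eps' g"
    using p_closed(1)[OF x] g by (simp add: M'.T.T.m_ac)
  then show ?thesis using p_eps[OF x g] p_closed(2)[OF x] by (simp add: d_eq[OF g])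
qed

text \<open>The right side is forced upon any equivariant extension: it is the value on the part
  g(e')T'. Compatibility of these parts needs \<open>p_eps'\<close>, hence the equality
  \<open>d_eq\<close>.\<close>

lemma extend_ex:
  assumes t: "t \<in> carrier T"
  shows "\<exists>t'\<in>carrier T'. \<forall>g\<in>carrier G. t' \<otimes>\<^sub>T' eps' g = pact T' g (p (pact T (inv\<^bsub>G\<^esub> g) t \<otimes>\<^sub>T e))"
proof (rule M'.T.patch[OF M'.full])
  have pc: "p (x \<otimes>\<^sub>T e) \<in> carrier T'" "p (x \<otimes>\<^sub>T e) \<otimes>\<^sub>T' e' = p (x \<otimes>\<^sub>T e)" if "x \<in> carrier T" for x
    using p_closed[OF inD_ops(3)[OF that]] by auto
  fix g assume g: "g \<in> carrier G"
  show "pact T' g (p (pact T (inv\<^bsub>G\<^esub> g) t \<otimes>\<^sub>T e)) \<in> carrier T'" using g t pc by simp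
  show "pact T' g (p (pact T (inv\<^bsub>G\<^esub> g) t \<otimes>\<^sub>T e)) \<otimes>\<^sub>T' eps' g = pact T' g (p (pact T (inv\<^bsub>G\<^esub> g) t \<otimes>\<^sub>T e))"
    using g t pc by (simp add: M'.T.act_mult[symmetric])
  fix h assume h: "h \<in> carrier G"
  let ?x = "pact T (inv\<^bsub>G\<^esub> g) t" and ?u = "inv\<^bsub>G\<^esub> g \<otimes>\<^sub>G h"
  have u: "?u \<in> carrier G" "inv\<^bsub>G\<^esub> ?u \<in> carrier G" and x: "?x \<in> carrier T" using g h t by auto
  have ux: "pact T (inv\<^bsub>G\<^esub> h) t = pact T (inv\<^bsub>G\<^esub> ?u) ?x"
    using g h t by (simp add: M.T.act_comp M.T.G.inv_mult_group M.T.G.m_assoc)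
  let ?z = "pact T (inv\<^bsub>G\<^esub> ?u) ?x \<otimes>\<^sub>T e \<otimes>\<^sub>T eps (inv\<^bsub>G\<^esub> ?u)"
  have zD: "inD ?z" using inD_eps[OF inD_ops(3)] u x by simp
  have "pact T' g (p (?x \<otimes>\<^sub>T e)) \<otimes>\<^sub>T' eps' h = pact T' g (p (?x \<otimes>\<^sub>T e) \<otimes>\<^sub>T' eps' ?u)"
    using g h u pc[OF x] by (simp add: M'.T.act_mult M'.T.act_comp)
  also have "\<dots> = pact T' g (p (?x \<otimes>\<^sub>T e \<otimes>\<^sub>T eps ?u))" using p_eps'[OF inD_ops(3)[OF x] u(1)] by simp
  also have "?x \<otimes>\<^sub>T e \<otimes>\<^sub>T eps ?u = pact T ?u ?z" using u x by (simp add: M.T.act_mult M.T.T.m_ac)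
  also have "p (pact T ?u ?z) = pact T' ?u (p ?z)"
    using u x by (intro p_act(2)[OF zD]) (simp_all add: M.eps_assoc)
  also have "pact T' g (pact T' ?u (p ?z)) = pact T' h (p ?z)"
    using g h u p_closed(1)[OF zD] by (simp add: M'.T.act_comp)
  also have "p ?z = p (pact T (inv\<^bsub>G\<^esub> ?u) ?x \<otimes>\<^sub>T e) \<otimes>\<^sub>T' eps' (inv\<^bsub>G\<^esub> ?u)"
    using u x by (intro p_eps' inD_ops(3)) auto
  also have "pact T' h \<dots> = pact T' h (p (pact T (inv\<^bsub>G\<^esub> h) t \<otimes>\<^sub>T e)) \<otimes>\<^sub>T' eps' (h \<otimes>\<^sub>G inv\<^bsub>G\<^esub> ?u)"
    unfolding ux using h u x pc by (simp add: M'.T.act_mult M'.T.act_comp)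
  also have "h \<otimes>\<^sub>G inv\<^bsub>G\<^esub> ?u = g" using g h by (simp add: M.T.G.inv_mult_group)
  finally show "pact T' g (p (?x \<otimes>\<^sub>T e)) \<otimes>\<^sub>T' eps' h = pact T' h (p (pact T (inv\<^bsub>G\<^esub> h) t \<otimes>\<^sub>T e)) \<otimes>\<^sub>T' eps' g" .
qed

text \<open>Identities in T' are verified on each part g(e')T' by \<open>full_eqI\<close>, where
  they reduce to properties of p.\<close>

lemma extend: "\<exists>F. ghom G A T T' F \<and> F e = e'"
proof -
  obtain F where F: "!!t. t \<in> carrier T ==> F t \<in> carrier T'"
    "!!t g. t \<in> carrier T ==> g \<in> carrier G ==> F t \<otimes>\<^sub>T' eps' g = pact T' g (p (pact T (inv\<^bsub>G\<^esub> g) t \<otimes>\<^sub>T e))"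
    using bchoice[of "carrier T" "\<lambda>t t'. t' \<in> carrier T' \<and> (\<forall>g\<in>carrier G. t' \<otimes>\<^sub>T' eps' g = pact T' g (p (pact T (inv\<^bsub>G\<^esub> g) t \<otimes>\<^sub>T e)))"]
      extend_ex by blast
  have D: "inD (pact T (inv\<^bsub>G\<^esub> g) t \<otimes>\<^sub>T e)" if "t \<in> carrier T" "g \<in> carrier G" for t g
    using that by (intro inD_ops(3)) simp
  have pc: "p (pact T (inv\<^bsub>G\<^esub> g) t \<otimes>\<^sub>T e) \<in> carrier T'" "p (pact T (inv\<^bsub>G\<^esub> g) t \<otimes>\<^sub>T e) \<otimes>\<^sub>T' e' = p (pact T (inv\<^bsub>G\<^esub> g) t \<otimes>\<^sub>T e)"
    if "t \<in> carrier T" "g \<in> carrier G" for t g using p_closed[OF D[OF that]] by auto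
  note eqI = M'.T.full_eqI[OF M'.full]
  have one: "F \<one>\<^sub>T = \<one>\<^sub>T'"
    by (rule eqI) (use F in \<open>simp_all add: p_e\<close>)
  have add: "F (t \<oplus>\<^sub>T u) = F t \<oplus>\<^sub>T' F u" if tu: "t \<in> carrier T" "u \<in> carrier T" for t u
  proof (rule eqI)
    fix g assume g: "g \<in> carrier G"
    show "F (t \<oplus>\<^sub>T u) \<otimes>\<^sub>T' eps' g = (F t \<oplus>\<^sub>T' F u) \<otimes>\<^sub>T' eps' g"
      using tu g F pc p_add[OF D[OF tu(1) g] D[OF tu(2) g]]
      by (simp add: M.T.act_add M.T.T.l_distr M'.T.act_add M'.T.T.l_distr)
  qed (use tu F in simp_all)
  have mult: "F (t \<otimes>\<^sub>T u) = F t \<otimes>\<^sub>T' F u" if tu: "t \<in> carrier T" "u \<in> carrier T" for t u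
  proof (rule eqI)
    fix g assume g: "g \<in> carrier G"
    let ?t = "pact T (inv\<^bsub>G\<^esub> g) t" and ?u = "pact T (inv\<^bsub>G\<^esub> g) u"
    have "?t \<otimes>\<^sub>T ?u \<otimes>\<^sub>T e = ?t \<otimes>\<^sub>T ?u \<otimes>\<^sub>T (e \<otimes>\<^sub>T e)" by simp
    also have "\<dots> = (?t \<otimes>\<^sub>T e) \<otimes>\<^sub>T (?u \<otimes>\<^sub>T e)" using tu g by (simp add: M.T.T.m_ac del: M.e_idem)
    finally have "F (t \<otimes>\<^sub>T u) \<otimes>\<^sub>T' eps' g = (F t \<otimes>\<^sub>T' eps' g) \<otimes>\<^sub>T' (F u \<otimes>\<^sub>T' eps' g)"
      using tu g F(2) pc p_mult[OF D[OF tu(1) g] D[OF tu(2) g]] by (simp add: M.T.act_mult M'.T.act_mult)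
    also have "\<dots> = F t \<otimes>\<^sub>T' F u \<otimes>\<^sub>T' (eps' g \<otimes>\<^sub>T' eps' g)" using tu g F(1) by (simp add: M'.T.T.m_ac)
    finally show "F (t \<otimes>\<^sub>T u) \<otimes>\<^sub>T' eps' g = F t \<otimes>\<^sub>T' F u \<otimes>\<^sub>T' eps' g" using g by (simp add: M'.eps)
  qed (use tu F in simp_all)
  have act: "F (pact T h t) = pact T' h (F t)" if h: "h \<in> carrier G" and t: "t \<in> carrier T" for h t
  proof (rule eqI)
    fix g assume g: "g \<in> carrier G"
    let ?v = "inv\<^bsub>G\<^esub> h \<otimes>\<^sub>G g"
    have v: "?v \<in> carrier G" "inv\<^bsub>G\<^esub> ?v = inv\<^bsub>G\<^esub> g \<otimes>\<^sub>G h" using g h by (simp_all add: M.T.G.inv_mult_group)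
    have "pact T' h (F t) \<otimes>\<^sub>T' eps' g = pact T' h (F t \<otimes>\<^sub>T' eps' ?v)"
      using g h t F(1) by (simp add: M'.T.act_mult M'.T.act_comp)
    also have "\<dots> = pact T' h (pact T' ?v (p (pact T (inv\<^bsub>G\<^esub> ?v) t \<otimes>\<^sub>T e)))" using F(2)[OF t v(1)] by simp
    also have "\<dots> = pact T' g (p (pact T (inv\<^bsub>G\<^esub> ?v) t \<otimes>\<^sub>T e))" using pc[OF t v(1)] g h by (simp add: M'.T.act_comp)
    also have "\<dots> = F (pact T h t) \<otimes>\<^sub>T' eps' g" unfolding v(2) using F(2)[of "pact T h t" g] g h t by (simp add: M.T.act_comp)
    finally show "F (pact T h t) \<otimes>\<^sub>T' eps' g = pact T' h (F t) \<otimes>\<^sub>T' eps' g" ..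
  qed (use h t F in simp_all)
  have emb: "F (emb T a) = emb T' a" if a: "a \<in> carrier A" for a
    by (rule eqI) (use a F in \<open>simp_all add: p_emb M'.T.act_mult\<close>)
  \<comment> \<open>Here \<open>d_eq\<close> enters again: the part of F(e) at g is
    g(d(\<open>inv\<close> g)) = e' g(e').\<close>
  have "F e = e'"
  proof (rule eqI)
    fix g assume g: "g \<in> carrier G"
    have "F e \<otimes>\<^sub>T' eps' g = pact T' g (d (inv\<^bsub>G\<^esub> g))" using F(2)[of e g] g by (simp add: d_def M.T.T.m_comm)
    also have "\<dots> = e' \<otimes>\<^sub>T' eps' g" using g by (simp add: d_eq M'.T.act_mult)
    finally show "F e \<otimes>\<^sub>T' eps' g = e' \<otimes>\<^sub>T' eps' g" .
  qed (use F in simp_all)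
  moreover have "ghom G A T T' F" unfolding ghom_def
    by (intro conjI ballI ring_hom_memI) (simp_all add: F(1) one add mult act emb)
  ultimately show ?thesis by blast
qed

end

lemma ghom_of_partially_isomorphic:
  assumes M: "model G k A R T \<phi> S e \<iota>" "model G k A R T' \<phi> S' e' \<iota>'"
    and "partially_isomorphic G k R S S'"
  shows "\<exists>F. ghom G A T T' F \<and> F e = e'"
proof -
  obtain f where f: "f \<in> alg_iso k S S'"
    "\<forall>r\<in>carrier R. \<forall>s\<in>carrier S. f (emb S r \<otimes>\<^sub>S s) = emb S' r \<otimes>\<^sub>S' f s"
    "\<forall>g\<in>carrier G. f ` pdom S g \<subseteq> pdom S' g \<and> (\<forall>x\<in>pdom S (inv\<^bsub>G\<^esub> g). f (pact S g x) = pact S' g (f x))"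
    using assms(3) unfolding partially_isomorphic_def by blast
  have "model_map G k A R T \<phi> S e \<iota> T' S' e' \<iota>' f"
    using f(2,3) by (intro model_map.intro M model_map_axioms.intro f(1)) blast+
  then show ?thesis by (rule model_map.extend)
qed

lemma partially_isomorphic_iff:
  assumes "model G k A R T \<phi> S e \<iota>" "model G k A R T' \<phi> S' e' \<iota>'"
  shows "partially_isomorphic G k R S S' \<longleftrightarrow> (\<exists>F. ghom G A T T' F \<and> F e = e')"
  using partially_isomorphic_of_ghom[OF assms] ghom_of_partially_isomorphic[OF assms] by blast

section \<open>Products of partial extensions\<close>

text \<open>The representation of 1 by translates of e persists under homomorphisms. This allows
  fullness of e \<otimes> e' to be checked in one tensor factor after the other.\<close>

lemma (in gact) full_zero_hom:
  assumes W: "cring W" and h: "h \<in> ring_hom T W" and e: "full e" and z: "z \<in> carrier W"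
    and ze: "!!g. g \<in> carrier G ==> z \<otimes>\<^sub>W h (pact T g e) = \<zero>\<^sub>W"
  shows "z = \<zero>\<^sub>W"
proof -
  interpret W: cring W by fact
  interpret h: ring_hom_cring T W h
    by (intro ring_hom_cringI ring_hom_ringI2 h T.ring_axioms W.ring_axioms T.M_cring W)
  note ec = fullD(1)[OF e]
  obtain v where v: "v \<in> carrier G \<rightarrow> carrier T" "\<one> = (\<Oplus>g\<in>carrier G. v g \<otimes> pact T g e)"
    using full_sum[OF e] by blast
  have vc: "v g \<in> carrier T" if "g \<in> carrier G" for g using v(1) that by auto
  have z0: "z \<otimes>\<^sub>W h (v g \<otimes> pact T g e) = \<zero>\<^sub>W" if g: "g \<in> carrier G" for g
  proof -
    have "z \<otimes>\<^sub>W h (v g \<otimes> pact T g e) = h (v g) \<otimes>\<^sub>W (z \<otimes>\<^sub>W h (pact T g e))"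
      using g vc ec z by (simp add: W.m_lcomm)
    then show ?thesis using g vc by (simp add: ze)
  qed
  have "z = z \<otimes>\<^sub>W h \<one>" using z by simp
  also have "\<dots> = z \<otimes>\<^sub>W (\<Oplus>\<^sub>W g\<in>carrier G. h (v g \<otimes> pact T g e))"
    unfolding v(2) using vc ec by (subst h.hom_finsum) (auto simp: comp_def)
  also have "\<dots> = (\<Oplus>\<^sub>W g\<in>carrier G. z \<otimes>\<^sub>W h (v g \<otimes> pact T g e))"
    using z vc ec by (intro W.finsum_rdistr fin) auto
  also have "\<dots> = \<zero>\<^sub>W" by (rule W.add.finprod_one_eqI) (rule z0)
  finally show ?thesis .
qed

section \<open>Tensor products of models\<close>

locale model_tensor = M: model G k A R T \<phi> S e \<iota> + M': model G k A R T' \<phi> S' e' \<iota>'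
  for G :: "'g monoid" and k :: "'k ring" and A :: "('k, 'a) module" and R :: "('k, 'r) module"
    and T :: "('k, 't, 'g, 'a) extension" and \<phi> and S :: "('k, 's, 'g, 'r) extension" and e \<iota>
    and T' :: "('k, 't1, 'g, 'a) extension" and S' :: "('k, 's1, 'g, 'r) extension" and e' \<iota>'
begin

sublocale W: galois_tensor G k A T T'
  by (intro galois_tensor.intro M.T.galois_axioms M'.T.galois_axioms)

sublocale Wg: galois "G \<times>\<times> G" k A W.P by (rule W.galois_P)

lemma emb_S: "r \<in> carrier R ==> emb S r \<in> carrier S" "r \<in> carrier R ==> emb S' r \<in> carrier S'"
  using M.phi_surj[of r] M.emb M'.emb by auto

sublocale P: tensor_setup k R S S' G
  using emb_S by unfold_locales auto

sublocale Pc: algebra k P.P by (rule P.P_algebra)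

abbreviation "\<epsilon> \<equiv> W.pure e e'"

lemma eps_closed: "\<epsilon> \<in> carrier W.P" and eps_idem: "\<epsilon> \<otimes>\<^sub>W.P \<epsilon> = \<epsilon>"
  by (auto simp: W.mult_pure)

text \<open>The tensor product of the two inclusions. The choice is harmless: the conditions
  determine the map on \<open>P.P\<close>, which pure tensors span.\<close>

definition "j = (SOME j. (\<forall>X\<in>carrier P.P. j X \<in> carrier W.P) \<and>
  (\<forall>X\<in>carrier P.P. \<forall>Y\<in>carrier P.P. j (X \<oplus>\<^sub>P.P Y) = j X \<oplus>\<^sub>W.P j Y) \<and>
  (\<forall>s\<in>carrier S. \<forall>t\<in>carrier S'. j (P.pure s t) = W.pure (\<iota> s) (\<iota>' t)))"

lemma j: "X \<in> carrier P.P ==> j X \<in> carrier W.P"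
  "X \<in> carrier P.P ==> Y \<in> carrier P.P ==> j (X \<oplus>\<^sub>P.P Y) = j X \<oplus>\<^sub>W.P j Y"
  "s \<in> carrier S ==> t \<in> carrier S' ==> j (P.pure s t) = W.pure (\<iota> s) (\<iota>' t)"
proof -
  have bal: "W.pure (\<iota> (emb S r \<otimes>\<^sub>S x)) (\<iota>' y) = W.pure (\<iota> x) (\<iota>' (emb S' r \<otimes>\<^sub>S' y))"
    if rxy: "r \<in> carrier R" "x \<in> carrier S" "y \<in> carrier S'" for r x y
  proof -
    obtain a where a: "a \<in> carrier A" "r = \<phi> a" using M.phi_surj rxy by blast
    have "\<iota> (emb S r \<otimes>\<^sub>S x) = emb T a \<otimes>\<^sub>T \<iota> x"
      using a rxy M.emb[OF a(1)] by (simp add: M.io_hom M.T.T.m_assoc M.T.T.m_comm[of e])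
    moreover have "\<iota>' (emb S' r \<otimes>\<^sub>S' y) = emb T' a \<otimes>\<^sub>T' \<iota>' y"
      using a rxy M'.emb[OF a(1)] by (simp add: M'.io_hom M'.T.T.m_assoc M'.T.T.m_comm[of e'])
    ultimately show ?thesis using a rxy W.pure_balance by simp
  qed
  have "\<exists>j. (\<forall>X\<in>carrier P.P. j X \<in> carrier W.P) \<and>
    (\<forall>X\<in>carrier P.P. \<forall>Y\<in>carrier P.P. j (X \<oplus>\<^sub>P.P Y) = j X \<oplus>\<^sub>W.P j Y) \<and>
    (\<forall>s\<in>carrier S. \<forall>t\<in>carrier S'. j (P.pure s t) = W.pure (\<iota> s) (\<iota>' t))" (is ?ex)
  proof (rule P.lift_ex[OF W.P_abelian_group, of "\<lambda>s t. W.pure (\<iota> s) (\<iota>' t)"])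
    show "W.pure (\<iota> (emb S r \<otimes>\<^sub>S x)) (\<iota>' y) = W.pure (\<iota> x) (\<iota>' (emb S' r \<otimes>\<^sub>S' y))"
      if "r \<in> carrier R" "x \<in> carrier S" "y \<in> carrier S'" for r x y using that by (rule bal)
  next
    fix L assume L: "!!X. X \<in> carrier P.P ==> L X \<in> carrier W.P"
      "!!X Y. X \<in> carrier P.P ==> Y \<in> carrier P.P ==> L (X \<oplus>\<^sub>P.P Y) = L X \<oplus>\<^sub>W.P L Y"
      "!!s t. s \<in> carrier S ==> t \<in> carrier S' ==> L (P.pure s t) = W.pure (\<iota> s) (\<iota>' t)"
    show ?ex by (intro exI[of _ L] conjI ballI L)
  qed (simp_all add: M.io_hom M'.io_hom W.pure_add_left W.pure_add_right)
  from someI_ex[OF this] show "X \<in> carrier P.P ==> j X \<in> carrier W.P"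
    "X \<in> carrier P.P ==> Y \<in> carrier P.P ==> j (X \<oplus>\<^sub>P.P Y) = j X \<oplus>\<^sub>W.P j Y"
    "s \<in> carrier S ==> t \<in> carrier S' ==> j (P.pure s t) = W.pure (\<iota> s) (\<iota>' t)"
    unfolding j_def by blast+
qed

lemma cut: "t \<in> carrier T ==> M.pre (t \<otimes>\<^sub>T e) \<in> carrier S" "t \<in> carrier T ==> \<iota> (M.pre (t \<otimes>\<^sub>T e)) = t \<otimes>\<^sub>T e"
  "t' \<in> carrier T' ==> M'.pre (t' \<otimes>\<^sub>T' e') \<in> carrier S'" "t' \<in> carrier T' ==> \<iota>' (M'.pre (t' \<otimes>\<^sub>T' e')) = t' \<otimes>\<^sub>T' e'"
  by (simp_all add: M.pre_closed M.io_pre M'.pre_closed M'.io_pre M.T.T.m_assoc M'.T.T.m_assoc)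

text \<open>Tensoring need not preserve injections. Here multiplication by e and e' gives a map
  back, well defined because cutting is linear over \<open>A\<close>; it splits
  \<open>j\<close>.\<close>

lemma retract_ex:
  obtains q where "!!X. X \<in> carrier W.P ==> q X \<in> carrier P.P"
    "!!X Y. X \<in> carrier W.P ==> Y \<in> carrier W.P ==> q (X \<oplus>\<^sub>W.P Y) = q X \<oplus>\<^sub>P.P q Y"
    "!!t t'. t \<in> carrier T ==> t' \<in> carrier T' ==> q (W.pure t t') = P.pure (M.pre (t \<otimes>\<^sub>T e)) (M'.pre (t' \<otimes>\<^sub>T' e'))"
proof (rule W.lift_ex[OF P.P_abelian_group, of "\<lambda>t t'. P.pure (M.pre (t \<otimes>\<^sub>T e)) (M'.pre (t' \<otimes>\<^sub>T' e'))"])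
  fix a t t' assume at: "a \<in> carrier A" "t \<in> carrier T" "t' \<in> carrier T'"
  have 1: "M.pre (emb T a \<otimes>\<^sub>T t \<otimes>\<^sub>T e) = emb S (\<phi> a) \<otimes>\<^sub>S M.pre (t \<otimes>\<^sub>T e)"
  proof (rule M.io_eqD)
    have "emb T a \<otimes>\<^sub>T t \<otimes>\<^sub>T (e \<otimes>\<^sub>T e) = emb T a \<otimes>\<^sub>T e \<otimes>\<^sub>T (t \<otimes>\<^sub>T e)"
      using at by (simp add: M.T.T.m_ac del: M.e_idem)
    moreover have "\<iota> (M.pre (emb T a \<otimes>\<^sub>T t \<otimes>\<^sub>T e)) = emb T a \<otimes>\<^sub>T t \<otimes>\<^sub>T e" using at by (intro cut) auto
    moreover have "\<iota> (emb S (\<phi> a) \<otimes>\<^sub>S M.pre (t \<otimes>\<^sub>T e)) = emb T a \<otimes>\<^sub>T e \<otimes>\<^sub>T (t \<otimes>\<^sub>T e)"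
      using at M.emb[OF at(1)] by (simp add: cut M.io_hom)
    ultimately show "\<iota> (M.pre (emb T a \<otimes>\<^sub>T t \<otimes>\<^sub>T e)) = \<iota> (emb S (\<phi> a) \<otimes>\<^sub>S M.pre (t \<otimes>\<^sub>T e))" by simp
  qed (use at M.emb[OF at(1)] in \<open>simp_all add: cut\<close>)
  have 2: "M'.pre (emb T' a \<otimes>\<^sub>T' t' \<otimes>\<^sub>T' e') = emb S' (\<phi> a) \<otimes>\<^sub>S' M'.pre (t' \<otimes>\<^sub>T' e')"
  proof (rule M'.io_eqD)
    have "emb T' a \<otimes>\<^sub>T' t' \<otimes>\<^sub>T' (e' \<otimes>\<^sub>T' e') = emb T' a \<otimes>\<^sub>T' e' \<otimes>\<^sub>T' (t' \<otimes>\<^sub>T' e')"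
      using at by (simp add: M'.T.T.m_ac del: M'.e_idem)
    moreover have "\<iota>' (M'.pre (emb T' a \<otimes>\<^sub>T' t' \<otimes>\<^sub>T' e')) = emb T' a \<otimes>\<^sub>T' t' \<otimes>\<^sub>T' e'" using at by (intro cut) auto
    moreover have "\<iota>' (emb S' (\<phi> a) \<otimes>\<^sub>S' M'.pre (t' \<otimes>\<^sub>T' e')) = emb T' a \<otimes>\<^sub>T' e' \<otimes>\<^sub>T' (t' \<otimes>\<^sub>T' e')"
      using at M'.emb[OF at(1)] by (simp add: cut M'.io_hom)
    ultimately show "\<iota>' (M'.pre (emb T' a \<otimes>\<^sub>T' t' \<otimes>\<^sub>T' e')) = \<iota>' (emb S' (\<phi> a) \<otimes>\<^sub>S' M'.pre (t' \<otimes>\<^sub>T' e'))" by simp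
  qed (use at M'.emb[OF at(1)] in \<open>simp_all add: cut\<close>)
  show "P.pure (M.pre (emb T a \<otimes>\<^sub>T t \<otimes>\<^sub>T e)) (M'.pre (t' \<otimes>\<^sub>T' e')) =
    P.pure (M.pre (t \<otimes>\<^sub>T e)) (M'.pre (emb T' a \<otimes>\<^sub>T' t' \<otimes>\<^sub>T' e'))"
    unfolding 1 2 using at by (intro P.pure_balance) (simp_all add: cut M.phi_closed)
next
  fix x y z assume xyz: "x \<in> carrier T" "y \<in> carrier T" "z \<in> carrier T'"
  have "M.pre ((x \<oplus>\<^sub>T y) \<otimes>\<^sub>T e) = M.pre (x \<otimes>\<^sub>T e) \<oplus>\<^sub>S M.pre (y \<otimes>\<^sub>T e)"
    by (rule M.io_eqD) (use xyz in \<open>simp_all add: cut M.io_hom M.T.T.l_distr[symmetric]\<close>)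
  then show "P.pure (M.pre ((x \<oplus>\<^sub>T y) \<otimes>\<^sub>T e)) (M'.pre (z \<otimes>\<^sub>T' e')) =
    P.pure (M.pre (x \<otimes>\<^sub>T e)) (M'.pre (z \<otimes>\<^sub>T' e')) \<oplus>\<^sub>P.P P.pure (M.pre (y \<otimes>\<^sub>T e)) (M'.pre (z \<otimes>\<^sub>T' e'))"
    using xyz by (simp add: cut P.pure_add_left)
next
  fix x y z assume xyz: "x \<in> carrier T" "y \<in> carrier T'" "z \<in> carrier T'"
  have "M'.pre ((y \<oplus>\<^sub>T' z) \<otimes>\<^sub>T' e') = M'.pre (y \<otimes>\<^sub>T' e') \<oplus>\<^sub>S' M'.pre (z \<otimes>\<^sub>T' e')"
    by (rule M'.io_eqD) (use xyz in \<open>simp_all add: cut M'.io_hom M'.T.T.l_distr[symmetric]\<close>)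
  then show "P.pure (M.pre (x \<otimes>\<^sub>T e)) (M'.pre ((y \<oplus>\<^sub>T' z) \<otimes>\<^sub>T' e')) =
    P.pure (M.pre (x \<otimes>\<^sub>T e)) (M'.pre (y \<otimes>\<^sub>T' e')) \<oplus>\<^sub>P.P P.pure (M.pre (x \<otimes>\<^sub>T e)) (M'.pre (z \<otimes>\<^sub>T' e'))"
    using xyz by (simp add: cut P.pure_add_right)
next
  fix L assume L: "!!X. X \<in> carrier W.P ==> L X \<in> carrier P.P"
    "!!X Y. X \<in> carrier W.P ==> Y \<in> carrier W.P ==> L (X \<oplus>\<^sub>W.P Y) = L X \<oplus>\<^sub>P.P L Y"
    "!!t t'. t \<in> carrier T ==> t' \<in> carrier T' ==>
      L (W.pure t t') = P.pure (M.pre (t \<otimes>\<^sub>T e)) (M'.pre (t' \<otimes>\<^sub>T' e'))"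
  show thesis by (rule that[OF L])
qed (simp_all add: cut)

lemma j_mult: assumes X: "X \<in> carrier P.P" and Y: "Y \<in> carrier P.P"
  shows "j (X \<otimes>\<^sub>P.P Y) = j X \<otimes>\<^sub>W.P j Y"
  using X
proof (induction X rule: P.P_induct)
  case (pure s t)
  from Y show ?case
    by (induction Y rule: P.P_induct)
      (use pure in \<open>simp_all add: P.mult_pure j W.mult_pure M.io_hom M'.io_hom Pc.r_distr W.Pc.r_distr\<close>)
qed (use Y in \<open>simp_all add: j Pc.l_distr W.Pc.l_distr\<close>)

lemma j_smult: assumes c: "c \<in> carrier k" and X: "X \<in> carrier P.P"
  shows "j (c \<odot>\<^sub>P.P X) = c \<odot>\<^sub>W.P j X"
  using X c by (induction X rule: P.P_induct)
    (simp_all add: P.smult_pure j W.smult_pure M.io_hom Pc.smult_r_distr Wg.T.smult_r_distr)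

lemma j_zero: "j \<zero>\<^sub>P.P = \<zero>\<^sub>W.P"
proof -
  have "j \<zero>\<^sub>P.P \<oplus>\<^sub>W.P j \<zero>\<^sub>P.P = j \<zero>\<^sub>P.P" by (simp add: j(2)[symmetric])
  then show ?thesis by (simp add: W.Pc.add.r_cancel_one j)
qed

lemma j_one: "j \<one>\<^sub>P.P = \<epsilon>"
  by (simp add: P.one_P j M.io_hom M'.io_hom)

lemma j_eps: "X \<in> carrier P.P ==> j X \<otimes>\<^sub>W.P \<epsilon> = j X"
  by (induction X rule: P.P_induct) (simp_all add: j W.mult_pure W.Pc.l_distr)

lemma q_ex:
  obtains q where "!!X. X \<in> carrier P.P ==> q (j X) = X"
    "!!X Y. X \<in> carrier W.P ==> Y \<in> carrier W.P ==> q (X \<oplus>\<^sub>W.P Y) = q X \<oplus>\<^sub>P.P q Y"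
    "!!t t'. t \<in> carrier T ==> t' \<in> carrier T' ==> q (W.pure t t') = P.pure (M.pre (t \<otimes>\<^sub>T e)) (M'.pre (t' \<otimes>\<^sub>T' e'))"
proof -
  obtain q where q: "!!X. X \<in> carrier W.P ==> q X \<in> carrier P.P"
    "!!X Y. X \<in> carrier W.P ==> Y \<in> carrier W.P ==> q (X \<oplus>\<^sub>W.P Y) = q X \<oplus>\<^sub>P.P q Y"
    "!!t t'. t \<in> carrier T ==> t' \<in> carrier T' ==> q (W.pure t t') = P.pure (M.pre (t \<otimes>\<^sub>T e)) (M'.pre (t' \<otimes>\<^sub>T' e'))"
    by (fact retract_ex)
  have pre: "M.pre (\<iota> s) = s" "M'.pre (\<iota>' s') = s'" if "s \<in> carrier S" "s' \<in> carrier S'" for s s'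
    using that M.io_inj M'.io_inj by (simp_all add: M.pre_def M'.pre_def)
  have "q (j X) = X" if "X \<in> carrier P.P" for X
    using that by (induction X rule: P.P_induct) (simp_all add: j q pre)
  then show thesis by (rule that[OF _ q(2,3)])
qed

lemma j_inj: "inj_on j (carrier P.P)"
  by (rule q_ex) (rule inj_on_inverseI)

lemma j_surj: "w \<in> carrier W.P ==> w \<otimes>\<^sub>W.P \<epsilon> \<in> j ` carrier P.P"
proof (induction w rule: W.P_induct)
  case (pure t t')
  have "W.pure t t' \<otimes>\<^sub>W.P \<epsilon> = j (P.pure (M.pre (t \<otimes>\<^sub>T e)) (M'.pre (t' \<otimes>\<^sub>T' e')))"
    using pure by (simp add: W.mult_pure j cut)
  then show ?case using pure by (simp add: cut)
next
  case (add X Y)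
  obtain x y where "x \<in> carrier P.P" "y \<in> carrier P.P" "X \<otimes>\<^sub>W.P \<epsilon> = j x" "Y \<otimes>\<^sub>W.P \<epsilon> = j y"
    using add.IH by (auto simp: image_iff)
  then have "(X \<oplus>\<^sub>W.P Y) \<otimes>\<^sub>W.P \<epsilon> = j (x \<oplus>\<^sub>P.P y)" "x \<oplus>\<^sub>P.P y \<in> carrier P.P"
    using add by (simp_all add: W.Pc.l_distr eps_closed j)
  then show ?case by (simp only: imageI)
qed

lemma full_eps: "Wg.full \<epsilon>"
  unfolding Wg.full_def
proof (intro conjI ballI impI)
  fix z assume z: "z \<in> carrier W.P" "\<forall>\<gamma>\<in>carrier (G \<times>\<times> G). z \<otimes>\<^sub>W.P pact W.P \<gamma> \<epsilon> = \<zero>\<^sub>W.P"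
  show "z = \<zero>\<^sub>W.P"
  proof (rule M.T.full_zero_hom[OF W.P_cring W.pure_hom(1) M.full z(1)])
    fix g assume g: "g \<in> carrier G"
    show "z \<otimes>\<^sub>W.P W.pure (pact T g e) \<one>\<^sub>T' = \<zero>\<^sub>W.P"
    proof (rule M'.T.full_zero_hom[OF W.P_cring W.pure_hom(2) M'.full])
      fix h assume h: "h \<in> carrier G"
      have "z \<otimes>\<^sub>W.P pact W.P (g, h) \<epsilon> = \<zero>\<^sub>W.P" using z(2) g h by auto
      then show "z \<otimes>\<^sub>W.P W.pure (pact T g e) \<one>\<^sub>T' \<otimes>\<^sub>W.P W.pure \<one>\<^sub>T (pact T' h e') = \<zero>\<^sub>W.P"
        using z(1) g h by (simp add: W.Pc.m_assoc W.mult_pure W.act_pure)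
    qed (use z g in simp)
  qed
qed (simp_all add: eps_closed eps_idem)

lemma el_minus: "Poly_Mapping.keys a \<subseteq> P.F ==> Poly_Mapping.keys b \<subseteq> P.F ==>
  j (P.el (a - b)) = j (P.el a) \<ominus>\<^sub>W.P j (P.el b)"
proof -
  assume ab: "Poly_Mapping.keys a \<subseteq> P.F" "Poly_Mapping.keys b \<subseteq> P.F"
  have c: "P.el a \<in> carrier P.P" "P.el b \<in> carrier P.P" "P.el (a - b) \<in> carrier P.P"
    using ab by (simp_all add: P.el_closed P.keys_diff_F)
  have "j (P.el a) = j (P.el (a - b)) \<oplus>\<^sub>W.P j (P.el b)" using c by (simp add: j(2)[symmetric] P.add_P)
  then show ?thesis using j(1)[OF c(2)] j(1)[OF c(3)] by (simp add: W.Pc.minus_eq W.Pc.a_assoc W.Pc.r_neg)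
qed

text \<open>Membership in the ideal means having an expression with support in S_g \<times> S'_h.
  Such elements satisfy the equation by additivity. Conversely, the retraction applied to j(X) times
  the translate of \<epsilon> yields such an expression and returns X.\<close>

lemma dom_P:
  assumes g: "g \<in> carrier G" and h: "h \<in> carrier G"
  shows "pdom P.P (g, h) = {X \<in> carrier P.P. j X \<otimes>\<^sub>W.P pact W.P (g, h) \<epsilon> = j X}"
proof -
  have pd: "pdom P.P (g, h) = P.el ` {c. Poly_Mapping.keys c \<subseteq> pdom S g \<times> pdom S' h}"
    by (simp add: tensor_def)
  have dS: "pdom S g \<times> pdom S' h \<subseteq> P.F" using g h M.pdomD M'.pdomD by blast
  have ge: "pact W.P (g, h) \<epsilon> = W.pure (pact T g e) (pact T' h e')" using g h by (simp add: W.act_pure)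
  have gc: "W.pure (pact T g e) (pact T' h e') \<in> carrier W.P" using g h by simp
  show ?thesis unfolding pd ge
  proof (intro equalityI subsetI)
    fix X assume "X \<in> P.el ` {c. Poly_Mapping.keys c \<subseteq> pdom S g \<times> pdom S' h}"
    then obtain c where c: "X = P.el c" "Poly_Mapping.keys c \<subseteq> pdom S g \<times> pdom S' h" by blast
    have "Poly_Mapping.keys c \<subseteq> P.F \<and> j (P.el c) \<otimes>\<^sub>W.P W.pure (pact T g e) (pact T' h e') = j (P.el c)"
      using c(2)
    proof (induction c rule: frag_induction)
      case zero
      then show ?case using gc by (simp add: P.zero_P[symmetric] j_zero)
    next
      case (one x)
      obtain s t where st: "x = (s, t)" "s \<in> pdom S g" "t \<in> pdom S' h" using one by auto
      then show ?case using M.pdomD[OF g st(2)] M'.pdomD[OF h st(3)] g h by (simp add: j W.mult_pure)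
    next
      case (diff a b)
      then have c: "j (P.el a) \<in> carrier W.P" "j (P.el b) \<in> carrier W.P" by (auto intro!: j P.el_closed)
      then show ?case using diff gc
        by (simp add: el_minus P.keys_diff_F W.Pc.minus_eq W.Pc.l_distr W.Pc.l_minus)
    qed
    then show "X \<in> {X \<in> carrier P.P. j X \<otimes>\<^sub>W.P W.pure (pact T g e) (pact T' h e') = j X}"
      unfolding c(1) by (simp add: P.el_closed)
  next
    fix X assume X: "X \<in> {X \<in> carrier P.P. j X \<otimes>\<^sub>W.P W.pure (pact T g e) (pact T' h e') = j X}"
    obtain q where q: "!!X. X \<in> carrier P.P ==> q (j X) = X"
      "!!X Y. X \<in> carrier W.P ==> Y \<in> carrier W.P ==> q (X \<oplus>\<^sub>W.P Y) = q X \<oplus>\<^sub>P.P q Y"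
      "!!t t'. t \<in> carrier T ==> t' \<in> carrier T' ==> q (W.pure t t') = P.pure (M.pre (t \<otimes>\<^sub>T e)) (M'.pre (t' \<otimes>\<^sub>T' e'))"
      by (fact q_ex)
    have "q (j Y \<otimes>\<^sub>W.P W.pure (pact T g e) (pact T' h e')) \<in> P.el ` {c. Poly_Mapping.keys c \<subseteq> pdom S g \<times> pdom S' h}"
      if "Y \<in> carrier P.P" for Y
      using that
    proof (induction Y rule: P.P_induct)
      case (pure s t)
      let ?a = "M.pre (\<iota> s \<otimes>\<^sub>T pact T g e \<otimes>\<^sub>T e)" and ?b = "M'.pre (\<iota>' t \<otimes>\<^sub>T' pact T' h e' \<otimes>\<^sub>T' e')"
      have "\<iota> ?a \<otimes>\<^sub>T pact T g e = \<iota> ?a" "\<iota>' ?b \<otimes>\<^sub>T' pact T' h e' = \<iota>' ?b"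
      proof -
        have "\<iota> s \<otimes>\<^sub>T pact T g e \<otimes>\<^sub>T e \<otimes>\<^sub>T pact T g e = \<iota> s \<otimes>\<^sub>T pact T g e \<otimes>\<^sub>T pact T g e \<otimes>\<^sub>T e"
          using pure g by (simp add: M.T.T.m_assoc M.T.T.m_comm[of e])
        then show "\<iota> ?a \<otimes>\<^sub>T pact T g e = \<iota> ?a" using pure g by (simp add: cut M.eps_assoc)
        have "\<iota>' t \<otimes>\<^sub>T' pact T' h e' \<otimes>\<^sub>T' e' \<otimes>\<^sub>T' pact T' h e' = \<iota>' t \<otimes>\<^sub>T' pact T' h e' \<otimes>\<^sub>T' pact T' h e' \<otimes>\<^sub>T' e'"
          using pure h by (simp add: M'.T.T.m_assoc M'.T.T.m_comm[of e'])
        then show "\<iota>' ?b \<otimes>\<^sub>T' pact T' h e' = \<iota>' ?b" using pure h by (simp add: cut M'.eps_assoc)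
      qed
      then have "?a \<in> pdom S g" "?b \<in> pdom S' h" using pure g h by (simp_all add: M.dom M'.dom cut)
      moreover have "q (j (P.pure s t) \<otimes>\<^sub>W.P W.pure (pact T g e) (pact T' h e')) = P.pure ?a ?b"
        using pure g h by (simp add: j W.mult_pure q)
      ultimately show ?case by (intro image_eqI[of _ _ "frag_of (?a, ?b)"]) auto
    next
      case (add X Y)
      obtain c d where cd: "Poly_Mapping.keys c \<subseteq> pdom S g \<times> pdom S' h" "Poly_Mapping.keys d \<subseteq> pdom S g \<times> pdom S' h"
        "q (j X \<otimes>\<^sub>W.P W.pure (pact T g e) (pact T' h e')) = P.el c"
        "q (j Y \<otimes>\<^sub>W.P W.pure (pact T g e) (pact T' h e')) = P.el d" using add.IH by blast
      have "q (j (X \<oplus>\<^sub>P.P Y) \<otimes>\<^sub>W.P W.pure (pact T g e) (pact T' h e')) = P.el (c + d)"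
        using add.hyps cd(3,4) gc by (simp add: j W.Pc.l_distr q P.add_P)
      then show ?case using P.keys_add_F[OF cd(1,2)] by blast
    qed
    from this[of X] show "X \<in> P.el ` {c. Poly_Mapping.keys c \<subseteq> pdom S g \<times> pdom S' h}"
      using X q(1) by simp
  qed
qed

text \<open>The action is evaluated on expressions supported in the domain. All of them give the
  same class because \<open>j\<close> is injective and turns each value into the image of j(X) under
  the action on T \<otimes> T'.\<close>

lemma act_P:
  assumes g: "g \<in> carrier G" and h: "h \<in> carrier G" and X: "X \<in> pdom P.P (inv\<^bsub>G\<^esub> g, inv\<^bsub>G\<^esub> h)"
  shows "pact P.P (g, h) X \<in> carrier P.P \<and> j (pact P.P (g, h) X) = pact W.P (g, h) (j X)"
proof -
  let ?D = "pdom S (inv\<^bsub>G\<^esub> g) \<times> pdom S' (inv\<^bsub>G\<^esub> h)"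
  let ?f = "\<lambda>(s, t). frag_of (pact S g s, pact S' h t)"
  have gi: "inv\<^bsub>G\<^esub> g \<in> carrier G" "inv\<^bsub>G\<^esub> h \<in> carrier G" using g h by auto
  have dS: "?D \<subseteq> P.F" using gi M.pdomD M'.pdomD by blast
  have X': "X \<in> P.el ` {c. Poly_Mapping.keys c \<subseteq> ?D}" using X by (simp add: tensor_def)
  then obtain c where c: "X = P.el c" "Poly_Mapping.keys c \<subseteq> ?D" by blast
  have key: "Poly_Mapping.keys c \<subseteq> P.F \<and> Poly_Mapping.keys (frag_extend ?f c) \<subseteq> P.F \<and>
     j (P.el (frag_extend ?f c)) = pact W.P (g, h) (j (P.el c))"
    if "Poly_Mapping.keys c \<subseteq> ?D" for c
    using that
  proof (induction c rule: frag_induction)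
    case zero
    show ?case using g h by (simp add: P.zero_P[symmetric] j_zero)
  next
    case (one x)
    obtain s t where st: "x = (s, t)" "s \<in> pdom S (inv\<^bsub>G\<^esub> g)" "t \<in> pdom S' (inv\<^bsub>G\<^esub> h)" using one by auto
    then show ?case using M.pdomD[OF gi(1) st(2)] M'.pdomD[OF gi(2) st(3)] M.act[OF g st(2)] M'.act[OF h st(3)] g h
      by (simp add: j W.act_pure)
  next
    case (diff a b)
    then have c: "j (P.el a) \<in> carrier W.P" "j (P.el b) \<in> carrier W.P" by (auto intro!: j P.el_closed)
    then show ?case using diff g h
      by (simp add: el_minus P.keys_diff_F frag_extend_diff W.Pc.minus_eq W.act_P_add Wg.act_uminus)
  qed
  let ?Z = "P.el (frag_extend ?f c)"
  have "pact P.P (g, h) X = (\<Union>c'\<in>{c' \<in> X. Poly_Mapping.keys c' \<subseteq> ?D}. P.el (frag_extend ?f c'))"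
    by (simp add: tensor_def)
  also have "\<dots> = ?Z"
  proof -
    have "P.el (frag_extend ?f c') = ?Z" if c': "c' \<in> X" "Poly_Mapping.keys c' \<subseteq> ?D" for c'
    proof -
      have "P.el c' = P.el c" using c' c(1) P.in_el_iff P.el_eq_iff by simp
      then have "j (P.el (frag_extend ?f c')) = j ?Z" using key[OF c'(2)] key[OF c(2)] by simp
      then show ?thesis using key[OF c'(2)] key[OF c(2)] inj_onD[OF j_inj] by (simp add: P.el_closed)
    qed
    moreover have "c \<in> {c' \<in> X. Poly_Mapping.keys c' \<subseteq> ?D}" using c P.in_el_self by simp
    ultimately show ?thesis by blast
  qed
  finally have "pact P.P (g, h) X = ?Z" .
  then show ?thesis using key[OF c(2)] c(1) by (simp add: P.el_closed)
qed

lemma tensor_model: "model (G \<times>\<times> G) k A R W.P \<phi> P.P \<epsilon> j"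
proof (intro model.intro W.galois_P M.R.algebra_axioms model_axioms.intro M.phi full_eps j_inj)
  show "t \<in> j ` carrier P.P" if "t \<in> carrier W.P" "t \<otimes>\<^sub>W.P \<epsilon> = t" for t
    using j_surj[OF that(1)] that(2) by simp
  show "pdom P.P \<gamma> = {x \<in> carrier P.P. j x \<otimes>\<^sub>W.P pact W.P \<gamma> \<epsilon> = j x}" if "\<gamma> \<in> carrier (G \<times>\<times> G)" for \<gamma>
    using that dom_P by (cases \<gamma>) auto
  show "pact P.P \<gamma> x \<in> carrier P.P \<and> j (pact P.P \<gamma> x) = pact W.P \<gamma> (j x)"
    if "\<gamma> \<in> carrier (G \<times>\<times> G)" "x \<in> pdom P.P (inv\<^bsub>G \<times>\<times> G\<^esub> \<gamma>)" for \<gamma> x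
    using that act_P by (cases \<gamma>) (auto simp: inv_DirProd[OF M.T.G.group_axioms M.T.G.group_axioms])
  show "emb P.P (\<phi> a) \<in> carrier P.P \<and> j (emb P.P (\<phi> a)) = emb W.P a \<otimes>\<^sub>W.P \<epsilon>" if a: "a \<in> carrier A" for a
    using M.emb[OF a] a by (simp add: P.emb_P W.emb_P j W.mult_pure M'.io_hom)
qed (simp_all add: j j_eps j_zero j_one j_mult j_smult)

end

lemma ghom_fixed_ext:
  assumes V: "galois \<Gamma> k A V" and F: "ghom \<Gamma> A V V' F" and N: "N \<subseteq> carrier \<Gamma>"
    and \<sigma>: "!!g. g \<in> carrier G ==> \<sigma> g \<in> carrier \<Gamma>"
  shows "ghom G A (fixed_ext N V \<sigma>) (fixed_ext N V' \<sigma>) F"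
proof -
  interpret V: galois \<Gamma> k A V by fact
  note F' = F[unfolded ghom_def]
  have h: "F \<in> ring_hom V V'" using F' by blast
  have eq: "F (pact V g x) = pact V' g (F x)" if "g \<in> carrier \<Gamma>" "x \<in> carrier V" for g x using F' that by blast
  have "pact V' n (F x) = F x" if "n \<in> N" "x \<in> carrier V" "pact V n x = x" for n x
    using eq[of n x] that N by auto
  then show ?thesis using F' \<sigma> eq
    by (auto simp: ghom_def carrier_fixed_ext intro!: ring_hom_memI
        simp: ring_hom_closed[OF h] ring_hom_mult[OF h] ring_hom_add[OF h] ring_hom_one[OF h])
qed

section \<open>Hulls of idempotents under a subgroup\<close>

context gact
begin

text \<open>Belonging to the ideal generated by the translates \<open>n(e)\<close>, expressed through their common annihilator.\<close>

definition supported :: "'g set \<Rightarrow> 't \<Rightarrow> 't \<Rightarrow> bool" where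
  "supported N e y \<longleftrightarrow> y \<in> carrier T \<and> (\<forall>z\<in>carrier T. (\<forall>n\<in>N. z \<otimes> pact T n e = \<zero>) \<longrightarrow> z \<otimes> y = \<zero>)"

text \<open>The identity element of the ideal generated by the translates n(e). It characterizes e_N
  without enumeration, which makes the partial product independent of choices
  (\<open>hull_unique\<close>).\<close>

definition hull :: "'g set \<Rightarrow> 't \<Rightarrow> 't \<Rightarrow> bool" where
  "hull N e c \<longleftrightarrow> supported N e c \<and> (\<forall>n\<in>N. c \<otimes> pact T n e = pact T n e)"

text \<open>1 - c kills all translates, hence everything they support.\<close>

lemma hull_absorbs:
  assumes N: "N \<subseteq> carrier G" and e: "e \<in> carrier T" and c: "hull N e c" and y: "supported N e y"
  shows "c \<otimes> y = y"
proof -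
  have cc: "c \<in> carrier T" "y \<in> carrier T" using c y by (auto simp: hull_def supported_def)
  have "(\<one> \<ominus> c) \<otimes> pact T n e = \<zero>" if "n \<in> N" for n
  proof -
    have "c \<otimes> pact T n e = pact T n e" using c that by (simp add: hull_def)
    then show ?thesis using cc e N that by (simp add: T.minus_eq T.l_distr T.l_minus T.r_neg subset_iff)
  qed
  then have "(\<one> \<ominus> c) \<otimes> y = \<zero>" using y cc by (simp add: supported_def)
  then have "y \<ominus> c \<otimes> y = \<zero>" using cc by (simp add: T.minus_eq T.l_distr T.l_minus)
  from T.minus_zeroD[OF _ _ this] show ?thesis using cc by simp
qed

lemma hull_unique:
  assumes N: "N \<subseteq> carrier G" and e: "e \<in> carrier T" and c: "hull N e c" "hull N e c'"
  shows "c = c'"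
proof -
  have cc: "c \<in> carrier T" "c' \<in> carrier T" using c by (auto simp: hull_def supported_def)
  have "c \<otimes> c' = c'" "c' \<otimes> c = c" using hull_absorbs[OF N e] c by (auto simp: hull_def)
  then show ?thesis using T.m_comm[OF cc] by simp
qed

text \<open>The local form of \<open>full_eqI\<close>: an element of cT is determined by its
  products with the translates n(e).\<close>

lemma hull_ext:
  assumes N: "N \<subseteq> carrier G" and e: "e \<in> carrier T" and c: "hull N e c"
    and x: "x \<in> carrier T" "c \<otimes> x = x" and y: "y \<in> carrier T" "c \<otimes> y = y"
    and eq: "!!n. n \<in> N ==> x \<otimes> pact T n e = y \<otimes> pact T n e"
  shows "x = y"
proof (rule T.minus_zeroD[OF x(1) y(1)])
  have cc: "c \<in> carrier T" using c by (auto simp: hull_def supported_def)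
  have "(x \<ominus> y) \<otimes> pact T n e = \<zero>" if "n \<in> N" for n
    using eq[OF that] x(1) y(1) e N that by (simp add: T.minus_eq T.l_distr T.l_minus T.r_neg subset_iff)
  then have "(x \<ominus> y) \<otimes> c = \<zero>" using c x y by (simp add: hull_def supported_def)
  then have "c \<otimes> x \<ominus> c \<otimes> y = \<zero>"
    using x(1) y(1) cc by (simp add: T.minus_eq T.l_distr T.l_minus T.m_comm[of c])
  then show "x \<ominus> y = \<zero>" using x y by simp
qed

end

lemma (in cring) split_complement:
  "z \<in> carrier R ==> h \<in> carrier R ==> z \<otimes> h \<oplus> (\<one> \<ominus> h) \<otimes> z = z"
  by (simp add: minus_eq l_distr l_minus m_comm[of h z] a_lcomm[of "z \<otimes> h" z] r_neg)

lemma (in cring) kill_complement: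
  assumes "h \<in> carrier R" "z \<in> carrier R" "h \<otimes> h = h" shows "h \<otimes> ((\<one> \<ominus> h) \<otimes> z) = \<zero>"
proof -
  have "h \<otimes> (\<one> \<ominus> h) = \<zero>" using assms by (simp add: minus_eq r_distr r_minus r_neg)
  then have "h \<otimes> (\<one> \<ominus> h) \<otimes> z = \<zero>" using assms by simp
  then show ?thesis using assms by (simp add: m_assoc)
qed

section \<open>The quotient partial action\<close>

locale patching = gact \<Gamma> k V for \<Gamma> :: "'h monoid" and k :: "'k ring"
    and V :: "('k, 'v, 'h, 'z) partial_algebra_scheme" (structure) +
  fixes S :: "('k, 's, 'h, 'y) partial_algebra_scheme" and \<iota> :: "'s \<Rightarrow> 'v" and N hs
  assumes N: "subgroup N \<Gamma>" and enum: "enumerates \<Gamma> hs N"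
    and e_closed [simp, intro]: "\<iota> \<one>\<^sub>S \<in> carrier V" and e_idem [simp]: "\<iota> \<one>\<^sub>S \<otimes> \<iota> \<one>\<^sub>S = \<iota> \<one>\<^sub>S"
begin

abbreviation "e \<equiv> \<iota> \<one>\<^sub>S"
abbreviation "\<psi> \<equiv> quot_psi S V \<iota> hs"
abbreviation "E \<equiv> quot_idem S V \<iota> hs"
abbreviation "Z i \<equiv> (\<Otimes>j\<in>{..<i}. \<one> \<ominus> pact V (hs ! j) e)"

lemma N_sub: "n \<in> N ==> n \<in> carrier \<Gamma>"
  using subgroup.subset[OF N] by auto

lemma N_sub': "N \<subseteq> carrier \<Gamma>"
  by (rule subgroup.subset[OF N])

lemma hs_N: "i < length hs ==> hs ! i \<in> N"
  using enum by (auto simp: enumerates_def)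

lemma hs_cl [simp, intro]: "i < length hs ==> hs ! i \<in> carrier \<Gamma>"
  by (intro N_sub hs_N)

lemma Z_closed: "i \<le> length hs ==> Z i \<in> carrier V"
  by (rule T.finprod_closed) auto

lemma Z_Suc: "i < length hs ==> Z (Suc i) = (\<one> \<ominus> pact V (hs ! i) e) \<otimes> Z i"
  unfolding lessThan_Suc by (rule T.finprod_insert) auto

lemma E_closed: "i < length hs ==> E i \<in> carrier V"
  unfolding quot_idem_def using Z_closed[of i] by simp

text \<open>Telescoping: since \<open>E i\<close> is \<open>Z i\<close> times the translate of e at
  position i, adding \<open>E i\<close> to \<open>Z (Suc i)\<close> gives back
  \<open>Z i\<close>.\<close>

lemma E_sum: "i \<le> length hs ==> (\<Oplus>j\<in>{..<i}. E j) \<oplus> Z i = \<one>"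
proof (induction i)
  case 0
  then show ?case by simp
next
  case (Suc i)
  then have i: "i < length hs" by simp
  let ?h = "pact V (hs ! i) e"
  have c: "Z i \<in> carrier V" "?h \<in> carrier V" "(\<Oplus>j\<in>{..<i}. E j) \<in> carrier V" "E i \<in> carrier V"
    using i by (auto intro!: Z_closed E_closed T.finsum_closed)
  have "E i \<oplus> Z (Suc i) = Z i \<otimes> ?h \<oplus> (\<one> \<ominus> ?h) \<otimes> Z i" using i by (simp add: Z_Suc quot_idem_def)
  also have "\<dots> = Z i" using c(1,2) by (rule T.split_complement)
  finally have "E i \<oplus> Z (Suc i) = Z i" .
  moreover have "(\<Oplus>j\<in>{..<Suc i}. E j) = E i \<oplus> (\<Oplus>j\<in>{..<i}. E j)"
    unfolding lessThan_Suc using i by (intro T.finsum_insert) (auto intro!: E_closed)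
  moreover have "Z (Suc i) \<in> carrier V" using Suc.prems by (rule Z_closed)
  moreover from this have "E i \<oplus> (\<Oplus>j\<in>{..<i}. E j) \<oplus> Z (Suc i) = (\<Oplus>j\<in>{..<i}. E j) \<oplus> (E i \<oplus> Z (Suc i))"
    using c(3,4) by (simp add: T.a_ac)
  ultimately have "(\<Oplus>j\<in>{..<Suc i}. E j) \<oplus> Z (Suc i) = (\<Oplus>j\<in>{..<i}. E j) \<oplus> Z i" by simp
  then show ?case using Suc by simp
qed

lemma Z_kill: "j < i ==> i \<le> length hs ==> pact V (hs ! j) e \<otimes> Z i = \<zero>"
proof (induction i)
  case (Suc i)
  let ?h = "pact V (hs ! j) e" and ?i = "pact V (hs ! i) e"
  have c: "Z i \<in> carrier V" "?h \<in> carrier V" "?i \<in> carrier V" using Suc.prems by (auto intro!: Z_closed)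
  show ?case
  proof (cases "j = i")
    case True
    have "?h \<otimes> ?h = ?h" using Suc.prems act_mult[of "hs ! j" e e] by simp
    then show ?thesis using True Suc.prems T.kill_complement[of ?h "Z i"] c by (simp add: Z_Suc)
  next
    case False
    then have "?h \<otimes> Z i = \<zero>" using Suc by simp
    then show ?thesis using Suc.prems c by (simp add: Z_Suc T.m_lcomm[of ?h])
  qed
qed simp

text \<open>The remainder \<open>Z (length hs)\<close> contains the complement of every translate
  n(e) as a factor, so the sum of all \<open>E j\<close> acts as identity on each of them.\<close>

lemma E_total: "n \<in> N ==> pact V n e \<otimes> (\<Oplus>j\<in>{..<length hs}. E j) = pact V n e"
proof -
  assume n: "n \<in> N"
  then obtain j where j: "j < length hs" "n = hs ! j" using enum by (auto simp: enumerates_def in_set_conv_nth)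
  have c: "(\<Oplus>j\<in>{..<length hs}. E j) \<in> carrier V" "Z (length hs) \<in> carrier V"
    by (auto intro!: Z_closed E_closed T.finsum_closed)
  have "pact V n e \<otimes> ((\<Oplus>j\<in>{..<length hs}. E j) \<oplus> Z (length hs)) = pact V n e"
    using E_sum[OF order_refl] n N_sub by simp
  then show ?thesis using Z_kill[OF j(1) order_refl] j c by (simp add: T.r_distr)
qed

lemma psi_closed: "x \<in> carrier V ==> \<psi> x \<in> carrier V"
  unfolding quot_psi_def by (rule T.finsum_closed) (auto intro!: E_closed)

text \<open>Invariance of an element of eV under the partial action of \<open>N\<close>, in the
  ambient form of \<open>invariants_sub_iff\<close>.\<close>

definition "agrees x \<longleftrightarrow> x \<in> carrier V \<and> x \<otimes> e = x \<and> (\<forall>n\<in>N. pact V n x \<otimes> e = x \<otimes> pact V n e)"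

lemma agrees_e: "agrees e"
  by (auto simp: agrees_def N_sub T.m_comm)

lemma agrees_shift:
  assumes x: "agrees x" and m: "m \<in> N" and n: "n \<in> N"
  shows "pact V m x \<otimes> pact V n e = pact V n x \<otimes> pact V m e"
proof -
  let ?l = "inv\<^bsub>\<Gamma>\<^esub> n \<otimes>\<^sub>\<Gamma> m"
  note c = N_sub[OF m] N_sub[OF n]
  have "?l \<in> N" using m n by (simp add: subgroup.m_closed[OF N] subgroup.m_inv_closed[OF N])
  then have "pact V ?l x \<otimes> e = x \<otimes> pact V ?l e" "x \<in> carrier V" using x by (auto simp: agrees_def)
  then have "pact V n (pact V ?l x \<otimes> e) = pact V n (x \<otimes> pact V ?l e)" "x \<in> carrier V" by simp_all
  then show ?thesis using c by (simp add: act_mult act_comp G.m_assoc[symmetric])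
qed

text \<open>The formula for \<psi> is a gluing: on n(e) each term h_i(x) E_i may be replaced by n(x)
  E_i by \<open>agrees_shift\<close>, and the E_i add up to the identity there.\<close>

lemma psi_patch:
  assumes x: "agrees x" and n: "n \<in> N"
  shows "\<psi> x \<otimes> pact V n e = pact V n x"
proof -
  have xc: "x \<in> carrier V" "x \<otimes> e = x" using x by (auto simp: agrees_def)
  note nc = N_sub[OF n]
  have ee: "pact V (hs ! i) e \<otimes> E i = E i" if "i < length hs" for i
    unfolding quot_idem_def using that Z_closed[of i] act_mult[of "hs ! i" e e]
    by (simp add: T.m_lcomm[of "pact V (hs ! i) e"])
  have t: "pact V (hs ! i) x \<otimes> E i \<otimes> pact V n e = pact V n x \<otimes> E i" if i: "i < length hs" for i
  proof -
    have "pact V (hs ! i) x \<otimes> E i \<otimes> pact V n e = (pact V (hs ! i) x \<otimes> pact V n e) \<otimes> E i"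
      using i xc nc E_closed[OF i] by (simp add: T.m_ac)
    also have "\<dots> = pact V n x \<otimes> (pact V (hs ! i) e \<otimes> E i)"
      unfolding agrees_shift[OF x hs_N[OF i] n] using i xc nc E_closed[OF i] by (simp add: T.m_assoc)
    finally show ?thesis unfolding ee[OF i] .
  qed
  have "\<psi> x \<otimes> pact V n e = (\<Oplus>i\<in>{..<length hs}. pact V (hs ! i) x \<otimes> E i \<otimes> pact V n e)"
    unfolding quot_psi_def using xc nc by (intro T.finsum_ldistr) (auto intro!: E_closed)
  also have "\<dots> = (\<Oplus>i\<in>{..<length hs}. pact V n x \<otimes> E i)"
    using xc nc by (intro T.finsum_cong') (auto intro!: E_closed simp: t)
  also have "\<dots> = pact V n x \<otimes> (\<Oplus>i\<in>{..<length hs}. E i)"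
    using xc nc by (intro T.finsum_rdistr[symmetric]) (auto intro!: E_closed)
  also have "\<dots> = pact V n (x \<otimes> e) \<otimes> (\<Oplus>i\<in>{..<length hs}. E i)" using xc by simp
  also have "\<dots> = pact V n x \<otimes> (pact V n e \<otimes> (\<Oplus>i\<in>{..<length hs}. E i))"
    using xc(1) nc by (simp add: act_mult T.m_assoc T.finsum_closed E_closed Pi_iff del: xc(2))
  also have "\<dots> = pact V n (x \<otimes> e)" unfolding E_total[OF n] using xc(1) nc by (simp add: act_mult)
  finally show ?thesis using xc by simp
qed

lemma psi_supported: "x \<in> carrier V ==> supported N e (\<psi> x)"
  unfolding supported_def
proof (intro conjI ballI impI)
  fix z assume x: "x \<in> carrier V" and z: "z \<in> carrier V" "\<forall>n\<in>N. z \<otimes> pact V n e = \<zero>"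
  have t: "z \<otimes> (pact V (hs ! i) x \<otimes> E i) = \<zero>" if i: "i < length hs" for i
  proof -
    have "z \<otimes> (pact V (hs ! i) x \<otimes> E i) = (z \<otimes> pact V (hs ! i) e) \<otimes> (pact V (hs ! i) x \<otimes> Z i)"
      unfolding quot_idem_def using i x z(1) Z_closed[of i] by (simp add: T.m_ac)
    then show ?thesis using z(2) hs_N[OF i] i x Z_closed[of i] by simp
  qed
  have "z \<otimes> \<psi> x = (\<Oplus>i\<in>{..<length hs}. z \<otimes> (pact V (hs ! i) x \<otimes> E i))"
    unfolding quot_psi_def using x z by (intro T.finsum_rdistr) (auto intro!: E_closed)
  also have "\<dots> = \<zero>" by (rule T.add.finprod_one_eqI) (simp add: t)
  finally show "z \<otimes> \<psi> x = \<zero>" .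
qed (rule psi_closed)

abbreviation "c \<equiv> \<psi> e"

lemma c_hull: "hull N e c"
  by (simp add: hull_def psi_supported psi_patch[OF agrees_e])

lemma c_psi: "x \<in> carrier V ==> c \<otimes> \<psi> x = \<psi> x"
  by (rule hull_absorbs[OF N_sub' e_closed c_hull psi_supported])

text \<open>\<psi>(x) is the only element of cV that glues the translates of x. Later identities for
  \<psi> follow from this and not from its formula.\<close>

lemma psi_unique:
  assumes "agrees x" "y \<in> carrier V" "c \<otimes> y = y" "!!n. n \<in> N ==> y \<otimes> pact V n e = pact V n x"
  shows "y = \<psi> x"
proof (rule hull_ext[OF N_sub' e_closed c_hull assms(2,3)])
  have x: "x \<in> carrier V" using assms(1) by (simp add: agrees_def)
  show "\<psi> x \<in> carrier V" by (rule psi_closed[OF x])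
  show "c \<otimes> \<psi> x = \<psi> x" by (rule c_psi[OF x])
  show "y \<otimes> pact V n e = \<psi> x \<otimes> pact V n e" if "n \<in> N" for n
    using assms(4)[OF that] psi_patch[OF assms(1) that] by simp
qed

lemma one_N: "\<one>\<^sub>\<Gamma> \<in> N"
  by (rule subgroup.one_closed[OF N])

text \<open>\<open>N\<close> permutes the translates of e, so their common annihilator is stable
  under \<open>N\<close>, and so is the ideal cV.\<close>

lemma act_hull:
  assumes y: "y \<in> carrier V" "c \<otimes> y = y" and n: "n \<in> N"
  shows "c \<otimes> pact V n y = pact V n y"
proof (rule hull_absorbs[OF N_sub' e_closed c_hull])
  show "supported N e (pact V n y)" unfolding supported_def
  proof (intro conjI ballI impI)
    fix z assume z: "z \<in> carrier V" "\<forall>n\<in>N. z \<otimes> pact V n e = \<zero>"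
    note nc = N_sub[OF n]
    have "pact V (inv\<^bsub>\<Gamma>\<^esub> n) z \<otimes> pact V m e = \<zero>" if m: "m \<in> N" for m
    proof -
      have "pact V (inv\<^bsub>\<Gamma>\<^esub> n) (z \<otimes> pact V (n \<otimes>\<^sub>\<Gamma> m) e) = \<zero>"
        using z(2) subgroup.m_closed[OF N n m] nc by simp
      then show ?thesis using z(1) nc N_sub[OF m] by (simp add: act_mult act_comp)
    qed
    then have "pact V (inv\<^bsub>\<Gamma>\<^esub> n) z \<otimes> c = \<zero>" using c_hull z nc by (simp add: hull_def supported_def)
    then have "(pact V (inv\<^bsub>\<Gamma>\<^esub> n) z \<otimes> c) \<otimes> y = \<zero>" using y by simp
    then have "pact V (inv\<^bsub>\<Gamma>\<^esub> n) z \<otimes> y = \<zero>" using z(1) nc y psi_closed[of e] by (simp add: T.m_assoc)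
    then have "pact V n (pact V (inv\<^bsub>\<Gamma>\<^esub> n) z \<otimes> y) = \<zero>" using nc by simp
    then show "z \<otimes> pact V n y = \<zero>" using z y nc by (simp add: act_mult)
  qed (use y N_sub[OF n] in simp)
qed

text \<open>m(\<psi>(x)) glues the same family of translates as \<psi>(x).\<close>

lemma psi_inv:
  assumes x: "agrees x" and m: "m \<in> N"
  shows "pact V m (\<psi> x) = \<psi> x"
proof (rule psi_unique[OF x])
  have xc: "x \<in> carrier V" using x by (simp add: agrees_def)
  note mc = N_sub[OF m]
  show "pact V m (\<psi> x) \<in> carrier V" using xc mc psi_closed by simp
  show "c \<otimes> pact V m (\<psi> x) = pact V m (\<psi> x)" using xc m by (intro act_hull psi_closed c_psi)
  fix n assume n: "n \<in> N"
  have l: "inv\<^bsub>\<Gamma>\<^esub> m \<otimes>\<^sub>\<Gamma> n \<in> N" using m n by (simp add: subgroup.m_closed[OF N] subgroup.m_inv_closed[OF N])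
  have "pact V m (\<psi> x \<otimes> pact V (inv\<^bsub>\<Gamma>\<^esub> m \<otimes>\<^sub>\<Gamma> n) e) = pact V m (pact V (inv\<^bsub>\<Gamma>\<^esub> m \<otimes>\<^sub>\<Gamma> n) x)"
    by (simp add: psi_patch[OF x l])
  then show "pact V m (\<psi> x) \<otimes> pact V n e = pact V n x"
    using xc mc N_sub[OF n] psi_closed by (simp add: act_mult act_comp G.m_assoc[symmetric])
qed

lemma psi_e: "agrees x ==> \<psi> x \<otimes> e = x"
  using psi_patch[OF _ one_N] by (simp add: agrees_def)

text \<open>Together with \<open>psi_e\<close> this shows that \<psi> and multiplication by e are
  inverse bijections between the invariants of S and the \<open>N\<close>-fixed elements of
  cV.\<close>

lemma fixed_agrees:
  assumes "t \<in> carrier V" "!!n. n \<in> N ==> pact V n t = t" "c \<otimes> t = t"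
  shows "agrees (t \<otimes> e)" "\<psi> (t \<otimes> e) = t"
proof -
  show co: "agrees (t \<otimes> e)" using assms N_sub
    by (simp add: agrees_def act_mult T.m_assoc) (simp add: T.m_comm)
  show "\<psi> (t \<otimes> e) = t"
    using assms N_sub by (intro psi_unique[OF co, symmetric]) (simp_all add: act_mult)
qed

end

text \<open>The reindexing of \<open>par_product\<close> by (g, 1) \<delta>G, separated from the
  tensor product so that an arbitrary model for \<open>G \<times>\<times> G\<close> can be
  treated.\<close>

definition coset_ext :: "'g monoid \<Rightarrow> ('k, 's, ('g \<times> 'g) set, 'r) extension \<Rightarrow> ('k, 's, 'g, 'r) extension" where
  "coset_ext G Q = (let coset = (\<lambda>g. (g, \<one>\<^sub>G) <#\<^bsub>G \<times>\<times> G\<^esub> anti_diagonal G)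
     in \<lparr>carrier = carrier Q, monoid.mult = monoid.mult Q, one = \<one>\<^sub>Q, ring.zero = \<zero>\<^sub>Q, add = add Q,
         smult = smult Q, pdom = (\<lambda>g. pdom Q (coset g)), pact = (\<lambda>g. pact Q (coset g)),
         emb = emb Q\<rparr>)"

lemma par_product_eq: "par_product G R S S' T \<iota> hs =
  coset_ext G (quotient_action (G \<times>\<times> G) (anti_diagonal G) (tensor G R S S') T \<iota> hs)"
  by (simp add: par_product_def coset_ext_def Let_def)

text \<open>\<open>V0\<close> is the bare globalization that occurs in \<open>par_product\<close>;
  \<open>V\<close> has the same operations and in addition the structure map that makes it a Galois
  extension of \<open>A\<close>.\<close>

locale quot_model = M: model "G \<times>\<times> G" k A R V \<phi> S e \<iota> + G: comm_group G
  for G :: "'g monoid" and k :: "'k ring" and A :: "('k, 'a) module" and R :: "('k, 'r) module"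
    and V :: "('k, 'v, 'g \<times> 'g, 'a) extension" (structure) and \<phi>
    and S :: "('k, 's, 'g \<times> 'g, 'r) extension" and e \<iota> +
  fixes V0 :: "('k, 'v, 'g \<times> 'g) partial_algebra" and hs
  assumes sel: "carrier V0 = carrier V" "monoid.mult V0 = monoid.mult V" "\<one>\<^sub>V0 = \<one>" "\<zero>\<^sub>V0 = \<zero>"
      "add V0 = add V" "smult V0 = smult V" "pdom V0 = pdom V" "pact V0 = pact V"
    and enum: "enumerates (G \<times>\<times> G) hs (anti_diagonal G)"
    and finG: "finite (carrier G)"
begin

abbreviation "N \<equiv> anti_diagonal G"

sublocale Q: galois_quot "G \<times>\<times> G" k A V G "\<lambda>(g, h). g \<otimes>\<^sub>G h" "\<lambda>g. (g, \<one>\<^sub>G)"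
  rewrites "galois_quot.N (G \<times>\<times> G) G (\<lambda>(g, h). g \<otimes>\<^sub>G h) = anti_diagonal G"
  using galois_quot_mult[OF G.comm_group_axioms finG M.T.galois_axioms] by simp_all

abbreviation "VN \<equiv> fixed_ext N V (\<lambda>g. (g, \<one>\<^sub>G))"

sublocale Vq: galois G k A VN by (rule Q.galois_V)

lemma gact_V0: "gact (G \<times>\<times> G) k V0"
proof (intro gact.intro M.T.G.group_axioms gact_axioms.intro)
  show "algebra k V0"
    by (rule algebra_inj[OF M.T.T.algebra_axioms, where \<iota> = "\<lambda>x. x"])
      (auto simp: sel intro: M.T.T.smult_closed)
  show "pact V0 \<one>\<^bsub>G \<times>\<times> G\<^esub> x = x" if "x \<in> carrier V0" for x using that by (simp only: sel M.T.act_id)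
  show "finite (carrier (G \<times>\<times> G))" by (rule M.T.fin)
qed (auto simp: sel M.T.dom M.T.act_add M.T.act_mult M.T.act_comp)

sublocale Pt: patching "G \<times>\<times> G" k V0 S \<iota> N hs
proof (intro patching.intro gact_V0 patching_axioms.intro enum)
  show "subgroup N (G \<times>\<times> G)" by (rule Q.subgroup_N)
qed (simp_all add: sel M.io_hom)

lemmas pt [unfolded sel M.io_hom] = Pt.psi_closed Pt.agrees_def Pt.agrees_e Pt.c_psi Pt.psi_inv Pt.psi_e
  Pt.fixed_agrees Pt.c_hull

abbreviation "c \<equiv> quot_psi S V0 \<iota> hs e"
abbreviation "\<kappa> x \<equiv> quot_psi S V0 \<iota> hs (\<iota> x)"
abbreviation "I \<equiv> invariants (G \<times>\<times> G) N S"
abbreviation "Y \<equiv> coset_ext G (quotient_action (G \<times>\<times> G) N S V0 \<iota> hs)"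

lemma I_iff: "s \<in> I \<longleftrightarrow> s \<in> carrier S \<and> Pt.agrees (\<iota> s)"
proof -
  have "N \<subseteq> carrier (G \<times>\<times> G)" using Q.N_sub by blast
  from M.invariants_sub_iff[OF this, of s] show ?thesis by (auto simp: pt(2))
qed

lemma c_V: "c \<in> carrier VN" "c \<otimes> e = e" "c \<otimes> c = c"
  using pt(1)[of e] pt(5)[OF pt(3)] pt(6)[OF pt(3)] pt(4)[of e] by (simp_all add: Q.V_carrier)

lemma c_closed [simp, intro]: "c \<in> carrier V"
  using c_V by (simp add: Q.V_carrier)

lemma kappa_V: "x \<in> I ==> \<kappa> x \<in> carrier VN" "x \<in> I ==> \<kappa> x \<in> carrier V"
    "x \<in> I ==> c \<otimes> \<kappa> x = \<kappa> x" "x \<in> I ==> \<kappa> x \<otimes> e = \<iota> x"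
  using pt(1)[of "\<iota> x"] pt(5)[of "\<iota> x"] pt(6)[of "\<iota> x"] pt(4)[of "\<iota> x"] by (simp_all add: Q.V_carrier I_iff)

lemma kappa_pre:
  assumes t: "t \<in> carrier VN" "c \<otimes> t = t"
  shows "M.pre (t \<otimes> e) \<in> I" "\<kappa> (M.pre (t \<otimes> e)) = t"
proof -
  have tc: "t \<in> carrier V" using t by (simp add: Q.V_carrier)
  have te: "t \<otimes> e \<in> carrier V" "t \<otimes> e \<otimes> e = t \<otimes> e" using tc by (simp_all add: M.T.T.m_assoc)
  note p = M.pre_closed[OF te] M.io_pre[OF te]
  show "M.pre (t \<otimes> e) \<in> I" "\<kappa> (M.pre (t \<otimes> e)) = t"
    using t p pt(7,8)[of t] by (simp_all add: Q.V_carrier I_iff)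
qed

text \<open>Computes \<kappa> without its formula: an \<open>N\<close>-fixed element of cV whose cut
  is s must be \<kappa>(s), and s is then invariant. It is the device behind most clauses of
  \<open>quot_model\<close>.\<close>

lemma kappa_eqI:
  assumes "t \<in> carrier VN" "c \<otimes> t = t" "s \<in> carrier S" "t \<otimes> e = \<iota> s"
  shows "s \<in> I \<and> \<kappa> s = t"
proof -
  have "M.pre (t \<otimes> e) = s" using assms M.io_inj by (simp add: M.pre_def)
  then show ?thesis using kappa_pre[OF assms(1,2)] by simp
qed

text \<open>The representative chosen by \<open>SOME\<close> has the form (gh, \<open>inv\<close> h)
  and acts on \<open>N\<close>-fixed elements as (g, 1) does.\<close>

lemma coset_rep:
  assumes g: "g \<in> carrier G"
  defines "\<gamma> \<equiv> SOME \<gamma>. \<gamma> \<in> (g, \<one>\<^sub>G) <#\<^bsub>G \<times>\<times> G\<^esub> N"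
  shows "t \<in> carrier VN ==> pact V \<gamma> t = pact V (g, \<one>\<^sub>G) t"
proof -
  have "(g, \<one>\<^sub>G) \<otimes>\<^bsub>G \<times>\<times> G\<^esub> (\<one>\<^sub>G, inv\<^bsub>G\<^esub> \<one>\<^sub>G) \<in> (g, \<one>\<^sub>G) <#\<^bsub>G \<times>\<times> G\<^esub> N"
    unfolding l_coset_def anti_diagonal_def by blast
  then have "\<gamma> \<in> (g, \<one>\<^sub>G) <#\<^bsub>G \<times>\<times> G\<^esub> N" unfolding \<gamma>_def by (rule someI)
  then obtain h where "h \<in> carrier G" "\<gamma> = (g \<otimes>\<^sub>G h, \<one>\<^sub>G \<otimes>\<^sub>G inv\<^bsub>G\<^esub> h)"
    by (auto simp: l_coset_def anti_diagonal_def)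
  then show "t \<in> carrier VN ==> pact V \<gamma> t = pact V (g, \<one>\<^sub>G) t"
    using g by (intro Q.act_chi) (auto simp: G.m_assoc)
qed

lemma Y_simps: "carrier Y = I" "monoid.mult Y = monoid.mult S" "\<one>\<^sub>Y = \<one>\<^sub>S" "\<zero>\<^sub>Y = \<zero>\<^sub>S"
  "add Y = add S" "smult Y = smult S" "emb Y = emb S"
  by (simp_all add: coset_ext_def quotient_action_def Let_def)

lemma Y_pdom: "g \<in> carrier G ==> pdom Y g = (\<lambda>x. M.pre (\<iota> x \<otimes> pact V (g, \<one>\<^sub>G) c \<otimes> e)) ` I"
  using coset_rep[of g c] c_V by (simp add: coset_ext_def quotient_action_def Let_def sel M.io_hom M.pre_def)

lemma Y_pact: "g \<in> carrier G ==> x \<in> I ==> pact Y g x = M.pre (pact V (g, \<one>\<^sub>G) (\<kappa> x) \<otimes> e)"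
  using coset_rep[of g "\<kappa> x"] kappa_V by (simp add: coset_ext_def quotient_action_def Let_def sel M.io_hom M.pre_def)

lemma Vq_ops: "x \<in> carrier VN ==> y \<in> carrier VN ==> x \<otimes> y \<in> carrier VN"
  "x \<in> carrier VN ==> y \<in> carrier VN ==> x \<oplus> y \<in> carrier VN"
  "x \<in> carrier VN ==> x \<in> carrier V" "\<zero> \<in> carrier VN"
  "a \<in> carrier k ==> x \<in> carrier VN ==> a \<odot>\<^sub>V x \<in> carrier VN"
  using Vq.T.m_closed[of x y] Vq.T.a_closed[of x y] Vq.T.zero_closed Vq.T.smult_closed[of a x] by (simp_all add: Q.V_carrier)

text \<open>c absorbs e, so an element killed by the translates of c is killed by those of e. An
  arbitrary (g, h) acts on c as (gh, 1).\<close>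

lemma full_c: "Vq.full c"
  unfolding Vq.full_def
proof (intro conjI ballI impI)
  fix z assume z: "z \<in> carrier VN" and zg: "\<forall>g\<in>carrier G. z \<otimes>\<^sub>VN pact VN g c = \<zero>\<^sub>VN"
  have zc: "z \<in> carrier V" using z by (rule Vq_ops)
  have "z = \<zero>"
  proof (rule M.T.full_zero[OF M.full zc])
    fix \<gamma> assume \<gamma>: "\<gamma> \<in> carrier (G \<times>\<times> G)"
    obtain g h where gh: "\<gamma> = (g, h)" "g \<in> carrier G" "h \<in> carrier G" using \<gamma> by auto
    have "pact V \<gamma> c = pact V (g \<otimes>\<^sub>G h, \<one>\<^sub>G) c" using c_V(1) gh by (intro Q.act_chi) auto
    then have "z \<otimes> pact V \<gamma> c = \<zero>" using zg gh by simp
    then have "z \<otimes> pact V \<gamma> (c \<otimes> e) = \<zero>" using \<gamma> zc by (simp add: M.T.act_mult M.T.T.m_assoc[symmetric] del: c_V)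
    then show "z \<otimes> pact V \<gamma> e = \<zero>" unfolding c_V(2) .
  qed
  then show "z = \<zero>\<^sub>VN" by simp
qed (simp_all add: c_V)

text \<open>The map \<psi> after the inclusion identifies the invariants of S with the cut of the
  fixed ring by c, and translates the quotient action into the restriction of the action of
  \<open>G\<close>. So the fixed ring globalizes the quotient.\<close>

lemma quot_model: "model G k A R VN \<phi> Y c (quot_psi S V0 \<iota> hs \<circ> \<iota>)"
proof -
  have hom: "\<zero>\<^sub>S \<in> I \<and> \<kappa> \<zero>\<^sub>S = \<zero>" "\<one>\<^sub>S \<in> I \<and> \<kappa> \<one>\<^sub>S = c"
    by (rule kappa_eqI; simp add: Vq_ops c_V M.io_hom)+
  have Is: "x \<in> carrier S" if "x \<in> I" for x using that by (simp add: I_iff)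
  have add: "x \<oplus>\<^sub>S y \<in> I \<and> \<kappa> (x \<oplus>\<^sub>S y) = \<kappa> x \<oplus> \<kappa> y"
    and mult: "x \<otimes>\<^sub>S y \<in> I \<and> \<kappa> (x \<otimes>\<^sub>S y) = \<kappa> x \<otimes> \<kappa> y" if xy: "x \<in> I" "y \<in> I" for x y
  proof -
    note k = kappa_V[OF xy(1)] kappa_V[OF xy(2)]
    show "x \<oplus>\<^sub>S y \<in> I \<and> \<kappa> (x \<oplus>\<^sub>S y) = \<kappa> x \<oplus> \<kappa> y"
      by (rule kappa_eqI) (use k Is xy in \<open>simp_all add: Vq_ops M.io_hom M.T.T.r_distr M.T.T.l_distr\<close>)
    have "\<kappa> x \<otimes> \<kappa> y \<otimes> (e \<otimes> e) = (\<kappa> x \<otimes> e) \<otimes> (\<kappa> y \<otimes> e)"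
      using k(2,6) by (simp add: M.T.T.m_ac del: M.e_idem)
    then have "\<kappa> x \<otimes> \<kappa> y \<otimes> e = \<iota> (x \<otimes>\<^sub>S y)" using k Is xy by (simp add: M.io_hom)
    then show "x \<otimes>\<^sub>S y \<in> I \<and> \<kappa> (x \<otimes>\<^sub>S y) = \<kappa> x \<otimes> \<kappa> y"
      by (intro kappa_eqI) (use k Is xy in \<open>simp_all add: Vq_ops M.T.T.m_assoc[symmetric]\<close>)
  qed
  have kc: "\<kappa> x \<otimes> c = \<kappa> x" if "x \<in> I" for x
    by (rule trans[OF M.T.T.m_comm[OF kappa_V(2)[OF that] c_closed] kappa_V(3)[OF that]])
  have smult: "a \<odot>\<^sub>S x \<in> I \<and> \<kappa> (a \<odot>\<^sub>S x) = a \<odot>\<^sub>V \<kappa> x" if ax: "a \<in> carrier k" "x \<in> I" for a x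
  proof (rule kappa_eqI)
    note k = kappa_V[OF ax(2)]
    show "a \<odot>\<^sub>V \<kappa> x \<in> carrier VN" "a \<odot>\<^sub>S x \<in> carrier S" using k Is ax by (simp_all add: Vq_ops)
    have "c \<otimes> (a \<odot>\<^sub>V \<kappa> x) = (a \<odot>\<^sub>V \<kappa> x) \<otimes> c" using k(2) ax(1) by (intro M.T.T.m_comm) auto
    also have "\<dots> = a \<odot>\<^sub>V (\<kappa> x \<otimes> c)" using k(2) ax(1) by (simp add: M.T.T.smult_assoc2)
    finally show "c \<otimes> (a \<odot>\<^sub>V \<kappa> x) = a \<odot>\<^sub>V \<kappa> x" unfolding kc[OF ax(2)] .
    show "(a \<odot>\<^sub>V \<kappa> x) \<otimes> e = \<iota> (a \<odot>\<^sub>S x)"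
      using k(2) Is[OF ax(2)] ax(1) by (simp add: M.io_hom M.T.T.smult_assoc2 k(4))
  qed
  have inj: "x = y" if "x \<in> I" "y \<in> I" "\<kappa> x = \<kappa> y" for x y
  proof (rule M.io_eqD[OF Is[OF that(1)] Is[OF that(2)]])
    have "\<kappa> x \<otimes> e = \<kappa> y \<otimes> e" by (rule arg_cong[OF that(3)])
    then show "\<iota> x = \<iota> y" unfolding kappa_V(4)[OF that(1)] kappa_V(4)[OF that(2)] .
  qed
  have dom: "pdom Y g = {x \<in> I. \<kappa> x \<otimes> pact V (g, \<one>\<^sub>G) c = \<kappa> x}" if g: "g \<in> carrier G" for g
  proof -
    let ?d = "pact V (g, \<one>\<^sub>G) c"
    have d: "?d \<in> carrier VN" "?d \<otimes> ?d = ?d"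
      using g c_V M.T.act_mult[of "(g, \<one>\<^sub>G)" c c] by (auto intro: Q.act_V)
    have dV: "?d \<in> carrier V" using d(1) by (rule Vq_ops)
    \<comment> \<open>The domain is defined by multiplication inside eV; as \<open>?d\<close> is
      fixed by \<open>N\<close>, this corresponds to multiplication of \<kappa>(x) by
      \<open>?d\<close> in the fixed ring.\<close>
    have f: "M.pre (\<iota> x \<otimes> ?d \<otimes> e) \<in> I \<and> \<kappa> (M.pre (\<iota> x \<otimes> ?d \<otimes> e)) = \<kappa> x \<otimes> ?d" if x: "x \<in> I" for x
    proof -
      note k = kappa_V[OF x]
      have "\<iota> x \<otimes> ?d \<otimes> e = (\<iota> x \<otimes> e) \<otimes> ?d" using Is[OF x] dV by (simp add: M.T.T.m_ac del: M.io_e)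
      also have "\<dots> = (\<kappa> x \<otimes> e) \<otimes> ?d" using Is[OF x] by (simp add: k)
      also have "\<dots> = \<kappa> x \<otimes> ?d \<otimes> e" using k(2) dV by (simp add: M.T.T.m_ac)
      finally have eq: "\<iota> x \<otimes> ?d \<otimes> e = \<kappa> x \<otimes> ?d \<otimes> e" .
      show ?thesis unfolding eq
        by (intro conjI kappa_pre) (use k d dV in \<open>simp_all add: Vq_ops M.T.T.m_assoc[symmetric]\<close>)
    qed
    show ?thesis unfolding Y_pdom[OF g]
    proof (intro equalityI subsetI)
      fix y assume "y \<in> (\<lambda>x. M.pre (\<iota> x \<otimes> ?d \<otimes> e)) ` I"
      then obtain x where x: "x \<in> I" "y = M.pre (\<iota> x \<otimes> ?d \<otimes> e)" by blast
      then show "y \<in> {x \<in> I. \<kappa> x \<otimes> ?d = \<kappa> x}"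
        using f[OF x(1)] kappa_V(2)[OF x(1)] dV d(2) by (simp add: M.T.T.m_assoc)
    next
      fix x assume "x \<in> {x \<in> I. \<kappa> x \<otimes> ?d = \<kappa> x}"
      then have x: "x \<in> I" "\<kappa> x \<otimes> ?d = \<kappa> x" by auto
      have "x = M.pre (\<iota> x \<otimes> ?d \<otimes> e)" using f[OF x(1)] x by (intro inj) auto
      then show "x \<in> (\<lambda>x. M.pre (\<iota> x \<otimes> ?d \<otimes> e)) ` I" using x(1) by (rule image_eqI)
    qed
  qed
  have act: "pact Y g x \<in> I \<and> \<kappa> (pact Y g x) = pact V (g, \<one>\<^sub>G) (\<kappa> x)"
    if g: "g \<in> carrier G" and x: "x \<in> pdom Y (inv\<^bsub>G\<^esub> g)" for g x
  proof -
    have x': "x \<in> I" "\<kappa> x \<otimes> pact V (inv\<^bsub>G\<^esub> g, \<one>\<^sub>G) c = \<kappa> x" using x dom[of "inv\<^bsub>G\<^esub> g"] g by auto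
    note k = kappa_V[OF x'(1)]
    have "pact VN g (\<kappa> x \<otimes>\<^sub>VN pact VN (inv\<^bsub>G\<^esub> g) c) = pact VN g (\<kappa> x)" using x'(2) by simp
    then have "pact VN g (\<kappa> x) \<otimes>\<^sub>VN pact VN g (pact VN (inv\<^bsub>G\<^esub> g) c) = pact VN g (\<kappa> x)"
      using Vq.act_mult[OF g k(1) Vq.act_closed[OF _ c_V(1), of "inv\<^bsub>G\<^esub> g"]] g by simp
    then have "pact V (g, \<one>\<^sub>G) (\<kappa> x) \<otimes> c = pact V (g, \<one>\<^sub>G) (\<kappa> x)"
      using Vq.act_inv_cancel(1)[OF g c_V(1)] by simp
    then show ?thesis unfolding Y_pact[OF g x'(1)]
      by (intro conjI kappa_pre)
        (use k(1,2) g M.T.T.m_comm[of c "pact V (g, \<one>\<^sub>G) (\<kappa> x)"] in \<open>auto intro: Q.act_V\<close>)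
  qed
  have emb: "emb S (\<phi> a) \<in> I \<and> \<kappa> (emb S (\<phi> a)) = emb V a \<otimes> c" if a: "a \<in> carrier A" for a
  proof (rule kappa_eqI)
    have ea: "emb V a \<in> carrier VN" using Vq.emb_closed[OF a] by simp
    then show "emb V a \<otimes> c \<in> carrier VN" by (intro Vq_ops c_V)
    show "c \<otimes> (emb V a \<otimes> c) = emb V a \<otimes> c" using a c_V(3) by (simp add: M.T.T.m_lcomm[of c])
    show "emb S (\<phi> a) \<in> carrier S" "emb V a \<otimes> c \<otimes> e = \<iota> (emb S (\<phi> a))"
      using M.emb[OF a] a c_V(2) by (simp_all add: M.T.T.m_assoc)
  qed
  have surj: "t \<in> quot_psi S V0 \<iota> hs ` \<iota> ` I" if "t \<in> carrier VN" "t \<otimes> c = t" for t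
  proof -
    have "c \<otimes> t = t" using that M.T.T.m_comm[OF c_closed Vq_ops(3)[OF that(1)]] by simp
    from kappa_pre[OF that(1) this] show ?thesis unfolding image_image by (intro image_eqI) auto
  qed
  show ?thesis
    by (intro model.intro Vq.galois_axioms M.R.algebra_axioms model_axioms.intro M.phi full_c)
      (use hom add mult smult inj dom act emb surj in
        \<open>simp_all add: Y_simps kappa_V kc inj_on_def image_image\<close>)
qed

lemma c_hull: "M.T.hull N e c"
  using pt(9) by (simp add: M.T.hull_def M.T.supported_def Pt.hull_def Pt.supported_def sel M.io_hom)

end

section \<open>Transport along equivariant isomorphisms\<close>

locale ghom_map = T: galois G k A T + T': galois G k A T'
  for G :: "'g monoid" and k :: "'k ring" and A :: "('k, 'a) module"
    and T :: "('k, 't, 'g, 'a) extension" and T' :: "('k, 't1, 'g, 'a) extension" +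
  fixes F assumes F: "ghom G A T T' F"
begin

sublocale F: ring_hom_cring T T' F
  by (rule ghom_hom[OF T.galois_axioms T'.galois_axioms F])

lemma F_act [simp]: "g \<in> carrier G ==> x \<in> carrier T ==> F (pact T g x) = pact T' g (F x)"
  and F_emb [simp]: "a \<in> carrier A ==> F (emb T a) = emb T' a"
  using F by (auto simp: ghom_def)

lemma F_smult [simp]: "c \<in> carrier k ==> x \<in> carrier T ==> F (c \<odot>\<^sub>T x) = c \<odot>\<^sub>T' F x"
  by (simp add: T.smult_eq T'.smult_eq)

lemma F_bij: "bij_betw F (carrier T) (carrier T')"
  by (rule ghom_bij[OF T.galois_axioms T'.galois_axioms F])

lemma F_eq_iff: "x \<in> carrier T ==> y \<in> carrier T ==> F x = F y \<longleftrightarrow> x = y"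
  using F_bij by (auto simp: bij_betw_def dest: inj_onD)

lemma F_cases: assumes "y \<in> carrier T'" obtains x where "x \<in> carrier T" "y = F x"
  using assms F_bij by (auto simp: bij_betw_def)

lemma F_annihilates:
  assumes "x \<in> carrier T" "y \<in> carrier T" "g \<in> carrier G"
  shows "F x \<otimes>\<^sub>T' pact T' g (F y) = \<zero>\<^sub>T' \<longleftrightarrow> x \<otimes>\<^sub>T pact T g y = \<zero>\<^sub>T"
  using assms F_eq_iff[of "x \<otimes>\<^sub>T pact T g y" "\<zero>\<^sub>T"] by simp

lemma F_full: "T.full e ==> T'.full (F e)"
proof -
  assume e: "T.full e"
  note ee = T.fullD[OF e]
  have "z = \<zero>\<^sub>T'" if z: "z \<in> carrier T'" "\<forall>g\<in>carrier G. z \<otimes>\<^sub>T' pact T' g (F e) = \<zero>\<^sub>T'" for z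
  proof -
    obtain x where x: "x \<in> carrier T" "z = F x" by (rule F_cases[OF z(1)])
    have "x = \<zero>\<^sub>T" by (rule T.full_zero[OF e x(1)]) (use z(2) x ee F_annihilates in simp)
    then show ?thesis using x by simp
  qed
  then show ?thesis unfolding T'.full_def using ee F.hom_mult[of e e] by simp
qed

lemma F_hull:
  assumes N: "N \<subseteq> carrier G" and e: "e \<in> carrier T" and c: "T.hull N e c"
  shows "T'.hull N (F e) (F c)"
proof -
  have cc: "c \<in> carrier T" using c by (simp add: T.hull_def T.supported_def)
  have "z \<otimes>\<^sub>T' F c = \<zero>\<^sub>T'" if z: "z \<in> carrier T'" "\<forall>n\<in>N. z \<otimes>\<^sub>T' pact T' n (F e) = \<zero>\<^sub>T'" for z
  proof -
    obtain x where x: "x \<in> carrier T" "z = F x" by (rule F_cases[OF z(1)])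
    have "\<forall>n\<in>N. x \<otimes>\<^sub>T pact T n e = \<zero>\<^sub>T" using z(2) N x e F_annihilates by (auto simp: subset_iff)
    then have "x \<otimes>\<^sub>T c = \<zero>\<^sub>T" using c x by (simp add: T.hull_def T.supported_def)
    then have "F (x \<otimes>\<^sub>T c) = \<zero>\<^sub>T'" by simp
    then show ?thesis using x cc by simp
  qed
  moreover have "F c \<otimes>\<^sub>T' pact T' n (F e) = pact T' n (F e)" if n: "n \<in> N" for n
  proof -
    have "F (c \<otimes>\<^sub>T pact T n e) = F (pact T n e)" using c n by (simp add: T.hull_def)
    then show ?thesis using cc e n N by (simp add: subset_iff)
  qed
  ultimately show ?thesis using cc by (simp add: T'.hull_def T'.supported_def)
qed

lemma F_model:
  assumes "model G k A R T \<phi> S e \<iota>"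
  shows "model G k A R T' \<phi> S (F e) (F \<circ> \<iota>)"
proof -
  interpret M: model G k A R T \<phi> S e \<iota> by fact
  show ?thesis
  proof (intro model.intro T'.galois_axioms M.R.algebra_axioms model_axioms.intro M.phi F_full[OF M.full])
    show "(F \<circ> \<iota>) x \<otimes>\<^sub>T' F e = (F \<circ> \<iota>) x" if "x \<in> carrier S" for x
      using that F.hom_mult[of "\<iota> x" e] by simp
    show "inj_on (F \<circ> \<iota>) (carrier S)"
      using M.io_inj F_eq_iff by (auto simp: inj_on_def)
    show "t \<in> (F \<circ> \<iota>) ` carrier S" if t: "t \<in> carrier T'" "t \<otimes>\<^sub>T' F e = t" for t
    proof -
      obtain x where x: "x \<in> carrier T" "t = F x" by (rule F_cases[OF t(1)])
      then have "x \<otimes>\<^sub>T e = x" using t(2) F_eq_iff[of "x \<otimes>\<^sub>T e" x] by simp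
      then show ?thesis using M.io_surj[OF x(1)] x(2) by auto
    qed
    show "pdom S g = {x \<in> carrier S. (F \<circ> \<iota>) x \<otimes>\<^sub>T' pact T' g (F e) = (F \<circ> \<iota>) x}" if g: "g \<in> carrier G" for g
    proof -
      have "(F \<circ> \<iota>) x \<otimes>\<^sub>T' pact T' g (F e) = (F \<circ> \<iota>) x \<longleftrightarrow> \<iota> x \<otimes>\<^sub>T pact T g e = \<iota> x" if "x \<in> carrier S" for x
        using that g F_eq_iff[of "\<iota> x \<otimes>\<^sub>T pact T g e" "\<iota> x"] by simp
      then show ?thesis using M.dom[OF g] by auto
    qed
    show "pact S g x \<in> carrier S \<and> (F \<circ> \<iota>) (pact S g x) = pact T' g ((F \<circ> \<iota>) x)"
      if "g \<in> carrier G" "x \<in> pdom S (inv\<^bsub>G\<^esub> g)" for g x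
      using that M.act[OF that] M.pdomD[OF _ that(2)] by simp
    show "emb S (\<phi> a) \<in> carrier S \<and> (F \<circ> \<iota>) (emb S (\<phi> a)) = emb T' a \<otimes>\<^sub>T' F e" if "a \<in> carrier A" for a
      using M.emb[OF that] that by simp
  qed (simp_all add: M.S_closed M.io_hom)
qed

end

lemma ghom_id: "ghom G A T T (\<lambda>x. x)"
  by (simp add: ghom_def ring_hom_def)

text \<open>The value on one prescribed pure tensor is recorded in order to follow e \<otimes> e'
  through the isomorphism.\<close>

lemma tensor_ghom:
  assumes gal: "galois G k A T1" "galois G k A T1'" "galois G k A T2" "galois G k A T2'"
    and f: "ghom G A T1 T2 f" and f': "ghom G A T1' T2' f'"
    and s: "s \<in> carrier T1" and t: "t \<in> carrier T1'"
  shows "\<exists>F. ghom (G \<times>\<times> G) A (tensor G A T1 T1') (tensor G A T2 T2') F \<and>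
    F (tensor_elem A T1 T1' (frag_of (s, t))) = tensor_elem A T2 T2' (frag_of (f s, f' t))"
proof -
  interpret H1: galois_tensor G k A T1 T1' by (intro galois_tensor.intro gal)
  interpret H2: galois_tensor G k A T2 T2' by (intro galois_tensor.intro gal)
  interpret f: ghom_map G k A T1 T2 f by (intro ghom_map.intro gal ghom_map_axioms.intro f)
  interpret f': ghom_map G k A T1' T2' f' by (intro ghom_map.intro gal ghom_map_axioms.intro f')
  have u: "(\<lambda>s. H2.pure s \<one>\<^sub>T2') \<circ> f \<in> ring_hom T1 H2.P" by (rule ring_hom_trans[OF f.F.homh H2.pure_hom(1)])
  have v: "(\<lambda>t. H2.pure \<one>\<^sub>T2 t) \<circ> f' \<in> ring_hom T1' H2.P" by (rule ring_hom_trans[OF f'.F.homh H2.pure_hom(2)])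
  obtain L where L: "L \<in> ring_hom H1.P H2.P" "!!s t. s \<in> carrier T1 ==> t \<in> carrier T1' ==>
      L (H1.pure s t) = ((\<lambda>s. H2.pure s \<one>\<^sub>T2') \<circ> f) s \<otimes>\<^sub>H2.P ((\<lambda>t. H2.pure \<one>\<^sub>T2 t) \<circ> f') t"
    by (rule H1.lift_hom[OF H2.P_cring u v]) (simp_all add: H2.emb_pure_left H2.emb_pure_right)
  have Lp: "L (H1.pure s t) = H2.pure (f s) (f' t)" if "s \<in> carrier T1" "t \<in> carrier T1'" for s t
    using that by (simp add: L(2) H2.mult_pure)
  have "L (pact H1.P \<gamma> X) = pact H2.P \<gamma> (L X)" if \<gamma>: "\<gamma> \<in> carrier (G \<times>\<times> G)" and X: "X \<in> carrier H1.P" for \<gamma> X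
  proof -
    obtain g h where gh: "\<gamma> = (g, h)" "g \<in> carrier G" "h \<in> carrier G" using \<gamma> by auto
    show ?thesis unfolding gh(1)
      by (rule H1.lift_equiv[OF H2.galois_P u v L]) (use gh X in \<open>simp_all add: H2.act_pure\<close>)
  qed
  moreover have "L (emb H1.P a) = emb H2.P a" if "a \<in> carrier A" for a
    using that by (simp add: H1.emb_P H2.emb_P Lp)
  ultimately have "ghom (G \<times>\<times> G) A H1.P H2.P L" using L(1) by (simp add: ghom_def)
  then show ?thesis using Lp[OF s t] by blast
qed

text \<open>\<open>V0\<close> is an arbitrary globalization of the tensor product. It is compared
  with T \<otimes> T', another globalization of the same partial extension; this exhibits the
  partial product as the cut of a fixed ring by the hull of e \<otimes> e'.\<close>

lemma par_product_model:
  fixes G :: "'g monoid" and V0 :: "('k, 'v, 'g \<times> 'g) partial_algebra" and A :: "('k, 'a) module"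
  assumes G: "comm_group G" and M: "model G k A R T \<phi> S e \<iota>" "model G k A R T' \<phi> S' e' \<iota>'"
    and V0: "globalization (G \<times>\<times> G) k (tensor G R S S') V0 j"
    and hs: "enumerates (G \<times>\<times> G) hs (anti_diagonal G)"
  obtains V :: "('k, 'v, 'g \<times> 'g, 'a) extension" and F c \<kappa> where
    "galois (G \<times>\<times> G) k A V" "ghom (G \<times>\<times> G) A (tensor G A T T') V F"
    "gact.hull V (anti_diagonal G) (F (tensor_elem A T T' (frag_of (e, e')))) c"
    "model G k A R (fixed_ext (anti_diagonal G) V (\<lambda>g. (g, \<one>\<^sub>G))) \<phi> (par_product G R S S' V0 j hs) c \<kappa>"
proof -
  interpret MT: model_tensor G k A R T \<phi> S e \<iota> T' S' e' \<iota>' by (rule model_tensor.intro[OF M])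
  interpret W: model "G \<times>\<times> G" k A R MT.W.P \<phi> MT.P.P MT.\<epsilon> MT.j by (rule MT.tensor_model)
  obtain V :: "('k, 'v, 'g \<times> 'g, 'a) extension" where V: "model (G \<times>\<times> G) k A R V \<phi> MT.P.P (j \<one>\<^sub>MT.P.P) j"
    and sel: "carrier V = carrier V0" "monoid.mult V = monoid.mult V0" "\<one>\<^sub>V = \<one>\<^sub>V0" "\<zero>\<^sub>V = \<zero>\<^sub>V0"
      "add V = add V0" "smult V = smult V0" "pdom V = pdom V0" "pact V = pact V0"
    by (rule globalization_model[OF W.partial_extension_S MT.M.T.A.algebra_axioms W.phi V0])
  have fin: "finite (carrier G)" by (rule MT.M.T.fin)
  interpret Q: quot_model G k A R V \<phi> MT.P.P "j \<one>\<^sub>MT.P.P" j V0 hs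
    by (intro quot_model.intro V G quot_model_axioms.intro hs fin) (simp_all add: sel)
  \<comment> \<open>The identity of the tensor product, viewed as a partial isomorphism between two
    of its models, extends to an isomorphism of the globalizations.\<close>
  have "partially_isomorphic (G \<times>\<times> G) k R MT.P.P MT.P.P"
    unfolding partially_isomorphic_iff[OF MT.tensor_model MT.tensor_model] using ghom_id by blast
  then obtain F where F: "ghom (G \<times>\<times> G) A MT.W.P V F" "F MT.\<epsilon> = j \<one>\<^sub>MT.P.P"
    unfolding partially_isomorphic_iff[OF MT.tensor_model V] by blast
  show thesis
  proof (rule that[OF Q.M.T.galois_axioms F(1)])
    show "gact.hull V (anti_diagonal G) (F MT.\<epsilon>) Q.c" unfolding F(2) by (rule Q.c_hull)
    show "model G k A R (fixed_ext (anti_diagonal G) V (\<lambda>g. (g, \<one>\<^sub>G))) \<phi> (par_product G R S S' V0 j hs) Q.c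
      (quot_psi MT.P.P V0 j hs \<circ> j)" unfolding par_product_eq by (rule Q.quot_model)
  qed
qed

text \<open>Representatives, globalization and enumeration vary at the same time. The composite
  isomorphism of the two globalizations matches the images of e1 \<otimes> e1' and e2 \<otimes> e2',
  hence their hulls by uniqueness, and it restricts to the fixed rings.\<close>

lemma par_product_cong:
  fixes G :: "'g monoid" and A :: "('k, 'a) module"
    and V1 :: "('k, 'v1, 'g \<times> 'g) partial_algebra" and V2 :: "('k, 'v2, 'g \<times> 'g) partial_algebra"
  assumes G: "comm_group G"
    and M1: "model G k A R T1 \<phi> S1 e1 \<iota>1" "model G k A R T1' \<phi> S1' e1' \<iota>1'"
    and M2: "model G k A R T2 \<phi> S2 e2 \<iota>2" "model G k A R T2' \<phi> S2' e2' \<iota>2'"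
    and iso: "partially_isomorphic G k R S1 S2" "partially_isomorphic G k R S1' S2'"
    and V: "globalization (G \<times>\<times> G) k (tensor G R S1 S1') V1 j1" "globalization (G \<times>\<times> G) k (tensor G R S2 S2') V2 j2"
    and hs: "enumerates (G \<times>\<times> G) hs1 (anti_diagonal G)" "enumerates (G \<times>\<times> G) hs2 (anti_diagonal G)"
  shows "partially_isomorphic G k R (par_product G R S1 S1' V1 j1 hs1) (par_product G R S2 S2' V2 j2 hs2)"
proof -
  let ?N = "anti_diagonal G" and ?\<Gamma> = "G \<times>\<times> G"
  let ?W1 = "tensor G A T1 T1'" and ?W2 = "tensor G A T2 T2'"
  interpret M1: model G k A R T1 \<phi> S1 e1 \<iota>1 by fact
  interpret M1': model G k A R T1' \<phi> S1' e1' \<iota>1' by fact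
  note gal = M1.T.galois_axioms M1'.T.galois_axioms model.axioms(1)[OF M2(1)] model.axioms(1)[OF M2(2)]
  obtain U1 :: "('k, 'v1, 'g \<times> 'g, 'a) extension" and F1 c1 \<kappa>1 where 1: "galois ?\<Gamma> k A U1" "ghom ?\<Gamma> A ?W1 U1 F1"
    "gact.hull U1 ?N (F1 (tensor_elem A T1 T1' (frag_of (e1, e1')))) c1"
    "model G k A R (fixed_ext ?N U1 (\<lambda>g. (g, \<one>\<^sub>G))) \<phi> (par_product G R S1 S1' V1 j1 hs1) c1 \<kappa>1"
    by (rule par_product_model[OF G M1 V(1) hs(1)])
  obtain U2 :: "('k, 'v2, 'g \<times> 'g, 'a) extension" and F2 c2 \<kappa>2 where 2: "galois ?\<Gamma> k A U2" "ghom ?\<Gamma> A ?W2 U2 F2"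
    "gact.hull U2 ?N (F2 (tensor_elem A T2 T2' (frag_of (e2, e2')))) c2"
    "model G k A R (fixed_ext ?N U2 (\<lambda>g. (g, \<one>\<^sub>G))) \<phi> (par_product G R S2 S2' V2 j2 hs2) c2 \<kappa>2"
    by (rule par_product_model[OF G M2 V(2) hs(2)])
  obtain f where f: "ghom G A T1 T2 f" "f e1 = e2" using ghom_of_partially_isomorphic[OF M1(1) M2(1) iso(1)] by blast
  obtain f' where f': "ghom G A T1' T2' f'" "f' e1' = e2'" using ghom_of_partially_isomorphic[OF M1(2) M2(2) iso(2)] by blast
  let ?x1 = "tensor_elem A T1 T1' (frag_of (e1, e1'))" and ?x2 = "tensor_elem A T2 T2' (frag_of (e2, e2'))"
  obtain F where F: "ghom ?\<Gamma> A ?W1 ?W2 F" "F ?x1 = ?x2"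
    using tensor_ghom[OF gal f(1) f'(1) M1.e_closed M1'.e_closed] f(2) f'(2) by auto
  have W: "galois ?\<Gamma> k A ?W1" "galois ?\<Gamma> k A ?W2"
    using gal by (auto intro!: galois_tensor.galois_P galois_tensor.intro)
  have F1i: "ghom ?\<Gamma> A U1 ?W1 (inv_into (carrier ?W1) F1)" by (rule ghom_inv[OF W(1) 1(1,2)])
  interpret T: galois_tensor G k A T1 T1' by (intro galois_tensor.intro gal)
  interpret F1: ghom_map ?\<Gamma> k A ?W1 U1 F1 by (intro ghom_map.intro W 1 ghom_map_axioms.intro)
  let ?H = "F2 \<circ> (F \<circ> inv_into (carrier ?W1) F1)"
  have H: "ghom ?\<Gamma> A U1 U2 ?H"
    by (rule ghom_comp[OF 1(1) W(2) 2(1) ghom_comp[OF 1(1) W F1i F(1)] 2(2)])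
  have x1: "?x1 \<in> carrier ?W1" by (rule T.pure_closed) auto
  have Hx: "?H (F1 ?x1) = F2 ?x2"
    using F1.F_bij x1 F(2) by (simp add: bij_betw_def inv_into_f_f)
  interpret H: ghom_map ?\<Gamma> k A U1 U2 ?H by (intro ghom_map.intro 1 2 ghom_map_axioms.intro H)
  have N: "?N \<subseteq> carrier ?\<Gamma>" using M1.T.G.group_axioms by (auto simp: anti_diagonal_def group.inv_closed)
  have "?H c1 = c2"
  proof (rule H.T'.hull_unique[OF N _ _ 2(3)])
    show "F2 ?x2 \<in> carrier U2" using H.F.hom_closed[OF F1.F.hom_closed[OF x1]] unfolding Hx .
    show "H.T'.hull ?N (F2 ?x2) (?H c1)" using H.F_hull[OF N F1.F.hom_closed[OF x1] 1(3)] unfolding Hx .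
  qed
  moreover have "ghom G A (fixed_ext ?N U1 (\<lambda>g. (g, \<one>\<^sub>G))) (fixed_ext ?N U2 (\<lambda>g. (g, \<one>\<^sub>G))) ?H"
    by (rule ghom_fixed_ext[OF 1(1) H N]) simp
  ultimately show ?thesis unfolding partially_isomorphic_iff[OF 1(4) 2(4)] by blast
qed

definition img_ext :: "('t \<Rightarrow> 'u) \<Rightarrow> ('k, 't, 'g, 'a) extension \<Rightarrow> ('k, 'u, 'g, 'a) extension" where
  "img_ext f T = (let p = inv_into (carrier T) f in
    \<lparr>carrier = f ` carrier T, monoid.mult = (\<lambda>x y. f (p x \<otimes>\<^sub>T p y)), one = f \<one>\<^sub>T, ring.zero = f \<zero>\<^sub>T,
     add = (\<lambda>x y. f (p x \<oplus>\<^sub>T p y)), smult = (\<lambda>c x. f (c \<odot>\<^sub>T p x)), pdom = (\<lambda>g. f ` carrier T),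
     pact = (\<lambda>g x. f (pact T g (p x))), emb = (\<lambda>a. f (emb T a))\<rparr>)"

lemma img_ext_galois:
  assumes T: "galois G k A T" and f: "inj_on f (carrier T)"
  shows "galois G k A (img_ext f T)" "ghom G A T (img_ext f T) f"
proof -
  interpret T: galois G k A T by fact
  let ?I = "img_ext f T" and ?p = "inv_into (carrier T) f"
  have p [simp]: "?p (f x) = x" if "x \<in> carrier T" for x using f that by (rule inv_into_f_f)
  have pc: "?p y \<in> carrier T" "f (?p y) = y" if "y \<in> carrier ?I" for y
    using that by (auto simp: img_ext_def Let_def)
  have I: "carrier ?I = f ` carrier T" "\<one>\<^sub>?I = f \<one>\<^sub>T" "\<zero>\<^sub>?I = f \<zero>\<^sub>T" "pdom ?I g = f ` carrier T"
    "x \<otimes>\<^sub>?I y = f (?p x \<otimes>\<^sub>T ?p y)" "x \<oplus>\<^sub>?I y = f (?p x \<oplus>\<^sub>T ?p y)" "c \<odot>\<^sub>?I x = f (c \<odot>\<^sub>T ?p x)"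
    "pact ?I g x = f (pact T g (?p x))" "emb ?I a = f (emb T a)" for g x y a c
    by (simp_all add: img_ext_def Let_def)
  have alg: "algebra k ?I"
  proof (rule algebra_inj[OF T.T.algebra_axioms, where \<iota> = ?p])
    show "inj_on ?p (carrier ?I)" unfolding I by (rule inj_on_inv_into) simp
    show "\<exists>y\<in>carrier ?I. ?p y = \<ominus>\<^sub>T ?p x" if "x \<in> carrier ?I" for x
      using pc[OF that] by (intro bexI[of _ "f (\<ominus>\<^sub>T ?p x)"]) (auto simp: I)
  qed (use pc in \<open>auto simp: I intro: T.T.smult_closed\<close>)
  have co: "coord G ?I (pact ?I) (\<lambda>g. f (F g))" if "coord G T (pact T) F" for F
    using that
  proof (induction rule: coord.induct)
    case (single x y F)
    show ?case by (rule coord.single[of "f x" _ "f y"]) (use single in \<open>simp_all add: I\<close>)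
  next
    case (add P Q F)
    note cl = T.coord_T_closed[OF add.hyps(1)] T.coord_T_closed[OF add.hyps(2)]
    show ?case by (rule coord.add[OF add.IH]) (use add.hyps(3) cl in \<open>simp add: I\<close>)
  qed
  have delta: "coord G ?I (pact ?I) (\<lambda>g. if g = \<one>\<^sub>G then \<one>\<^sub>?I else \<zero>\<^sub>?I)"
    by (rule coord_cong[OF co[OF T.delta]]) (simp add: I)
  have surj: "x \<in> emb ?I ` carrier A" if x: "x \<in> carrier ?I" "!!g. g \<in> carrier G ==> pact ?I g x = x" for x
  proof -
    have "pact T g (?p x) = ?p x" if "g \<in> carrier G" for g
    proof -
      have "?p (f (pact T g (?p x))) = ?p x" using x(2)[OF that] by (simp add: I)
      then show ?thesis using pc[OF x(1)] that by simp
    qed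
    from T.emb_surj[OF pc(1)[OF x(1)] this] obtain a where "a \<in> carrier A" "?p x = emb T a" by blast
    then show ?thesis using pc(2)[OF x(1)] by (auto simp: I intro!: image_eqI[of _ _ a])
  qed
  have inj: "inj_on (emb ?I) (carrier A)"
    using T.emb_inj inj_onD[OF f] by (auto simp: I inj_on_def)
  show "galois G k A ?I"
    by (rule galoisI[OF T.G.group_axioms alg T.fin _ _ _ _ _ _ T.A.algebra_axioms _ _ _ _ _ inj _ surj delta])
      (auto simp: I T.act_add T.act_mult T.act_comp T.emb_add T.emb_mult T.emb_smult)
  show "ghom G A T ?I f"
    unfolding ghom_def by (auto intro!: ring_hom_memI simp: I)
qed

section \<open>The semigroups of classes\<close>

text \<open>An element of the span is encoded by a chosen coefficient of the head and a chosen
  remainder; pairs fit into an infinite type because it is equipotent to its square.\<close>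

lemma lspan_embeds:
  fixes v :: "'t \<Rightarrow> 'u"
  assumes inf: "infinite (UNIV :: 'u set)" and v: "inj_on v J"
  shows "\<exists>f :: 't \<Rightarrow> 'u. inj_on f (lspan T J xs)"
proof (induction xs)
  case Nil
  then show ?case by simp
next
  case (Cons x xs)
  then obtain f :: "'t \<Rightarrow> 'u" where f: "inj_on f (lspan T J xs)" by blast
  obtain p :: "'u \<times> 'u \<Rightarrow> 'u" where p: "inj p"
    using card_of_Times_same_infinite[OF inf] by (auto simp: card_of_ordIso[symmetric] bij_betw_def)
  define h where "h z = (SOME w. fst w \<in> J \<and> snd w \<in> lspan T J xs \<and> z = fst w \<otimes>\<^sub>T x \<oplus>\<^sub>T snd w)" for z
  have h: "fst (h z) \<in> J" "snd (h z) \<in> lspan T J xs" "z = fst (h z) \<otimes>\<^sub>T x \<oplus>\<^sub>T snd (h z)"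
    if "z \<in> lspan T J (x # xs)" for z
  proof -
    have "\<exists>w. fst w \<in> J \<and> snd w \<in> lspan T J xs \<and> z = fst w \<otimes>\<^sub>T x \<oplus>\<^sub>T snd w" using that by auto
    from someI_ex[OF this] show "fst (h z) \<in> J" "snd (h z) \<in> lspan T J xs" "z = fst (h z) \<otimes>\<^sub>T x \<oplus>\<^sub>T snd (h z)"
      unfolding h_def by blast+
  qed
  have "inj_on (\<lambda>z. p (v (fst (h z)), f (snd (h z)))) (lspan T J (x # xs))"
  proof (rule inj_onI)
    fix z z' assume z: "z \<in> lspan T J (x # xs)" "z' \<in> lspan T J (x # xs)"
      "p (v (fst (h z)), f (snd (h z))) = p (v (fst (h z')), f (snd (h z')))"
    then have "v (fst (h z)) = v (fst (h z'))" "f (snd (h z)) = f (snd (h z'))" using p by (auto dest: injD)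
    then have "fst (h z) = fst (h z')" "snd (h z) = snd (h z')"
      using inj_onD[OF v] inj_onD[OF f] h(1,2)[OF z(1)] h(1,2)[OF z(2)] by blast+
    then show "z = z'" using h(3)[OF z(1)] h(3)[OF z(2)] by simp
  qed
  then show ?case by blast
qed

text \<open>Guarantees that the classes and products, which are unions over representatives in the
  fixed type, are not empty.\<close>

lemma galois_copy:
  fixes T :: "('k, 't, 'g, 'a) extension" and v :: "'a \<Rightarrow> 'u"
  assumes T: "galois G k A T" and inf: "infinite (UNIV :: 'u set)" and v: "inj_on v (carrier A)"
  obtains Z :: "('k, 'u, 'g, 'a) extension" and f where "galois G k A Z" "ghom G A T Z f"
proof -
  interpret T: galois G k A T by fact
  obtain xs where xs: "carrier T = lspan T (emb T ` carrier A) xs" using T.lspan_emb by blast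
  have "inj_on (v \<circ> inv_into (carrier A) (emb T)) (emb T ` carrier A)"
    by (intro comp_inj_on inj_on_inv_into inj_on_subset[OF v]) (auto intro: inv_into_into)
  from lspan_embeds[OF inf this] obtain f :: "'t \<Rightarrow> 'u" where "inj_on f (carrier T)" unfolding xs by blast
  from img_ext_galois[OF T this] show thesis by (rule that)
qed

text \<open>\<open>par_mult\<close> ranges over records without a structure map, so the field
  \<open>emb\<close> of a model has to be dropped.\<close>

lemma globalization_truncate:
  fixes T :: "('k, 't, 'g, 'a) extension" and G :: "'g monoid"
  assumes gl: "globalization G k S T \<iota>"
  obtains V :: "('k, 't, 'g) partial_algebra" where "globalization G k S V \<iota>"
proof -
  define V :: "('k, 't, 'g) partial_algebra" where "V = \<lparr>carrier = carrier T, monoid.mult = monoid.mult T,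
    one = \<one>\<^sub>T, ring.zero = \<zero>\<^sub>T, add = add T, smult = smult T, pdom = pdom T, pact = pact T\<rparr>"
  have sel: "carrier V = carrier T" "monoid.mult V = monoid.mult T" "\<one>\<^sub>V = \<one>\<^sub>T" "\<zero>\<^sub>V = \<zero>\<^sub>T"
    "add V = add T" "smult V = smult T" "pdom V = pdom T" "pact V = pact T" by (simp_all add: V_def)
  note glD = gl[unfolded globalization_def]
  interpret T: global_action G k T using glD by blast
  have alg: "algebra k V"
    by (rule algebra_inj[OF T.S.algebra_axioms, where \<iota> = "\<lambda>x. x"]) (auto simp: sel intro: T.S.smult_closed)
  interpret V: algebra k V by (rule alg)
  have ga: "global_action G k V"
  proof (intro global_action.intro partial_action.intro T.G.group_axioms alg partial_action_axioms.intro global_action_axioms.intro)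
    show "ideal (pdom V g) V" if "g \<in> carrier G" for g
      using V.oneideal T.global[OF that] by (simp add: sel)
    show "pact V g \<in> nonunital_alg_hom k V (pdom V (inv\<^bsub>G\<^esub> g)) V (pdom V g)" if "g \<in> carrier G" for g
      using T.pact_hom[OF that] unfolding nonunital_alg_hom_def sel .
  qed (use T.pact_bij T.pdom_one T.pact_one T.pact_image T.pact_mult T.global in \<open>simp_all add: sel\<close>)
  have id: "ideal (\<iota> ` carrier S) V"
  proof -
    interpret I: ideal "\<iota> ` carrier S" T using glD by blast
    have "subgroup (\<iota> ` carrier S) (add_monoid V)"
      using I.a_subgroup by (simp add: subgroup_def m_inv_def sel)
    then show ?thesis using I.I_l_closed I.I_r_closed
      by (intro idealI V.ring_axioms) (simp_all add: sel)
  qed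
  have fs: "finsum V f X = finsum T f X" for f :: "'g \<Rightarrow> 't" and X
    by (rule finsum_record_cong) (simp_all add: sel)
  have "globalization G k S V \<iota>" using glD ga id
    unfolding globalization_def nonunital_alg_hom_def sel fs by (elim conjE, intro conjI) assumption+
  then show thesis by (rule that)
qed

section \<open>Quotients by kernel congruences\<close>

lemma magma_group:
  assumes closed: "!!x y. x \<in> C ==> y \<in> C ==> m x y \<in> C"
    and assoc: "!!x y z. x \<in> C ==> y \<in> C ==> z \<in> C ==> m (m x y) z = m x (m y z)"
    and e: "e \<in> C" "!!x. x \<in> C ==> m e x = x" and inv: "!!x. x \<in> C ==> \<exists>y\<in>C. m y x = e"
  shows "group (magma C m)"
proof -
  let ?M = "\<lparr>carrier = C, monoid.mult = m, one = e\<rparr>"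
  interpret M: group ?M by (rule groupI) (use assms in auto)
  have "(THE e. e \<in> C \<and> (\<forall>x\<in>C. m e x = x \<and> m x e = x)) = e"
  proof (rule the_equality)
    show "e \<in> C \<and> (\<forall>x\<in>C. m e x = x \<and> m x e = x)" using M.r_one M.l_one e(1) by simp
    show "e' = e" if "e' \<in> C \<and> (\<forall>x\<in>C. m e' x = x \<and> m x e' = x)" for e' using that e by metis
  qed
  then show ?thesis using M.group_axioms by (simp add: magma_def)
qed

lemma magma_sel [simp]: "carrier (magma C m) = C" "monoid.mult (magma C m) = m"
  by (simp_all add: magma_def)

text \<open>Classes are equal iff their values under f are, so every law of the quotient is read off
  in H. A class that serves as identity is that of any preimage of the identity of H.\<close>

lemma quotient_magma_iso:
  fixes I :: "'x monoid" and H :: "'y monoid"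
  assumes H: "group H" and f: "f \<in> hom I H" and surj: "f ` carrier I = carrier H"
    and closed: "!!x y. x \<in> carrier I ==> y \<in> carrier I ==> x \<otimes>\<^sub>I y \<in> carrier I"
  defines "\<rho> \<equiv> ker_congruence I f"
  shows "group (quotient_magma I \<rho>)" and "induced_map f \<in> iso (quotient_magma I \<rho>) H"
    and "x \<in> carrier I ==> induced_map f (\<rho> `` {x}) = f x"
proof -
  interpret H: group H by fact
  have fm: "f (x \<otimes>\<^sub>I y) = f x \<otimes>\<^sub>H f y" if "x \<in> carrier I" "y \<in> carrier I" for x y using f that by (simp add: hom_def)
  have fc: "f x \<in> carrier H" if "x \<in> carrier I" for x using surj that by blast
  have cl: "\<rho> `` {x} = {y \<in> carrier I. f y = f x}" if "x \<in> carrier I" for x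
    using that by (auto simp: \<rho>_def ker_congruence_def)
  have eq: "\<rho> `` {x} = \<rho> `` {y} \<longleftrightarrow> f x = f y" if xy: "x \<in> carrier I" "y \<in> carrier I" for x y
    unfolding cl[OF xy(1)] cl[OF xy(2)] using xy by auto
  let ?C = "carrier I // \<rho>" and ?m = "\<lambda>X Y. \<Union>x\<in>X. \<Union>y\<in>Y. \<rho> `` {x \<otimes>\<^sub>I y}"
  have C: "X \<in> ?C \<longleftrightarrow> (\<exists>x\<in>carrier I. X = \<rho> `` {x})" for X by (auto simp: quotient_def)
  have m: "?m (\<rho> `` {x}) (\<rho> `` {y}) = \<rho> `` {x \<otimes>\<^sub>I y}" if xy: "x \<in> carrier I" "y \<in> carrier I" for x y
  proof -
    have "\<rho> `` {x' \<otimes>\<^sub>I y'} = \<rho> `` {x \<otimes>\<^sub>I y}" if "x' \<in> \<rho> `` {x}" "y' \<in> \<rho> `` {y}" for x' y'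
      by (rule iffD2[OF eq]) (use that xy in \<open>simp_all add: cl fm closed\<close>)
    moreover have "x \<in> \<rho> `` {x}" "y \<in> \<rho> `` {y}" using xy by (simp_all add: cl)
    ultimately show ?thesis by blast
  qed
  have pre: "\<exists>x\<in>carrier I. f x = h" if "h \<in> carrier H" for h using surj that by (metis imageE)
  obtain o' where o': "o' \<in> carrier I" "f o' = \<one>\<^sub>H" using pre by blast
  show gr: "group (quotient_magma I \<rho>)"
    unfolding quotient_magma_def
  proof (rule magma_group[where e = "\<rho> `` {o'}"])
    show "?m X Y \<in> ?C" if XY: "X \<in> ?C" "Y \<in> ?C" for X Y
    proof -
      obtain x y where "x \<in> carrier I" "y \<in> carrier I" "X = \<rho> `` {x}" "Y = \<rho> `` {y}" using XY C by meson
      then show ?thesis using m closed C by auto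
    qed
    show "?m (?m X Y) Z = ?m X (?m Y Z)" if XYZ: "X \<in> ?C" "Y \<in> ?C" "Z \<in> ?C" for X Y Z
    proof -
      obtain x y z where x: "x \<in> carrier I" "y \<in> carrier I" "z \<in> carrier I" "X = \<rho> `` {x}" "Y = \<rho> `` {y}" "Z = \<rho> `` {z}"
        using XYZ C by meson
      show ?thesis unfolding x(4-6) m[OF x(1,2)] m[OF x(2,3)] m[OF closed[OF x(1,2)] x(3)] m[OF x(1) closed[OF x(2,3)]]
        by (rule iffD2[OF eq]) (use x(1-3) in \<open>simp_all add: closed fm fc H.m_assoc\<close>)
    qed
    show "\<rho> `` {o'} \<in> ?C" using o' C by blast
    show "?m (\<rho> `` {o'}) X = X" if X: "X \<in> ?C" for X
    proof -
      obtain x where x: "x \<in> carrier I" "X = \<rho> `` {x}" using X C by meson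
      show ?thesis unfolding x(2) m[OF o'(1) x(1)] by (rule iffD2[OF eq]) (use x(1) o' in \<open>simp_all add: closed fm fc\<close>)
    qed
    show "\<exists>Y\<in>?C. ?m Y X = \<rho> `` {o'}" if X: "X \<in> ?C" for X
    proof -
      obtain x where x: "x \<in> carrier I" "X = \<rho> `` {x}" using X C by meson
      obtain y where y: "y \<in> carrier I" "f y = inv\<^bsub>H\<^esub> f x" using pre[of "inv\<^bsub>H\<^esub> f x"] fc[OF x(1)] by auto
      have "?m (\<rho> `` {y}) X = \<rho> `` {o'}"
        unfolding x(2) m[OF y(1) x(1)] by (rule iffD2[OF eq]) (use x(1) y o' in \<open>simp_all add: closed fm fc\<close>)
      then show ?thesis using y(1) C by blast
    qed
  qed
  show ind: "induced_map f (\<rho> `` {x}) = f x" if "x \<in> carrier I" for x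
  proof -
    have "f ` (\<rho> `` {x}) = {f x}" using that by (auto simp: cl)
    then show ?thesis by (simp add: induced_map_def)
  qed
  have "bij_betw (induced_map f) ?C (carrier H)"
    unfolding bij_betw_def
  proof
    show "inj_on (induced_map f) ?C"
    proof (rule inj_onI)
      fix X Y assume XY: "X \<in> ?C" "Y \<in> ?C" "induced_map f X = induced_map f Y"
      then obtain x y where x: "x \<in> carrier I" "y \<in> carrier I" "X = \<rho> `` {x}" "Y = \<rho> `` {y}" using C by meson
      then have "f x = f y" using XY(3) ind by simp
      then show "X = Y" using eq x by simp
    qed
    have "induced_map f ` ?C = f ` carrier I"
    proof (intro equalityI subsetI)
      fix h assume "h \<in> induced_map f ` ?C"
      then obtain X where X: "h = induced_map f X" "X \<in> ?C" by (rule imageE)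
      obtain x where "x \<in> carrier I" "X = \<rho> `` {x}" using X(2) C by meson
      then show "h \<in> f ` carrier I" using ind X(1) by simp
    next
      fix h assume "h \<in> f ` carrier I"
      then obtain x where x: "h = f x" "x \<in> carrier I" by (rule imageE)
      have "\<rho> `` {x} \<in> ?C" by (rule quotientI[OF x(2)])
      then show "h \<in> induced_map f ` ?C" by (rule image_eqI[rotated]) (simp add: ind x)
    qed
    then show "induced_map f ` ?C = carrier H" using surj by simp
  qed
  moreover have "induced_map f \<in> hom (quotient_magma I \<rho>) H"
  proof (rule homI)
    fix X assume "X \<in> carrier (quotient_magma I \<rho>)"
    then obtain x where "x \<in> carrier I" "X = \<rho> `` {x}" using C unfolding quotient_magma_def magma_sel by meson
    then show "induced_map f X \<in> carrier H" by (simp add: ind fc)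
  next
    fix X Y assume "X \<in> carrier (quotient_magma I \<rho>)" "Y \<in> carrier (quotient_magma I \<rho>)"
    then obtain x y where x: "x \<in> carrier I" "y \<in> carrier I" "X = \<rho> `` {x}" "Y = \<rho> `` {y}"
      using C unfolding quotient_magma_def magma_sel by meson
    have "X \<otimes>\<^bsub>quotient_magma I \<rho>\<^esub> Y = \<rho> `` {x \<otimes>\<^sub>I y}"
      unfolding quotient_magma_def magma_sel x(3,4) by (rule m[OF x(1,2)])
    then show "induced_map f (X \<otimes>\<^bsub>quotient_magma I \<rho>\<^esub> Y) = induced_map f X \<otimes>\<^sub>H induced_map f Y"
      using x by (simp add: ind closed fm)
  qed
  ultimately show "induced_map f \<in> iso (quotient_magma I \<rho>) H"
    by (simp add: iso_def quotient_magma_def)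
qed

section \<open>Classes of extensions and their products\<close>

text \<open>The map u places a copy of \<open>R\<close>, and through \<phi> one of \<open>A\<close>,
  inside the universe; by finite generation all Galois extensions of \<open>A\<close> then have
  copies there.\<close>

locale classes = G: comm_group G + A: algebra k A + R: algebra k R
  for G :: "'g monoid" and k :: "'k ring" and A :: "('k, 'a) module" and R :: "('k, 'r) module" +
  fixes \<phi> :: "'a \<Rightarrow> 'r" and u :: "'r \<Rightarrow> 'u"
  assumes fin: "finite (carrier G)" and phi: "\<phi> \<in> alg_iso k A R"
    and inf: "infinite (UNIV :: 'u set)" and u: "inj_on u (carrier R)"
begin

abbreviation glob_cl :: "('k, 't, 'g, 'a) extension \<Rightarrow> ('k, 'u, 'g, 'a) extension set" where
  "glob_cl B \<equiv> glob_class G k A B"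

abbreviation par_cl :: "('k, 's, 'g, 'r) extension \<Rightarrow> ('k, 'u, 'g, 'r) extension set" where
  "par_cl S \<equiv> par_class G k R S"

lemma copy_inj: "inj_on (u \<circ> \<phi>) (carrier A)"
  using phi u by (auto simp: alg_iso_def ring_iso_def bij_betw_def intro!: comp_inj_on)

lemma copy:
  fixes T :: "('k, 't, 'h, 'a) extension"
  assumes "galois \<Gamma> k A T"
  obtains Z :: "('k, 'u, 'h, 'a) extension" and f where "galois \<Gamma> k A Z" "ghom \<Gamma> A T Z f"
  by (rule galois_copy[OF assms inf copy_inj])

lemma glob_iso:
  assumes "galois G k A T" "galois G k A T'"
  shows "partially_isomorphic G k A T T' \<longleftrightarrow> (\<exists>F. ghom G A T T' F)"
  unfolding partially_isomorphic_iff[OF galois_model_self[OF assms(1)] galois_model_self[OF assms(2)]]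
  by (auto simp: ghom_def ring_hom_one)

lemma glob_cl_iff:
  "galois G k A B ==> Z \<in> glob_cl B \<longleftrightarrow> galois G k A Z \<and> (\<exists>F. ghom G A B Z F)"
  unfolding glob_class_def using glob_iso[of B Z] by (auto simp: galois_iff_global_extension[symmetric])

lemma glob_cl_eq:
  assumes B: "galois G k A B" "galois G k A B'" and f: "ghom G A B B' f"
  shows "glob_cl B = glob_cl B'"
proof (intro equalityI subsetI)
  fix Z assume "Z \<in> glob_cl B"
  then obtain h where Z: "galois G k A Z" "ghom G A B Z h" using glob_cl_iff[OF B(1)] by blast
  have "ghom G A B' Z (h \<circ> inv_into (carrier B) f)"
    by (rule ghom_comp[OF B(2,1) Z(1) ghom_inv[OF B f] Z(2)])
  then show "Z \<in> glob_cl B'" using Z(1) glob_cl_iff[OF B(2)] by blast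
next
  fix Z assume "Z \<in> glob_cl B'"
  then obtain h where Z: "galois G k A Z" "ghom G A B' Z h" using glob_cl_iff[OF B(2)] by blast
  have "ghom G A B Z (h \<circ> f)" by (rule ghom_comp[OF B Z(1) f Z(2)])
  then show "Z \<in> glob_cl B" using Z(1) glob_cl_iff[OF B(1)] by blast
qed

lemma glob_cl_copy:
  assumes "galois G k A B"
  obtains Z :: "('k, 'u, 'g, 'a) extension" where "galois G k A Z" "glob_cl B = glob_cl Z" "Z \<in> glob_cl B"
proof -
  obtain Z :: "('k, 'u, 'g, 'a) extension" and f where Z: "galois G k A Z" "ghom G A B Z f" by (rule copy[OF assms])
  have "Z \<in> glob_cl B" using Z glob_cl_iff[OF assms] by blast
  with Z(1) glob_cl_eq[OF assms Z] show thesis by (rule that)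
qed

text \<open>By \<open>hp_cong\<close> all members of the union are the same class. The factors may
  live in other types than the universe; their classes are nonempty thanks to
  \<open>glob_cl_copy\<close>.\<close>

lemma harrison_mult_cl:
  assumes B: "galois G k A B" "galois G k A B'"
  shows "harrison_mult G k A (glob_cl B) (glob_cl B') = glob_cl (harrison_product G A B B')"
proof -
  have hp: "galois G k A (harrison_product G A X X')" if "galois G k A X" "galois G k A X'"
    for X :: "('k, 'x, 'g, 'a) extension" and X' :: "('k, 'y, 'g, 'a) extension"
    by (intro harrison.galois_hp harrison.intro galois_tensor.intro that G.comm_group_axioms)
  have eq: "glob_cl (harrison_product G A Z Z') = glob_cl (harrison_product G A B B')"
    if Z: "Z \<in> glob_cl B" "Z' \<in> glob_cl B'" for Z Z'
  proof -
    obtain f f' where f: "galois G k A Z" "ghom G A B Z f" "galois G k A Z'" "ghom G A B' Z' f'"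
      using iffD1[OF glob_cl_iff[OF B(1)] Z(1)] iffD1[OF glob_cl_iff[OF B(2)] Z(2)] by blast
    obtain h where "ghom G A (harrison_product G A B B') (harrison_product G A Z Z') h"
      using hp_cong[OF G.comm_group_axioms B f(1,3,2,4)] by (rule exE)
    from glob_cl_eq[OF hp[OF B] hp[OF f(1,3)] this] show ?thesis by simp
  qed
  obtain Z where Z: "Z \<in> glob_cl B" by (rule glob_cl_copy[OF B(1)])
  obtain Z' where Z': "Z' \<in> glob_cl B'" by (rule glob_cl_copy[OF B(2)])
  have ne: "glob_cl B \<noteq> {}" "glob_cl B' \<noteq> {}" using Z Z' by blast+
  have "harrison_mult G k A (glob_cl B) (glob_cl B') =
    (\<Union>Z\<in>glob_cl B. \<Union>Z'\<in>glob_cl B'. glob_cl (harrison_product G A B B'))"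
    unfolding harrison_mult_def by (intro SUP_cong refl) (rule eq)
  also have "\<dots> = glob_cl (harrison_product G A B B')" using ne by simp
  finally show ?thesis .
qed

lemma hp_galois: "galois G k A B ==> galois G k A B' ==> galois G k A (harrison_product G A B B')"
  by (intro harrison.galois_hp harrison.intro galois_tensor.intro G.comm_group_axioms)

abbreviation HC :: "('k, 'u, 'g, 'a) extension set set" where
  "HC \<equiv> {glob_class G k A B |B :: ('k, 'u, 'g, 'a) extension. global_extension G k A B}"

lemma HC_iff: "X \<in> HC \<longleftrightarrow> (\<exists>B :: ('k, 'u, 'g, 'a) extension. galois G k A B \<and> X = glob_cl B)"
  by (auto simp: galois_iff_global_extension)

lemma glob_cl_HC: "galois G k A B ==> glob_cl B \<in> HC"
  unfolding HC_iff by (metis glob_cl_copy)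

lemma harrison_group: "group (Harrison G k A :: ('k, 'u, 'g, 'a) extension set monoid)"
  unfolding Harrison_def
proof (rule magma_group)
  note cg = G.comm_group_axioms
  have E: "galois G k A (triv_ext G A)" by (rule triv_ext_galois[OF cg fin A.algebra_axioms])
  show "harrison_mult G k A X Y \<in> HC" if XY: "X \<in> HC" "Y \<in> HC" for X Y
  proof -
    obtain B B' :: "('k, 'u, 'g, 'a) extension" where
      B: "galois G k A B" "X = glob_cl B" "galois G k A B'" "Y = glob_cl B'" using XY unfolding HC_iff by blast
    show ?thesis unfolding B(2,4) harrison_mult_cl[OF B(1,3)] by (intro glob_cl_HC hp_galois B)
  qed
  show "harrison_mult G k A (harrison_mult G k A X Y) Z = harrison_mult G k A X (harrison_mult G k A Y Z)"
    if XYZ: "X \<in> HC" "Y \<in> HC" "Z \<in> HC" for X Y Z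
  proof -
    obtain B B' B'' :: "('k, 'u, 'g, 'a) extension" where
      B: "galois G k A B" "galois G k A B'" "galois G k A B''" and eq: "X = glob_cl B" "Y = glob_cl B'" "Z = glob_cl B''"
      using XYZ unfolding HC_iff by blast
    obtain h where h: "ghom G A (harrison_product G A (harrison_product G A B B') B'')
      (harrison_product G A B (harrison_product G A B' B'')) h" using hp_assoc[OF cg B] by blast
    show ?thesis
      unfolding eq harrison_mult_cl[OF B(1,2)] harrison_mult_cl[OF B(2,3)]
        harrison_mult_cl[OF hp_galois[OF B(1,2)] B(3)] harrison_mult_cl[OF B(1) hp_galois[OF B(2,3)]]
      by (intro glob_cl_eq[OF _ _ h] hp_galois B)
  qed
  show "glob_cl (triv_ext G A) \<in> HC" by (rule glob_cl_HC[OF E])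
  show "harrison_mult G k A (glob_cl (triv_ext G A)) X = X" if X: "X \<in> HC" for X
  proof -
    obtain B :: "('k, 'u, 'g, 'a) extension" where B: "galois G k A B" "X = glob_cl B" using X unfolding HC_iff by blast
    obtain h where h: "ghom G A B (harrison_product G A (triv_ext G A) B) h" using hp_one[OF cg B(1)] by blast
    show ?thesis unfolding B(2) harrison_mult_cl[OF E B(1)]
      by (rule glob_cl_eq[OF B(1) hp_galois[OF E B(1)] h, symmetric])
  qed
  show "\<exists>Y\<in>HC. harrison_mult G k A Y X = glob_cl (triv_ext G A)" if X: "X \<in> HC" for X
  proof -
    obtain B :: "('k, 'u, 'g, 'a) extension" where B: "galois G k A B" "X = glob_cl B" using X unfolding HC_iff by blast
    have O: "galois G k A (opp_ext G B)" by (rule opp_ext_galois[OF cg B(1)])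
    obtain h where h: "ghom G A (triv_ext G A) (harrison_product G A (opp_ext G B) B) h"
      using hp_inverse[OF cg B(1)] by blast
    have "harrison_mult G k A (glob_cl (opp_ext G B)) X = glob_cl (triv_ext G A)"
      unfolding B(2) harrison_mult_cl[OF O B(1)]
      by (rule glob_cl_eq[OF E hp_galois[OF O B(1)] h, symmetric])
    then show ?thesis using glob_cl_HC[OF O] by blast
  qed
qed

text \<open>Symmetry is not visible in the definition, where domains are only mapped into domains.
  It holds because the extension to the globalizations is invertible and matches the
  idempotents.\<close>

lemma par_iso_sym_trans:
  fixes S :: "('k, 's, 'g, 'r) extension" and S' :: "('k, 's1, 'g, 'r) extension" and S'' :: "('k, 's2, 'g, 'r) extension"
  assumes S: "partial_extension G k R S" "partial_extension G k R S'" and iso: "partially_isomorphic G k R S S'"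
  shows "partially_isomorphic G k R S' S"
    and "partial_extension G k R S'' ==> partially_isomorphic G k R S' S'' ==> partially_isomorphic G k R S S''"
proof -
  obtain T :: "('k, 'g \<Rightarrow> 's, 'g, 'a) extension" and e \<iota> where M: "model G k A R T \<phi> S e \<iota>" by (rule model_exists[OF S(1) A.algebra_axioms phi])
  obtain T' :: "('k, 'g \<Rightarrow> 's1, 'g, 'a) extension" and e' \<iota>' where M': "model G k A R T' \<phi> S' e' \<iota>'" by (rule model_exists[OF S(2) A.algebra_axioms phi])
  obtain F where F: "ghom G A T T' F" "F e = e'" using ghom_of_partially_isomorphic[OF M M' iso] by blast
  note gal = model.axioms(1)[OF M] model.axioms(1)[OF M']
  have "inv_into (carrier T) F e' = e"
    using ghom_bij[OF gal F(1)] model.e_closed[OF M] F(2) by (auto simp: bij_betw_def inv_into_f_f)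
  then show "partially_isomorphic G k R S' S"
    by (rule partially_isomorphic_of_ghom[OF M' M ghom_inv[OF gal F(1)]])
  assume S'': "partial_extension G k R S''" and iso': "partially_isomorphic G k R S' S''"
  obtain T'' :: "('k, 'g \<Rightarrow> 's2, 'g, 'a) extension" and e'' \<iota>'' where M'': "model G k A R T'' \<phi> S'' e'' \<iota>''" by (rule model_exists[OF S'' A.algebra_axioms phi])
  obtain F' where F': "ghom G A T' T'' F'" "F' e' = e''" using ghom_of_partially_isomorphic[OF M' M'' iso'] by blast
  show "partially_isomorphic G k R S S''"
    by (rule partially_isomorphic_of_ghom[OF M M'' ghom_comp[OF gal model.axioms(1)[OF M''] F(1) F'(1)]]) (simp add: F F')
qed

lemma par_cl_eq:
  assumes S: "partial_extension G k R S" "partial_extension G k R S'" and iso: "partially_isomorphic G k R S S'"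
  shows "par_cl S = par_cl S'"
  using par_iso_sym_trans(2)[OF S iso] par_iso_sym_trans(2)[OF S(2,1) par_iso_sym_trans(1)[OF S iso]]
  by (auto simp: par_class_def)

lemma par_iso_refl:
  fixes S :: "('k, 's, 'g, 'r) extension"
  assumes S: "partial_extension G k R S"
  shows "partially_isomorphic G k R S S"
proof -
  obtain T :: "('k, 'g \<Rightarrow> 's, 'g, 'a) extension" and e \<iota> where M: "model G k A R T \<phi> S e \<iota>" by (rule model_exists[OF S A.algebra_axioms phi])
  show ?thesis by (rule partially_isomorphic_of_ghom[OF M M ghom_id]) simp
qed

text \<open>The globalization is copied into the universe, and the copy of S is cut out of it by the
  image of e.\<close>

lemma par_copy:
  assumes M: "model G k A R T \<phi> S e \<iota>"
  obtains Z :: "('k, 'u, 'g, 'r) extension" and U :: "('k, 'u, 'g, 'a) extension" and F \<kappa> where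
    "model G k A R U \<phi> Z (F e) \<kappa>" "ghom G A T U F" "Z \<in> par_cl S" "par_cl S = par_cl Z"
proof -
  note T = model.axioms(1)[OF M]
  obtain U :: "('k, 'u, 'g, 'a) extension" and F where U: "galois G k A U" "ghom G A T U F" by (rule copy[OF T])
  interpret F: ghom_map G k A T U F by (intro ghom_map.intro T U ghom_map_axioms.intro)
  have Z: "model G k A R U \<phi> (res_ext A \<phi> U (F e)) (F e) (\<lambda>t. t)"
    by (rule res_ext_model[OF U(1) R.algebra_axioms phi F.F_full[OF model.full[OF M]]])
  have iso: "partially_isomorphic G k R S (res_ext A \<phi> U (F e))"
    by (rule partially_isomorphic_of_ghom[OF M Z U(2) refl])
  note pe = model.partial_extension_S[OF M] model.partial_extension_S[OF Z]
  show thesis by (rule that[OF Z U(2) _ par_cl_eq[OF pe iso]]) (use pe iso in \<open>simp add: par_class_def\<close>)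
qed

text \<open>Any globalization of any representative receives an equivariant map from T by extension
  of a partial isomorphism, so the union consists of one class; \<open>par_copy\<close> shows that
  it is not empty.\<close>

lemma globalization_map_cl:
  assumes M: "model G k A R T \<phi> S e \<iota>"
  shows "globalization_map G k A \<phi> (par_cl S) = glob_cl T"
proof -
  note S = model.partial_extension_S[OF M]
  have eq: "glob_cl T' = glob_cl T" if Z: "Z \<in> par_cl S" "extension_globalization G k A \<phi> Z T' \<kappa>"
    for Z and T' :: "('k, 'u, 'g, 'a) extension" and \<kappa>
  proof -
    have Z': "partial_extension G k R Z" "partially_isomorphic G k R S Z" using Z(1) by (auto simp: par_class_def)
    have M': "model G k A R T' \<phi> Z (\<kappa> \<one>\<^sub>Z) \<kappa>"
      by (rule extension_globalization_model[OF Z'(1) A.algebra_axioms phi Z(2)])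
    obtain F where "ghom G A T T' F" using ghom_of_partially_isomorphic[OF M M' Z'(2)] by blast
    from glob_cl_eq[OF model.axioms(1)[OF M] model.axioms(1)[OF M'] this] show ?thesis by simp
  qed
  obtain Z :: "('k, 'u, 'g, 'r) extension" and U :: "('k, 'u, 'g, 'a) extension" and F \<kappa> where
    Z: "model G k A R U \<phi> Z (F e) \<kappa>" "ghom G A T U F" "Z \<in> par_cl S" "par_cl S = par_cl Z"
    by (rule par_copy[OF M])
  have U: "extension_globalization G k A \<phi> Z U \<kappa>" by (rule model.extension_globalization[OF Z(1)])
  show ?thesis
  proof (intro equalityI subsetI)
    fix X assume "X \<in> globalization_map G k A \<phi> (par_cl S)"
    then obtain Z' and T' :: "('k, 'u, 'g, 'a) extension" and \<kappa>' where "Z' \<in> par_cl S" "extension_globalization G k A \<phi> Z' T' \<kappa>'" "X \<in> glob_cl T'"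
      unfolding globalization_map_def by blast
    then show "X \<in> glob_cl T" using eq[of Z' T' \<kappa>'] by simp
  next
    fix X assume "X \<in> glob_cl T"
    then have "X \<in> glob_cl U" using eq[OF Z(3) U] by simp
    then show "X \<in> globalization_map G k A \<phi> (par_cl S)"
      unfolding globalization_map_def using Z(3) U by blast
  qed
qed

lemma enumeration_exists: obtains hs where "enumerates (G \<times>\<times> G) hs (anti_diagonal G)"
proof -
  have "finite (anti_diagonal G - {\<one>\<^bsub>G \<times>\<times> G\<^esub>})" using fin by (simp add: anti_diagonal_def)
  then obtain xs where xs: "set xs = anti_diagonal G - {\<one>\<^bsub>G \<times>\<times> G\<^esub>}" "distinct xs"
    using finite_distinct_list by blast
  have "(\<one>\<^sub>G, inv\<^bsub>G\<^esub> \<one>\<^sub>G) \<in> anti_diagonal G" unfolding anti_diagonal_def by blast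
  then have "\<one>\<^bsub>G \<times>\<times> G\<^esub> \<in> anti_diagonal G" by simp
  then have "enumerates (G \<times>\<times> G) (\<one>\<^bsub>G \<times>\<times> G\<^esub> # xs) (anti_diagonal G)"
    using xs by (auto simp: enumerates_def)
  then show thesis by (rule that)
qed

text \<open>T \<otimes> T' globalizes the tensor product but lives in another type than
  \<open>par_mult\<close> demands, so it is copied and its structure map is removed.\<close>

lemma tensor_globalization_exists:
  assumes M: "model G k A R T \<phi> S e \<iota>" "model G k A R T' \<phi> S' e' \<iota>'"
  obtains V :: "('k, 'u, 'g \<times> 'g) partial_algebra" and j where "globalization (G \<times>\<times> G) k (tensor G R S S') V j"
proof -
  interpret MT: model_tensor G k A R T \<phi> S e \<iota> T' S' e' \<iota>' by (rule model_tensor.intro[OF M])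
  obtain U :: "('k, 'u, 'g \<times> 'g, 'a) extension" and F where U: "galois (G \<times>\<times> G) k A U" "ghom (G \<times>\<times> G) A MT.W.P U F"
    by (rule copy[OF MT.W.galois_P])
  have MU: "model (G \<times>\<times> G) k A R U \<phi> MT.P.P (F MT.\<epsilon>) (F \<circ> MT.j)"
    by (rule ghom_map.F_model[OF ghom_map.intro[OF MT.W.galois_P U(1) ghom_map_axioms.intro[OF U(2)]] MT.tensor_model])
  have "globalization (G \<times>\<times> G) k MT.P.P U (F \<circ> MT.j)"
    using model.extension_globalization[OF MU] by (simp add: extension_globalization_def)
  then show thesis by (rule globalization_truncate) (rule that)
qed

text \<open>The partial product is globalized by the fixed ring of a copy of T \<otimes> T' under
  the anti-diagonal, which is the Harrison product of T and T' up to isomorphism. Multiplicativity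
  of \<pi> is contained in this.\<close>

lemma par_mult_cl:
  fixes S S' :: "('k, 'u, 'g, 'r) extension"
  assumes S: "partial_extension G k R S" "partial_extension G k R S'"
  obtains Z :: "('k, 'u, 'g, 'r) extension" where "partial_extension G k R Z"
    "par_mult G k R (par_cl S) (par_cl S') = par_cl Z"
    "globalization_map G k A \<phi> (par_cl Z) =
      harrison_mult G k A (globalization_map G k A \<phi> (par_cl S)) (globalization_map G k A \<phi> (par_cl S'))"
proof -
  let ?N = "anti_diagonal G"
  note cg = G.comm_group_axioms
  obtain T :: "('k, 'g \<Rightarrow> 'u, 'g, 'a) extension" and e \<iota> where M: "model G k A R T \<phi> S e \<iota>"
    by (rule model_exists[OF S(1) A.algebra_axioms phi])
  obtain T' :: "('k, 'g \<Rightarrow> 'u, 'g, 'a) extension" and e' \<iota>' where M': "model G k A R T' \<phi> S' e' \<iota>'"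
    by (rule model_exists[OF S(2) A.algebra_axioms phi])
  note gal = model.axioms(1)[OF M] model.axioms(1)[OF M']
  interpret H: harrison G k A T T' by (intro harrison.intro galois_tensor.intro gal cg)
  obtain V :: "('k, 'u, 'g \<times> 'g) partial_algebra" and j where V: "globalization (G \<times>\<times> G) k (tensor G R S S') V j"
    by (rule tensor_globalization_exists[OF M M'])
  obtain hs where hs: "enumerates (G \<times>\<times> G) hs ?N" by (rule enumeration_exists)
  let ?P = "par_product G R S S' V j hs"
  obtain U :: "('k, 'u, 'g \<times> 'g, 'a) extension" and F c \<kappa> where
    U: "galois (G \<times>\<times> G) k A U" "ghom (G \<times>\<times> G) A H.P U F" and
    P: "model G k A R (fixed_ext ?N U (\<lambda>g. (g, \<one>\<^sub>G))) \<phi> ?P c \<kappa>"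
    by (rule par_product_model[OF cg M M' V hs])
  note pP = model.partial_extension_S[OF P]
  have eq: "par_cl (par_product G R Z Z' V' j' hs') = par_cl ?P"
    if Z: "Z \<in> par_cl S" "Z' \<in> par_cl S'" and V': "globalization (G \<times>\<times> G) k (tensor G R Z Z') V' j'"
      "enumerates (G \<times>\<times> G) hs' ?N"
    for Z Z' and V' :: "('k, 'u, 'g \<times> 'g) partial_algebra" and j' hs'
  proof -
    have Zp: "partial_extension G k R Z" "partial_extension G k R Z'"
      and iso: "partially_isomorphic G k R S Z" "partially_isomorphic G k R S' Z'"
      using Z by (auto simp: par_class_def)
    obtain Y :: "('k, 'g \<Rightarrow> 'u, 'g, 'a) extension" and y \<eta> where Y: "model G k A R Y \<phi> Z y \<eta>"
      by (rule model_exists[OF Zp(1) A.algebra_axioms phi])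
    obtain Y' :: "('k, 'g \<Rightarrow> 'u, 'g, 'a) extension" and y' \<eta>' where Y': "model G k A R Y' \<phi> Z' y' \<eta>'"
      by (rule model_exists[OF Zp(2) A.algebra_axioms phi])
    obtain U' :: "('k, 'u, 'g \<times> 'g, 'a) extension" and F' c' \<kappa>' where
      P': "model G k A R (fixed_ext ?N U' (\<lambda>g. (g, \<one>\<^sub>G))) \<phi> (par_product G R Z Z' V' j' hs') c' \<kappa>'"
      by (rule par_product_model[OF cg Y Y' V'])
    show ?thesis
      by (rule par_cl_eq[OF pP model.partial_extension_S[OF P']
        par_product_cong[OF cg M M' Y Y' iso V V'(1) hs V'(2)], symmetric])
  qed
  have mult: "par_mult G k R (par_cl S) (par_cl S') = par_cl ?P"
  proof (intro equalityI subsetI)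
    fix X assume "X \<in> par_mult G k R (par_cl S) (par_cl S')"
    then obtain Z Z' V' j' hs' where "Z \<in> par_cl S" "Z' \<in> par_cl S'"
      "globalization (G \<times>\<times> G) k (tensor G R Z Z') (V' :: ('k, 'u, 'g \<times> 'g) partial_algebra) j'"
      "enumerates (G \<times>\<times> G) hs' ?N" "X \<in> par_cl (par_product G R Z Z' V' j' hs')"
      unfolding par_mult_def by blast
    then show "X \<in> par_cl ?P" using eq by simp
  next
    fix X assume X: "X \<in> par_cl ?P"
    have "S \<in> par_cl S" "S' \<in> par_cl S'" using S par_iso_refl by (auto simp: par_class_def)
    then show "X \<in> par_mult G k R (par_cl S) (par_cl S')" unfolding par_mult_def using V hs X by blast
  qed
  obtain Z :: "('k, 'u, 'g, 'r) extension" and Y :: "('k, 'u, 'g, 'a) extension" and f \<eta> where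
    Z: "model G k A R Y \<phi> Z (f c) \<eta>" "ghom G A (fixed_ext ?N U (\<lambda>g. (g, \<one>\<^sub>G))) Y f" "par_cl ?P = par_cl Z"
    by (rule par_copy[OF P])
  have "ghom G A (fixed_ext ?N H.P (\<lambda>g. (g, \<one>\<^sub>G))) (fixed_ext ?N U (\<lambda>g. (g, \<one>\<^sub>G))) F"
    by (rule ghom_fixed_ext[OF H.galois_P U(2)]) (auto simp: anti_diagonal_def)
  then have "glob_cl (harrison_product G A T T') = glob_cl (fixed_ext ?N U (\<lambda>g. (g, \<one>\<^sub>G)))"
    by (intro glob_cl_eq H.galois_hp model.axioms(1)[OF P]) (simp add: H.harrison_product_eq)
  then have "globalization_map G k A \<phi> (par_cl Z) =
      harrison_mult G k A (globalization_map G k A \<phi> (par_cl S)) (globalization_map G k A \<phi> (par_cl S'))"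
    unfolding Z(3)[symmetric] globalization_map_cl[OF M] globalization_map_cl[OF M'] globalization_map_cl[OF P]
      harrison_mult_cl[OF gal] by simp
  moreover have "par_mult G k R (par_cl S) (par_cl S') = par_cl Z" using mult Z(3) by simp
  ultimately show thesis using model.partial_extension_S[OF Z(1)] by (intro that)
qed

end

theorem theorem5p3:
  fixes k :: "'k ring" and G :: "'g monoid"
    and R :: "('k, 'r) module" and A :: "('k, 'a) module" and \<phi> :: "'a \<Rightarrow> 'r"
    and \<T> :: "('k, 'u, 'g, 'r) extension set monoid"
    and \<H> :: "('k, 'u, 'g, 'a) extension set monoid"
    and \<pi> :: "('k, 'u, 'g, 'r) extension set \<Rightarrow> ('k, 'u, 'g, 'a) extension set"
    and \<rho> :: "('k, 'u, 'g, 'r) extension set rel"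
    and u :: "'r \<Rightarrow> 'u"
  assumes "comm_group G" and "finite (carrier G)"
    and "algebra k R" and "algebra k A" and "\<phi> \<in> alg_iso k A R"
    and universe: "infinite (UNIV :: 'u set)" "inj_on u (carrier R)"
    and "\<T> = T_par G k R" and "\<H> = Harrison G k A"
    and "\<pi> = globalization_map G k A \<phi>" and "\<rho> = ker_congruence \<T> \<pi>"
  shows "\<pi> \<in> hom \<T> \<H> \<and>
    group (quotient_magma \<T> \<rho>) \<and> group \<H> \<and>
    induced_map \<pi> \<in> iso (quotient_magma \<T> \<rho>) \<H> \<and>
    (\<forall>(S :: ('k, 'u, 'g, 'r) extension) (T :: ('k, 'u, 'g, 'a) extension) \<iota>.
      partial_extension G k R S \<and> extension_globalization G k A \<phi> S T \<iota> \<longrightarrow>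
      induced_map \<pi> (\<rho> `` {par_class G k R S}) = glob_class G k A T)"
proof -
  interpret classes G k A R \<phi> u
    by (intro classes.intro classes_axioms.intro assms)
  have T: "carrier \<T> = {par_cl S |S :: ('k, 'u, 'g, 'r) extension. partial_extension G k R S}"
    "monoid.mult \<T> = par_mult G k R" and H: "carrier \<H> = HC" "monoid.mult \<H> = harrison_mult G k A"
    using assms by (simp_all add: T_par_def Harrison_def)
  have pi_mem: "\<pi> (par_cl S) \<in> HC" if S: "partial_extension G k R S" for S :: "('k, 'u, 'g, 'r) extension"
  proof -
    obtain T :: "('k, 'g \<Rightarrow> 'u, 'g, 'a) extension" and e \<iota> where M: "model G k A R T \<phi> S e \<iota>"
      by (rule model_exists[OF S A.algebra_axioms phi])
    show ?thesis unfolding assms globalization_map_cl[OF M] by (rule glob_cl_HC[OF model.axioms(1)[OF M]])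
  qed
  have mult: "par_mult G k R X Y \<in> carrier \<T> \<and> \<pi> (par_mult G k R X Y) = harrison_mult G k A (\<pi> X) (\<pi> Y)"
    if XY: "X \<in> carrier \<T>" "Y \<in> carrier \<T>" for X Y
  proof -
    obtain S S' :: "('k, 'u, 'g, 'r) extension" where
      S: "partial_extension G k R S" "partial_extension G k R S'" and eq: "X = par_cl S" "Y = par_cl S'"
      using XY unfolding T by blast
    obtain Z :: "('k, 'u, 'g, 'r) extension" where Z: "partial_extension G k R Z"
      "par_mult G k R (par_cl S) (par_cl S') = par_cl Z"
      "globalization_map G k A \<phi> (par_cl Z) =
        harrison_mult G k A (globalization_map G k A \<phi> (par_cl S)) (globalization_map G k A \<phi> (par_cl S'))"
      by (rule par_mult_cl[OF S])
    show ?thesis unfolding eq Z(2) T using Z(1,3) assms(10) by auto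
  qed
  have hom: "\<pi> \<in> hom \<T> \<H>"
  proof (rule homI)
    show "\<pi> X \<in> carrier \<H>" if "X \<in> carrier \<T>" for X using that pi_mem unfolding T H by blast
    show "\<pi> (X \<otimes>\<^bsub>\<T>\<^esub> Y) = \<pi> X \<otimes>\<^bsub>\<H>\<^esub> \<pi> Y" if "X \<in> carrier \<T>" "Y \<in> carrier \<T>" for X Y
      using mult[OF that] unfolding T(2) H(2) by blast
  qed
  have surj: "\<pi> ` carrier \<T> = carrier \<H>"
  proof
    show "\<pi> ` carrier \<T> \<subseteq> carrier \<H>" using hom by (auto simp: hom_def)
    show "carrier \<H> \<subseteq> \<pi> ` carrier \<T>"
    proof
      fix X assume "X \<in> carrier \<H>"
      then obtain B :: "('k, 'u, 'g, 'a) extension" where B: "galois G k A B" "X = glob_cl B" unfolding H(1) HC_iff by blast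
      \<comment> \<open>A preimage is \<open>B\<close> itself with e = 1, made an extension of
        \<open>R\<close> through the inverse of \<phi>; it is its own globalization.\<close>
      have full: "gact.full G B \<one>\<^sub>B" by (rule model.full[OF galois_model_self[OF B(1)]])
      note M = res_ext_model[OF B(1) R.algebra_axioms phi full]
      have "par_cl (res_ext A \<phi> B \<one>\<^sub>B) \<in> carrier \<T>" unfolding T(1) using model.partial_extension_S[OF M] by blast
      moreover have "X = \<pi> (par_cl (res_ext A \<phi> B \<one>\<^sub>B))" unfolding assms(10) globalization_map_cl[OF M] by (rule B(2))
      ultimately show "X \<in> \<pi> ` carrier \<T>" by (rule image_eqI[rotated])
    qed
  qed
  have gH: "group \<H>" unfolding assms(9) by (rule harrison_group)
  note Q = quotient_magma_iso[OF gH hom surj, folded assms(11)]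
  have cl: "X \<otimes>\<^bsub>\<T>\<^esub> Y \<in> carrier \<T>" if "X \<in> carrier \<T>" "Y \<in> carrier \<T>" for X Y
    using mult[OF that] unfolding T(2) by blast
  have "induced_map \<pi> (\<rho> `` {par_cl S}) = glob_cl T"
    if S: "partial_extension G k R S" and T': "extension_globalization G k A \<phi> S T \<iota>"
    for S :: "('k, 'u, 'g, 'r) extension" and T :: "('k, 'u, 'g, 'a) extension" and \<iota>
  proof -
    note M = extension_globalization_model[OF S A.algebra_axioms phi T']
    have "par_cl S \<in> carrier \<T>" unfolding T(1) using S by blast
    from Q(3)[OF cl this] show ?thesis unfolding assms(10) globalization_map_cl[OF M] .
  qed
  then show ?thesis using hom gH Q(1,2)[OF cl] by blast
qed

end
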